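(* Let $\mathbf A$ be an algebra with exactly three elements. Then $\mathbf A\in\mathcal K_{\mathrm{surj}}$ if and only if every minimal congruence $\alpha$ of $\mathbf A$ satisfies $\mathrm{typ}(0_A,\alpha)\neq1$. Moreover, if $\mathbf A\in\mathcal K_{\mathrm{surj}}$, then $\mathbf A\in\mathcal K_{\mathrm{surj}}^{\mathrm{eff}}$.
   Context: A minimal congruence is a congruence $\alpha\ne0_A$ (where $0_A$ is equality) containing no other congruence except $0_A$. A polynomial operation of $\mathbf A$ is a term operation with some arguments fixed to elements of $A$; $\mathbf A|_N$ is the algebra on $N\subseteq A$ whose operations are the polynomial operations of $\mathbf A$ preserving $N$. For a minimal congruence $\alpha$: let $U$ be minimal under inclusion among sets $p(A)$, $p$ a unary polynomial with $p(x)\ne p(y)$ for some $(x,y)\in\alpha$; for $a\in U$ with $|a/\alpha\cap U|\ge2$, $N=a/\alpha\cap U$ is a $(0_A,\alpha)$-trace and $\mathbf A|_N$ is a minimal algebra (each unary polynomial is constant or a permutation), polynomially equivalent to one of: (1) an algebra all of whose operations are unary permutations; (2) a vector space over a finite field; (3) a two-element Boolean algebra; (4) a two-element lattice; (5) a two-element semilattice; the index (independent of choices) is $\mathrm{typ}(0_A,\alpha)$. $\mathcal K_{\mathrm{surj}}$: finite algebras $\mathbf C$ with a polynomial $p$ bounding, for every finite $\mathbf X$ of the same signature, the number of surjective homomorphisms $\mathbf X\to\mathbf C$ by $p(|X|)$; $\mathcal K_{\mathrm{surj}}^{\mathrm{eff}}$ additionally requires these to be enumerable in time polynomial in $|X|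$.
   Formalization: The "moreover" clause (membership in K_surj^eff) is stated for algebras with finitely many basic operations, since otherwise the input X is not a finite object and "time polynomial in |X|" has no meaning; the equivalence is stated for arbitrary signatures. *)

theory Defs
  imports Complex_Main "HOL-Library.FuncSet" "HOL-Algebra.Module"
    "HOL-Computational_Algebra.Polynomial"
begin

section \<open>Algebras, homomorphisms, congruences\<close>

record ('f, 'a) ualg =
  syms :: "'f set"
  arity :: "'f \<Rightarrow> nat"
  univ :: "'a set"
  interp :: "'f \<Rightarrow> 'a list \<Rightarrow> 'a"

definition tuples :: "'a set \<Rightarrow> nat \<Rightarrow> 'a list set" where
  "tuples B n = {xs. length xs = n \<and> set xs \<subseteq> B}"

definition is_ualg :: "('f, 'a) ualg \<Rightarrow> bool" where
  "is_ualg A \<longleftrightarrow> univ A \<noteq> {} \<and>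
     (\<forall>f\<in>syms A. \<forall>xs\<in>tuples (univ A) (arity A f). interp A f xs \<in> univ A)"

definition same_signature :: "('f, 'a) ualg \<Rightarrow> ('f, 'b) ualg \<Rightarrow> bool" where
  "same_signature A B \<longleftrightarrow> syms A = syms B \<and> (\<forall>f\<in>syms A. arity A f = arity B f)"

text \<open>Homomorphisms are taken extensional on the universe, so that they can be counted.\<close>

definition homs :: "('f, 'a) ualg \<Rightarrow> ('f, 'b) ualg \<Rightarrow> ('a \<Rightarrow> 'b) set" where
  "homs X C = {h \<in> univ X \<rightarrow>\<^sub>E univ C.
     \<forall>f\<in>syms X. \<forall>xs\<in>tuples (univ X) (arity X f).
       h (interp X f xs) = interp C f (map h xs)}"

definition surj_homs :: "('f, 'a) ualg \<Rightarrow> ('f, 'b) ualg \<Rightarrow> ('a \<Rightarrow> 'b) set" where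
  "surj_homs X C = {h \<in> homs X C. h ` univ X = univ C}"

definition congruence :: "('f, 'a) ualg \<Rightarrow> ('a \<times> 'a) set \<Rightarrow> bool" where
  "congruence A \<alpha> \<longleftrightarrow> \<alpha> \<subseteq> univ A \<times> univ A \<and> equiv (univ A) \<alpha> \<and>
     (\<forall>f\<in>syms A. \<forall>xs\<in>tuples (univ A) (arity A f). \<forall>ys\<in>tuples (univ A) (arity A f).
        list_all2 (\<lambda>x y. (x, y) \<in> \<alpha>) xs ys \<longrightarrow> (interp A f xs, interp A f ys) \<in> \<alpha>)"

definition minimal_congruence :: "('f, 'a) ualg \<Rightarrow> ('a \<times> 'a) set \<Rightarrow> bool" where
  "minimal_congruence A \<alpha> \<longleftrightarrow> congruence A \<alpha> \<and> \<alpha> \<noteq> Id_on (univ A) \<and>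
     (\<forall>\<beta>. congruence A \<beta> \<and> \<beta> \<subseteq> \<alpha> \<longrightarrow> \<beta> = Id_on (univ A) \<or> \<beta> = \<alpha>)"

section \<open>Polynomial operations and induced algebras\<close>

datatype 'f trm = Var nat | App 'f "'f trm list"

fun wf_trm :: "('f, 'a) ualg \<Rightarrow> nat \<Rightarrow> 'f trm \<Rightarrow> bool" where
  "wf_trm A m (Var i) \<longleftrightarrow> i < m"
| "wf_trm A m (App f ts) \<longleftrightarrow>
     f \<in> syms A \<and> length ts = arity A f \<and> (\<forall>t\<in>set ts. wf_trm A m t)"

fun eval_trm :: "('f, 'a) ualg \<Rightarrow> 'a list \<Rightarrow> 'f trm \<Rightarrow> 'a" where
  "eval_trm A xs (Var i) = xs ! i"
| "eval_trm A xs (App f ts) = interp A f (map (eval_trm A xs) ts)"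

text \<open>The \<open>n\<close>-ary polynomial operations: the arguments of a term operation beyond the first
  \<open>n\<close> are fixed to elements \<open>cs\<close>. They are extensional on the \<open>n\<close>-tuples, so that
  equality of operations is equality of functions.\<close>

definition polys :: "('f, 'a) ualg \<Rightarrow> nat \<Rightarrow> ('a list \<Rightarrow> 'a) set" where
  "polys A n = {restrict (\<lambda>xs. eval_trm A (xs @ cs) t) (tuples (univ A) n) | t cs.
     set cs \<subseteq> univ A \<and> wf_trm A (n + length cs) t}"

text \<open>The operation symbols of the induced algebra are the polynomial operations
  themselves, tagged with their arity.\<close>

definition induced :: "('f, 'a) ualg \<Rightarrow> 'a set \<Rightarrow> (nat \<times> ('a list \<Rightarrow> 'a), 'a) ualg" where
  "induced A N = \<lparr>syms = {(n, p). p \<in> polys A n \<and> (\<forall>xs\<in>tuples N n. p xs \<in> N)},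
     arity = fst, univ = N, interp = snd\<rparr>"

definition poly_equivalent :: "('f, 'a) ualg \<Rightarrow> ('g, 'a) ualg \<Rightarrow> bool" where
  "poly_equivalent A B \<longleftrightarrow> univ A = univ B \<and> (\<forall>n. polys A n = polys B n)"

section \<open>Traces and types of minimal congruences\<close>

definition separating_images :: "('f, 'a) ualg \<Rightarrow> ('a \<times> 'a) set \<Rightarrow> 'a set set" where
  "separating_images A \<alpha> = {(\<lambda>x. p [x]) ` univ A | p.
     p \<in> polys A 1 \<and> (\<exists>(x, y)\<in>\<alpha>. p [x] \<noteq> p [y])}"

definition minimal_set :: "('f, 'a) ualg \<Rightarrow> ('a \<times> 'a) set \<Rightarrow> 'a set \<Rightarrow> bool" where
  "minimal_set A \<alpha> U \<longleftrightarrow> U \<in> separating_images A \<alpha> \<and>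
     (\<forall>V\<in>separating_images A \<alpha>. V \<subseteq> U \<longrightarrow> V = U)"

definition trace :: "('f, 'a) ualg \<Rightarrow> ('a \<times> 'a) set \<Rightarrow> 'a set \<Rightarrow> bool" where
  "trace A \<alpha> N \<longleftrightarrow> (\<exists>U. minimal_set A \<alpha> U \<and>
     (\<exists>a\<in>U. N = \<alpha> `` {a} \<inter> U \<and> card N \<ge> 2))"

definition unary_alg :: "'a set \<Rightarrow> ('a \<Rightarrow> 'a) set \<Rightarrow> ('a \<Rightarrow> 'a, 'a) ualg" where
  "unary_alg N G = \<lparr>syms = G, arity = (\<lambda>_. 1), univ = N, interp = (\<lambda>g xs. g (hd xs))\<rparr>"

datatype 'k vs_sym = VZero | VNeg | VAdd | VScale 'k

fun vs_arity :: "'k vs_sym \<Rightarrow> nat" where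
  "vs_arity VZero = 0"
| "vs_arity VNeg = 1"
| "vs_arity VAdd = 2"
| "vs_arity (VScale k) = 1"

fun vs_interp :: "('k, 'a) module \<Rightarrow> 'k vs_sym \<Rightarrow> 'a list \<Rightarrow> 'a" where
  "vs_interp M VZero xs = \<zero>\<^bsub>M\<^esub>"
| "vs_interp M VNeg xs = \<ominus>\<^bsub>M\<^esub> (xs ! 0)"
| "vs_interp M VAdd xs = xs ! 0 \<oplus>\<^bsub>M\<^esub> xs ! 1"
| "vs_interp M (VScale k) xs = k \<odot>\<^bsub>M\<^esub> xs ! 0"

definition vector_space_alg :: "'k ring \<Rightarrow> ('k, 'a) module \<Rightarrow> ('k vs_sym, 'a) ualg" where
  "vector_space_alg K M = \<lparr>syms = {VZero, VNeg, VAdd} \<union> VScale ` carrier K,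
     arity = vs_arity, univ = carrier M, interp = vs_interp M\<rparr>"

datatype bool_sym = BBot | BTop | BNot | BMeet | BJoin

fun bool_arity :: "bool_sym \<Rightarrow> nat" where
  "bool_arity BBot = 0"
| "bool_arity BTop = 0"
| "bool_arity BNot = 1"
| "bool_arity BMeet = 2"
| "bool_arity BJoin = 2"

fun bool_interp :: "'a \<Rightarrow> 'a \<Rightarrow> bool_sym \<Rightarrow> 'a list \<Rightarrow> 'a" where
  "bool_interp u v BBot xs = u"
| "bool_interp u v BTop xs = v"
| "bool_interp u v BNot xs = (if xs ! 0 = v then u else v)"
| "bool_interp u v BMeet xs = (if xs ! 0 = v \<and> xs ! 1 = v then v else u)"
| "bool_interp u v BJoin xs = (if xs ! 0 = v \<or> xs ! 1 = v then v else u)"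

text \<open>The reduct to the symbols \<open>F\<close> of the Boolean algebra on \<open>{u, v}\<close> with bottom \<open>u\<close> and
  top \<open>v\<close>.\<close>

definition two_element_alg :: "bool_sym set \<Rightarrow> 'a \<Rightarrow> 'a \<Rightarrow> (bool_sym, 'a) ualg" where
  "two_element_alg F u v =
     \<lparr>syms = F, arity = bool_arity, univ = {u, v}, interp = bool_interp u v\<rparr>"

text \<open>Every finite field is isomorphic to one whose carrier is a set of natural numbers.
  In the last case, the order of \<open>u\<close> and \<open>v\<close> is free, so join semilattices are included.\<close>

inductive minimal_alg_type :: "('f, 'a) ualg \<Rightarrow> nat \<Rightarrow> bool" for B :: "('f, 'a) ualg" where
  unary: "\<forall>g\<in>G. bij_betw g (univ B) (univ B) \<Longrightarrow>
    poly_equivalent B (unary_alg (univ B) G) \<Longrightarrow> minimal_alg_type B 1"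
| vector_space: "Ring.field (K :: nat ring) \<Longrightarrow> finite (carrier K) \<Longrightarrow> Module.module K M \<Longrightarrow>
    poly_equivalent B (vector_space_alg K M) \<Longrightarrow> minimal_alg_type B 2"
| boolean: "u \<noteq> v \<Longrightarrow>
    poly_equivalent B (two_element_alg {BBot, BTop, BNot, BMeet, BJoin} u v) \<Longrightarrow>
    minimal_alg_type B 3"
| lattice: "u \<noteq> v \<Longrightarrow> poly_equivalent B (two_element_alg {BMeet, BJoin} u v) \<Longrightarrow>
    minimal_alg_type B 4"
| semilattice: "u \<noteq> v \<Longrightarrow> poly_equivalent B (two_element_alg {BMeet} u v) \<Longrightarrow>
    minimal_alg_type B 5"

definition tct_type :: "('f, 'a) ualg \<Rightarrow> ('a \<times> 'a) set \<Rightarrow> nat" where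
  "tct_type A \<alpha> = (THE i. \<exists>N. trace A \<alpha> N \<and> minimal_alg_type (induced A N) i)"

section \<open>Few surjective homomorphisms\<close>

text \<open>Up to isomorphism, the universe of a finite algebra is a set of natural numbers.\<close>

definition in_K_surj :: "('f, 'a) ualg \<Rightarrow> bool" where
  "in_K_surj C \<longleftrightarrow> is_ualg C \<and> finite (univ C) \<and>
     (\<exists>p :: real poly. \<forall>X :: ('f, nat) ualg.
        is_ualg X \<and> finite (univ X) \<and> same_signature X C \<longrightarrow>
          real (card (surj_homs X C)) \<le> poly p (real (card (univ X))))"

section \<open>Polynomial-time enumeration\<close>

text \<open>The machine model is a random access machine programmed by while programs over
  finitely many registers and multi-dimensional arrays of natural numbers. Every node of an
  expression costs one time unit. The arithmetic is addition and truncated subtraction only,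
  so numbers have at most linearly many bits in the running time and the initial register
  contents, and polynomial time agrees with polynomial time on Turing machines.
  The input is an algebra with universe \<open>{..<n}\<close>, given by \<open>n\<close> (in register 0) and its
  operation tables, which are read by \<open>Lookup\<close>.\<close>

datatype 'f exp =
    Num nat
  | Reg nat
  | Plus "'f exp" "'f exp"
  | Monus "'f exp" "'f exp"
  | Read nat "'f exp list"
  | Lookup 'f "'f exp list"

datatype 'f com =
    Skip
  | Assign nat "'f exp"
  | Store nat "'f exp list" "'f exp"
  | Output "'f exp"
  | Seq "'f com" "'f com"
  | Cond "'f exp" "'f com" "'f com"
  | While "'f exp" "'f com"

record state =
  regs :: "nat \<Rightarrow> nat"
  arrays :: "nat \<Rightarrow> nat list \<Rightarrow> nat"
  outp :: "nat list"

fun eval_exp :: "('f \<Rightarrow> nat list \<Rightarrow> nat) \<Rightarrow> state \<Rightarrow> 'f exp \<Rightarrow> nat" where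
  "eval_exp T s (Num k) = k"
| "eval_exp T s (Reg r) = regs s r"
| "eval_exp T s (Plus e1 e2) = eval_exp T s e1 + eval_exp T s e2"
| "eval_exp T s (Monus e1 e2) = eval_exp T s e1 - eval_exp T s e2"
| "eval_exp T s (Read a es) = arrays s a (map (eval_exp T s) es)"
| "eval_exp T s (Lookup f es) = T f (map (eval_exp T s) es)"

fun exp_cost :: "'f exp \<Rightarrow> nat" where
  "exp_cost (Num k) = 1"
| "exp_cost (Reg r) = 1"
| "exp_cost (Plus e1 e2) = 1 + exp_cost e1 + exp_cost e2"
| "exp_cost (Monus e1 e2) = 1 + exp_cost e1 + exp_cost e2"
| "exp_cost (Read a es) = 1 + sum_list (map exp_cost es)"
| "exp_cost (Lookup f es) = 1 + sum_list (map exp_cost es)"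

text \<open>\<open>exec T c s t s'\<close>: with operation tables \<open>T\<close>, the program \<open>c\<close> started in \<open>s\<close> halts in
  \<open>s'\<close> after \<open>t\<close> time units. Guards are true iff nonzero.\<close>

inductive exec :: "('f \<Rightarrow> nat list \<Rightarrow> nat) \<Rightarrow> 'f com \<Rightarrow> state \<Rightarrow> nat \<Rightarrow> state \<Rightarrow> bool"
  for T :: "'f \<Rightarrow> nat list \<Rightarrow> nat" where
  Skip: "exec T Skip s 1 s"
| Assign: "exec T (Assign r e) s (1 + exp_cost e)
    (s\<lparr>regs := (regs s)(r := eval_exp T s e)\<rparr>)"
| Store: "exec T (Store a es e) s (1 + sum_list (map exp_cost es) + exp_cost e)
    (s\<lparr>arrays := (arrays s)(a :=
        (arrays s a)(map (eval_exp T s) es := eval_exp T s e))\<rparr>)"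
| Output: "exec T (Output e) s (1 + exp_cost e) (s\<lparr>outp := outp s @ [eval_exp T s e]\<rparr>)"
| Seq: "exec T c1 s t1 s1 \<Longrightarrow> exec T c2 s1 t2 s2 \<Longrightarrow> exec T (Seq c1 c2) s (t1 + t2) s2"
| CondTrue: "eval_exp T s b \<noteq> 0 \<Longrightarrow> exec T c1 s t s1 \<Longrightarrow>
    exec T (Cond b c1 c2) s (1 + exp_cost b + t) s1"
| CondFalse: "eval_exp T s b = 0 \<Longrightarrow> exec T c2 s t s1 \<Longrightarrow>
    exec T (Cond b c1 c2) s (1 + exp_cost b + t) s1"
| WhileTrue: "eval_exp T s b \<noteq> 0 \<Longrightarrow> exec T c s t1 s1 \<Longrightarrow> exec T (While b c) s1 t2 s2 \<Longrightarrow>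
    exec T (While b c) s (1 + exp_cost b + t1 + t2) s2"
| WhileFalse: "eval_exp T s b = 0 \<Longrightarrow> exec T (While b c) s (1 + exp_cost b) s"

definition op_table :: "('f, nat) ualg \<Rightarrow> 'f \<Rightarrow> nat list \<Rightarrow> nat" where
  "op_table X f xs =
     (if f \<in> syms X \<and> xs \<in> tuples (univ X) (arity X f) then interp X f xs else 0)"

definition init_state :: "nat \<Rightarrow> state" where
  "init_state n = \<lparr>regs = (\<lambda>_. 0)(0 := n), arrays = (\<lambda>_ _. 0), outp = []\<rparr>"

text \<open>The elements of the fixed algebra \<open>C\<close> are printed through a fixed injective numbering
  \<open>code\<close>; a map \<open>h\<close> on \<open>{..<n}\<close> is printed as the sequence of its \<open>n\<close> values.\<close>

definition surj_homs_poly_time_enumerable :: "('f, 'a) ualg \<Rightarrow> bool" where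
  "surj_homs_poly_time_enumerable C \<longleftrightarrow>
     (\<exists>(c :: 'f com) (code :: 'a \<Rightarrow> nat) (p :: real poly). inj_on code (univ C) \<and>
        (\<forall>(X :: ('f, nat) ualg) n.
           is_ualg X \<and> univ X = {..<n} \<and> same_signature X C \<longrightarrow>
             (\<exists>t s hs. exec (op_table X) c (init_state n) t s \<and> real t \<le> poly p (real n) \<and>
                distinct hs \<and> set hs = surj_homs X C \<and>
                outp s = concat (map (\<lambda>h. map (\<lambda>x. code (h x)) [0..<n]) hs))))"

definition in_K_surj_eff :: "('f, 'a) ualg \<Rightarrow> bool" where
  "in_K_surj_eff C \<longleftrightarrow> in_K_surj C \<and> surj_homs_poly_time_enumerable C"

end

theory Submission
  imports Defs "HOL-Computational_Algebra.Primes"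
begin

text \<open>
  The type of a trace is read off its unary and binary polynomials. In type 1 every polynomial
  restricted to a trace \<open>N\<close> depends on at most one variable, so the \<open>k\<close>-ary polynomials restricted to
  \<open>N\<close> form an algebra of size linear in \<open>k\<close>, while evaluation at the points of \<open>N\<^sup>k\<close> gives
  exponentially many surjective homomorphisms from it.

  Conversely, given a homomorphism \<open>h\<close> from \<open>X\<close> onto \<open>A\<close>, fix a preimage of each element of \<open>A\<close>; there
  are at most \<open>|X|\<^sup>3\<close> choices. Polynomials of \<open>A\<close> then lift to polynomials of \<open>X\<close> and \<open>h\<close> is
  compatible with them. If the type is not 1, a lifted meet, join or addition on a trace forces the
  number of such \<open>h\<close> to be polynomial.

  For the enumeration, which works for every finite algebra with finitely many operations and few
  surjective homomorphisms, partial homomorphisms with fixed preimages are extended along the elements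
  of \<open>X\<close> in order, each time closing the domain under the operations. Restricted to their common
  domain, the partial homomorphisms of one stage are distinct surjective homomorphisms of a subalgebra
  of \<open>X\<close>, so every stage stays polynomially small.
\<close>

section \<open>Tuples\<close>

lemma tuples_nth: "xs \<in> tuples B n \<Longrightarrow> i < n \<Longrightarrow> xs ! i \<in> B"
  by (auto simp: tuples_def)

lemma tuples_length: "xs \<in> tuples B n \<Longrightarrow> length xs = n"
  by (simp add: tuples_def)

lemma tuples_map_upt: "(\<And>i. i < n \<Longrightarrow> g i \<in> B) \<Longrightarrow> map g [0..<n] \<in> tuples B n"
  by (auto simp: tuples_def)

lemma tuples_map: "xs \<in> tuples B n \<Longrightarrow> (\<And>x. x \<in> B \<Longrightarrow> g x \<in> C) \<Longrightarrow> map g xs \<in> tuples C n"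
  by (auto simp: tuples_def)

lemma tuples_update: "xs \<in> tuples B n \<Longrightarrow> y \<in> B \<Longrightarrow> xs[j := y] \<in> tuples B n"
  using set_update_subset_insert[of xs j y] by (auto simp: tuples_def)

lemma tuples_mono: "B \<subseteq> C \<Longrightarrow> xs \<in> tuples B n \<Longrightarrow> xs \<in> tuples C n"
  by (auto simp: tuples_def)

lemma tuples_Nil: "xs \<in> tuples B 0 \<longleftrightarrow> xs = []"
  by (auto simp: tuples_def)

lemma tuples_Suc: "xs \<in> tuples B (Suc n) \<longleftrightarrow> (\<exists>y ys. xs = y # ys \<and> y \<in> B \<and> ys \<in> tuples B n)"
  by (auto simp: tuples_def length_Suc_conv)

lemma tuples_Cons: "y # ys \<in> tuples B (Suc n) \<longleftrightarrow> y \<in> B \<and> ys \<in> tuples B n"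
  by (auto simp: tuples_def)

lemma tuples_one: "xs \<in> tuples B (Suc 0) \<longleftrightarrow> (\<exists>x\<in>B. xs = [x])"
  by (auto simp: tuples_Suc tuples_Nil)

lemma tuples_two: "xs \<in> tuples B 2 \<longleftrightarrow> (\<exists>x\<in>B. \<exists>y\<in>B. xs = [x, y])"
  by (auto simp: numeral_2_eq_2 tuples_Suc tuples_Nil)

lemma tuples_replicate: "z \<in> B \<Longrightarrow> replicate n z \<in> tuples B n"
  by (auto simp: tuples_def)

lemma card_tuples: "finite B \<Longrightarrow> card (tuples B n) = card B ^ n"
  using card_lists_length_eq[of B n] by (simp add: tuples_def conj_commute)

lemma list_all2_replace_induct:
  assumes "list_all2 R xs ys" "P xs"
    and replace: "\<And>zs i. length zs = length xs \<Longrightarrow> i < length xs \<Longrightarrow> set zs \<subseteq> set xs \<union> set ys \<Longrightarrow>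
      zs ! i = xs ! i \<Longrightarrow> P zs \<Longrightarrow> R (xs ! i) (ys ! i) \<Longrightarrow> P (zs[i := ys ! i])"
  shows "P ys"
proof -
  have len: "length xs = length ys" using assms(1) by (rule list_all2_lengthD)
  have "k \<le> length xs \<Longrightarrow> P (take k ys @ drop k xs)" for k
  proof (induction k)
    case 0
    then show ?case using assms by simp
  next
    case (Suc k)
    let ?zs = "take k ys @ drop k xs"
    have "P (?zs[k := ys ! k])"
    proof (rule replace)
      show "set ?zs \<subseteq> set xs \<union> set ys" by (auto dest: in_set_takeD in_set_dropD)
      show "R (xs ! k) (ys ! k)" using assms(1) Suc.prems by (simp add: list_all2_conv_all_nth)
    qed (use Suc len in \<open>auto simp: nth_append\<close>)
    moreover have "?zs[k := ys ! k] = take (Suc k) ys @ drop (Suc k) xs"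
      using Suc.prems len
      by (intro nth_equalityI) (auto simp: nth_append nth_list_update less_Suc_eq min_def)
    ultimately show ?case by simp
  qed
  from this[of "length xs"] show ?thesis using len by simp
qed

lemma tuples_change_induct:
  assumes "zs \<in> tuples B n" "ws \<in> tuples B n" "P zs"
    and change: "\<And>xs j y. xs \<in> tuples B n \<Longrightarrow> P xs \<Longrightarrow> j < n \<Longrightarrow> y \<in> B \<Longrightarrow> P (xs[j := y])"
  shows "P ws"
proof -
  have "list_all2 (\<lambda>_ _. True) zs ws"
    using assms(1,2) by (simp add: list_all2_conv_all_nth tuples_length)
  then have "ws \<in> tuples B n \<and> P ws"
  proof (rule list_all2_replace_induct)
    fix xs j assume "j < length zs" "xs \<in> tuples B n \<and> P xs"
    then show "xs[j := ws ! j] \<in> tuples B n \<and> P (xs[j := ws ! j])"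
      using assms(1,2) change by (auto simp: tuples_length intro: tuples_update tuples_nth)
  qed (use assms in simp)
  then show ?thesis ..
qed

section \<open>Polynomial operations\<close>

definition pol :: "('f, 'a) ualg \<Rightarrow> nat \<Rightarrow> ('a list \<Rightarrow> 'a) \<Rightarrow> bool" where
  "pol A n F \<longleftrightarrow> restrict F (tuples (univ A) n) \<in> polys A n"

abbreviation pol1 :: "('f, 'a) ualg \<Rightarrow> ('a \<Rightarrow> 'a) \<Rightarrow> bool" where
  "pol1 A f \<equiv> pol A 1 (\<lambda>xs. f (xs ! 0))"

abbreviation pol2 :: "('f, 'a) ualg \<Rightarrow> ('a \<Rightarrow> 'a \<Rightarrow> 'a) \<Rightarrow> bool" where
  "pol2 A g \<equiv> pol A 2 (\<lambda>xs. g (xs ! 0) (xs ! 1))"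

lemma polys_pol: "p \<in> polys A n \<Longrightarrow> pol A n p"
  unfolding pol_def by (auto simp: polys_def) blast

lemma pol_polys: "pol A n F \<Longrightarrow> restrict F (tuples (univ A) n) \<in> polys A n"
  by (simp add: pol_def)

lemma pol_cong: "(\<And>xs. xs \<in> tuples (univ A) n \<Longrightarrow> F xs = G xs) \<Longrightarrow> pol A n F \<longleftrightarrow> pol A n G"
  unfolding pol_def by (metis restrict_ext)

lemma pol_congI: "pol A n F \<Longrightarrow> (\<And>xs. xs \<in> tuples (univ A) n \<Longrightarrow> F xs = G xs) \<Longrightarrow> pol A n G"
  using pol_cong[of A n F G] by blast

lemma pol1_iff: "pol A 1 F \<longleftrightarrow> pol1 A (\<lambda>x. F [x])"
  by (rule pol_cong) (auto simp: tuples_one)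

lemma pol2_iff: "pol A 2 F \<longleftrightarrow> pol2 A (\<lambda>x y. F [x, y])"
  by (rule pol_cong) (auto simp: tuples_two)

lemma polys_eq_iff:
  assumes "univ A = univ B"
  shows "polys A n = polys B n \<longleftrightarrow> (\<forall>F. pol A n F \<longleftrightarrow> pol B n F)"
proof
  assume same_pol: "\<forall>F. pol A n F \<longleftrightarrow> pol B n F"
  have "p \<in> polys A n \<longleftrightarrow> p \<in> polys B n" for p
  proof -
    have "restrict p (tuples (univ A) n) = p" if "p \<in> polys A n \<or> p \<in> polys B n"
      using that assms by (auto simp: polys_def)
    then show ?thesis using same_pol assms unfolding pol_def by metis
  qed
  then show "polys A n = polys B n" by blast
qed (use assms in \<open>simp add: pol_def\<close>)

lemma poly_equivalent_pol:
  "poly_equivalent B D \<longleftrightarrow> univ B = univ D \<and> (\<forall>n F. pol B n F \<longleftrightarrow> pol D n F)"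
  unfolding poly_equivalent_def using polys_eq_iff by blast

fun rename_trm :: "(nat \<Rightarrow> nat) \<Rightarrow> 'f trm \<Rightarrow> 'f trm" where
  "rename_trm r (Var i) = Var (r i)"
| "rename_trm r (App f ts) = App f (map (rename_trm r) ts)"

lemma wf_rename_trm:
  "wf_trm A m t \<Longrightarrow> (\<And>i. i < m \<Longrightarrow> r i < m') \<Longrightarrow> wf_trm A m' (rename_trm r t)"
  by (induction t) auto

lemma eval_rename_trm:
  "wf_trm A m t \<Longrightarrow> (\<And>i. i < m \<Longrightarrow> ys ! (r i) = xs ! i) \<Longrightarrow>
   eval_trm A ys (rename_trm r t) = eval_trm A xs t"
proof (induction t)
  case (App f ts)
  have "map (eval_trm A ys \<circ> rename_trm r) ts = map (eval_trm A xs) ts"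
    using App by auto
  then show ?case unfolding rename_trm.simps eval_trm.simps map_map by (rule arg_cong)
qed simp

lemma pol_trm_iff:
  assumes set_cs: "set cs = univ A"
  shows "pol A n F \<longleftrightarrow> (\<exists>t. wf_trm A (n + length cs) t \<and>
     (\<forall>xs\<in>tuples (univ A) n. F xs = eval_trm A (xs @ cs) t))"
proof
  assume "pol A n F"
  then obtain t ds where ds: "set ds \<subseteq> univ A" and wf: "wf_trm A (n + length ds) t"
    and F: "restrict F (tuples (univ A) n) = restrict (\<lambda>xs. eval_trm A (xs @ ds) t) (tuples (univ A) n)"
    unfolding pol_def polys_def by blast
  have "\<forall>i<length ds. \<exists>j<length cs. cs ! j = ds ! i"
    using ds set_cs by (metis in_set_conv_nth nth_mem subsetD)
  then obtain pos where pos: "\<And>i. i < length ds \<Longrightarrow> pos i < length cs \<and> cs ! pos i = ds ! i" by metis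
  define r where "r i = (if i < n then i else n + pos (i - n))" for i
  have "wf_trm A (n + length cs) (rename_trm r t)"
    using wf by (rule wf_rename_trm) (use pos in \<open>auto simp: r_def\<close>)
  moreover have "F xs = eval_trm A (xs @ cs) (rename_trm r t)" if "xs \<in> tuples (univ A) n" for xs
  proof -
    have "F xs = eval_trm A (xs @ ds) t" using fun_cong[OF F, of xs] that by simp
    also have "\<dots> = eval_trm A (xs @ cs) (rename_trm r t)"
      by (rule eval_rename_trm[symmetric, OF wf])
        (use that pos in \<open>auto simp: r_def nth_append tuples_length\<close>)
    finally show ?thesis .
  qed
  ultimately show "\<exists>t. wf_trm A (n + length cs) t \<and>
     (\<forall>xs\<in>tuples (univ A) n. F xs = eval_trm A (xs @ cs) t)" by blast
next
  assume "\<exists>t. wf_trm A (n + length cs) t \<and>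
     (\<forall>xs\<in>tuples (univ A) n. F xs = eval_trm A (xs @ cs) t)"
  then show "pol A n F"
    unfolding pol_def polys_def using set_cs by (fastforce intro!: restrict_ext)
qed

locale finite_ualg =
  fixes A :: "('f, 'a) ualg"
  assumes is_ualg: "is_ualg A" and finite_univ: "finite (univ A)"
begin

lemma interp_closed: "f \<in> syms A \<Longrightarrow> xs \<in> tuples (univ A) (arity A f) \<Longrightarrow> interp A f xs \<in> univ A"
  using is_ualg by (simp add: is_ualg_def)

lemma ex_element: obtains z where "z \<in> univ A"
  using is_ualg by (auto simp: is_ualg_def)

lemma ex_constants: obtains cs where "set cs = univ A"
  using finite_list[OF finite_univ] by blast

lemma pol_proj: "i < n \<Longrightarrow> pol A n (\<lambda>xs. xs ! i)"
proof -
  assume "i < n"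
  obtain cs where cs: "set cs = univ A" by (rule ex_constants)
  show ?thesis unfolding pol_trm_iff[OF cs]
    by (rule exI[of _ "Var i"]) (use \<open>i < n\<close> in \<open>auto simp: tuples_length nth_append\<close>)
qed

lemma pol_const: "c \<in> univ A \<Longrightarrow> pol A n (\<lambda>_. c)"
proof -
  assume "c \<in> univ A"
  obtain cs where cs: "set cs = univ A" by (rule ex_constants)
  then obtain j where "j < length cs" "cs ! j = c" using \<open>c \<in> univ A\<close> by (metis in_set_conv_nth)
  then show ?thesis unfolding pol_trm_iff[OF cs]
    by (intro exI[of _ "Var (n + j)"]) (auto simp: tuples_length nth_append)
qed

lemma pol_app:
  assumes "f \<in> syms A" and args: "\<And>i. i < arity A f \<Longrightarrow> pol A n (G i)"
  shows "pol A n (\<lambda>xs. interp A f (map (\<lambda>i. G i xs) [0..<arity A f]))"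
proof -
  obtain cs where cs: "set cs = univ A" by (rule ex_constants)
  have "\<forall>i<arity A f. \<exists>t. wf_trm A (n + length cs) t \<and>
     (\<forall>xs\<in>tuples (univ A) n. G i xs = eval_trm A (xs @ cs) t)"
    using args unfolding pol_trm_iff[OF cs] by blast
  then obtain t where wf: "\<And>i. i < arity A f \<Longrightarrow> wf_trm A (n + length cs) (t i)"
    and eval: "\<And>i xs. i < arity A f \<Longrightarrow> xs \<in> tuples (univ A) n \<Longrightarrow> G i xs = eval_trm A (xs @ cs) (t i)"
    by metis
  show ?thesis unfolding pol_trm_iff[OF cs]
  proof (intro exI conjI ballI)
    show "wf_trm A (n + length cs) (App f (map t [0..<arity A f]))"
      using assms(1) wf by auto
    fix xs assume "xs \<in> tuples (univ A) n"
    then have "map (\<lambda>i. G i xs) [0..<arity A f] = map (eval_trm A (xs @ cs)) (map t [0..<arity A f])"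
      using eval by auto
    then show "interp A f (map (\<lambda>i. G i xs) [0..<arity A f]) =
      eval_trm A (xs @ cs) (App f (map t [0..<arity A f]))"
      unfolding eval_trm.simps by (rule arg_cong)
  qed
qed

lemma pol_induct [consumes 1, case_names proj const app cong]:
  assumes "pol A n F"
    and proj: "\<And>i. i < n \<Longrightarrow> Q (\<lambda>xs. xs ! i)"
    and const: "\<And>c. c \<in> univ A \<Longrightarrow> Q (\<lambda>_. c)"
    and app: "\<And>f G. f \<in> syms A \<Longrightarrow> (\<And>i. i < arity A f \<Longrightarrow> pol A n (G i)) \<Longrightarrow>
       (\<And>i. i < arity A f \<Longrightarrow> Q (G i)) \<Longrightarrow>
       Q (\<lambda>xs. interp A f (map (\<lambda>i. G i xs) [0..<arity A f]))"
    and cong: "\<And>F G. Q F \<Longrightarrow> (\<And>xs. xs \<in> tuples (univ A) n \<Longrightarrow> F xs = G xs) \<Longrightarrow> Q G"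
  shows "Q F"
proof -
  obtain cs where cs: "set cs = univ A" by (rule ex_constants)
  have "wf_trm A (n + length cs) t \<Longrightarrow> Q (\<lambda>xs. eval_trm A (xs @ cs) t)" for t
  proof (induction t)
    case (Var i)
    show ?case
    proof (cases "i < n")
      case True
      show ?thesis by (rule cong[OF proj[OF True]]) (auto simp: nth_append tuples_length True)
    next
      case False
      then have "cs ! (i - n) \<in> univ A"
        using Var cs by (metis add.commute less_diff_conv2 linorder_not_less nth_mem wf_trm.simps(1))
      then show ?thesis by (rule cong[OF const]) (auto simp: nth_append tuples_length False)
    qed
  next
    case (App f ts)
    then have f: "f \<in> syms A" "length ts = arity A f" by auto
    have "Q (\<lambda>xs. interp A f (map (\<lambda>i. eval_trm A (xs @ cs) (ts ! i)) [0..<arity A f]))"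
    proof (rule app[OF f(1)])
      fix i assume i: "i < arity A f"
      then have "wf_trm A (n + length cs) (ts ! i)" using App.prems f by simp
      then show "pol A n (\<lambda>xs. eval_trm A (xs @ cs) (ts ! i))" unfolding pol_trm_iff[OF cs] by blast
      show "Q (\<lambda>xs. eval_trm A (xs @ cs) (ts ! i))" using App f i by auto
    qed
    moreover have "map (\<lambda>i. eval_trm A (xs @ cs) (ts ! i)) [0..<arity A f] =
        map (eval_trm A (xs @ cs)) ts" for xs
      using f(2) by (auto intro: nth_equalityI)
    ultimately show ?case by simp
  qed
  then show ?thesis using assms(1) cong unfolding pol_trm_iff[OF cs] by fastforce
qed

lemma pol_closed:
  assumes "pol A n F" "xs \<in> tuples (univ A) n"
  shows "F xs \<in> univ A"
proof -
  have "\<forall>xs\<in>tuples (univ A) n. F xs \<in> univ A"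
    using assms(1)
  proof (induction rule: pol_induct)
    case (app f G)
    then have "map (\<lambda>i. G i xs) [0..<arity A f] \<in> tuples (univ A) (arity A f)"
      if "xs \<in> tuples (univ A) n" for xs
      using that by (intro tuples_map_upt) blast
    then show ?case using interp_closed[OF app(1)] by blast
  qed (auto intro: tuples_nth)
  then show ?thesis using assms(2) by blast
qed

lemma pol_comp:
  assumes "pol A m F" and args: "\<And>i. i < m \<Longrightarrow> pol A n (G i)"
  shows "pol A n (\<lambda>xs. F (map (\<lambda>i. G i xs) [0..<m]))"
  using assms(1)
proof (induction rule: pol_induct)
  case (proj i)
  then show ?case using args[of i] by simp
next
  case (const c)
  then show ?case by (rule pol_const)
next
  case (app f H)
  then show ?case
    using pol_app[OF app(1), of n "\<lambda>i xs. H i (map (\<lambda>i. G i xs) [0..<m])"] by blast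
next
  case (cong F F')
  have "F (map (\<lambda>i. G i xs) [0..<m]) = F' (map (\<lambda>i. G i xs) [0..<m])"
    if "xs \<in> tuples (univ A) n" for xs
    by (rule cong(2)) (intro tuples_map_upt pol_closed[OF args that])
  then show ?case by (rule pol_congI[OF cong(1)])
qed

lemma pol_comp_list:
  assumes "pol A (length Gs) F" and args: "\<And>G. G \<in> set Gs \<Longrightarrow> pol A n G"
  shows "pol A n (\<lambda>xs. F (map (\<lambda>G. G xs) Gs))"
proof -
  have "map (\<lambda>i. (Gs ! i) xs) [0..<length Gs] = map (\<lambda>G. G xs) Gs" for xs
    by (rule nth_equalityI) auto
  then show ?thesis using pol_comp[OF assms(1), of n "\<lambda>i. Gs ! i"] args by simp
qed

lemma pol_comp1: "pol A 1 F \<Longrightarrow> pol A n G \<Longrightarrow> pol A n (\<lambda>xs. F [G xs])"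
  using pol_comp_list[of "[G]" F n] by simp

lemma pol_comp2: "pol A 2 F \<Longrightarrow> pol A n G \<Longrightarrow> pol A n H \<Longrightarrow> pol A n (\<lambda>xs. F [G xs, H xs])"
  using pol_comp_list[of "[G, H]" F n] by (auto simp: numeral_2_eq_2)

lemma pol_basic:
  assumes "f \<in> syms A"
  shows "pol A (arity A f) (interp A f)"
proof -
  have "pol A (arity A f) (\<lambda>xs. interp A f (map (\<lambda>i. xs ! i) [0..<arity A f]))"
    by (rule pol_app[OF assms pol_proj])
  moreover have "map ((!) xs) [0..<arity A f] = xs" if "xs \<in> tuples (univ A) (arity A f)" for xs
    using tuples_length[OF that] map_nth[of xs] by simp
  ultimately show ?thesis by (auto intro: pol_congI)
qed

lemma pol_Cons:
  assumes "pol A (Suc n) F" "c \<in> univ A"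
  shows "pol A n (\<lambda>xs. F (c # xs))"
proof -
  let ?Gs = "(\<lambda>_. c) # map (\<lambda>i xs. xs ! i) [0..<n]"
  have "pol A n (\<lambda>xs. F (map (\<lambda>G. G xs) ?Gs))"
    using assms by (intro pol_comp_list) (auto intro: pol_const pol_proj)
  moreover have "map (\<lambda>G. G xs) ?Gs = c # xs" if "xs \<in> tuples (univ A) n" for xs
    using that map_nth[of xs] by (simp add: tuples_length comp_def)
  ultimately show ?thesis by (elim pol_congI) simp
qed

lemma pol_tl:
  assumes "pol A n F"
  shows "pol A (Suc n) (\<lambda>xs. F (tl xs))"
proof -
  have "pol A (Suc n) (\<lambda>xs. F (map (\<lambda>i. xs ! Suc i) [0..<n]))"
    using assms by (rule pol_comp) (simp add: pol_proj)
  moreover have "map (\<lambda>i. xs ! Suc i) [0..<n] = tl xs" if "xs \<in> tuples (univ A) (Suc n)" for xs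
    by (rule nth_equalityI) (use that in \<open>auto simp: tuples_length nth_tl\<close>)
  ultimately show ?thesis by (elim pol_congI) simp
qed

lemma pol_update2:
  assumes "pol A n F" "zs \<in> tuples (univ A) n" "pol A m G" "pol A m H"
  shows "pol A m (\<lambda>xs. F (zs[i := G xs, j := H xs]))"
proof -
  let ?Gs = "(map (\<lambda>z _. z) zs)[i := G, j := H]"
  have "pol A m K" if "K \<in> set ?Gs" for K
  proof -
    have "K \<in> insert H (insert G (set (map (\<lambda>z _. z) zs)))"
      using that set_update_subset_insert[of _ j H] set_update_subset_insert[of _ i G] by blast
    then show ?thesis using assms(2-4) by (auto simp: tuples_def intro: pol_const)
  qed
  then have "pol A m (\<lambda>xs. F (map (\<lambda>G. G xs) ?Gs))"
    using assms(1,2) by (intro pol_comp_list) (simp_all add: tuples_length)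
  then show ?thesis by (simp add: map_update comp_def)
qed

lemma pol_update:
  assumes "pol A n F" "zs \<in> tuples (univ A) n" "pol A m G"
  shows "pol A m (\<lambda>xs. F (zs[i := G xs]))"
  using pol_update2[OF assms assms(3), of i i] by simp

lemma pol1_id: "pol1 A (\<lambda>x. x)"
  by (rule pol_proj) simp

lemma pol1_const: "c \<in> univ A \<Longrightarrow> pol1 A (\<lambda>_. c)"
  by (rule pol_const)

lemma pol1_closed: "pol1 A f \<Longrightarrow> x \<in> univ A \<Longrightarrow> f x \<in> univ A"
  using pol_closed[of 1 "\<lambda>xs. f (xs ! 0)" "[x]"] by (simp add: tuples_one)

lemma pol2_closed: "pol2 A g \<Longrightarrow> x \<in> univ A \<Longrightarrow> y \<in> univ A \<Longrightarrow> g x y \<in> univ A"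
  using pol_closed[of 2 "\<lambda>xs. g (xs ! 0) (xs ! 1)" "[x, y]"] by (simp add: tuples_two)

lemma pol_pol1: "pol1 A f \<Longrightarrow> pol A n F \<Longrightarrow> pol A n (\<lambda>xs. f (F xs))"
  using pol_comp1[of "\<lambda>xs. f (xs ! 0)" n F] by simp

lemma pol_pol2: "pol2 A g \<Longrightarrow> pol A n F \<Longrightarrow> pol A n G \<Longrightarrow> pol A n (\<lambda>xs. g (F xs) (G xs))"
  using pol_comp2[of "\<lambda>xs. g (xs ! 0) (xs ! 1)" n F G] by simp

lemma pol1_comp: "pol1 A f \<Longrightarrow> pol1 A g \<Longrightarrow> pol1 A (\<lambda>x. f (g x))"
  by (rule pol_pol1)

lemma pol1_funpow: "pol1 A f \<Longrightarrow> pol1 A (f ^^ k)"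
  by (induction k) (auto simp: pol1_id[simplified] intro: pol_pol1)

lemma pol1_pol2: "pol2 A g \<Longrightarrow> pol1 A f \<Longrightarrow> pol1 A h \<Longrightarrow> pol1 A (\<lambda>x. g (f x) (h x))"
  by (rule pol_pol2)

lemma pol2_left: "pol2 A g \<Longrightarrow> c \<in> univ A \<Longrightarrow> pol1 A (g c)"
  by (rule pol1_pol2[OF _ pol1_const pol1_id])

lemma pol2_right: "pol2 A g \<Longrightarrow> c \<in> univ A \<Longrightarrow> pol1 A (\<lambda>x. g x c)"
  by (rule pol1_pol2[OF _ pol1_id pol1_const])

lemma pol2_flip: "pol2 A g \<Longrightarrow> pol2 A (\<lambda>x y. g y x)"
  by (erule pol_pol2) (simp_all add: pol_proj)

lemma pol2_comp_args: "pol2 A g \<Longrightarrow> pol1 A r \<Longrightarrow> pol1 A s \<Longrightarrow> pol2 A (\<lambda>x y. g (r x) (s y))"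
  by (erule pol_pol2) (erule pol_pol1, simp add: pol_proj)+

lemma pol_if_basic_pol:
  assumes "finite_ualg D" "univ D = univ A"
    and basic: "\<And>f. f \<in> syms D \<Longrightarrow> pol A (arity D f) (interp D f)"
    and "pol D n F"
  shows "pol A n F"
proof -
  interpret D: finite_ualg D by fact
  from assms(4) show ?thesis
  proof (induction rule: D.pol_induct)
    case (proj i)
    then show ?case by (rule pol_proj)
  next
    case (const c)
    then show ?case using assms(2) by (intro pol_const) simp
  next
    case (app f G)
    then show ?case using pol_comp[OF basic[OF app(1)], of n G] by blast
  next
    case (cong F G)
    then show ?case using pol_cong[of A n F G] assms(2) by simp
  qed
qed

lemma poly_equivalentI:
  assumes "finite_ualg D" "univ D = univ A"
    and "\<And>f. f \<in> syms D \<Longrightarrow> pol A (arity D f) (interp D f)"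
    and "\<And>n F. pol A n F \<Longrightarrow> pol D n F"
  shows "poly_equivalent A D"
  using assms pol_if_basic_pol[OF assms(1-3)] by (auto simp: poly_equivalent_pol)

lemma pol_arity_induct [consumes 3, case_names Suc]:
  assumes "finite_ualg D" "univ D = univ A" "pol A n F"
    and step: "\<And>n F. (\<And>G. pol A n G \<Longrightarrow> pol D n G) \<Longrightarrow> pol A (Suc n) F \<Longrightarrow> pol D (Suc n) F"
  shows "pol D n F"
  using assms(3)
proof (induction n arbitrary: F)
  case 0
  interpret D: finite_ualg D by fact
  have "F [] \<in> univ D" using pol_closed[OF 0] assms(2) by (simp add: tuples_Nil)
  then have "pol D 0 (\<lambda>_. F [])" by (rule D.pol_const)
  then show ?case by (rule pol_congI) (simp add: tuples_Nil)
next
  case (Suc n)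
  then show ?case using step by blast
qed

end

section \<open>Induced algebras\<close>

lemma univ_induced [simp]: "univ (induced A N) = N"
  by (simp add: induced_def)

lemma arity_induced [simp]: "arity (induced A N) (n, p) = n"
  by (simp add: induced_def)

lemma interp_induced [simp]: "interp (induced A N) (n, p) = p"
  by (simp add: induced_def)

lemma syms_induced_iff:
  "(n, p) \<in> syms (induced A N) \<longleftrightarrow> p \<in> polys A n \<and> (\<forall>xs\<in>tuples N n. p xs \<in> N)"
  by (simp add: induced_def)

context finite_ualg
begin

lemma finite_ualg_induced:
  assumes "N \<subseteq> univ A" "N \<noteq> {}"
  shows "finite_ualg (induced A N)"
proof
  show "is_ualg (induced A N)"
    using assms(2) unfolding is_ualg_def by (auto simp: syms_induced_iff)
  show "finite (univ (induced A N))" using assms(1) finite_univ finite_subset by auto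
qed

lemma pol_inducedI:
  assumes "N \<subseteq> univ A" "N \<noteq> {}" and p: "pol A n p" "\<And>xs. xs \<in> tuples N n \<Longrightarrow> p xs \<in> N"
  shows "pol (induced A N) n p"
proof -
  interpret I: finite_ualg "induced A N" by (rule finite_ualg_induced[OF assms(1,2)])
  let ?q = "restrict p (tuples (univ A) n)"
  have restrict: "?q xs = p xs" if "xs \<in> tuples N n" for xs
    using tuples_mono[OF assms(1) that] by simp
  then have "(n, ?q) \<in> syms (induced A N)"
    using p by (simp add: syms_induced_iff pol_polys)
  from I.pol_basic[OF this] have "pol (induced A N) n ?q" by simp
  then show ?thesis by (rule pol_congI) (simp add: restrict del: restrict_apply)
qed

lemma pol_inducedE:
  assumes "N \<subseteq> univ A" "N \<noteq> {}" "pol (induced A N) n F"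
  obtains p where "pol A n p" "\<And>xs. xs \<in> tuples N n \<Longrightarrow> p xs \<in> N"
    "\<And>xs. xs \<in> tuples N n \<Longrightarrow> F xs = p xs"
proof -
  interpret I: finite_ualg "induced A N" by (rule finite_ualg_induced[OF assms(1,2)])
  have "\<exists>p. pol A n p \<and> (\<forall>xs\<in>tuples N n. p xs = F xs)"
    using assms(3)
  proof (induction rule: I.pol_induct)
    case (proj i)
    then show ?case by (intro exI[of _ "\<lambda>xs. xs ! i"]) (simp add: pol_proj)
  next
    case (const c)
    then show ?case using assms(1) by (intro exI[of _ "\<lambda>_. c"]) (auto intro: pol_const)
  next
    case (app f G)
    obtain m q where f: "f = (m, q)" by (cases f)
    have q: "q \<in> polys A m" using app(1) f by (simp add: syms_induced_iff)
    have "\<forall>i<m. \<exists>p. pol A n p \<and> (\<forall>xs\<in>tuples N n. p xs = G i xs)" using app(3) f by simp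
    then obtain P where P: "\<And>i. i < m \<Longrightarrow> pol A n (P i)"
      "\<And>i xs. i < m \<Longrightarrow> xs \<in> tuples N n \<Longrightarrow> P i xs = G i xs" by metis
    have "map (\<lambda>i. P i xs) [0..<m] = map (\<lambda>i. G i xs) [0..<m]" if "xs \<in> tuples N n" for xs
      using P(2) that by simp
    then have "\<forall>xs\<in>tuples N n. q (map (\<lambda>i. P i xs) [0..<m]) =
        interp (induced A N) f (map (\<lambda>i. G i xs) [0..<arity (induced A N) f])"
      unfolding f interp_induced arity_induced by metis
    moreover have "pol A n (\<lambda>xs. q (map (\<lambda>i. P i xs) [0..<m]))"
      by (rule pol_comp[OF polys_pol[OF q] P(1)])
    ultimately show ?case by blast
  next
    case (cong F G)
    then show ?case by simp
  qed
  then obtain p where "pol A n p" "\<forall>xs\<in>tuples N n. p xs = F xs" by blast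
  moreover have "F xs \<in> N" if "xs \<in> tuples N n" for xs
    using I.pol_closed[OF assms(3)] that by simp
  ultimately show ?thesis using that by metis
qed

end

section \<open>Essentially unary operations\<close>

definition ess_unary_on :: "'a set \<Rightarrow> nat \<Rightarrow> ('a list \<Rightarrow> 'b) \<Rightarrow> bool" where
  "ess_unary_on N n F \<longleftrightarrow> (\<exists>c. \<forall>xs\<in>tuples N n. F xs = c) \<or>
     (\<exists>i<n. \<exists>g. \<forall>xs\<in>tuples N n. F xs = g (xs ! i))"

lemma ess_unary_on_unary:
  assumes "ess_unary_on N n F" "n > 0"
  shows "\<exists>i<n. \<exists>g. \<forall>xs\<in>tuples N n. F xs = g (xs ! i)"
  using assms unfolding ess_unary_on_def by (elim disjE exE) (auto intro: exI[of _ "\<lambda>_. c" for c])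

lemma ess_unary_on_two:
  "ess_unary_on N 2 F \<longleftrightarrow> (\<forall>x\<in>N. \<forall>x'\<in>N. \<forall>y\<in>N. F [x, y] = F [x', y]) \<or>
     (\<forall>x\<in>N. \<forall>y\<in>N. \<forall>y'\<in>N. F [x, y] = F [x, y'])" (is "_ \<longleftrightarrow> ?snd \<or> ?fst")
proof
  assume "ess_unary_on N 2 F"
  then show "?snd \<or> ?fst" by (auto simp: ess_unary_on_def tuples_two less_2_cases_iff)
next
  assume ignores: "?snd \<or> ?fst"
  show "ess_unary_on N 2 F"
  proof (cases "N = {}")
    case True
    then have "tuples N 2 = {}" by (auto simp: tuples_two)
    then show ?thesis by (simp add: ess_unary_on_def)
  next
    case False
    then obtain z where z: "z \<in> N" by blast
    have pair: "\<exists>x\<in>N. \<exists>y\<in>N. xs = [x, y]" if "xs \<in> tuples N 2" for xs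
      using that by (simp add: tuples_two)
    from ignores show ?thesis
    proof
      assume ?snd
      have "F xs = F [z, xs ! 1]" if in_tuples: "xs \<in> tuples N 2" for xs
      proof -
        obtain x y where "x \<in> N" "y \<in> N" and xs: "xs = [x, y]" using pair[OF in_tuples] by blast
        then have "F [x, y] = F [z, y]" using \<open>?snd\<close> z by blast
        then show ?thesis by (simp add: xs)
      qed
      then show ?thesis unfolding ess_unary_on_def
        by (intro disjI2 exI[of _ 1] conjI exI[of _ "\<lambda>y. F [z, y]"]) auto
    next
      assume ?fst
      have "F xs = F [xs ! 0, z]" if in_tuples: "xs \<in> tuples N 2" for xs
      proof -
        obtain x y where "x \<in> N" "y \<in> N" and xs: "xs = [x, y]" using pair[OF in_tuples] by blast
        then have "F [x, y] = F [x, z]" using \<open>?fst\<close> z by blast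
        then show ?thesis by (simp add: xs)
      qed
      then show ?thesis unfolding ess_unary_on_def
        by (intro disjI2 exI[of _ 0] conjI exI[of _ "\<lambda>x. F [x, z]"]) auto
    qed
  qed
qed

text \<open>If \<open>F\<close> depends on coordinate \<open>i\<close> at \<open>zs\<close>, then changing another coordinate of \<open>zs\<close> does
  not change the map \<open>w \<mapsto> F (zs[i := w])\<close>.\<close>

lemma ess_unary_onI:
  assumes pairs: "\<And>zs i j. zs \<in> tuples N n \<Longrightarrow> i < n \<Longrightarrow> j < n \<Longrightarrow> i \<noteq> j \<Longrightarrow>
      ess_unary_on N 2 (\<lambda>xs. F (zs[i := xs ! 0, j := xs ! 1]))"
  shows "ess_unary_on N n F"
proof (cases "\<exists>zs\<in>tuples N n. \<exists>i<n. \<exists>x\<in>N. F (zs[i := x]) \<noteq> F zs")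
  case True
  then obtain zs i x where zs: "zs \<in> tuples N n" "i < n" "x \<in> N" "F (zs[i := x]) \<noteq> F zs" by blast
  have "\<forall>w\<in>N. F (ws[i := w]) = F (zs[i := w])" if "ws \<in> tuples N n" for ws
    using zs(1) that
  proof (rule tuples_change_induct)
    fix xs j y assume xs: "xs \<in> tuples N n" "\<forall>w\<in>N. F (xs[i := w]) = F (zs[i := w])"
      and j: "j < n" "y \<in> N"
    show "\<forall>w\<in>N. F (xs[j := y, i := w]) = F (zs[i := w])"
    proof (cases "j = i")
      case False
      let ?G = "\<lambda>ys. F (xs[i := ys ! 0, j := ys ! 1])"
      have "?G [x, xs ! j] = F (xs[i := x])" "?G [zs ! i, xs ! j] = F (xs[i := zs ! i])"
        using False by (simp_all add: list_update_swap[of i j])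
      then have "?G [x, xs ! j] \<noteq> ?G [zs ! i, xs ! j]"
        using xs(2) zs by (simp add: tuples_nth)
      moreover have "ess_unary_on N 2 ?G" using pairs[OF xs(1) zs(2) j(1)] False by auto
      ultimately have "?G [w, y] = ?G [w, xs ! j]" if "w \<in> N" for w
        using that zs xs j unfolding ess_unary_on_two by (meson tuples_nth)
      then show ?thesis using xs False by (simp add: list_update_swap[of i j])
    qed (use xs in simp)
  qed simp
  then have "F xs = F (zs[i := xs ! i])" if "xs \<in> tuples N n" for xs
    using that zs(2) by (metis list_update_id tuples_nth)
  then show ?thesis unfolding ess_unary_on_def
    using zs(2) by (intro disjI2 exI[of _ i] conjI exI[of _ "\<lambda>x. F (zs[i := x])"]) auto
next
  case False
  have "F ws = F zs" if "zs \<in> tuples N n" "ws \<in> tuples N n" for zs ws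
    using that by (rule tuples_change_induct) (use False in auto)
  then show ?thesis unfolding ess_unary_on_def by blast
qed

section \<open>Kinds of polynomial clones\<close>

definition ess_unary :: "('f, 'a) ualg \<Rightarrow> bool" where
  "ess_unary B \<longleftrightarrow> (\<forall>F. pol B 2 F \<longrightarrow> ess_unary_on (univ B) 2 F)"

definition term_condition :: "('f, 'a) ualg \<Rightarrow> bool" where
  "term_condition B \<longleftrightarrow> (\<forall>F. pol B 2 F \<longrightarrow> (\<forall>x\<in>univ B. \<forall>w\<in>univ B. \<forall>y\<in>univ B. \<forall>z\<in>univ B.
     F [x, y] = F [x, z] \<longrightarrow> F [w, y] = F [w, z]))"

definition has_swap :: "('f, 'a) ualg \<Rightarrow> bool" where
  "has_swap B \<longleftrightarrow> (\<exists>F. pol B 1 F \<and>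
     (\<exists>x\<in>univ B. \<exists>y\<in>univ B. x \<noteq> y \<and> F [x] = y \<and> F [y] = x))"

definition has_meet :: "('f, 'a) ualg \<Rightarrow> 'a \<Rightarrow> 'a \<Rightarrow> bool" where
  "has_meet B u v \<longleftrightarrow>
     (\<exists>F. pol B 2 F \<and> F [u, u] = u \<and> F [u, v] = u \<and> F [v, u] = u \<and> F [v, v] = v)"

definition lattice_like :: "('f, 'a) ualg \<Rightarrow> bool" where
  "lattice_like B \<longleftrightarrow> (\<exists>u\<in>univ B. \<exists>v\<in>univ B. u \<noteq> v \<and> has_meet B u v \<and> has_meet B v u)"

definition kind :: "('f, 'a) ualg \<Rightarrow> nat" where
  "kind B = (if ess_unary B then 1 else if term_condition B then 2
     else if has_swap B then 3 else if lattice_like B then 4 else 5)"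

lemma ess_unary_imp_term_condition: "ess_unary B \<Longrightarrow> term_condition B"
  unfolding ess_unary_def term_condition_def ess_unary_on_two by metis

lemma meet_not_term_condition:
  assumes "has_meet B u v" "u \<noteq> v" "u \<in> univ B" "v \<in> univ B"
  shows "\<not> term_condition B" "\<not> ess_unary B"
proof -
  show "\<not> term_condition B"
    using assms unfolding has_meet_def term_condition_def by metis
  then show "\<not> ess_unary B" using ess_unary_imp_term_condition by blast
qed

lemma kind_poly_equivalent:
  assumes "poly_equivalent B D"
  shows "kind B = kind D"
proof -
  have same: "univ B = univ D" "pol B = pol D"
    using assms by (auto simp: poly_equivalent_pol fun_eq_iff)
  show ?thesis
    unfolding kind_def ess_unary_def term_condition_def has_swap_def lattice_like_def has_meet_def same ..
qed

subsection \<open>Unary algebras\<close>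

lemma univ_unary_alg [simp]: "univ (unary_alg N G) = N"
  by (simp add: unary_alg_def)

lemma finite_ualg_unary_alg:
  assumes "finite N" "N \<noteq> {}" "\<And>g. g \<in> G \<Longrightarrow> bij_betw g N N"
  shows "finite_ualg (unary_alg N G)"
proof
  show "is_ualg (unary_alg N G)"
    using assms(2,3) bij_betwE by (fastforce simp: is_ualg_def unary_alg_def tuples_one)
qed (simp add: assms(1))

lemma pol1_unary_alg:
  assumes "finite_ualg (unary_alg N G)" "g \<in> G"
  shows "pol1 (unary_alg N G) g"
proof -
  interpret finite_ualg "unary_alg N G" by fact
  have "pol (unary_alg N G) 1 (\<lambda>xs. g (hd xs))"
    using pol_basic[of g] assms(2) by (simp add: unary_alg_def)
  then show ?thesis by (rule pol_congI) (auto simp: tuples_one)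
qed

lemma pol_unary_alg:
  assumes "finite_ualg (unary_alg N G)" "pol (unary_alg N G) n F"
  shows "ess_unary_on N n F"
proof -
  interpret finite_ualg "unary_alg N G" by fact
  from assms(2) show ?thesis
  proof (induction rule: pol_induct)
    case (proj i)
    then show ?case unfolding ess_unary_on_def
      by (intro disjI2 exI[of _ i] conjI exI[of _ "\<lambda>x. x"]) auto
  next
    case (const c)
    then show ?case unfolding ess_unary_on_def by blast
  next
    case (app f H)
    have apply_hd: "interp (unary_alg N G) f (map (\<lambda>i. H i xs) [0..<arity (unary_alg N G) f]) = f (H 0 xs)"
      for xs by (simp add: unary_alg_def)
    have "ess_unary_on N n (H 0)" using app(3)[of 0] by (simp add: unary_alg_def)
    then consider (const) c where "\<forall>xs\<in>tuples N n. H 0 xs = c" |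
      (unary) i g where "i < n" "\<forall>xs\<in>tuples N n. H 0 xs = g (xs ! i)"
      unfolding ess_unary_on_def by blast
    then show ?case
    proof cases
      case const
      then have "\<forall>xs\<in>tuples N n. f (H 0 xs) = f c" by simp
      then show ?thesis unfolding apply_hd ess_unary_on_def by blast
    next
      case unary
      then have "\<forall>xs\<in>tuples N n. f (H 0 xs) = (f \<circ> g) (xs ! i)" by simp
      then show ?thesis using unary(1) unfolding apply_hd ess_unary_on_def by blast
    qed
  next
    case (cong F F')
    then show ?case by (simp add: ess_unary_on_def)
  qed
qed

lemma kind_unary:
  assumes "finite (univ B)" "univ B \<noteq> {}" "\<forall>g\<in>G. bij_betw g (univ B) (univ B)"
    "poly_equivalent B (unary_alg (univ B) G)"
  shows "kind B = 1"
proof -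
  have "finite_ualg (unary_alg (univ B) G)"
    by (rule finite_ualg_unary_alg) (use assms in auto)
  then have "ess_unary B"
    unfolding ess_unary_def using pol_unary_alg assms(4) by (auto simp: poly_equivalent_pol)
  then show ?thesis by (simp add: kind_def)
qed

subsection \<open>Vector spaces\<close>

definition separable :: "('k, 'a, 'm) module_scheme \<Rightarrow> ('a list \<Rightarrow> 'a) \<Rightarrow> bool" where
  "separable M F \<longleftrightarrow> (\<exists>f\<in>carrier M \<rightarrow> carrier M. \<exists>g\<in>carrier M \<rightarrow> carrier M.
     \<forall>x\<in>carrier M. \<forall>y\<in>carrier M. F [x, y] = f x \<oplus>\<^bsub>M\<^esub> g y)"

lemma separableI:
  assumes "\<And>x. x \<in> carrier M \<Longrightarrow> f x \<in> carrier M" "\<And>y. y \<in> carrier M \<Longrightarrow> g y \<in> carrier M"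
    "\<And>x y. x \<in> carrier M \<Longrightarrow> y \<in> carrier M \<Longrightarrow> F [x, y] = f x \<oplus>\<^bsub>M\<^esub> g y"
  shows "separable M F"
  unfolding separable_def using assms by (intro bexI[of _ f] bexI[of _ g]) auto

lemma separableE:
  assumes "separable M F"
  obtains f g where "\<And>x. x \<in> carrier M \<Longrightarrow> f x \<in> carrier M" "\<And>y. y \<in> carrier M \<Longrightarrow> g y \<in> carrier M"
    "\<And>x y. x \<in> carrier M \<Longrightarrow> y \<in> carrier M \<Longrightarrow> F [x, y] = f x \<oplus>\<^bsub>M\<^esub> g y"
  using assms unfolding separable_def by blast

context Module.module
begin

lemma separable_const: "c \<in> carrier M \<Longrightarrow> separable M (\<lambda>_. c)"
  by (rule separableI[of M "\<lambda>_. c" "\<lambda>_. \<zero>\<^bsub>M\<^esub>"]) auto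

lemma separable_proj: "i < 2 \<Longrightarrow> separable M (\<lambda>xs. xs ! i)"
  by (cases "i = 0")
    (auto intro: separableI[of M "\<lambda>x. x" "\<lambda>_. \<zero>\<^bsub>M\<^esub>"] separableI[of M "\<lambda>_. \<zero>\<^bsub>M\<^esub>" "\<lambda>y. y"]
      simp: less_2_cases_iff)

lemma separable_minus:
  assumes "separable M F"
  shows "separable M (\<lambda>xs. \<ominus>\<^bsub>M\<^esub> F xs)"
proof -
  obtain f g where "\<And>x. x \<in> carrier M \<Longrightarrow> f x \<in> carrier M" "\<And>y. y \<in> carrier M \<Longrightarrow> g y \<in> carrier M"
    "\<And>x y. x \<in> carrier M \<Longrightarrow> y \<in> carrier M \<Longrightarrow> F [x, y] = f x \<oplus>\<^bsub>M\<^esub> g y"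
    by (rule separableE[OF assms], rule that)
  then show ?thesis
    by (intro separableI[of M "\<lambda>x. \<ominus>\<^bsub>M\<^esub> f x" "\<lambda>y. \<ominus>\<^bsub>M\<^esub> g y"]) (simp_all add: M.minus_add)
qed

lemma separable_add:
  assumes "separable M F" "separable M F'"
  shows "separable M (\<lambda>xs. F xs \<oplus>\<^bsub>M\<^esub> F' xs)"
proof -
  obtain f g where "\<And>x. x \<in> carrier M \<Longrightarrow> f x \<in> carrier M" "\<And>y. y \<in> carrier M \<Longrightarrow> g y \<in> carrier M"
    "\<And>x y. x \<in> carrier M \<Longrightarrow> y \<in> carrier M \<Longrightarrow> F [x, y] = f x \<oplus>\<^bsub>M\<^esub> g y"
    by (rule separableE[OF assms(1)], rule that)
  moreover obtain f' g' where "\<And>x. x \<in> carrier M \<Longrightarrow> f' x \<in> carrier M" "\<And>y. y \<in> carrier M \<Longrightarrow> g' y \<in> carrier M"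
    "\<And>x y. x \<in> carrier M \<Longrightarrow> y \<in> carrier M \<Longrightarrow> F' [x, y] = f' x \<oplus>\<^bsub>M\<^esub> g' y"
    by (rule separableE[OF assms(2)], rule that)
  ultimately show ?thesis
    by (intro separableI[of M "\<lambda>x. f x \<oplus>\<^bsub>M\<^esub> f' x" "\<lambda>y. g y \<oplus>\<^bsub>M\<^esub> g' y"]) (simp_all add: M.a_ac)
qed

lemma separable_smult:
  assumes "k \<in> carrier R" "separable M F"
  shows "separable M (\<lambda>xs. k \<odot>\<^bsub>M\<^esub> F xs)"
proof -
  obtain f g where "\<And>x. x \<in> carrier M \<Longrightarrow> f x \<in> carrier M" "\<And>y. y \<in> carrier M \<Longrightarrow> g y \<in> carrier M"
    "\<And>x y. x \<in> carrier M \<Longrightarrow> y \<in> carrier M \<Longrightarrow> F [x, y] = f x \<oplus>\<^bsub>M\<^esub> g y"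
    by (rule separableE[OF assms(2)], rule that)
  then show ?thesis
    by (intro separableI[of M "\<lambda>x. k \<odot>\<^bsub>M\<^esub> f x" "\<lambda>y. k \<odot>\<^bsub>M\<^esub> g y"])
      (simp_all add: assms(1) smult_r_distr)
qed

end

lemma univ_vector_space_alg [simp]: "univ (vector_space_alg K M) = carrier M"
  by (simp add: vector_space_alg_def)

lemma finite_ualg_vector_space_alg:
  assumes "Module.module K M" "finite (carrier M)"
  shows "finite_ualg (vector_space_alg K M)"
proof
  interpret Module.module K M by fact
  show "is_ualg (vector_space_alg K M)" unfolding is_ualg_def
  proof (intro conjI ballI)
    fix f xs assume "f \<in> syms (vector_space_alg K M)"
      "xs \<in> tuples (univ (vector_space_alg K M)) (arity (vector_space_alg K M) f)"
    then show "interp (vector_space_alg K M) f xs \<in> univ (vector_space_alg K M)"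
      by (cases f) (auto simp: vector_space_alg_def tuples_nth)
  qed (use M.zero_closed in auto)
qed (use assms(2) in simp)

lemma separable_vector_space:
  assumes "Module.module K M" "finite (carrier M)" "pol (vector_space_alg K M) 2 F"
  shows "separable M F"
proof -
  interpret Module.module K M by fact
  interpret V: finite_ualg "vector_space_alg K M"
    by (rule finite_ualg_vector_space_alg[OF assms(1,2)])
  from assms(3) show ?thesis
  proof (induction rule: V.pol_induct)
    case (proj i)
    then show ?case by (rule separable_proj)
  next
    case (const c)
    then show ?case by (simp add: separable_const)
  next
    case (app f G)
    have args: "separable M (G i)" if "i < vs_arity f" for i
      using app(3)[of i] that by (simp add: vector_space_alg_def)
    show ?case
    proof (cases f)
      case VZero
      then show ?thesis by (simp add: vector_space_alg_def separable_const)
    next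
      case VNeg
      then show ?thesis using separable_minus[OF args[of 0]] by (simp add: vector_space_alg_def)
    next
      case VAdd
      then show ?thesis using separable_add[OF args[of 0] args[of 1]]
        by (simp add: vector_space_alg_def numeral_2_eq_2)
    next
      case (VScale k)
      then have "k \<in> carrier K" using app(1) by (auto simp: vector_space_alg_def)
      then show ?thesis using separable_smult[OF _ args[of 0]] VScale
        by (simp add: vector_space_alg_def)
    qed
  next
    case (cong F G)
    then show ?case by (simp add: separable_def tuples_two)
  qed
qed

lemma term_condition_vector_space:
  assumes "Module.module K M" "finite (carrier M)"
  shows "term_condition (vector_space_alg K M)"
  unfolding term_condition_def univ_vector_space_alg
proof (intro allI impI ballI)
  interpret Module.module K M by fact
  fix F x w y z
  assume "pol (vector_space_alg K M) 2 F"
    and elems: "x \<in> carrier M" "w \<in> carrier M" "y \<in> carrier M" "z \<in> carrier M"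
    and eq: "F [x, y] = F [x, z]"
  then have "separable M F" by (intro separable_vector_space[OF assms])
  then obtain f g where closed: "\<And>x. x \<in> carrier M \<Longrightarrow> f x \<in> carrier M" "\<And>y. y \<in> carrier M \<Longrightarrow> g y \<in> carrier M"
    and F: "\<And>x y. x \<in> carrier M \<Longrightarrow> y \<in> carrier M \<Longrightarrow> F [x, y] = f x \<oplus>\<^bsub>M\<^esub> g y"
    by (elim separableE) blast
  have "g y = g z" using eq F closed elems by simp
  then show "F [w, y] = F [w, z]" using F elems by simp
qed

lemma not_ess_unary_vector_space:
  assumes "Module.module K M" "finite (carrier M)" "card (carrier M) \<ge> 2"
  shows "\<not> ess_unary (vector_space_alg K M)"
proof
  interpret Module.module K M by fact
  interpret V: finite_ualg "vector_space_alg K M"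
    by (rule finite_ualg_vector_space_alg[OF assms(1,2)])
  assume "ess_unary (vector_space_alg K M)"
  moreover have "pol (vector_space_alg K M) 2 (vs_interp M VAdd)"
    using V.pol_basic[of VAdd] by (simp add: vector_space_alg_def)
  ultimately have ess: "ess_unary_on (carrier M) 2 (vs_interp M VAdd)" by (simp add: ess_unary_def)
  have "\<not> carrier M \<subseteq> {\<zero>\<^bsub>M\<^esub>}" using assms(3) card_mono[of "{\<zero>\<^bsub>M\<^esub>}" "carrier M"] by auto
  then obtain a where a: "a \<in> carrier M" "a \<noteq> \<zero>\<^bsub>M\<^esub>" by blast
  have "vs_interp M VAdd [\<zero>\<^bsub>M\<^esub>, \<zero>\<^bsub>M\<^esub>] = vs_interp M VAdd [a, \<zero>\<^bsub>M\<^esub>] \<or>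
      vs_interp M VAdd [\<zero>\<^bsub>M\<^esub>, \<zero>\<^bsub>M\<^esub>] = vs_interp M VAdd [\<zero>\<^bsub>M\<^esub>, a]"
    using ess a(1) M.zero_closed unfolding ess_unary_on_two by blast
  then show False using a by simp
qed

lemma kind_vector_space:
  assumes "Module.module K M" "poly_equivalent B (vector_space_alg K M)" "card (univ B) \<ge> 2"
  shows "kind B = 2"
proof -
  have "univ B = carrier M" using assms(2) by (simp add: poly_equivalent_pol)
  moreover from this have "finite (carrier M)"
    using assms(3) by (metis card.infinite not_numeral_le_zero)
  ultimately have "kind (vector_space_alg K M) = 2"
    using term_condition_vector_space[OF assms(1)] not_ess_unary_vector_space[OF assms(1)] assms(3)
    by (simp add: kind_def)
  then show ?thesis by (simp add: kind_poly_equivalent[OF assms(2)])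
qed

subsection \<open>Two-element algebras\<close>

lemma univ_two_element_alg [simp]: "univ (two_element_alg S u v) = {u, v}"
  by (simp add: two_element_alg_def)

lemma finite_ualg_two_element_alg: "finite_ualg (two_element_alg S u v)"
proof
  have "bool_interp u v f xs \<in> {u, v}" if "xs \<in> tuples {u, v} (bool_arity f)" for f xs
    by (cases f) simp_all
  then show "is_ualg (two_element_alg S u v)"
    by (simp add: is_ualg_def two_element_alg_def)
qed simp

lemma pol_two_element_alg:
  assumes "f \<in> S"
  shows "pol (two_element_alg S u v) (bool_arity f) (bool_interp u v f)"
  using finite_ualg.pol_basic[OF finite_ualg_two_element_alg, of f S u v] assms
  by (simp add: two_element_alg_def)

lemma has_meet_two_element_alg:
  "BMeet \<in> S \<Longrightarrow> u \<noteq> v \<Longrightarrow> has_meet (two_element_alg S u v) u v"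
  "BJoin \<in> S \<Longrightarrow> u \<noteq> v \<Longrightarrow> has_meet (two_element_alg S u v) v u"
  using pol_two_element_alg[of BMeet S u v] pol_two_element_alg[of BJoin S u v]
  unfolding has_meet_def by auto

lemma has_swap_two_element_alg:
  "BNot \<in> S \<Longrightarrow> u \<noteq> v \<Longrightarrow> has_swap (two_element_alg S u v)"
  using pol_two_element_alg[of BNot S u v]
  unfolding has_swap_def by (auto intro!: exI[of _ "bool_interp u v BNot"])

lemma not_has_swap_two_element_alg:
  assumes "BNot \<notin> S" "u \<noteq> v"
  shows "\<not> has_swap (two_element_alg S u v)"
proof -
  interpret finite_ualg "two_element_alg S u v" by (rule finite_ualg_two_element_alg)
  let ?monotone = "\<lambda>F. F [u] \<in> {u, v} \<and> F [v] \<in> {u, v} \<and> (F [u] = v \<longrightarrow> F [v] = v)"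
  have "?monotone F" if "pol (two_element_alg S u v) 1 F" for F
    using that
  proof (induction rule: pol_induct)
    case (app f G)
    have args: "?monotone (G i)" if "i < bool_arity f" for i
      using app(3)[of i] that by (simp add: two_element_alg_def)
    have "f \<noteq> BNot" using app(1) assms(1) by (auto simp: two_element_alg_def)
    then show ?case
      using args[of 0] args[of 1] assms(2)
      by (cases f) (auto simp: two_element_alg_def numeral_2_eq_2)
  next
    case (cong F G)
    then show ?case by (simp add: tuples_one)
  qed auto
  then show ?thesis using assms(2) unfolding has_swap_def by fastforce
qed

definition meet_term :: "'a \<Rightarrow> 'a \<Rightarrow> nat set \<Rightarrow> 'a list \<Rightarrow> 'a" where
  "meet_term u v J xs = (if \<forall>j\<in>J. xs ! j = v then v else u)"

definition const_or_meet :: "'a \<Rightarrow> 'a \<Rightarrow> nat \<Rightarrow> ('a list \<Rightarrow> 'a) \<Rightarrow> bool" where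
  "const_or_meet u v n F \<longleftrightarrow> (\<forall>xs\<in>tuples {u, v} n. F xs = u) \<or>
     (\<exists>J\<subseteq>{..<n}. \<forall>xs\<in>tuples {u, v} n. F xs = meet_term u v J xs)"

lemma const_or_meetI_meet_term:
  "J \<subseteq> {..<n} \<Longrightarrow> (\<And>xs. xs \<in> tuples {u, v} n \<Longrightarrow> F xs = meet_term u v J xs) \<Longrightarrow> const_or_meet u v n F"
  unfolding const_or_meet_def by blast

lemma const_or_meet_meet:
  assumes "u \<noteq> v" "const_or_meet u v n F" "const_or_meet u v n G"
  shows "const_or_meet u v n (\<lambda>xs. if F xs = v \<and> G xs = v then v else u)"
proof (cases "(\<forall>xs\<in>tuples {u, v} n. F xs = u) \<or> (\<forall>xs\<in>tuples {u, v} n. G xs = u)")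
  case True
  then show ?thesis using assms(1) by (auto simp: const_or_meet_def)
next
  case False
  then obtain J J' where
    F: "J \<subseteq> {..<n}" "\<And>xs. xs \<in> tuples {u, v} n \<Longrightarrow> F xs = meet_term u v J xs" and
    G: "J' \<subseteq> {..<n}" "\<And>xs. xs \<in> tuples {u, v} n \<Longrightarrow> G xs = meet_term u v J' xs"
    using assms(2,3) unfolding const_or_meet_def by blast
  show ?thesis
    by (rule const_or_meetI_meet_term[of "J \<union> J'"])
      (use F G assms(1) in \<open>auto simp: meet_term_def ball_Un\<close>)
qed

lemma const_or_meet_pol_semilattice:
  assumes "u \<noteq> v" "pol (two_element_alg {BMeet} u v) n F"
  shows "const_or_meet u v n F"
proof -
  interpret finite_ualg "two_element_alg {BMeet} u v" by (rule finite_ualg_two_element_alg)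
  from assms(2) show ?thesis
  proof (induction rule: pol_induct)
    case (proj i)
    then show ?case
      using tuples_nth[of _ "{u, v}" n i]
      by (intro const_or_meetI_meet_term[of "{i}"]) (auto simp: meet_term_def)
  next
    case (const c)
    then consider "c = u" | "c = v" by auto
    then show ?case
    proof cases
      assume "c = v"
      then show ?thesis by (intro const_or_meetI_meet_term[of "{}"]) (auto simp: meet_term_def)
    qed (simp add: const_or_meet_def)
  next
    case (app f G)
    then have "f = BMeet" by (simp add: two_element_alg_def)
    then show ?case
      using const_or_meet_meet[OF assms(1), of n "G 0" "G 1"] app(3)
      by (simp add: two_element_alg_def numeral_2_eq_2)
  next
    case (cong F G)
    then show ?case by (simp add: const_or_meet_def)
  qed
qed

lemma not_has_join_semilattice:
  assumes "u \<noteq> v"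
  shows "\<not> has_meet (two_element_alg {BMeet} u v) v u"
proof
  assume "has_meet (two_element_alg {BMeet} u v) v u"
  then obtain F where F: "pol (two_element_alg {BMeet} u v) 2 F"
    "F [v, u] = v" "F [u, v] = v" "F [u, u] = u"
    unfolding has_meet_def by blast
  have "\<exists>xs\<in>tuples {u, v} 2. F xs \<noteq> u"
    using F(2) assms by (intro bexI[of _ "[v, u]"]) (auto simp: tuples_two)
  then obtain J where J: "J \<subseteq> {..<2}"
    and meet: "\<And>xs. xs \<in> tuples {u, v} 2 \<Longrightarrow> F xs = meet_term u v J xs"
    using const_or_meet_pol_semilattice[OF assms F(1)] unfolding const_or_meet_def by blast
  have "1 \<notin> J" using meet[of "[v, u]"] F(2) assms by (auto simp: tuples_two meet_term_def split: if_splits)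
  moreover have "0 \<notin> J" using meet[of "[u, v]"] F(3) assms by (auto simp: tuples_two meet_term_def split: if_splits)
  ultimately have "J = {}" using J by (auto simp: less_2_cases_iff)
  then show False using meet[of "[u, u]"] F(4) assms by (simp add: tuples_two meet_term_def)
qed

lemma minimal_alg_type_kind:
  assumes "minimal_alg_type B i" "card (univ B) \<ge> 2"
  shows "i = kind B"
  using assms(1)
proof cases
  case (unary G)
  have "finite (univ B)" "univ B \<noteq> {}" using assms(2) by (auto intro: card_ge_0_finite)
  then show ?thesis using unary kind_unary by metis
next
  case (vector_space K M)
  then show ?thesis using kind_vector_space assms(2) by metis
next
  case (boolean u v)
  let ?D = "two_element_alg {BBot, BTop, BNot, BMeet, BJoin} u v"
  have meet: "has_meet ?D u v" and "has_swap ?D"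
    using boolean by (auto intro: has_meet_two_element_alg has_swap_two_element_alg)
  then show ?thesis
    using kind_poly_equivalent[OF boolean(3)] meet_not_term_condition[OF meet] boolean
    by (simp add: kind_def)
next
  case (lattice u v)
  let ?D = "two_element_alg {BMeet, BJoin} u v"
  have meet: "has_meet ?D u v" and join: "has_meet ?D v u"
    using lattice by (auto intro: has_meet_two_element_alg)
  then have "lattice_like ?D" using lattice(2) unfolding lattice_like_def by auto
  then show ?thesis
    using kind_poly_equivalent[OF lattice(3)] meet_not_term_condition[OF meet] lattice
      not_has_swap_two_element_alg[of "{BMeet, BJoin}" u v]
    by (simp add: kind_def)
next
  case (semilattice u v)
  let ?D = "two_element_alg {BMeet} u v"
  have meet: "has_meet ?D u v" using semilattice by (auto intro: has_meet_two_element_alg)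
  moreover have "\<not> lattice_like ?D"
    using not_has_join_semilattice[OF semilattice(2)] unfolding lattice_like_def by auto
  ultimately show ?thesis
    using kind_poly_equivalent[OF semilattice(3)] meet_not_term_condition[OF meet] semilattice
      not_has_swap_two_element_alg[of "{BMeet}" u v]
    by (simp add: kind_def)
qed

section \<open>Minimal algebras with two or three elements\<close>

definition minimal_algebra :: "('f, 'a) ualg \<Rightarrow> bool" where
  "minimal_algebra A \<longleftrightarrow> (\<forall>f. pol1 A f \<longrightarrow>
     (\<forall>x\<in>univ A. \<forall>y\<in>univ A. f x = f y) \<or> bij_betw f (univ A) (univ A))"

lemma minimal_algebraD:
  "minimal_algebra A \<Longrightarrow> pol1 A f \<Longrightarrow> x \<in> univ A \<Longrightarrow> y \<in> univ A \<Longrightarrow> f x \<noteq> f y \<Longrightarrow>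
    bij_betw f (univ A) (univ A)"
  unfolding minimal_algebra_def by blast

lemma bij_betw_power_id:
  assumes "finite S" "bij_betw f S S"
  shows "\<exists>k. \<forall>x\<in>S. (f ^^ Suc k) x = x"
proof -
  have closed: "(f ^^ i) x \<in> S" if "x \<in> S" for i x
    using that assms(2) by (induction i) (auto simp: bij_betw_def)
  let ?power = "\<lambda>i. restrict (f ^^ i) S"
  have "range ?power \<subseteq> S \<rightarrow>\<^sub>E S" using closed by auto
  then have "finite (range ?power)" using assms(1) finite_PiE[of S "\<lambda>_. S"] finite_subset by blast
  then have "\<not> inj ?power" using finite_imageD infinite_UNIV_nat by blast
  then obtain i j where "?power i = ?power j" "i < j" unfolding inj_def by (metis linorder_neqE_nat)
  then have eq: "(f ^^ i) x = (f ^^ j) x" if "x \<in> S" for x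
    using that by (metis restrict_apply')
  obtain k where k: "j = i + Suc k" using \<open>i < j\<close> less_imp_Suc_add by auto
  have inj: "inj_on (f ^^ i) S"
    using bij_betw_funpow[OF assms(2), of i] by (auto simp: bij_betw_def)
  have "(f ^^ Suc k) x = x" if "x \<in> S" for x
  proof -
    have "(f ^^ i) ((f ^^ Suc k) x) = (f ^^ i) x"
      using eq[OF that] unfolding k funpow_add by simp
    then show ?thesis using inj that closed[of x "Suc k"] by (meson inj_onD)
  qed
  then show ?thesis by blast
qed

lemma (in finite_ualg) pol1_inverse:
  assumes "pol1 A f" "S \<subseteq> univ A" "bij_betw f S S"
  obtains g where "pol1 A g" "\<And>x. x \<in> S \<Longrightarrow> g x \<in> S" "\<And>x. x \<in> S \<Longrightarrow> g (f x) = x" "\<And>x. x \<in> S \<Longrightarrow> f (g x) = x"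
proof -
  have "finite S" using finite_univ assms(2) finite_subset by blast
  then obtain k where cycle: "\<And>x. x \<in> S \<Longrightarrow> (f ^^ Suc k) x = x"
    using bij_betw_power_id[OF _ assms(3)] by blast
  show ?thesis
  proof
    show "pol1 A (f ^^ k)" by (rule pol1_funpow[OF assms(1)])
    show "(f ^^ k) x \<in> S" if "x \<in> S" for x
      using that assms(3) by (induction k) (auto simp: bij_betw_def)
    show "(f ^^ k) (f x) = x" if "x \<in> S" for x using cycle[OF that] by (simp add: funpow_swap1)
    show "f ((f ^^ k) x) = x" if "x \<in> S" for x using cycle[OF that] by simp
  qed
qed

subsection \<open>Essentially unary minimal algebras\<close>

context finite_ualg
begin

lemma ess_unary_on_pol:
  assumes "ess_unary A" "pol A n F"
  shows "ess_unary_on (univ A) n F"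
proof (rule ess_unary_onI)
  fix zs i j assume "zs \<in> tuples (univ A) n"
  then have "pol A 2 (\<lambda>xs. F (zs[i := xs ! 0, j := xs ! 1]))"
    by (intro pol_update2[OF assms(2)] pol_proj) auto
  then show "ess_unary_on (univ A) 2 (\<lambda>xs. F (zs[i := xs ! 0, j := xs ! 1]))"
    using assms(1) by (simp add: ess_unary_def)
qed

lemma ess_unary_on_polE:
  assumes "ess_unary_on (univ A) n F" "pol A n F"
  obtains (const) c where "c \<in> univ A" "\<And>xs. xs \<in> tuples (univ A) n \<Longrightarrow> F xs = c"
    | (unary) i g where "i < n" "pol1 A g" "\<And>xs. xs \<in> tuples (univ A) n \<Longrightarrow> F xs = g (xs ! i)"
proof -
  obtain z where "z \<in> univ A" by (rule ex_element)
  then have zs: "replicate n z \<in> tuples (univ A) n" by (rule tuples_replicate)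
  from assms(1) consider c where "\<forall>xs\<in>tuples (univ A) n. F xs = c" |
    i g where "i < n" "\<forall>xs\<in>tuples (univ A) n. F xs = g (xs ! i)"
    unfolding ess_unary_on_def by blast
  then show thesis
  proof cases
    fix c assume "\<forall>xs\<in>tuples (univ A) n. F xs = c"
    moreover from this have "c \<in> univ A" using pol_closed[OF assms(2) zs] zs by simp
    ultimately show thesis by (intro const) auto
  next
    fix i g assume i: "i < n" and F: "\<forall>xs\<in>tuples (univ A) n. F xs = g (xs ! i)"
    have "F xs = F ((replicate n z)[i := xs ! i])" if "xs \<in> tuples (univ A) n" for xs
      using F that i tuples_update[OF zs, of "xs ! i" i] by (simp add: tuples_nth)
    moreover have "pol1 A (\<lambda>x. F ((replicate n z)[i := x]))"
      by (rule pol_update[OF assms(2) zs pol1_id])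
    ultimately show thesis by (rule unary[OF i, rotated])
  qed
qed

lemma minimal_alg_type_unary:
  assumes "ess_unary A" "minimal_algebra A"
  shows "minimal_alg_type A 1"
proof -
  define G where "G = {g. bij_betw g (univ A) (univ A) \<and> pol1 A g}"
  let ?D = "unary_alg (univ A) G"
  have finite_ualg_D: "finite_ualg ?D"
    by (rule finite_ualg_unary_alg) (use is_ualg finite_univ in \<open>auto simp: G_def is_ualg_def\<close>)
  interpret D: finite_ualg ?D by (rule finite_ualg_D)
  have "poly_equivalent A ?D"
  proof (rule poly_equivalentI[OF finite_ualg_D])
    fix g assume "g \<in> syms ?D"
    then have "pol1 A g" by (simp add: unary_alg_def G_def)
    then have "pol A 1 (\<lambda>xs. g (hd xs))" by (rule pol_congI) (auto simp: tuples_one)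
    then show "pol A (arity ?D g) (interp ?D g)" by (simp add: unary_alg_def)
  next
    fix n F assume "pol A n F"
    from ess_unary_on_pol[OF assms(1) this] this show "pol ?D n F"
    proof (cases rule: ess_unary_on_polE)
      case (const c)
      then show ?thesis using D.pol_const[of c n] by (auto elim!: pol_congI)
    next
      case (unary i g)
      show ?thesis
      proof (cases "\<forall>x\<in>univ A. \<forall>y\<in>univ A. g x = g y")
        case True
        obtain z where z: "z \<in> univ A" by (rule ex_element)
        then have "pol ?D n (\<lambda>_. g z)" using pol1_closed[OF unary(2)] by (intro D.pol_const) simp
        then show ?thesis
        proof (rule pol_congI)
          fix xs assume "xs \<in> tuples (univ ?D) n"
          then show "g z = F xs" using unary(1,3) True z by (metis tuples_nth univ_unary_alg)
        qed
      next
        case False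
        then have "g \<in> G" using assms(2) unary(2) unfolding G_def minimal_algebra_def by blast
        from D.pol_pol1[OF pol1_unary_alg[OF finite_ualg_D this] D.pol_proj[OF unary(1)]]
        show ?thesis by (rule pol_congI) (use unary(3) in simp)
      qed
    qed
  qed simp
  then show ?thesis by (rule minimal_alg_type.unary[rotated]) (simp add: G_def)
qed

end

subsection \<open>A zero and a unit from a failure of the term condition\<close>

context finite_ualg
begin

text \<open>Row \<open>a\<close> in which the bijective column \<open>d\<close> takes the value \<open>k\<close> of the constant column \<open>c\<close> is
  constant by minimality. Inverting column \<open>d\<close> and another row turns \<open>k\<close> into a zero and a second
  element into a unit.\<close>

lemma zero_unit_of_constant_column:
  assumes minimal: "minimal_algebra A" and g: "pol2 A g"
    and c: "c \<in> univ A" "\<And>x. x \<in> univ A \<Longrightarrow> g x c = k"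
    and d: "d \<in> univ A" "x \<in> univ A" "x' \<in> univ A" "g x d \<noteq> g x' d"
  obtains G l where "pol2 A G" "k \<in> univ A" "l \<in> univ A" "k \<noteq> l"
    "\<And>y. y \<in> univ A \<Longrightarrow> G k y = k" "\<And>y. y \<in> univ A \<Longrightarrow> G y k = k"
    "\<And>y. y \<in> univ A \<Longrightarrow> G l y = y" "\<And>y. y \<in> univ A \<Longrightarrow> G y l = y"
proof -
  have k: "k \<in> univ A" using c d(2) pol2_closed[OF g] by metis
  have column_pol: "pol1 A (\<lambda>x. g x d)" by (rule pol2_right[OF g d(1)])
  then have column: "bij_betw (\<lambda>x. g x d) (univ A) (univ A)"
    by (rule minimal_algebraD[OF minimal _ d(2,3,4)])
  then obtain a where a: "a \<in> univ A" "g a d = k" using k by (metis bij_betw_iff_bijections)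
  have "c \<noteq> d" using c d by metis
  then have "\<not> inj_on (g a) (univ A)" using a c d(1) by (metis inj_onD)
  then have row_a: "g a y = k" if "y \<in> univ A" for y
    using minimal_algebraD[OF minimal pol2_left[OF g a(1)] that d(1)] a(2) bij_betw_imp_inj_on by metis
  obtain b where b: "b \<in> univ A" "b \<noteq> a" using d(2-4) by metis
  define l where "l = g b d"
  have l: "l \<in> univ A" "k \<noteq> l"
    using a b column d(1) pol2_closed[OF g] unfolding l_def by (auto simp: bij_betw_def dest: inj_onD)
  have "bij_betw (g b) (univ A) (univ A)"
    by (rule minimal_algebraD[OF minimal pol2_left[OF g b(1)] c(1) d(1)])
      (use c(2)[OF b(1)] l in \<open>simp add: l_def\<close>)
  then obtain r where r: "pol1 A r" "\<And>y. y \<in> univ A \<Longrightarrow> r y \<in> univ A"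
    "\<And>y. y \<in> univ A \<Longrightarrow> r (g b y) = y" "\<And>y. y \<in> univ A \<Longrightarrow> g b (r y) = y"
    using pol1_inverse[OF pol2_left[OF g b(1)] subset_refl] by metis
  obtain s where s: "pol1 A s" "\<And>x. x \<in> univ A \<Longrightarrow> s x \<in> univ A"
    "\<And>x. x \<in> univ A \<Longrightarrow> s (g x d) = x" "\<And>x. x \<in> univ A \<Longrightarrow> g (s x) d = x"
    using pol1_inverse[OF column_pol subset_refl column] by metis
  have inverse: "r k = c" "r l = d" "s k = a" "s l = b"
    using r(3)[OF c(1)] r(3)[OF d(1)] s(3)[OF a(1)] s(3)[OF b(1)] c(2)[OF b(1)] a by (auto simp: l_def)
  show thesis
  proof (rule that[of "\<lambda>x y. g (s x) (r y)" l])
    show "pol2 A (\<lambda>x y. g (s x) (r y))" by (rule pol2_comp_args[OF g s(1) r(1)])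
  qed (use inverse row_a r s c k l in auto)
qed

end

subsection \<open>Two-element minimal algebras\<close>

locale two_element_ualg = finite_ualg A for A :: "('f, 'a) ualg" +
  assumes two: "card (univ A) = 2"
begin

lemma univ_pair: "u \<in> univ A \<Longrightarrow> v \<in> univ A \<Longrightarrow> u \<noteq> v \<Longrightarrow> univ A = {u, v}"
  using two by (metis card_2_iff doubleton_eq_iff insertE singletonD)

lemma minimal_algebra_two: "minimal_algebra A"
  unfolding minimal_algebra_def
proof (intro allI impI disjCI)
  fix f assume f: "pol1 A f" and "\<not> bij_betw f (univ A) (univ A)"
  moreover have "bij_betw f (univ A) (univ A)" if "x \<in> univ A" "y \<in> univ A" "f x \<noteq> f y" for x y
  proof -
    have "univ A = {x, y}" using that univ_pair by blast
    moreover have "univ A = {f x, f y}" using that pol1_closed[OF f] univ_pair by blast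
    ultimately show ?thesis unfolding bij_betw_def using that(3) by auto
  qed
  ultimately show "\<forall>x\<in>univ A. \<forall>y\<in>univ A. f x = f y" by blast
qed

lemma meet_of_not_term_condition:
  assumes "\<not> term_condition A"
  obtains u v where "univ A = {u, v}" "u \<noteq> v" "has_meet A u v"
proof -
  obtain F x w y z where F: "pol A 2 F" and elems: "x \<in> univ A" "w \<in> univ A" "y \<in> univ A" "z \<in> univ A"
    and eq: "F [x, y] = F [x, z]" and ne: "F [w, y] \<noteq> F [w, z]"
    using assms unfolding term_condition_def by blast
  define u where "u = F [x, y]"
  have "univ A = {y, z}" using elems ne univ_pair by metis
  then have row_x: "F [x, t] = u" if "t \<in> univ A" for t using that eq by (auto simp: u_def)
  have flipped: "pol2 A (\<lambda>s t. F [t, s])"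
    using F pol2_flip[of "\<lambda>s t. F [s, t]"] pol2_iff[of A F] by simp
  obtain G v where G: "pol2 A G" and uv: "u \<in> univ A" "v \<in> univ A" "u \<noteq> v"
    and "\<And>y. y \<in> univ A \<Longrightarrow> G u y = u" "\<And>y. y \<in> univ A \<Longrightarrow> G y u = u" "\<And>y. y \<in> univ A \<Longrightarrow> G v y = y"
    by (rule zero_unit_of_constant_column[OF minimal_algebra_two flipped elems(1) row_x elems(2-4) ne])
      blast+
  then have "has_meet A u v" unfolding has_meet_def
    by (intro exI[of _ "\<lambda>xs. G (xs ! 0) (xs ! 1)"]) simp
  then show ?thesis using that univ_pair uv by blast
qed

end

locale two_element_pair = two_element_ualg A for A :: "('f, 'a) ualg" +
  fixes u v :: 'a
  assumes univ_uv: "univ A = {u, v}" and u_neq_v: "u \<noteq> v"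
begin

lemma has_meet_swap:
  assumes "has_swap A" "has_meet A u v"
  shows "has_meet A v u"
proof -
  obtain F x y where F: "pol A 1 F" "x \<in> univ A" "y \<in> univ A" "x \<noteq> y" "F [x] = y" "F [y] = x"
    using assms(1) unfolding has_swap_def by blast
  then have swap: "F [u] = v" "F [v] = u" using univ_uv by auto
  obtain H where H: "pol A 2 H" "H [u, u] = u" "H [u, v] = u" "H [v, u] = u" "H [v, v] = v"
    using assms(2) unfolding has_meet_def by blast
  have "pol A 2 (\<lambda>xs. F [H [F [xs ! 0], F [xs ! 1]]])"
    by (intro pol_comp1[OF F(1)] pol_comp2[OF H(1)] pol_proj) auto
  then show ?thesis unfolding has_meet_def
    by (intro exI[of _ "\<lambda>xs. F [H [F [xs ! 0], F [xs ! 1]]]"]) (simp add: swap H)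
qed

lemma pol_meet:
  assumes "has_meet A u v"
  shows "pol A 2 (bool_interp u v BMeet)"
proof -
  obtain H where H: "pol A 2 H" "H [u, u] = u" "H [u, v] = u" "H [v, u] = u" "H [v, v] = v"
    using assms unfolding has_meet_def by blast
  show ?thesis
    by (rule pol_congI[OF H(1)]) (use H univ_uv u_neq_v in \<open>auto simp: tuples_two\<close>)
qed

lemma pol_join:
  assumes "has_meet A v u"
  shows "pol A 2 (bool_interp u v BJoin)"
proof -
  obtain H where H: "pol A 2 H" "H [v, v] = v" "H [v, u] = v" "H [u, v] = v" "H [u, u] = u"
    using assms unfolding has_meet_def by blast
  show ?thesis
    by (rule pol_congI[OF H(1)]) (use H univ_uv u_neq_v in \<open>auto simp: tuples_two\<close>)
qed

lemma pol_not:
  assumes "has_swap A"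
  shows "pol A 1 (bool_interp u v BNot)"
proof -
  obtain F x y where F: "pol A 1 F" "x \<in> univ A" "y \<in> univ A" "x \<noteq> y" "F [x] = y" "F [y] = x"
    using assms unfolding has_swap_def by blast
  then have "F [u] = v" "F [v] = u" using univ_uv by auto
  then show ?thesis
    by (intro pol_congI[OF F(1)]) (use univ_uv u_neq_v in \<open>auto simp: tuples_one\<close>)
qed

lemma slice_cases:
  assumes "pol A (Suc n) F" "ys \<in> tuples (univ A) n" "c = u \<or> c = v"
  shows "F (c # ys) = u \<or> F (c # ys) = v"
  using pol_closed[OF assms(1), of "c # ys"] assms(2,3) univ_uv by (auto simp: tuples_Cons)

lemma slice_indicator:
  assumes "pol A (Suc n) F" "ys \<in> tuples (univ A) n" "c = u \<or> c = v"
  shows "(if F (c # ys) = v then v else u) = F (c # ys)"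
  using slice_cases[OF assms] by auto

lemma no_swap_imp_monotone:
  assumes "\<not> has_swap A" "pol A (Suc n) F" "ys \<in> tuples (univ A) n" "F (u # ys) = v"
  shows "F (v # ys) = v"
proof (rule ccontr)
  assume "F (v # ys) \<noteq> v"
  then have "F (v # ys) = u" using slice_cases[OF assms(2,3)] by blast
  moreover have "pol A 1 (\<lambda>zs. F ((u # ys)[0 := zs ! 0]))"
    by (rule pol_update[OF assms(2) _ pol1_id]) (use assms(3) univ_uv in \<open>simp add: tuples_Cons\<close>)
  ultimately have "has_swap A" using assms(4) univ_uv u_neq_v unfolding has_swap_def
    by (intro exI[of _ "\<lambda>zs. F ((u # ys)[0 := zs ! 0])"] conjI bexI[of _ u] bexI[of _ v]) auto
  then show False using assms(1) by blast
qed

end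

locale two_element_reduct = two_element_pair A u v for A :: "('f, 'a) ualg" and u v +
  fixes S :: "bool_sym set"
begin

abbreviation D where "D \<equiv> two_element_alg S u v"

sublocale D: finite_ualg D
  by (rule finite_ualg_two_element_alg)

lemma univ_D: "univ D = univ A"
  by (simp add: univ_uv)

lemma pol_D_meet:
  assumes "BMeet \<in> S" "pol D n F" "pol D n G"
  shows "pol D n (\<lambda>xs. if F xs = v \<and> G xs = v then v else u)"
  using D.pol_comp2[OF _ assms(2,3), of "bool_interp u v BMeet"]
    pol_two_element_alg[OF assms(1), of u v] by simp

lemma pol_D_join:
  assumes "BJoin \<in> S" "pol D n F" "pol D n G"
  shows "pol D n (\<lambda>xs. if F xs = v \<or> G xs = v then v else u)"
  using D.pol_comp2[OF _ assms(2,3), of "bool_interp u v BJoin"]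
    pol_two_element_alg[OF assms(1), of u v] by simp

lemma pol_D_not:
  assumes "BNot \<in> S" "pol D n F"
  shows "pol D n (\<lambda>xs. if F xs = v then u else v)"
  using D.pol_comp1[OF _ assms(2), of "bool_interp u v BNot"]
    pol_two_element_alg[OF assms(1), of u v] by simp

lemma pol_D_head: "pol D (Suc n) (\<lambda>xs. xs ! 0)"
  by (rule D.pol_proj) simp

lemma pol_D_slice:
  assumes "\<And>G. pol A n G \<Longrightarrow> pol D n G" "pol A (Suc n) F" "c \<in> univ A"
  shows "pol D (Suc n) (\<lambda>xs. F (c # tl xs))"
  by (rule D.pol_tl[OF assms(1)[OF pol_Cons[OF assms(2,3)]]])

lemma pol_D_cong_slices:
  assumes "pol D (Suc n) G"
    and "\<And>ys. ys \<in> tuples (univ A) n \<Longrightarrow> G (u # ys) = F (u # ys)"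
    and "\<And>ys. ys \<in> tuples (univ A) n \<Longrightarrow> G (v # ys) = F (v # ys)"
  shows "pol D (Suc n) F"
  using assms(1)
proof (rule pol_congI)
  fix xs assume "xs \<in> tuples (univ D) (Suc n)"
  then show "G xs = F xs" using assms(2,3) unfolding univ_D tuples_Suc univ_uv by blast
qed

lemma poly_equivalent_boolean:
  assumes S: "S = {BBot, BTop, BNot, BMeet, BJoin}" and "has_swap A" "has_meet A u v"
  shows "poly_equivalent A D"
proof (rule poly_equivalentI[OF D.finite_ualg_axioms univ_D])
  fix f
  have "pol A 0 (bool_interp u v BBot)" "pol A 0 (bool_interp u v BTop)"
    by (rule pol_congI[OF pol_const], use univ_uv in auto)+
  then show "pol A (arity D f) (interp D f)"
    using pol_meet[OF assms(3)] pol_join[OF has_meet_swap[OF assms(2,3)]] pol_not[OF assms(2)]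
    by (cases f) (simp_all add: two_element_alg_def)
next
  fix n F assume "pol A n F"
  with D.finite_ualg_axioms univ_D show "pol D n F"
  proof (induction rule: pol_arity_induct)
    case (Suc n F)
    have "pol D (Suc n) (\<lambda>xs. if (if xs ! 0 = v \<and> F (v # tl xs) = v then v else u) = v \<or>
        (if (if xs ! 0 = v then u else v) = v \<and> F (u # tl xs) = v then v else u) = v then v else u)"
      using Suc S univ_uv by (intro pol_D_join pol_D_meet pol_D_not pol_D_head pol_D_slice) auto
    then show ?case
      by (rule pol_D_cong_slices) (use u_neq_v in \<open>simp_all add: slice_indicator[OF Suc(2)]\<close>)
  qed
qed

lemma poly_equivalent_lattice:
  assumes S: "S = {BMeet, BJoin}" and "\<not> has_swap A" "has_meet A u v" "has_meet A v u"
  shows "poly_equivalent A D"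
proof (rule poly_equivalentI[OF D.finite_ualg_axioms univ_D])
  fix f assume "f \<in> syms D"
  then show "pol A (arity D f) (interp D f)"
    using pol_meet[OF assms(3)] pol_join[OF assms(4)] S
    by (cases f) (auto simp: two_element_alg_def)
next
  fix n F assume "pol A n F"
  with D.finite_ualg_axioms univ_D show "pol D n F"
  proof (induction rule: pol_arity_induct)
    case (Suc n F)
    have join_form: "pol D (Suc n) (\<lambda>xs. if F (u # tl xs) = v \<or>
        (if xs ! 0 = v \<and> F (v # tl xs) = v then v else u) = v then v else u)"
      using Suc S univ_uv by (intro pol_D_join pol_D_meet pol_D_head pol_D_slice) auto
    have monotone: "F (u # ys) = v \<or> F (v # ys) = v \<longleftrightarrow> F (v # ys) = v" if "ys \<in> tuples (univ A) n" for ys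
      using no_swap_imp_monotone[OF assms(2) Suc(2) that] by blast
    from join_form show ?case
      by (rule pol_D_cong_slices) (use u_neq_v in \<open>simp_all add: monotone slice_indicator[OF Suc(2)]\<close>)
  qed
qed

end

context two_element_pair
begin

text \<open>Fixing all coordinates but \<open>0\<close> and \<open>j\<close> to \<open>v\<close> makes \<open>F\<close> the join.\<close>

lemma join_of_meet_slices:
  assumes F: "pol A (Suc n) F" and j: "j \<in> J" "j \<notin> J'" and J: "J \<subseteq> {..<n}" "J' \<subseteq> {..<n}"
    and slice_u: "\<And>ys. ys \<in> tuples (univ A) n \<Longrightarrow> F (u # ys) = meet_term u v J ys"
    and slice_v: "\<And>ys. ys \<in> tuples (univ A) n \<Longrightarrow> F (v # ys) = meet_term u v J' ys"
  shows "has_meet A v u"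
proof -
  let ?vs = "replicate n v"
  have vs: "?vs \<in> tuples (univ A) n" using univ_uv by (intro tuples_replicate) simp
  have slices: "F (u # ?vs[j := y]) = y" "F (v # ?vs[j := y]) = v" if "y \<in> univ A" for y
  proof -
    have ys: "?vs[j := y] \<in> tuples (univ A) n" using vs that by (rule tuples_update)
    have nth: "?vs[j := y] ! i = (if i = j then y else v)" if "i < n" for i
      using that by (simp add: nth_list_update)
    have "(\<forall>i\<in>J. ?vs[j := y] ! i = v) \<longleftrightarrow> y = v" using J(1) j(1) nth by (metis lessThan_iff subsetD)
    then show "F (u # ?vs[j := y]) = y" using slice_u[OF ys] that univ_uv by (auto simp: meet_term_def)
    have "\<forall>i\<in>J'. ?vs[j := y] ! i = v" using J(2) j(2) nth by (metis lessThan_iff subsetD)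
    then show "F (v # ?vs[j := y]) = v" using slice_v[OF ys] by (simp add: meet_term_def)
  qed
  have "pol A 2 (\<lambda>zs. F ((v # ?vs)[0 := zs ! 0, Suc j := zs ! 1]))"
    by (rule pol_update2[OF F]) (use vs univ_uv in \<open>auto simp: tuples_Cons intro: pol_proj\<close>)
  then show ?thesis unfolding has_meet_def
    by (intro exI[of _ "\<lambda>zs. F ((v # ?vs)[0 := zs ! 0, Suc j := zs ! 1])"])
      (use slices univ_uv in auto)
qed

lemma slices_agree:
  assumes "\<not> has_swap A" "\<not> has_meet A v u" and F: "pol A (Suc n) F"
    and J: "J \<subseteq> {..<n}" "J' \<subseteq> {..<n}"
    and slice_u: "\<And>ys. ys \<in> tuples (univ A) n \<Longrightarrow> F (u # ys) = meet_term u v J ys"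
    and slice_v: "\<And>ys. ys \<in> tuples (univ A) n \<Longrightarrow> F (v # ys) = meet_term u v J' ys"
    and ys: "ys \<in> tuples (univ A) n"
  shows "F (u # ys) = F (v # ys)"
proof -
  have "J \<subseteq> J'" using join_of_meet_slices[OF F _ _ J slice_u slice_v] assms(2) by blast
  then have "F (u # ys) = v" if "F (v # ys) = v"
    using that slice_u[OF ys] slice_v[OF ys] u_neq_v by (auto simp: meet_term_def split: if_splits)
  then show ?thesis
    using no_swap_imp_monotone[OF assms(1) F ys] slice_cases[OF F ys] by metis
qed

end

lemma (in two_element_reduct) poly_equivalent_semilattice:
  assumes S: "S = {BMeet}" and "\<not> has_swap A" "has_meet A u v" "\<not> has_meet A v u"
  shows "poly_equivalent A D"
proof (rule poly_equivalentI[OF D.finite_ualg_axioms univ_D])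
  fix f assume "f \<in> syms D"
  then show "pol A (arity D f) (interp D f)"
    using pol_meet[OF assms(3)] S by (cases f) (auto simp: two_element_alg_def)
next
  fix n F assume "pol A n F"
  with D.finite_ualg_axioms univ_D show "pol D n F"
  proof (induction rule: pol_arity_induct)
    case (Suc n F)
    note pol_slice = pol_D_slice[OF Suc]
    have "const_or_meet u v n (\<lambda>ys. F (c # ys))" if "c \<in> univ A" for c
      using const_or_meet_pol_semilattice[OF u_neq_v] Suc(1)[OF pol_Cons[OF Suc(2) that]] S by simp
    then have "const_or_meet u v n (\<lambda>ys. F (u # ys))" "const_or_meet u v n (\<lambda>ys. F (v # ys))"
      using univ_uv by auto
    then consider (const_u) "\<forall>ys\<in>tuples (univ A) n. F (u # ys) = u" |
      (const_v) "\<forall>ys\<in>tuples (univ A) n. F (v # ys) = u" |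
      (meets) J J' where "J \<subseteq> {..<n}" "J' \<subseteq> {..<n}"
        "\<And>ys. ys \<in> tuples (univ A) n \<Longrightarrow> F (u # ys) = meet_term u v J ys"
        "\<And>ys. ys \<in> tuples (univ A) n \<Longrightarrow> F (v # ys) = meet_term u v J' ys"
      unfolding const_or_meet_def univ_uv[symmetric] by blast
    then show ?case
    proof cases
      case const_u
      have "pol D (Suc n) (\<lambda>xs. if xs ! 0 = v \<and> F (v # tl xs) = v then v else u)"
        using S univ_uv by (intro pol_D_meet pol_D_head pol_slice) auto
      then show ?thesis
        by (rule pol_D_cong_slices) (use const_u u_neq_v in \<open>simp_all add: slice_indicator[OF Suc(2)]\<close>)
    next
      case const_v
      have "F (u # ys) = u" if "ys \<in> tuples (univ A) n" for ys
        using no_swap_imp_monotone[OF assms(2) Suc(2) that] slice_cases[OF Suc(2) that]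
          bspec[OF const_v that] u_neq_v by metis
      then show ?thesis using const_v
        by (intro pol_D_cong_slices[OF D.pol_const[of u]]) simp_all
    next
      case meets
      then have "F (u # ys) = F (v # ys)" if "ys \<in> tuples (univ A) n" for ys
        using that by (rule slices_agree[OF assms(2,4) Suc(2)])
      then show ?thesis by (intro pol_D_cong_slices[OF pol_slice[of u]]) (simp_all add: univ_uv)
    qed
  qed
qed

subsection \<open>Algebras affine over a prime field\<close>

definition zmod_ring :: "nat \<Rightarrow> nat ring" where
  "zmod_ring p = \<lparr>carrier = {..<p}, monoid.mult = (\<lambda>x y. x * y mod p), one = 1, zero = 0,
     add = (\<lambda>x y. (x + y) mod p)\<rparr>"

lemma field_zmod_ring:
  assumes "prime p"
  shows "Ring.field (zmod_ring p)"
proof -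
  have p: "p > 1" using assms by (rule prime_gt_1_nat)
  have "abelian_group (zmod_ring p)"
  proof (rule abelian_groupI)
    fix x assume "x \<in> carrier (zmod_ring p)"
    then show "\<exists>y\<in>carrier (zmod_ring p). y \<oplus>\<^bsub>zmod_ring p\<^esub> x = \<zero>\<^bsub>zmod_ring p\<^esub>"
      by (intro bexI[of _ "(p - x) mod p"]) (auto simp: zmod_ring_def mod_add_left_eq)
  qed (use p in \<open>auto simp: zmod_ring_def mod_add_left_eq mod_add_right_eq ac_simps\<close>)
  moreover have "Group.comm_monoid (zmod_ring p)"
    by (rule comm_monoidI) (use p in \<open>auto simp: zmod_ring_def mod_mult_left_eq mod_mult_right_eq ac_simps\<close>)
  ultimately have "cring (zmod_ring p)"
    by (rule cringI) (auto simp: zmod_ring_def mod_simps algebra_simps)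
  then show ?thesis
  proof (rule cring.cring_fieldI2)
    show "\<zero>\<^bsub>zmod_ring p\<^esub> \<noteq> \<one>\<^bsub>zmod_ring p\<^esub>" by (simp add: zmod_ring_def)
    fix a assume "a \<in> carrier (zmod_ring p)" "a \<noteq> \<zero>\<^bsub>zmod_ring p\<^esub>"
    then have "0 < a" "a < p" by (auto simp: zmod_ring_def)
    then have "coprime a p" using assms
      by (metis coprime_commute nat_dvd_not_less prime_imp_coprime)
    then obtain b c where "a * b = 1 + p * c" using bezout_nat[of a p] \<open>0 < a\<close> by auto
    then have "a * (b mod p) mod p = (1 + p * c) mod p" by (simp add: mod_mult_right_eq)
    also have "\<dots> = 1" using p by (simp only: mod_mult_self2 mod_less)
    finally have "a * (b mod p) mod p = 1" .
    then show "\<exists>b\<in>carrier (zmod_ring p). a \<otimes>\<^bsub>zmod_ring p\<^esub> b = \<one>\<^bsub>zmod_ring p\<^esub>"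
      using p by (intro bexI[of _ "b mod p"]) (simp_all add: zmod_ring_def)
  qed
qed

lemma mod_sum_cancel:
  fixes u s t w r p :: nat
  assumes "(u + s) mod p = (t + w) mod p" "t mod p = (s + r) mod p"
  shows "u mod p = (w + r) mod p"
proof -
  have "(int u + int s) mod int p = (int t + int w) mod int p"
    "int t mod int p = (int s + int r) mod int p"
    using assms by (metis of_nat_add of_nat_mod)+
  then have "int p dvd (int u + int s) - (int t + int w)" "int p dvd int t - (int s + int r)"
    by (simp_all add: mod_eq_dvd_iff)
  from dvd_add[OF this] have "int u mod int p = (int w + int r) mod int p"
    by (simp add: mod_eq_dvd_iff algebra_simps)
  then show ?thesis by (metis of_nat_add of_nat_eq_iff of_nat_mod)
qed

locale labelled_ualg = finite_ualg A for A :: "('f, 'a) ualg" +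
  fixes \<phi> :: "'a \<Rightarrow> nat" and \<psi> :: "nat \<Rightarrow> 'a"
  assumes phi_less: "x \<in> univ A \<Longrightarrow> \<phi> x < card (univ A)"
    and psi_phi: "x \<in> univ A \<Longrightarrow> \<psi> (\<phi> x) = x"
    and psi_closed: "i < card (univ A) \<Longrightarrow> \<psi> i \<in> univ A"
    and phi_psi: "i < card (univ A) \<Longrightarrow> \<phi> (\<psi> i) = i"
begin

abbreviation p where "p \<equiv> card (univ A)"

lemma phi_eq_iff: "x \<in> univ A \<Longrightarrow> y \<in> univ A \<Longrightarrow> \<phi> x = \<phi> y \<longleftrightarrow> x = y"
  using psi_phi by metis

lemma psi_eq_iff: "i < p \<Longrightarrow> j < p \<Longrightarrow> \<psi> i = \<psi> j \<longleftrightarrow> i = j"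
  using phi_psi by metis

lemma card_pos: "0 < p"
  using is_ualg finite_univ by (simp add: is_ualg_def card_gt_0_iff)

lemma phi_psi_mod: "\<phi> (\<psi> (i mod p)) = i mod p"
  and psi_mod_closed: "\<psi> (i mod p) \<in> univ A"
  using phi_psi psi_closed card_pos by simp_all

end

locale affine_ualg = labelled_ualg A \<phi> \<psi> for A :: "('f, 'a) ualg" and \<phi> \<psi> +
  assumes prime_card: "prime p"
    and pol_add: "pol2 A (\<lambda>x y. \<psi> ((\<phi> x + \<phi> y) mod p))"
    and unary: "\<And>f. pol1 A f \<Longrightarrow> \<exists>a c. \<forall>x\<in>univ A. \<phi> (f x) = (a * \<phi> x + c) mod p"
    and binary: "\<And>g x y w z. pol2 A g \<Longrightarrow> x \<in> univ A \<Longrightarrow> y \<in> univ A \<Longrightarrow> w \<in> univ A \<Longrightarrow> z \<in> univ A \<Longrightarrow>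
      (\<phi> (g x y) + \<phi> (g w z)) mod p = (\<phi> (g x z) + \<phi> (g w y)) mod p"
begin

definition zmod_module :: "(nat, 'a) module" where
  "zmod_module = \<lparr>carrier = univ A, monoid.mult = undefined, one = undefined, zero = \<psi> 0,
     add = (\<lambda>x y. \<psi> ((\<phi> x + \<phi> y) mod p)), module.smult = (\<lambda>k x. \<psi> (k * \<phi> x mod p))\<rparr>"

lemma carrier_zmod_module [simp]: "carrier zmod_module = univ A"
  by (simp add: zmod_module_def)

lemma module_zmod: "Module.module (zmod_ring p) zmod_module"
proof -
  have p: "1 < p" using prime_card by (rule prime_gt_1_nat)
  have "abelian_group zmod_module"
  proof (rule abelian_groupI)
    fix x assume "x \<in> carrier zmod_module"
    then have "\<phi> x < p" using phi_less by simp
    then show "\<exists>y\<in>carrier zmod_module. y \<oplus>\<^bsub>zmod_module\<^esub> x = \<zero>\<^bsub>zmod_module\<^esub>"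
      by (intro bexI[of _ "\<psi> ((p - \<phi> x) mod p)"])
        (simp_all add: zmod_module_def phi_psi_mod psi_mod_closed mod_add_left_eq)
  qed (use psi_closed psi_phi phi_less phi_psi p in
      \<open>auto simp: zmod_module_def phi_psi_mod psi_mod_closed mod_add_left_eq mod_add_right_eq ac_simps\<close>)
  moreover have "cring (zmod_ring p)"
    using field_zmod_ring[OF prime_card] by (simp add: field_def domain_def)
  ultimately show ?thesis
    by (intro moduleI)
      (use phi_less psi_phi p in \<open>auto simp: zmod_module_def zmod_ring_def phi_psi_mod psi_mod_closed
        mod_simps algebra_simps\<close>)
qed

lemma pol1_scale: "pol1 A (\<lambda>x. \<psi> (k * \<phi> x mod p))"
proof (induction k)
  case 0
  then show ?case using pol1_const[of "\<psi> 0"] psi_closed card_pos by simp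
next
  case (Suc k)
  have "pol1 A (\<lambda>x. \<psi> ((\<phi> x + \<phi> (\<psi> (k * \<phi> x mod p))) mod p))"
    by (rule pol1_pol2[OF pol_add pol1_id Suc])
  then show ?case by (simp add: phi_psi_mod mod_add_right_eq)
qed

lemma minus_zmod:
  assumes "x \<in> univ A"
  shows "\<ominus>\<^bsub>zmod_module\<^esub> x = \<psi> ((p - 1) * \<phi> x mod p)"
proof -
  interpret Module.module "zmod_ring p" zmod_module by (rule module_zmod)
  have "(p - 1) * \<phi> x + \<phi> x = p * \<phi> x" using card_pos by (simp add: diff_mult_distrib)
  then have "\<psi> ((p - 1) * \<phi> x mod p) \<oplus>\<^bsub>zmod_module\<^esub> x = \<zero>\<^bsub>zmod_module\<^esub>"
    by (simp add: zmod_module_def phi_psi_mod mod_add_left_eq)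
  then show ?thesis
    by (rule M.minus_equality) (use assms psi_mod_closed in auto)
qed

abbreviation V where "V \<equiv> vector_space_alg (zmod_ring p) zmod_module"

sublocale V: finite_ualg V
  by (rule finite_ualg_vector_space_alg[OF module_zmod]) (simp add: finite_univ)

lemma univ_V: "univ V = univ A"
  by simp

lemma pol_interp_V: "pol A (arity V f) (interp V f)"
proof (cases f)
  case VZero
  have "pol A 0 (\<lambda>_. \<psi> 0)" using psi_closed card_pos by (intro pol_const) simp
  then show ?thesis unfolding VZero vector_space_alg_def
    by (simp, rule pol_congI) (simp add: zmod_module_def)
next
  case VNeg
  show ?thesis unfolding VNeg vector_space_alg_def
    by (simp, rule pol_congI[OF pol1_scale[of "p - 1", unfolded One_nat_def]])
      (auto simp: tuples_one minus_zmod)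
next
  case VAdd
  show ?thesis unfolding VAdd vector_space_alg_def
    by (simp, rule pol_congI[OF pol_add]) (simp add: zmod_module_def)
next
  case (VScale k)
  show ?thesis unfolding VScale vector_space_alg_def
    by (simp, rule pol_congI[OF pol1_scale[of k, unfolded One_nat_def]]) (simp add: zmod_module_def)
qed

lemma pol_V_add: "pol2 V (\<lambda>x y. \<psi> ((\<phi> x + \<phi> y) mod p))"
proof -
  have "pol V 2 (vs_interp zmod_module VAdd)"
    using V.pol_basic[of VAdd] by (simp add: vector_space_alg_def)
  then show ?thesis by (rule pol_congI) (simp add: zmod_module_def)
qed

lemma pol_V_scale: "pol1 V (\<lambda>x. \<psi> (k * \<phi> x mod p))"
proof -
  have "pol V 1 (vs_interp zmod_module (VScale (k mod p)))"
    using V.pol_basic[of "VScale (k mod p)"] card_pos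
    by (simp add: vector_space_alg_def zmod_ring_def)
  then show ?thesis by (rule pol_congI) (simp add: zmod_module_def mod_mult_left_eq)
qed

lemma affine_in_first_argument:
  assumes F: "pol A (Suc n) F"
  obtains a where "\<And>x xs. x \<in> univ A \<Longrightarrow> xs \<in> tuples (univ A) n \<Longrightarrow>
    \<phi> (F (x # xs)) mod p = (\<phi> (F (\<psi> 0 # xs)) + a * \<phi> x) mod p"
proof -
  define z where "z = \<psi> 0"
  have z: "z \<in> univ A" "\<phi> z = 0" using psi_closed phi_psi card_pos by (auto simp: z_def)
  have zs: "replicate n z \<in> tuples (univ A) n" using z by (intro tuples_replicate)
  have "pol1 A (\<lambda>x. F ((z # replicate n z)[0 := x]))"
    by (rule pol_update[OF F _ pol1_id]) (use z zs in \<open>simp add: tuples_Cons\<close>)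
  from unary[OF this] obtain a c
    where affine: "\<And>x. x \<in> univ A \<Longrightarrow> \<phi> (F (x # replicate n z)) = (a * \<phi> x + c) mod p" by auto
  have "\<phi> (F (x # xs)) mod p = (\<phi> (F (z # xs)) + a * \<phi> x) mod p"
    if x: "x \<in> univ A" and xs: "xs \<in> tuples (univ A) n" for x xs
    using zs xs
  proof (rule tuples_change_induct)
    show "\<phi> (F (x # replicate n z)) mod p = (\<phi> (F (z # replicate n z)) + a * \<phi> x) mod p"
      using affine[OF x] affine[OF z(1)] z(2) by (simp add: mod_simps add.commute)
  next
    fix xs j y assume xs: "xs \<in> tuples (univ A) n" and j: "j < n" and y: "y \<in> univ A"
      and IH: "\<phi> (F (x # xs)) mod p = (\<phi> (F (z # xs)) + a * \<phi> x) mod p"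
    have "pol2 A (\<lambda>s t. F ((z # xs)[0 := s, Suc j := t]))"
      by (rule pol_update2[OF F]) (use z xs in \<open>auto simp: tuples_Cons intro: pol_proj\<close>)
    from binary[OF this x y z(1) tuples_nth[OF xs j]]
    have "(\<phi> (F (x # xs[j := y])) + \<phi> (F (z # xs))) mod p =
          (\<phi> (F (x # xs)) + \<phi> (F (z # xs[j := y]))) mod p" by simp
    then show "\<phi> (F (x # xs[j := y])) mod p = (\<phi> (F (z # xs[j := y])) + a * \<phi> x) mod p"
      using IH by (rule mod_sum_cancel)
  qed
  then show ?thesis using that unfolding z_def by blast
qed

lemma poly_equivalent_vector_space: "poly_equivalent A V"
proof (rule poly_equivalentI[OF V.finite_ualg_axioms univ_V pol_interp_V])
  fix n F assume "pol A n F"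
  with V.finite_ualg_axioms univ_V show "pol V n F"
  proof (induction rule: pol_arity_induct)
    case (Suc n F)
    obtain a where affine: "\<And>x xs. x \<in> univ A \<Longrightarrow> xs \<in> tuples (univ A) n \<Longrightarrow>
        \<phi> (F (x # xs)) mod p = (\<phi> (F (\<psi> 0 # xs)) + a * \<phi> x) mod p"
      by (rule affine_in_first_argument[OF Suc(2)], rule that)
    have "pol V (Suc n) (\<lambda>xs. \<psi> ((\<phi> (F (\<psi> 0 # tl xs)) + \<phi> (\<psi> (a * \<phi> (xs ! 0) mod p))) mod p))"
      using psi_closed card_pos
      by (intro V.pol_pol2[OF pol_V_add] V.pol_pol1[OF pol_V_scale] V.pol_tl V.pol_proj
          Suc(1) pol_Cons[OF Suc(2)]) auto
    then show ?case
    proof (rule pol_congI)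
      fix xs assume "xs \<in> tuples (univ V) (Suc n)"
      then obtain x ys where xs: "xs = x # ys" "x \<in> univ A" "ys \<in> tuples (univ A) n"
        by (auto simp: tuples_Suc)
      then have closed: "F (x # ys) \<in> univ A"
        by (intro pol_closed[OF Suc(2)]) (simp add: tuples_Cons)
      then have "(\<phi> (F (\<psi> 0 # ys)) + a * \<phi> x) mod p = \<phi> (F (x # ys))"
        using affine[OF xs(2,3)] phi_less by simp
      then show "\<psi> ((\<phi> (F (\<psi> 0 # tl xs)) + \<phi> (\<psi> (a * \<phi> (xs ! 0) mod p))) mod p) = F xs"
        using xs psi_phi[OF closed] by (simp add: phi_psi_mod mod_add_right_eq)
    qed
  qed
qed

lemma minimal_alg_type_affine: "minimal_alg_type A 2"
  by (rule minimal_alg_type.vector_space[OF field_zmod_ring[OF prime_card] _ module_zmod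
      poly_equivalent_vector_space]) (simp add: zmod_ring_def)

end

subsection \<open>Latin squares of order two and three\<close>

definition latin :: "'a set \<Rightarrow> ('a \<Rightarrow> 'a \<Rightarrow> 'a) \<Rightarrow> bool" where
  "latin N g \<longleftrightarrow> (\<forall>c\<in>N. inj_on (g c) N) \<and> (\<forall>c\<in>N. inj_on (\<lambda>x. g x c) N)"

lemma latinD:
  assumes "latin N g" "c \<in> N" "x \<in> N" "y \<in> N"
  shows "g c x = g c y \<longleftrightarrow> x = y" "g x c = g y c \<longleftrightarrow> x = y"
  using assms unfolding latin_def by (auto dest: inj_onD)

lemma latin_square_two_affine:
  fixes f :: "nat \<Rightarrow> nat \<Rightarrow> nat"
  assumes closed: "\<And>i j. i < 2 \<Longrightarrow> j < 2 \<Longrightarrow> f i j < 2" and latin: "latin {..<2} f"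
    and "i < 2" "j < 2" "k < 2" "l < 2"
  shows "(f i j + f k l) mod 2 = (f i l + f k j) mod 2"
proof (cases "i = k \<or> j = l")
  case False
  then have "f i j \<noteq> f i l" "f k l \<noteq> f i l" "f k j \<noteq> f i j"
    using latinD[OF latin] assms(3-6) by auto
  moreover have "f i j < 2" "f k l < 2" "f i l < 2" "f k j < 2" using closed assms(3-6) by auto
  ultimately have "f k l = f i j" "f k j = f i l" by linarith+
  then show ?thesis by (simp add: mult_2[symmetric])
qed (auto simp: add.commute)

lemma latin_square_three_affine:
  fixes f :: "nat \<Rightarrow> nat \<Rightarrow> nat"
  assumes closed: "\<And>i j. i < 3 \<Longrightarrow> j < 3 \<Longrightarrow> f i j < 3" and latin: "latin {..<3} f"
    and "i < 3" "j < 3" "k < 3" "l < 3"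
  shows "(f i j + f k l) mod 3 = (f i l + f k j) mod 3"
proof (cases "i = k \<or> j = l")
  case False
  have "\<exists>m<3. m \<noteq> j \<and> m \<noteq> l"
    by (rule exI[of _ "if j \<noteq> 0 \<and> l \<noteq> 0 then 0 else if j \<noteq> 1 \<and> l \<noteq> 1 then 1 else 2"]) auto
  then obtain m where m: "m < 3" "m \<noteq> j" "m \<noteq> l" by blast
  define a b c d u v where
    entries: "a = f i j" "b = f i l" "c = f k j" "d = f k l" "u = f i m" "v = f k m"
  have "a < 3" "b < 3" "c < 3" "d < 3" "u < 3" "v < 3"
    unfolding entries using assms m by auto
  then have range: "a = 0 \<or> a = 1 \<or> a = 2" "b = 0 \<or> b = 1 \<or> b = 2" "c = 0 \<or> c = 1 \<or> c = 2"
    "d = 0 \<or> d = 1 \<or> d = 2" "u = 0 \<or> u = 1 \<or> u = 2" "v = 0 \<or> v = 1 \<or> v = 2" by linarith+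
  have distinct: "a \<noteq> b" "a \<noteq> u" "b \<noteq> u" "c \<noteq> d" "c \<noteq> v" "d \<noteq> v" "a \<noteq> c" "b \<noteq> d" "u \<noteq> v"
    unfolding entries using latinD[OF latin] assms(3-6) m False by auto
  have "(a + d) mod 3 = (b + c) mod 3"
    using range(1,2)
  proof (elim disjE)
  qed (use distinct range(3-6) in auto)
  then show ?thesis by (simp add: entries)
qed (auto simp: add.commute)

lemma permutation_two_affine:
  fixes f :: "nat \<Rightarrow> nat"
  assumes "\<And>i. i < 2 \<Longrightarrow> f i < 2" "inj_on f {..<2}"
  shows "\<exists>a c. \<forall>i<2. f i = (a * i + c) mod 2"
proof -
  have "f 0 \<noteq> f 1" using assms(2) unfolding inj_on_def by force
  moreover have "f 0 < 2" "f 1 < 2" using assms(1) by auto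
  ultimately have "\<forall>i\<in>{0, 1}. f i = (1 * i + f 0) mod 2" by (auto; presburger)
  moreover have "i \<in> {0, 1}" if "i < 2" for i :: nat using that by auto
  ultimately show ?thesis by blast
qed

lemma permutation_three_affine:
  fixes f :: "nat \<Rightarrow> nat"
  assumes "\<And>i. i < 3 \<Longrightarrow> f i < 3" "inj_on f {..<3}"
  shows "\<exists>a c. \<forall>i<3. f i = (a * i + c) mod 3"
proof -
  define x y z where images: "x = f 0" "y = f 1" "z = f 2"
  have "f i \<noteq> f j" if "i < 3" "j < 3" "i \<noteq> j" for i j
    using assms(2) that by (meson inj_onD lessThan_iff)
  from this[of 0 1] this[of 0 2] this[of 1 2] have "x \<noteq> y" "x \<noteq> z" "y \<noteq> z" by (auto simp: images)
  moreover have "x < 3" "y < 3" "z < 3" using assms(1) by (simp_all add: images)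
  moreover from this have "x = 0 \<or> x = 1 \<or> x = 2" "y = 0 \<or> y = 1 \<or> y = 2" "z = 0 \<or> z = 1 \<or> z = 2"
    by linarith+
  ultimately have "x = x mod 3" "y = (y + 3 - x + x) mod 3" "z = ((y + 3 - x) * 2 + x) mod 3"
    by auto
  then have "\<forall>i\<in>{0, 1, 2}. f i = ((y + 3 - x) * i + x) mod 3" by (simp add: images)
  moreover have "i \<in> {0, 1, 2}" if "i < 3" for i :: nat using that by auto
  ultimately show ?thesis by blast
qed

lemma ex_labelling:
  assumes "finite N" "e \<in> N"
  obtains \<phi> \<psi> where "\<And>x. x \<in> N \<Longrightarrow> \<phi> x < card N" "\<And>x. x \<in> N \<Longrightarrow> \<psi> (\<phi> x) = x"
    "\<And>i. i < card N \<Longrightarrow> \<psi> i \<in> N" "\<And>i. i < card N \<Longrightarrow> \<phi> (\<psi> i) = (i::nat)" "\<phi> e = 0"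
proof -
  obtain xs where "distinct xs" "set xs = N - {e}"
    using finite_distinct_list[of "N - {e}"] assms(1) by blast
  let ?ys = "e # xs"
  have ys: "distinct ?ys" "set ?ys = N" using \<open>distinct xs\<close> \<open>set xs = N - {e}\<close> assms by auto
  then have len: "length ?ys = card N" by (metis distinct_card)
  have bij: "bij_betw ((!) ?ys) {..<card N} N" by (rule bij_betw_nth) (use ys len in auto)
  then have inj: "inj_on ((!) ?ys) {..<card N}" and image: "(!) ?ys ` {..<card N} = N"
    by (auto simp: bij_betw_def)
  define \<phi> where "\<phi> = the_inv_into {..<card N} ((!) ?ys)"
  have \<phi>_nth: "\<phi> (?ys ! i) = i" if "i < card N" for i
    unfolding \<phi>_def using that the_inv_into_f_f[OF inj] by simp
  show ?thesis
  proof (rule that[of \<phi> "(!) ?ys"])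
    show "\<phi> x < card N" if "x \<in> N" for x using that image \<phi>_nth by (metis imageE lessThan_iff)
    show "?ys ! \<phi> x = x" if "x \<in> N" for x using that image \<phi>_nth by (metis imageE lessThan_iff)
    show "?ys ! i \<in> N" if "i < card N" for i using that image by auto
    show "\<phi> e = 0" using \<phi>_nth[of 0] len by simp
  qed (use \<phi>_nth in auto)
qed

subsection \<open>Algebras whose essentially binary polynomials are Latin squares\<close>

context finite_ualg
begin

lemma latin_bij:
  assumes "pol2 A g" "latin (univ A) g" "c \<in> univ A"
  shows "bij_betw (g c) (univ A) (univ A)" "bij_betw (\<lambda>x. g x c) (univ A) (univ A)"
proof -
  have "g c ` univ A \<subseteq> univ A" "(\<lambda>x. g x c) ` univ A \<subseteq> univ A"
    using pol2_closed[OF assms(1)] assms(3) by auto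
  then show "bij_betw (g c) (univ A) (univ A)" "bij_betw (\<lambda>x. g x c) (univ A) (univ A)"
    using assms(2,3) endo_inj_surj[OF finite_univ] by (auto simp: latin_def bij_betw_def)
qed

lemma loop_of_latin:
  assumes g: "pol2 A g" "latin (univ A) g"
  obtains q e where "pol2 A q" "latin (univ A) q" "e \<in> univ A"
    "\<And>x. x \<in> univ A \<Longrightarrow> q e x = x" "\<And>x. x \<in> univ A \<Longrightarrow> q x e = x"
proof -
  obtain c where c: "c \<in> univ A" by (rule ex_element)
  obtain r where r: "pol1 A r" "\<And>y. y \<in> univ A \<Longrightarrow> r y \<in> univ A"
    "\<And>y. y \<in> univ A \<Longrightarrow> r (g c y) = y" "\<And>y. y \<in> univ A \<Longrightarrow> g c (r y) = y"
    using pol1_inverse[OF pol2_left[OF g(1) c] subset_refl latin_bij(1)[OF g c]] by metis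
  obtain s where s: "pol1 A s" "\<And>x. x \<in> univ A \<Longrightarrow> s x \<in> univ A"
    "\<And>x. x \<in> univ A \<Longrightarrow> s (g x c) = x" "\<And>x. x \<in> univ A \<Longrightarrow> g (s x) c = x"
    using pol1_inverse[OF pol2_right[OF g(1) c] subset_refl latin_bij(2)[OF g c]] by metis
  show ?thesis
  proof (rule that[of "\<lambda>x y. g (s x) (r y)" "g c c"])
    show "pol2 A (\<lambda>x y. g (s x) (r y))" by (rule pol2_comp_args[OF g(1) s(1) r(1)])
    show "latin (univ A) (\<lambda>x y. g (s x) (r y))"
      unfolding latin_def
    proof (intro conjI ballI inj_onI)
      fix d x y assume elems: "d \<in> univ A" "x \<in> univ A" "y \<in> univ A"
      show "x = y" if "g (s d) (r x) = g (s d) (r y)"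
        using that latinD(1)[OF g(2)] r(2,4) s(2) elems by metis
      show "x = y" if "g (s x) (r d) = g (s y) (r d)"
        using that latinD(2)[OF g(2)] r(2) s(2,4) elems by metis
    qed
    show "g c c \<in> univ A" using pol2_closed[OF g(1) c c] .
  qed (use s r c in auto)
qed

end

locale small_labelled_ualg = labelled_ualg A \<phi> \<psi> for A :: "('f, 'a) ualg" and \<phi> \<psi> +
  assumes two_or_three: "p = 2 \<or> p = 3"
begin

lemma latin_parallelogram:
  assumes g: "pol2 A g" "latin (univ A) g"
    and elems: "x \<in> univ A" "y \<in> univ A" "w \<in> univ A" "z \<in> univ A"
  shows "(\<phi> (g x y) + \<phi> (g w z)) mod p = (\<phi> (g x z) + \<phi> (g w y)) mod p"
proof -
  let ?f = "\<lambda>i j. \<phi> (g (\<psi> i) (\<psi> j))"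
  have closed: "g (\<psi> i) (\<psi> j) \<in> univ A" if "i < p" "j < p" for i j
    using that psi_closed pol2_closed[OF g(1)] by blast
  have latin: "latin {..<p} ?f"
    unfolding latin_def inj_on_def
    by (simp add: phi_eq_iff closed latinD[OF g(2)] psi_closed psi_eq_iff)
  have less: "?f i j < p" if "i < p" "j < p" for i j using that closed phi_less by blast
  have "(?f i j + ?f k l) mod p = (?f i l + ?f k j) mod p" if "i < p" "j < p" "k < p" "l < p" for i j k l
    using two_or_three latin less that latin_square_two_affine[of ?f i j k l]
      latin_square_three_affine[of ?f i j k l] by (elim disjE) simp_all
  from this[of "\<phi> x" "\<phi> y" "\<phi> w" "\<phi> z"] show ?thesis using elems by (simp add: phi_less psi_phi)
qed

lemma minimal_unary_affine:
  assumes minimal: "minimal_algebra A" and f: "pol1 A f"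
  shows "\<exists>a c. \<forall>x\<in>univ A. \<phi> (f x) = (a * \<phi> x + c) mod p"
proof (cases "\<forall>x\<in>univ A. \<forall>y\<in>univ A. f x = f y")
  case True
  obtain e where e: "e \<in> univ A" by (rule ex_element)
  then have "\<phi> (f e) < p" using phi_less pol1_closed[OF f] by blast
  moreover have "f x = f e" if "x \<in> univ A" for x using True that e by blast
  ultimately have "\<forall>x\<in>univ A. \<phi> (f x) = (0 * \<phi> x + \<phi> (f e)) mod p" by simp
  then show ?thesis by blast
next
  case False
  then have "bij_betw f (univ A) (univ A)" using minimal f unfolding minimal_algebra_def by blast
  then have f_eq_iff: "f x = f y \<longleftrightarrow> x = y" if "x \<in> univ A" "y \<in> univ A" for x y
    using that by (auto simp: bij_betw_def dest: inj_onD)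
  let ?f = "\<lambda>i. \<phi> (f (\<psi> i))"
  have "inj_on ?f {..<p}"
    unfolding inj_on_def by (simp add: phi_eq_iff pol1_closed[OF f] f_eq_iff psi_closed psi_eq_iff)
  moreover have "?f i < p" if "i < p" for i using that psi_closed phi_less pol1_closed[OF f] by blast
  ultimately have "\<exists>a c. \<forall>i<p. ?f i = (a * i + c) mod p"
    using two_or_three permutation_two_affine[of ?f] permutation_three_affine[of ?f]
    by (elim disjE) simp_all
  then show ?thesis using phi_less psi_phi by metis
qed

end

lemma (in finite_ualg) affine_of_latin:
  assumes "card (univ A) = 2 \<or> card (univ A) = 3" and minimal: "minimal_algebra A"
    and dichotomy: "\<And>F. pol A 2 F \<Longrightarrow> \<not> ess_unary_on (univ A) 2 F \<Longrightarrow> latin (univ A) (\<lambda>x y. F [x, y])"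
    and "\<not> ess_unary A"
  obtains \<phi> \<psi> where "affine_ualg A \<phi> \<psi>"
proof -
  obtain F where F: "pol A 2 F" "\<not> ess_unary_on (univ A) 2 F"
    using assms(4) unfolding ess_unary_def by blast
  have F_pol2: "pol2 A (\<lambda>x y. F [x, y])" using F(1) pol2_iff by blast
  obtain q e where q: "pol2 A q" "latin (univ A) q" "e \<in> univ A"
    "\<And>x. x \<in> univ A \<Longrightarrow> q e x = x" "\<And>x. x \<in> univ A \<Longrightarrow> q x e = x"
    by (rule loop_of_latin[OF F_pol2 dichotomy[OF F]], rule that)
  obtain \<phi> :: "'a \<Rightarrow> nat" and \<psi> where label:
    "\<And>x. x \<in> univ A \<Longrightarrow> \<phi> x < card (univ A)" "\<And>x. x \<in> univ A \<Longrightarrow> \<psi> (\<phi> x) = x"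
    "\<And>i. i < card (univ A) \<Longrightarrow> \<psi> i \<in> univ A" "\<And>i. i < card (univ A) \<Longrightarrow> \<phi> (\<psi> i) = i" "\<phi> e = 0"
    by (rule ex_labelling[OF finite_univ q(3)], rule that)
  interpret small_labelled_ualg A \<phi> \<psi> by unfold_locales (use label assms(1) in auto)
  have add: "\<phi> (q x y) = (\<phi> x + \<phi> y) mod p" if "x \<in> univ A" "y \<in> univ A" for x y
    using latin_parallelogram[OF q(1,2) that q(3) q(3)] q(3-5) that label(5)
      phi_less[OF pol2_closed[OF q(1) that]] by simp
  have "affine_ualg A \<phi> \<psi>"
  proof unfold_locales
    show "prime p" using two_or_three by auto
    show "pol2 A (\<lambda>x y. \<psi> ((\<phi> x + \<phi> y) mod p))"
      by (rule pol_congI[OF q(1)]) (use psi_phi pol2_closed[OF q(1)] in \<open>auto simp: tuples_two simp flip: add\<close>)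
  next
    fix g x y w z
    assume g: "pol2 A g" and elems: "x \<in> univ A" "y \<in> univ A" "w \<in> univ A" "z \<in> univ A"
    show "(\<phi> (g x y) + \<phi> (g w z)) mod p = (\<phi> (g x z) + \<phi> (g w y)) mod p"
    proof (cases "ess_unary_on (univ A) 2 (\<lambda>xs. g (xs ! 0) (xs ! 1))")
      case True
      then have "g x y = g w y \<and> g x z = g w z \<or> g x y = g x z \<and> g w y = g w z"
        using elems unfolding ess_unary_on_two by auto
      then show ?thesis by (auto simp: add.commute)
    next
      case False
      from dichotomy[OF g False] have "latin (univ A) g" by simp
      then show ?thesis by (rule latin_parallelogram[OF g _ elems])
    qed
  qed (rule minimal_unary_affine[OF minimal])
  then show ?thesis by (rule that)
qed

subsection \<open>Classification\<close>

lemma (in two_element_ualg) latin_of_term_condition: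
  assumes "term_condition A" and F: "pol A 2 F" "\<not> ess_unary_on (univ A) 2 F"
  shows "latin (univ A) (\<lambda>x y. F [x, y])"
proof -
  obtain x x' d where x: "x \<in> univ A" "x' \<in> univ A" "d \<in> univ A" "F [x, d] \<noteq> F [x', d]"
    using F(2) unfolding ess_unary_on_two by blast
  obtain y y' e where y: "y \<in> univ A" "y' \<in> univ A" "e \<in> univ A" "F [e, y] \<noteq> F [e, y']"
    using F(2) unfolding ess_unary_on_two by blast
  have "univ A = {x, x'}" "univ A = {y, y'}" using x y univ_pair by metis+
  have flipped: "pol A 2 (\<lambda>xs. F [xs ! 1, xs ! 0])"
    by (rule pol_comp2[OF F(1)]) (auto intro: pol_proj)
  have columns: "F [a, c] = F [b, c] \<Longrightarrow> F [a, c'] = F [b, c']"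
    if "a \<in> univ A" "b \<in> univ A" "c \<in> univ A" "c' \<in> univ A" for a b c c'
    using assms(1)[unfolded term_condition_def, rule_format, OF flipped that(3,4,1,2)] by simp
  have "F [c, y] \<noteq> F [c, y']" "F [x, c] \<noteq> F [x', c]" if "c \<in> univ A" for c
    using assms(1) F(1) that y x columns unfolding term_condition_def by metis+
  then show ?thesis unfolding latin_def inj_on_def
    using \<open>univ A = {x, x'}\<close> \<open>univ A = {y, y'}\<close> by (metis insertE singletonD)
qed

lemma (in two_element_ualg) affine_of_term_condition:
  assumes "term_condition A" "\<not> ess_unary A"
  obtains \<phi> \<psi> where "affine_ualg A \<phi> \<psi>"
  using affine_of_latin[OF _ minimal_algebra_two latin_of_term_condition[OF assms(1)] assms(2)] two
  by blast

lemma (in two_element_ualg) minimal_alg_type_of_not_term_condition: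
  assumes "\<not> term_condition A"
  shows "minimal_alg_type A (kind A)"
proof -
  have not_unary: "\<not> ess_unary A" using assms ess_unary_imp_term_condition by blast
  obtain u v where uv: "univ A = {u, v}" "u \<noteq> v" "has_meet A u v"
    using meet_of_not_term_condition[OF assms] by blast
  then have reduct: "two_element_reduct A u v" by unfold_locales
  consider (boolean) "has_swap A" | (lattice) "\<not> has_swap A" "has_meet A v u" |
    (semilattice) "\<not> has_swap A" "\<not> has_meet A v u" by blast
  then show ?thesis
  proof cases
    case boolean
    then have "minimal_alg_type A 3"
      by (intro minimal_alg_type.boolean[OF uv(2)]
          two_element_reduct.poly_equivalent_boolean[OF reduct refl _ uv(3)])
    then show ?thesis using boolean assms not_unary by (simp add: kind_def)
  next
    case lattice
    then have "minimal_alg_type A 4"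
      by (intro minimal_alg_type.lattice[OF uv(2)]
          two_element_reduct.poly_equivalent_lattice[OF reduct refl _ uv(3)])
    moreover have "lattice_like A" unfolding lattice_like_def using uv lattice by auto
    ultimately show ?thesis using lattice assms not_unary by (simp add: kind_def)
  next
    case semilattice
    then have "minimal_alg_type A 5"
      by (intro minimal_alg_type.semilattice[OF uv(2)]
          two_element_reduct.poly_equivalent_semilattice[OF reduct refl _ uv(3)])
    moreover have "\<not> lattice_like A" unfolding lattice_like_def using uv semilattice by auto
    ultimately show ?thesis using semilattice assms not_unary by (simp add: kind_def)
  qed
qed

lemma (in two_element_ualg) minimal_alg_type_two: "minimal_alg_type A (kind A)"
proof -
  consider (unary) "ess_unary A" | (affine) "term_condition A" "\<not> ess_unary A" | (meet) "\<not> term_condition A"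
    by blast
  then show ?thesis
  proof cases
    case unary
    then show ?thesis using minimal_alg_type_unary minimal_algebra_two by (simp add: kind_def)
  next
    case affine
    then obtain \<phi> \<psi> where "affine_ualg A \<phi> \<psi>" using affine_of_term_condition by blast
    then show ?thesis using affine_ualg.minimal_alg_type_affine affine by (simp add: kind_def)
  next
    case meet
    then show ?thesis by (rule minimal_alg_type_of_not_term_condition)
  qed
qed

context finite_ualg
begin

text \<open>Modulo 3, the operation would be the multiplication, whose diagonal is neither constant nor a
  permutation.\<close>

lemma no_zero_unit_three:
  assumes minimal: "minimal_algebra A" and three: "card (univ A) = 3" and G: "pol2 A G"
    and kl: "k \<in> univ A" "l \<in> univ A" "k \<noteq> l"
    and zero: "\<And>y. y \<in> univ A \<Longrightarrow> G k y = k" "\<And>y. y \<in> univ A \<Longrightarrow> G y k = k"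
    and unit: "\<And>y. y \<in> univ A \<Longrightarrow> G l y = y" "\<And>y. y \<in> univ A \<Longrightarrow> G y l = y"
  shows False
proof -
  have "card (univ A - {k, l}) = 1" using three kl by (simp add: card_Diff_subset)
  then obtain m where "univ A - {k, l} = {m}" by (metis card_1_singletonE)
  then have m: "m \<in> univ A" "m \<noteq> k" "m \<noteq> l" and univ_A: "univ A = {k, l, m}" using kl by auto
  have "bij_betw (G m) (univ A) (univ A)"
    by (rule minimal_algebraD[OF minimal pol2_left[OF G m(1)] kl(1,2)]) (use zero unit m in simp)
  then have "G m m \<noteq> G m k" "G m m \<noteq> G m l"
    using m kl by (metis bij_betw_imp_inj_on inj_onD)+
  then have "G m m = l" using zero unit m univ_A pol2_closed[OF G m(1) m(1)] by auto
  moreover have "bij_betw (\<lambda>x. G x x) (univ A) (univ A)"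
    by (rule minimal_algebraD[OF minimal pol1_pol2[OF G pol1_id pol1_id] kl(1,2)])
      (use zero unit kl in simp)
  then have "inj_on (\<lambda>x. G x x) (univ A)" by (rule bij_betw_imp_inj_on)
  ultimately show False using unit(1)[OF kl(2)] m(1,3) kl(2) by (metis (no_types, lifting) inj_onD)
qed

lemma columns_injective_three:
  assumes minimal: "minimal_algebra A" and three: "card (univ A) = 3" and g: "pol2 A g"
    and d: "d \<in> univ A" "x \<in> univ A" "x' \<in> univ A" "g x d \<noteq> g x' d" and c: "c \<in> univ A"
  shows "inj_on (\<lambda>x. g x c) (univ A)"
proof (rule ccontr)
  assume "\<not> inj_on (\<lambda>x. g x c) (univ A)"
  then have column: "g x c = g c c" if "x \<in> univ A" for x
    using minimal_algebraD[OF minimal pol2_right[OF g c] that c] bij_betw_imp_inj_on by blast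
  show False
    by (rule zero_unit_of_constant_column[OF minimal g c column d])
      (assumption, rule no_zero_unit_three[OF minimal three])
qed

lemma latin_of_not_ess_unary_three:
  assumes minimal: "minimal_algebra A" and three: "card (univ A) = 3"
    and F: "pol A 2 F" "\<not> ess_unary_on (univ A) 2 F"
  shows "latin (univ A) (\<lambda>x y. F [x, y])"
proof -
  have F_pol2: "pol2 A (\<lambda>x y. F [x, y])" using F(1) pol2_iff by blast
  obtain x x' d where x: "d \<in> univ A" "x \<in> univ A" "x' \<in> univ A" "F [x, d] \<noteq> F [x', d]"
    using F(2) unfolding ess_unary_on_two by blast
  obtain y y' e where y: "e \<in> univ A" "y \<in> univ A" "y' \<in> univ A" "F [e, y] \<noteq> F [e, y']"
    using F(2) unfolding ess_unary_on_two by blast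
  show ?thesis
    unfolding latin_def
    using columns_injective_three[OF minimal three F_pol2 x]
      columns_injective_three[OF minimal three pol2_flip[OF F_pol2] y] by simp
qed

lemma affine_three:
  assumes "minimal_algebra A" "card (univ A) = 3" "\<not> ess_unary A"
  obtains \<phi> \<psi> where "affine_ualg A \<phi> \<psi>"
  using affine_of_latin[OF _ assms(1) latin_of_not_ess_unary_three[OF assms(1,2)] assms(3)] assms(2)
  by blast

lemma minimal_alg_type_three:
  assumes "minimal_algebra A" "card (univ A) = 3"
  shows "minimal_alg_type A (kind A)"
proof -
  have "minimal_alg_type A 1 \<or> minimal_alg_type A 2"
    using minimal_alg_type_unary[OF _ assms(1)] affine_three[OF assms]
      affine_ualg.minimal_alg_type_affine by blast
  then show ?thesis using minimal_alg_type_kind[of A] assms(2) by auto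
qed

end

section \<open>Congruences\<close>

lemma congruence_equiv: "congruence A \<theta> \<Longrightarrow> equiv (univ A) \<theta>"
  by (simp add: congruence_def)

lemma congruence_univ:
  assumes "congruence A \<theta>" "(x, y) \<in> \<theta>"
  shows "x \<in> univ A" "y \<in> univ A"
  using assms by (auto simp: congruence_def)

lemma congruence_refl: "congruence A \<theta> \<Longrightarrow> x \<in> univ A \<Longrightarrow> (x, x) \<in> \<theta>"
  by (auto simp: congruence_def equiv_def refl_on_def)

lemma congruence_sym: "congruence A \<theta> \<Longrightarrow> (x, y) \<in> \<theta> \<Longrightarrow> (y, x) \<in> \<theta>"
  by (auto simp: congruence_def equiv_def dest: symD)

lemma congruence_trans: "congruence A \<theta> \<Longrightarrow> (x, y) \<in> \<theta> \<Longrightarrow> (y, z) \<in> \<theta> \<Longrightarrow> (x, z) \<in> \<theta>"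
  by (auto simp: congruence_def equiv_def dest: transD)

lemma congruence_ne_Id_on:
  assumes "congruence A \<theta>" "\<theta> \<noteq> Id_on (univ A)"
  obtains x y where "(x, y) \<in> \<theta>" "x \<noteq> y"
proof -
  have "Id_on (univ A) \<subseteq> \<theta>" using congruence_refl[OF assms(1)] by auto
  then obtain x y where "(x, y) \<in> \<theta>" "(x, y) \<notin> Id_on (univ A)" using assms(2) by auto
  then show ?thesis using that congruence_univ[OF assms(1)] by blast
qed

context finite_ualg
begin

lemma congruence_pol:
  assumes "congruence A \<alpha>" "pol A n F" "xs \<in> tuples (univ A) n" "ys \<in> tuples (univ A) n"
    "list_all2 (\<lambda>x y. (x, y) \<in> \<alpha>) xs ys"
  shows "(F xs, F ys) \<in> \<alpha>"
proof -
  have "\<forall>xs\<in>tuples (univ A) n. \<forall>ys\<in>tuples (univ A) n.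
      list_all2 (\<lambda>x y. (x, y) \<in> \<alpha>) xs ys \<longrightarrow> (F xs, F ys) \<in> \<alpha>"
    using assms(2)
  proof (induction rule: pol_induct)
    case (proj i)
    then show ?case by (auto simp: list_all2_conv_all_nth tuples_length)
  next
    case (const c)
    then show ?case using congruence_refl[OF assms(1)] by blast
  next
    case (app f G)
    let ?args = "\<lambda>zs. map (\<lambda>i. G i zs) [0..<arity A f]"
    show ?case
    proof (intro ballI impI)
      fix xs ys assume xs: "xs \<in> tuples (univ A) n" "ys \<in> tuples (univ A) n"
        "list_all2 (\<lambda>x y. (x, y) \<in> \<alpha>) xs ys"
      have "?args zs \<in> tuples (univ A) (arity A f)" if "zs \<in> tuples (univ A) n" for zs
        using pol_closed[OF app(2) that] by (intro tuples_map_upt)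
      moreover have "list_all2 (\<lambda>x y. (x, y) \<in> \<alpha>) (?args xs) (?args ys)"
        using app(3) xs by (simp add: list_all2_conv_all_nth)
      ultimately show "(interp A f (?args xs), interp A f (?args ys)) \<in> \<alpha>"
        using assms(1) app(1) xs(1,2) unfolding congruence_def by blast
    qed
  next
    case (cong F G)
    then show ?case by simp
  qed
  then show ?thesis using assms by blast
qed

lemma congruence_pol1:
  assumes "congruence A \<alpha>" "pol1 A f" "(x, y) \<in> \<alpha>"
  shows "(f x, f y) \<in> \<alpha>"
  using congruence_pol[OF assms(1,2), of "[x]" "[y]"] congruence_univ[OF assms(1,3)] assms(3)
  by (simp add: tuples_one)

lemma congruence_pol2:
  assumes "congruence A \<alpha>" "pol2 A g" "(x, y) \<in> \<alpha>" "(x', y') \<in> \<alpha>"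
  shows "(g x x', g y y') \<in> \<alpha>"
  using congruence_pol[OF assms(1,2), of "[x, x']" "[y, y']"] assms(3,4)
    congruence_univ[OF assms(1,3)] congruence_univ[OF assms(1,4)]
  by (simp add: tuples_two)

lemma congruenceI_pol1:
  assumes "equiv (univ A) \<theta>" and closed: "\<And>f x y. pol1 A f \<Longrightarrow> (x, y) \<in> \<theta> \<Longrightarrow> (f x, f y) \<in> \<theta>"
  shows "congruence A \<theta>"
proof -
  have sub: "\<theta> \<subseteq> univ A \<times> univ A" and refl: "\<And>x. x \<in> univ A \<Longrightarrow> (x, x) \<in> \<theta>" and trans: "trans \<theta>"
    using assms(1) by (auto simp: equiv_def refl_on_def)
  have "(interp A f xs, interp A f ys) \<in> \<theta>"
    if f: "f \<in> syms A" and xs: "xs \<in> tuples (univ A) (arity A f)" and ys: "ys \<in> tuples (univ A) (arity A f)"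
      and related: "list_all2 (\<lambda>x y. (x, y) \<in> \<theta>) xs ys" for f xs ys
    using related
  proof (rule list_all2_replace_induct)
    show "(interp A f xs, interp A f xs) \<in> \<theta>" by (rule refl[OF interp_closed[OF f xs]])
    fix zs i assume zs: "length zs = length xs" "set zs \<subseteq> set xs \<union> set ys" "zs ! i = xs ! i"
      and IH: "(interp A f xs, interp A f zs) \<in> \<theta>" and pair: "(xs ! i, ys ! i) \<in> \<theta>"
    have "zs \<in> tuples (univ A) (arity A f)" using zs xs ys by (auto simp: tuples_def)
    then have "pol1 A (\<lambda>x. interp A f (zs[i := x]))"
      by (rule pol_update[OF pol_basic[OF f] _ pol1_id])
    from closed[OF this pair] have "(interp A f zs, interp A f (zs[i := ys ! i])) \<in> \<theta>"
      using zs(3) by (metis list_update_id)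
    then show "(interp A f xs, interp A f (zs[i := ys ! i])) \<in> \<theta>"
      using IH trans by (meson transD)
  qed
  then show ?thesis using assms(1) sub unfolding congruence_def by blast
qed

lemma congruence_full: "congruence A (univ A \<times> univ A)"
  by (rule congruenceI_pol1) (auto simp: equiv_def refl_on_def sym_def trans_def intro: pol1_closed)

lemma congruence_Id_on: "congruence A (Id_on (univ A))"
  by (rule congruenceI_pol1) (auto simp: equiv_def refl_on_def sym_def trans_def intro: pol1_closed)

definition pol_kernel :: "('a \<times> 'a) set \<Rightarrow> ('a \<Rightarrow> 'c) \<Rightarrow> ('a \<times> 'a) set" where
  "pol_kernel \<alpha> r = {(x, y) \<in> \<alpha>. \<forall>f. pol1 A f \<longrightarrow> r (f x) = r (f y)}"

lemma congruence_pol_kernel: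
  assumes "congruence A \<alpha>"
  shows "congruence A (pol_kernel \<alpha> r)"
proof (rule congruenceI_pol1)
  note equiv = congruence_equiv[OF assms]
  then have "refl_on (univ A) (pol_kernel \<alpha> r)" "sym (pol_kernel \<alpha> r)"
    unfolding equiv_def refl_on_def sym_def pol_kernel_def by auto
  moreover have "trans (pol_kernel \<alpha> r)"
    using equiv unfolding equiv_def pol_kernel_def by (intro transI) (auto dest: transD)
  moreover have "pol_kernel \<alpha> r \<subseteq> univ A \<times> univ A"
    using assms by (auto simp: pol_kernel_def congruence_def)
  ultimately show "equiv (univ A) (pol_kernel \<alpha> r)" by (simp add: equiv_def)
  fix f x y assume f: "pol1 A f" and xy: "(x, y) \<in> pol_kernel \<alpha> r"
  then have "(f x, f y) \<in> \<alpha>" using congruence_pol1[OF assms f] by (simp add: pol_kernel_def)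
  moreover have "\<forall>h. pol1 A h \<longrightarrow> r (h x) = r (h y)" using xy by (simp add: pol_kernel_def)
  then have "r (h (f x)) = r (h (f y))" if "pol1 A h" for h
    using pol1_comp[OF that f] by (elim allE[of _ "\<lambda>x. h (f x)"]) simp
  ultimately show "(f x, f y) \<in> pol_kernel \<alpha> r" by (simp add: pol_kernel_def)
qed

lemma ex_minimal_congruence:
  assumes "card (univ A) \<ge> 2"
  shows "\<exists>\<alpha>. minimal_congruence A \<alpha>"
proof -
  let ?C = "{\<alpha>. congruence A \<alpha> \<and> \<alpha> \<noteq> Id_on (univ A)}"
  obtain x y where "x \<in> univ A" "y \<in> univ A" "x \<noteq> y"
    using assms by (metis One_nat_def card_le_Suc0_iff_eq finite_univ not_less_eq_eq numeral_2_eq_2)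
  then have "univ A \<times> univ A \<in> ?C" using congruence_full by auto
  moreover have "?C \<subseteq> Pow (univ A \<times> univ A)" by (auto simp: congruence_def)
  then have "finite ?C" using finite_univ by (meson finite_Pow_iff finite_SigmaI finite_subset)
  ultimately obtain \<alpha> where "\<alpha> \<in> ?C" "\<forall>\<beta>\<in>?C. \<beta> \<subseteq> \<alpha> \<longrightarrow> \<beta> = \<alpha>"
    using finite_has_minimal[of ?C] by (metis (lifting) empty_iff)
  then show ?thesis unfolding minimal_congruence_def by blast
qed

end

section \<open>Minimal sets and traces\<close>

lemma (in finite_ualg) separating_images_iff:
  assumes "congruence A \<alpha>"
  shows "V \<in> separating_images A \<alpha> \<longleftrightarrow>
    (\<exists>f. pol1 A f \<and> V = f ` univ A \<and> (\<exists>x y. (x, y) \<in> \<alpha> \<and> f x \<noteq> f y))"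
proof
  assume "V \<in> separating_images A \<alpha>"
  then obtain p x y where "p \<in> polys A 1" "V = (\<lambda>x. p [x]) ` univ A" "(x, y) \<in> \<alpha>" "p [x] \<noteq> p [y]"
    unfolding separating_images_def by blast
  then show "\<exists>f. pol1 A f \<and> V = f ` univ A \<and> (\<exists>x y. (x, y) \<in> \<alpha> \<and> f x \<noteq> f y)"
    using polys_pol[of p A 1] unfolding pol1_iff[of A p] by (intro exI[of _ "\<lambda>x. p [x]"]) auto
next
  assume "\<exists>f. pol1 A f \<and> V = f ` univ A \<and> (\<exists>x y. (x, y) \<in> \<alpha> \<and> f x \<noteq> f y)"
  then obtain f x y where f: "pol1 A f" "V = f ` univ A" and xy: "(x, y) \<in> \<alpha>" "f x \<noteq> f y" by blast
  let ?p = "restrict (\<lambda>xs. f (xs ! 0)) (tuples (univ A) 1)"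
  have p: "?p [z] = f z" if "z \<in> univ A" for z using that by (simp add: tuples_one)
  show "V \<in> separating_images A \<alpha>" unfolding separating_images_def
  proof (intro CollectI exI conjI bexI[OF _ xy(1)])
    show "?p \<in> polys A 1" by (rule pol_polys[OF f(1)])
    show "V = (\<lambda>x. ?p [x]) ` univ A" using f(2) p by (metis (no_types, lifting) image_cong)
    show "case (x, y) of (x, y) \<Rightarrow> ?p [x] \<noteq> ?p [y]"
      using xy(2) p congruence_univ[OF assms xy(1)] by simp
  qed
qed

locale minimal_cong = finite_ualg A for A :: "('f, 'a) ualg" +
  fixes \<alpha>
  assumes minimal: "minimal_congruence A \<alpha>"
begin

lemma cong: "congruence A \<alpha>"
  using minimal by (simp add: minimal_congruence_def)

lemmas alpha_univ = congruence_univ[OF cong]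
  and alpha_refl = congruence_refl[OF cong]
  and alpha_sym = congruence_sym[OF cong]
  and alpha_trans = congruence_trans[OF cong]

lemma ex_alpha_pair: obtains x y where "(x, y) \<in> \<alpha>" "x \<noteq> y"
  using congruence_ne_Id_on[OF cong] minimal by (metis minimal_congruence_def)

lemma separate:
  assumes "(x, y) \<in> \<alpha>" "q x \<noteq> q y" "(a, b) \<in> \<alpha>" "a \<noteq> b"
  obtains r where "pol1 A r" "q (r a) \<noteq> q (r b)"
proof -
  have "(x, y) \<notin> pol_kernel \<alpha> q" using assms(2) pol1_id by (auto simp: pol_kernel_def)
  then have "pol_kernel \<alpha> q \<noteq> \<alpha>" using assms(1) by blast
  moreover have "pol_kernel \<alpha> q \<subseteq> \<alpha>" by (auto simp: pol_kernel_def)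
  ultimately have "pol_kernel \<alpha> q = Id_on (univ A)"
    using minimal congruence_pol_kernel[OF cong] unfolding minimal_congruence_def by blast
  then have "(a, b) \<notin> pol_kernel \<alpha> q" using assms(4) by auto
  then show ?thesis using that assms(3) by (auto simp: pol_kernel_def)
qed

lemma minimal_setE:
  assumes "minimal_set A \<alpha> U"
  obtains f x y where "pol1 A f" "U = f ` univ A" "(x, y) \<in> \<alpha>" "f x \<noteq> f y"
  using assms unfolding minimal_set_def separating_images_iff[OF cong] by blast

lemma minimal_setD:
  assumes "minimal_set A \<alpha> U" "pol1 A f" "f ` univ A \<subseteq> U" "(x, y) \<in> \<alpha>" "f x \<noteq> f y"
  shows "f ` univ A = U"
proof -
  have "f ` univ A \<in> separating_images A \<alpha>"
    unfolding separating_images_iff[OF cong] using assms by (intro exI[of _ f]) auto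
  then show ?thesis using assms(1,3) unfolding minimal_set_def by simp
qed

lemma minimal_set_sub: "minimal_set A \<alpha> U \<Longrightarrow> U \<subseteq> univ A"
  by (erule minimal_setE) (auto intro: pol1_closed)

lemma minimal_set_onto:
  assumes U: "minimal_set A \<alpha> U" and V: "minimal_set A \<alpha> V"
  obtains f where "pol1 A f" "f ` univ A \<subseteq> V" "f ` U = V"
proof -
  obtain p x y where p: "pol1 A p" "U = p ` univ A" "(x, y) \<in> \<alpha>" "p x \<noteq> p y"
    by (rule minimal_setE[OF U])
  obtain q x' y' where q: "pol1 A q" "V = q ` univ A" "(x', y') \<in> \<alpha>" "q x' \<noteq> q y'"
    by (rule minimal_setE[OF V])
  obtain r where r: "pol1 A r" "q (r (p x)) \<noteq> q (r (p y))"
    using separate[OF q(3,4) congruence_pol1[OF cong p(1,3)] p(4)] by blast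
  show ?thesis
  proof (rule that[of "\<lambda>x. q (r x)"])
    show "pol1 A (\<lambda>x. q (r x))" by (rule pol1_comp[OF q(1) r(1)])
    show range: "(\<lambda>x. q (r x)) ` univ A \<subseteq> V" using q(2) pol1_closed[OF r(1)] by auto
    have "(\<lambda>x. q (r (p x))) ` univ A = V"
    proof (rule minimal_setD[OF V _ _ p(3) r(2)])
      show "pol1 A (\<lambda>x. q (r (p x)))" by (rule pol1_comp[OF q(1) pol1_comp[OF r(1) p(1)]])
      show "(\<lambda>x. q (r (p x))) ` univ A \<subseteq> V" using range pol1_closed[OF p(1)] by blast
    qed
    then show "(\<lambda>x. q (r x)) ` U = V" unfolding p(2) by (simp add: image_image)
  qed
qed

lemma minimal_set_bij:
  assumes U: "minimal_set A \<alpha> U" and V: "minimal_set A \<alpha> V"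
  obtains f where "pol1 A f" "f ` univ A \<subseteq> V" "bij_betw f U V"
proof -
  have fin: "finite U" "finite V" using minimal_set_sub U V finite_univ finite_subset by metis+
  obtain f where f: "pol1 A f" "f ` univ A \<subseteq> V" "f ` U = V" by (rule minimal_set_onto[OF U V])
  obtain g where "g ` V = U" by (rule minimal_set_onto[OF V U])
  then have "card U \<le> card V" using fin(2) card_image_le by blast
  moreover have "card V \<le> card U" using f(3) fin(1) card_image_le by blast
  ultimately have "inj_on f U" using f(3) fin by (metis eq_card_imp_inj_on le_antisym)
  then show ?thesis using that f by (auto simp: bij_betw_def)
qed

lemma minimal_set_iso:
  assumes U: "minimal_set A \<alpha> U" and V: "minimal_set A \<alpha> V"
  obtains f g where "pol1 A f" "pol1 A g" "\<And>x. x \<in> univ A \<Longrightarrow> f x \<in> V" "\<And>x. x \<in> univ A \<Longrightarrow> g x \<in> U"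
    "\<And>x. x \<in> U \<Longrightarrow> g (f x) = x" "\<And>x. x \<in> V \<Longrightarrow> f (g x) = x"
proof -
  obtain f where f: "pol1 A f" "f ` univ A \<subseteq> V" "bij_betw f U V" by (rule minimal_set_bij[OF U V])
  obtain g where g: "pol1 A g" "g ` univ A \<subseteq> U" "bij_betw g V U" by (rule minimal_set_bij[OF V U])
  have sub: "U \<subseteq> univ A" "V \<subseteq> univ A" using minimal_set_sub U V by auto
  have "bij_betw (\<lambda>x. f (g x)) V V" using bij_betw_trans[OF g(3) f(3)] by (simp add: comp_def)
  then obtain h where h: "pol1 A h" "\<And>x. x \<in> V \<Longrightarrow> h x \<in> V" "\<And>x. x \<in> V \<Longrightarrow> f (g (h x)) = x"
    using pol1_inverse[OF pol1_comp[OF f(1) g(1)] sub(2)] by metis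
  show ?thesis
  proof (rule that[of f "\<lambda>x. g (h x)"])
    show "pol1 A (\<lambda>x. g (h x))" by (rule pol1_comp[OF g(1) h(1)])
    show "g (h x) \<in> U" if "x \<in> univ A" for x using g(2) pol1_closed[OF h(1) that] by blast
    show "g (h (f x)) = x" if "x \<in> U" for x
    proof -
      have fx: "f x \<in> V" using f(3) that by (auto simp: bij_betw_def)
      then have "f (g (h (f x))) = f x" using h(3) by blast
      moreover have "g (h (f x)) \<in> U" using fx h(2) g(3) by (auto simp: bij_betw_def)
      ultimately show ?thesis using f(3) that by (metis bij_betw_imp_inj_on inj_onD)
    qed
  qed (use f h in auto)
qed

lemma retraction:
  assumes "minimal_set A \<alpha> U"
  obtains e where "pol1 A e" "\<And>x. x \<in> univ A \<Longrightarrow> e x \<in> U" "\<And>x. x \<in> U \<Longrightarrow> e x = x"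
proof -
  obtain f g where fg: "pol1 A f" "pol1 A g" "\<And>x. x \<in> univ A \<Longrightarrow> f x \<in> U" "\<And>x. x \<in> univ A \<Longrightarrow> g x \<in> U"
    "\<And>x. x \<in> U \<Longrightarrow> g (f x) = x" "\<And>x. x \<in> U \<Longrightarrow> f (g x) = x"
    by (rule minimal_set_iso[OF assms assms], rule that)
  show ?thesis
  proof (rule that[of "\<lambda>x. g (f x)"])
    show "pol1 A (\<lambda>x. g (f x))" by (rule pol1_comp[OF fg(2,1)])
  qed (use fg pol1_closed in blast)+
qed

lemma ex_minimal_set: "\<exists>U. minimal_set A \<alpha> U"
proof -
  have "separating_images A \<alpha> \<subseteq> Pow (univ A)"
    using pol1_closed by (auto simp: separating_images_iff[OF cong])
  then have "finite (separating_images A \<alpha>)" using finite_univ by (meson finite_Pow_iff finite_subset)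
  moreover have "univ A \<in> separating_images A \<alpha>"
    unfolding separating_images_iff[OF cong]
    using ex_alpha_pair pol1_id by (intro exI[of _ "\<lambda>x. x"]) (auto, metis)
  ultimately obtain U where "U \<in> separating_images A \<alpha>" "\<forall>V\<in>separating_images A \<alpha>. V \<subseteq> U \<longrightarrow> V = U"
    using finite_has_minimal[of "separating_images A \<alpha>"] by (metis empty_iff)
  then show ?thesis unfolding minimal_set_def by blast
qed

lemma minimal_set_imp_trace:
  assumes "minimal_set A \<alpha> U"
  obtains a where "a \<in> U" "trace A \<alpha> (\<alpha> `` {a} \<inter> U)"
proof -
  obtain f x y where f: "pol1 A f" "U = f ` univ A" and xy: "(x, y) \<in> \<alpha>" "f x \<noteq> f y"
    by (rule minimal_setE[OF assms])
  have x: "f x \<in> U" and y: "f y \<in> U" using f(2) alpha_univ[OF xy(1)] by auto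
  have "(f x, f y) \<in> \<alpha>" by (rule congruence_pol1[OF cong f(1) xy(1)])
  then have "{f x, f y} \<subseteq> \<alpha> `` {f x} \<inter> U" using x y alpha_refl alpha_univ by auto
  moreover have "finite (\<alpha> `` {f x} \<inter> U)" using f(2) finite_univ by simp
  ultimately have "card {f x, f y} \<le> card (\<alpha> `` {f x} \<inter> U)" by (rule card_mono[rotated])
  then have "trace A \<alpha> (\<alpha> `` {f x} \<inter> U)" unfolding trace_def using assms x xy(2) by auto
  then show ?thesis by (rule that[OF x])
qed

lemma ex_trace: obtains N where "trace A \<alpha> N"
  using ex_minimal_set minimal_set_imp_trace by metis

lemma trace_rel:
  assumes "trace A \<alpha> N" "x \<in> N" "y \<in> N"
  shows "(x, y) \<in> \<alpha>"
  using assms alpha_sym alpha_trans unfolding trace_def by blast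

lemma trace_card: "trace A \<alpha> N \<Longrightarrow> 2 \<le> card N"
  unfolding trace_def by blast

end

section \<open>Polynomially isomorphic subsets\<close>

locale poly_isomorphism = finite_ualg A for A :: "('f, 'a) ualg" +
  fixes N N' :: "'a set" and f g :: "'a \<Rightarrow> 'a"
  assumes subsets: "N \<subseteq> univ A" "N' \<subseteq> univ A" and nonempty: "N \<noteq> {}" "N' \<noteq> {}"
    and f: "pol1 A f" "\<And>x. x \<in> N \<Longrightarrow> f x \<in> N'" and g: "pol1 A g" "\<And>x. x \<in> N' \<Longrightarrow> g x \<in> N"
    and gf: "\<And>x. x \<in> N \<Longrightarrow> g (f x) = x" and fg: "\<And>x. x \<in> N' \<Longrightarrow> f (g x) = x"
begin

lemma inverse: "poly_isomorphism A N' N g f"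
  by unfold_locales (use subsets nonempty f g gf fg in auto)

lemma transport:
  assumes "pol (induced A N) n F"
  shows "pol (induced A N') n (\<lambda>xs. f (F (map g xs)))"
proof -
  obtain p where p: "pol A n p" "\<And>xs. xs \<in> tuples N n \<Longrightarrow> p xs \<in> N" "\<And>xs. xs \<in> tuples N n \<Longrightarrow> F xs = p xs"
    by (rule pol_inducedE[OF subsets(1) nonempty(1) assms], rule that)
  have "pol A n (\<lambda>xs. g (xs ! i))" if "i < n" for i
    by (rule pol_pol1[OF g(1) pol_proj[OF that]])
  then have "pol A n (\<lambda>xs. p (map (\<lambda>i. g (xs ! i)) [0..<n]))" by (rule pol_comp[OF p(1)])
  moreover have "map (\<lambda>i. g (xs ! i)) [0..<n] = map g xs" if "xs \<in> tuples (univ A) n" for xs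
    by (rule nth_equalityI) (use that in \<open>auto simp: tuples_length\<close>)
  ultimately have "pol A n (\<lambda>xs. p (map g xs))" by (elim pol_congI) simp
  then have "pol A n (\<lambda>xs. f (p (map g xs)))" by (rule pol_pol1[OF f(1)])
  then have "pol (induced A N') n (\<lambda>xs. f (p (map g xs)))"
    by (rule pol_inducedI[OF subsets(2) nonempty(2)]) (use p(2) f(2) g(2) tuples_map in metis)
  then show ?thesis
    by (rule pol_congI) (use p(3) g(2) in \<open>auto intro!: arg_cong[where f = f] simp: tuples_map\<close>)
qed

lemma transport_back:
  "pol (induced A N') n F \<Longrightarrow> pol (induced A N) n (\<lambda>xs. g (F (map f xs)))"
  by (rule poly_isomorphism.transport[OF inverse])

lemma transport_recover:
  assumes "pol (induced A N') 2 F" "x \<in> N'" "y \<in> N'"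
  shows "F [x, y] = f (g (F (map f [g x, g y])))"
proof -
  interpret I: finite_ualg "induced A N'" by (rule finite_ualg_induced[OF subsets(2) nonempty(2)])
  have "F [x, y] \<in> N'" using I.pol_closed[OF assms(1), of "[x, y]"] assms(2,3) by (simp add: tuples_two)
  then show ?thesis using fg assms(2,3) by simp
qed

lemma ess_unary_transport:
  assumes "ess_unary (induced A N)"
  shows "ess_unary (induced A N')"
  unfolding ess_unary_def univ_induced
proof (intro allI impI)
  fix F assume F: "pol (induced A N') 2 F"
  then have "ess_unary_on N 2 (\<lambda>xs. g (F (map f xs)))"
    using assms transport_back by (simp add: ess_unary_def)
  then show "ess_unary_on N' 2 F"
    unfolding ess_unary_on_two using transport_recover[OF F] g(2) by metis
qed

lemma term_condition_transport:
  assumes "term_condition (induced A N)"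
  shows "term_condition (induced A N')"
  unfolding term_condition_def univ_induced
proof (intro allI impI ballI)
  fix F x w y z assume F: "pol (induced A N') 2 F"
    and elems: "x \<in> N'" "w \<in> N'" "y \<in> N'" "z \<in> N'" and eq: "F [x, y] = F [x, z]"
  have "g (F (map f [g w, g y])) = g (F (map f [g w, g z]))"
    using assms[unfolded term_condition_def univ_induced, rule_format, OF transport_back[OF F],
        of "g x" "g w" "g y" "g z"] elems g(2) eq fg by simp
  then show "F [w, y] = F [w, z]" using transport_recover[OF F] elems by metis
qed

lemma has_swap_transport:
  assumes "has_swap (induced A N)"
  shows "has_swap (induced A N')"
proof -
  obtain F x y where F: "pol (induced A N) 1 F" "x \<in> N" "y \<in> N" "x \<noteq> y" "F [x] = y" "F [y] = x"
    using assms unfolding has_swap_def by auto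
  have "f x \<noteq> f y" using F gf by metis
  then show ?thesis unfolding has_swap_def univ_induced
    by (intro exI[of _ "\<lambda>xs. f (F (map g xs))"] conjI transport[OF F(1)] bexI[of _ "f x"] bexI[of _ "f y"])
      (use F f gf in auto)
qed

lemma has_meet_transport:
  assumes "has_meet (induced A N) u v" "u \<in> N" "v \<in> N"
  shows "has_meet (induced A N') (f u) (f v)"
proof -
  obtain F where F: "pol (induced A N) 2 F" "F [u, u] = u" "F [u, v] = u" "F [v, u] = u" "F [v, v] = v"
    using assms(1) unfolding has_meet_def by blast
  then show ?thesis unfolding has_meet_def
    by (intro exI[of _ "\<lambda>xs. f (F (map g xs))"] conjI transport[OF F(1)]) (simp_all add: gf assms(2,3))
qed

lemma lattice_like_transport:
  assumes "lattice_like (induced A N)"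
  shows "lattice_like (induced A N')"
proof -
  obtain u v where uv: "u \<in> N" "v \<in> N" "u \<noteq> v" "has_meet (induced A N) u v" "has_meet (induced A N) v u"
    using assms unfolding lattice_like_def by auto
  moreover have "f u \<noteq> f v" using uv gf by metis
  ultimately show ?thesis unfolding lattice_like_def univ_induced
    using has_meet_transport f(2) by blast
qed

lemma kind_eq: "kind (induced A N) = kind (induced A N')"
  unfolding kind_def
  using ess_unary_transport poly_isomorphism.ess_unary_transport[OF inverse]
    term_condition_transport poly_isomorphism.term_condition_transport[OF inverse]
    has_swap_transport poly_isomorphism.has_swap_transport[OF inverse]
    lattice_like_transport poly_isomorphism.lattice_like_transport[OF inverse] by presburger

end

section \<open>Types of minimal congruences of three-element algebras\<close>

lemma (in finite_ualg) pol_induced_univ: "pol (induced A (univ A)) = pol A"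
proof (intro ext iffI)
  have "univ A \<noteq> {}" using ex_element by blast
  note univ = subset_refl[of "univ A"] this
  fix n F
  show "pol (induced A (univ A)) n F" if "pol A n F"
    by (rule pol_inducedI[OF univ that pol_closed[OF that]])
  show "pol A n F" if "pol (induced A (univ A)) n F"
    by (rule pol_inducedE[OF univ that]) (rule pol_congI, auto)
qed

locale three_minimal = minimal_cong A \<alpha> for A :: "('f, 'a) ualg" and \<alpha> +
  assumes three: "card (univ A) = 3"
begin

lemma two_element_subsets_meet:
  assumes "M \<subseteq> univ A" "N \<subseteq> univ A" "card M \<ge> 2" "card N \<ge> 2"
  shows "M \<inter> N \<noteq> {}"
proof
  assume "M \<inter> N = {}"
  moreover have "finite M" "finite N" using assms finite_univ finite_subset by auto
  ultimately have "card (M \<union> N) \<ge> 4" using assms by (simp add: card_Un_disjoint)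
  moreover have "card (M \<union> N) \<le> 3" using card_mono[OF finite_univ, of "M \<union> N"] assms three by simp
  ultimately show False by simp
qed

lemma large_class_unique:
  assumes "U \<subseteq> univ A" "card (\<alpha> `` {a} \<inter> U) \<ge> 2" "card (\<alpha> `` {b} \<inter> U) \<ge> 2"
  shows "\<alpha> `` {a} = \<alpha> `` {b}"
proof -
  have "(\<alpha> `` {a} \<inter> U) \<inter> (\<alpha> `` {b} \<inter> U) \<noteq> {}"
    by (rule two_element_subsets_meet) (use assms in auto)
  then obtain c where "(a, c) \<in> \<alpha>" "(b, c) \<in> \<alpha>" by blast
  then show ?thesis using alpha_sym alpha_trans by blast
qed

lemma trace_isomorphism:
  assumes N: "trace A \<alpha> N" and N': "trace A \<alpha> N'"
  obtains f g where "poly_isomorphism A N N' f g"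
proof -
  obtain U a where U: "minimal_set A \<alpha> U" "a \<in> U" "N = \<alpha> `` {a} \<inter> U"
    using N unfolding trace_def by blast
  obtain V b where V: "minimal_set A \<alpha> V" "b \<in> V" "N' = \<alpha> `` {b} \<inter> V"
    using N' unfolding trace_def by blast
  have sub: "U \<subseteq> univ A" "V \<subseteq> univ A" using minimal_set_sub U V by auto
  obtain f g where fg: "pol1 A f" "pol1 A g" "\<And>x. x \<in> univ A \<Longrightarrow> f x \<in> V" "\<And>x. x \<in> univ A \<Longrightarrow> g x \<in> U"
    "\<And>x. x \<in> U \<Longrightarrow> g (f x) = x" "\<And>x. x \<in> V \<Longrightarrow> f (g x) = x"
    by (rule minimal_set_iso[OF U(1) V(1)], rule that)
  have image: "f x \<in> \<alpha> `` {f a} \<inter> V" if "x \<in> N" for x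
    using that U sub fg congruence_pol1[OF cong fg(1)] by auto
  have "inj_on f N" using fg(5) U(3) by (metis IntE inj_onI)
  moreover have "f ` N \<subseteq> \<alpha> `` {f a} \<inter> V" using image by blast
  moreover have "finite (\<alpha> `` {f a} \<inter> V)" using sub finite_univ finite_subset by blast
  ultimately have "card (\<alpha> `` {f a} \<inter> V) \<ge> 2"
    using trace_card[OF N] by (metis card_image card_mono le_trans)
  then have "\<alpha> `` {f a} = \<alpha> `` {b}"
    using large_class_unique[OF sub(2)] trace_card[OF N'] V(3) by blast
  then have N'_eq: "N' = \<alpha> `` {f a} \<inter> V" using V(3) by simp
  have inverse_image: "g x \<in> N" if "x \<in> N'" for x
  proof -
    have "(g (f a), g x) \<in> \<alpha>" using that N'_eq congruence_pol1[OF cong fg(2)] by blast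
    then show ?thesis using that N'_eq U(2,3) fg(4,5) sub by auto
  qed
  have "poly_isomorphism A N N' f g"
  proof unfold_locales
    show "N \<noteq> {}" "N' \<noteq> {}" using trace_card[OF N] trace_card[OF N'] by auto
  qed (use U(3) N'_eq sub fg image inverse_image in auto)
  then show ?thesis by (rule that)
qed

lemma traceE:
  assumes "trace A \<alpha> N"
  obtains U a where "minimal_set A \<alpha> U" "a \<in> U" "N = \<alpha> `` {a} \<inter> U" "U \<subseteq> univ A" "N \<subseteq> univ A"
    "N \<noteq> {}" "card N = 2 \<or> N = univ A \<and> U = univ A"
proof -
  obtain U a where U: "minimal_set A \<alpha> U" "a \<in> U" "N = \<alpha> `` {a} \<inter> U"
    using assms unfolding trace_def by blast
  have sub: "U \<subseteq> univ A" using minimal_set_sub U by auto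
  then have N: "N \<subseteq> univ A" using U by auto
  have "N = univ A \<and> U = univ A" if "card N \<noteq> 2"
  proof -
    have "card N = 3" using that trace_card[OF assms] card_mono[OF finite_univ N] three by linarith
    then have "N = univ A" using N three finite_univ by (metis card_subset_eq)
    then show ?thesis using U(3) sub by auto
  qed
  moreover have "N \<noteq> {}" using trace_card[OF assms] by auto
  ultimately show ?thesis using that U sub N by blast
qed

lemma minimal_algebra_if_full_trace:
  assumes "trace A \<alpha> (univ A)"
  shows "minimal_algebra A"
  unfolding minimal_algebra_def
proof (intro allI impI disjCI)
  fix f assume f: "pol1 A f" and not_bij: "\<not> bij_betw f (univ A) (univ A)"
  have U: "minimal_set A \<alpha> (univ A)" by (rule traceE[OF assms]) (use three in auto)
  show "\<forall>x\<in>univ A. \<forall>y\<in>univ A. f x = f y"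
  proof (intro ballI, rule ccontr)
    fix x y assume "x \<in> univ A" "y \<in> univ A" "f x \<noteq> f y"
    then have "f ` univ A = univ A"
      using pol1_closed[OF f] by (intro minimal_setD[OF U f _ trace_rel[OF assms]]) auto
    then have "bij_betw f (univ A) (univ A)" using finite_univ by (simp add: bij_betw_def eq_card_imp_inj_on)
    then show False using not_bij by blast
  qed
qed

lemma minimal_alg_type_trace:
  assumes "trace A \<alpha> N"
  shows "minimal_alg_type (induced A N) (kind (induced A N))"
proof -
  obtain U where N: "N \<subseteq> univ A" "N \<noteq> {}" "card N = 2 \<or> N = univ A \<and> U = univ A"
    by (rule traceE[OF assms], rule that)
  interpret I: finite_ualg "induced A N" by (rule finite_ualg_induced[OF N(1,2)])
  from N(3) show ?thesis
  proof
    assume "card N = 2"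
    then interpret two_element_ualg "induced A N" by unfold_locales simp
    show ?thesis by (rule minimal_alg_type_two)
  next
    assume "N = univ A \<and> U = univ A"
    then have N: "N = univ A" ..
    then have "minimal_algebra A" using minimal_algebra_if_full_trace assms by blast
    then have "minimal_algebra (induced A N)"
      unfolding minimal_algebra_def N pol_induced_univ univ_induced .
    then show ?thesis using I.minimal_alg_type_three N three by simp
  qed
qed

lemma tct_type_trace:
  assumes "trace A \<alpha> N"
  shows "tct_type A \<alpha> = kind (induced A N)"
  unfolding tct_type_def
proof (rule the_equality)
  show "\<exists>N'. trace A \<alpha> N' \<and> minimal_alg_type (induced A N') (kind (induced A N))"
    using assms minimal_alg_type_trace by blast
next
  fix i assume "\<exists>N. trace A \<alpha> N \<and> minimal_alg_type (induced A N) i"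
  then obtain N' where N': "trace A \<alpha> N'" "minimal_alg_type (induced A N') i" by blast
  then have "i = kind (induced A N')"
    using minimal_alg_type_kind[OF N'(2)] trace_card[OF N'(1)] by simp
  also have "\<dots> = kind (induced A N)"
    using trace_isomorphism[OF N'(1) assms] poly_isomorphism.kind_eq by metis
  finally show "i = kind (induced A N)" .
qed

lemma tct_type_eq_1_iff:
  assumes "trace A \<alpha> N"
  shows "tct_type A \<alpha> = 1 \<longleftrightarrow> ess_unary (induced A N)"
  unfolding tct_type_trace[OF assms] by (simp add: kind_def)

end

section \<open>Polynomial bounds\<close>

definition poly_bounded :: "(nat \<Rightarrow> nat) \<Rightarrow> bool" where
  "poly_bounded f \<longleftrightarrow> (\<exists>c k. \<forall>n. f n \<le> c * (n + 1) ^ k)"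

lemma poly_bounded_power: "poly_bounded (\<lambda>n. c * (n + 1) ^ k)"
  unfolding poly_bounded_def by blast

lemma poly_bounded_const: "poly_bounded (\<lambda>_. c)"
  using poly_bounded_power[of c 0] by simp

lemma poly_bounded_id: "poly_bounded (\<lambda>n. n)"
  unfolding poly_bounded_def by (intro exI[of _ 1]) simp

lemma poly_bounded_mono: "poly_bounded g \<Longrightarrow> (\<And>n. f n \<le> g n) \<Longrightarrow> poly_bounded f"
  unfolding poly_bounded_def by (meson order_trans)

lemma poly_bounded_add:
  assumes "poly_bounded f" "poly_bounded g"
  shows "poly_bounded (\<lambda>n. f n + g n)"
proof -
  obtain c k d l where bounds: "\<And>n. f n \<le> c * (n + 1) ^ k" "\<And>n. g n \<le> d * (n + 1) ^ l"
    using assms unfolding poly_bounded_def by blast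
  have "f n + g n \<le> (c + d) * (n + 1) ^ (k + l)" for n
  proof -
    have "c * (n + 1) ^ k \<le> c * (n + 1) ^ (k + l)" "d * (n + 1) ^ l \<le> d * (n + 1) ^ (k + l)"
      by (intro mult_left_mono power_increasing; simp)+
    then show ?thesis using bounds[of n] unfolding distrib_right by linarith
  qed
  then show ?thesis unfolding poly_bounded_def by blast
qed

lemma poly_bounded_mult:
  assumes "poly_bounded f" "poly_bounded g"
  shows "poly_bounded (\<lambda>n. f n * g n)"
proof -
  obtain c k d l where bounds: "\<And>n. f n \<le> c * (n + 1) ^ k" "\<And>n. g n \<le> d * (n + 1) ^ l"
    using assms unfolding poly_bounded_def by blast
  have "f n * g n \<le> (c * d) * (n + 1) ^ (k + l)" for n
  proof -
    have "f n * g n \<le> (c * (n + 1) ^ k) * (d * (n + 1) ^ l)" using bounds[of n] by (rule mult_mono) auto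
    then show ?thesis by (simp only: power_add mult_ac)
  qed
  then show ?thesis unfolding poly_bounded_def by blast
qed

lemma poly_bounded_sum_list:
  "(\<And>x. poly_bounded (f x)) \<Longrightarrow> poly_bounded (\<lambda>n. \<Sum>x\<leftarrow>xs. f x n)"
  by (induction xs) (auto intro: poly_bounded_add poly_bounded_const)

lemma poly_bounded_scale:
  assumes "poly_bounded f"
  shows "poly_bounded (\<lambda>n. f (m * n))"
proof -
  obtain c k where bound: "\<And>n. f n \<le> c * (n + 1) ^ k"
    using assms unfolding poly_bounded_def by blast
  have "f (m * n) \<le> c * (m + 1) ^ k * (n + 1) ^ k" for n
  proof -
    have "(m * n + 1) ^ k \<le> ((m + 1) * (n + 1)) ^ k" by (rule power_mono) simp_all
    then have "c * (m * n + 1) ^ k \<le> c * ((m + 1) * (n + 1)) ^ k" by (rule mult_left_mono) simp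
    then show ?thesis using bound[of "m * n"] by (simp only: power_mult_distrib mult.assoc)
  qed
  then show ?thesis unfolding poly_bounded_def by blast
qed

lemma poly_bounded_monotone_bound:
  assumes "poly_bounded f"
  obtains g where "poly_bounded g" "mono g" "\<And>n. f n \<le> g n"
proof -
  obtain c k where "\<And>n. f n \<le> c * (n + 1) ^ k"
    using assms unfolding poly_bounded_def by blast
  moreover have "mono (\<lambda>n. c * (n + 1) ^ k)" by (intro monoI mult_left_mono power_mono) auto
  ultimately show ?thesis using that poly_bounded_power by blast
qed

lemma poly_bounded_poly:
  fixes p :: "real poly"
  shows "poly_bounded (\<lambda>n. nat \<lceil>poly p (real n)\<rceil>)"
proof (induction p)
  case 0
  then show ?case by (simp add: poly_bounded_const)
next
  case (pCons a p)
  have "poly_bounded (\<lambda>n. nat \<lceil>a\<rceil> + n * nat \<lceil>poly p (real n)\<rceil>)"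
    by (intro poly_bounded_add poly_bounded_mult poly_bounded_const poly_bounded_id pCons.IH)
  then show ?case
  proof (rule poly_bounded_mono)
    fix n
    have "poly (pCons a p) (real n) \<le> real (nat \<lceil>a\<rceil>) + real n * real (nat \<lceil>poly p (real n)\<rceil>)"
      by (auto intro!: add_mono mult_left_mono simp: real_nat_ceiling_ge)
    then show "nat \<lceil>poly (pCons a p) (real n)\<rceil> \<le> nat \<lceil>a\<rceil> + n * nat \<lceil>poly p (real n)\<rceil>"
      by (simp only: nat_ceiling_le_eq of_nat_add of_nat_mult)
  qed
qed

lemma poly_bounded_imp_poly:
  assumes "poly_bounded f"
  obtains p :: "real poly" where "\<And>n. real (f n) \<le> poly p (real n)"
proof -
  obtain c k where bound: "\<And>n. f n \<le> c * (n + 1) ^ k"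
    using assms unfolding poly_bounded_def by blast
  have "real (c * (n + 1) ^ k) = poly ([:real c:] * [:1, 1:] ^ k) (real n)" for n
    by (simp add: add.commute)
  then show ?thesis using that bound of_nat_mono by metis
qed

lemma poly_bounded_less_power:
  assumes "poly_bounded f"
  shows "\<exists>k>0. f k < 2 ^ k"
proof -
  obtain c d where bound: "\<And>n. f n \<le> c * (n + 1) ^ d"
    using assms unfolding poly_bounded_def by blast
  define t where "t = c + 2 * d"
  define k where "k = (2::nat) ^ (2 * t)"
  have "f k \<le> c * (k + 1) ^ d" by (rule bound)
  also have "\<dots> \<le> 2 ^ c * (2 ^ (2 * t + 1)) ^ d"
  proof (intro mult_mono power_mono)
    show "c \<le> 2 ^ c" using less_exp[of c] by simp
    show "k + 1 \<le> 2 ^ (2 * t + 1)" by (simp add: k_def)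
  qed auto
  also have "\<dots> = 2 ^ (c + (2 * t + 1) * d)" by (simp add: power_add power_mult)
  also have "\<dots> < 2 ^ k"
  proof (rule power_strict_increasing)
    have "c + (2 * t + 1) * d < (t + 1) * (t + 1)" by (simp add: t_def algebra_simps)
    also have "\<dots> \<le> 2 ^ t * 2 ^ t" using Suc_leI[OF less_exp[of t]] by (intro mult_mono) auto
    also have "\<dots> = k" by (simp add: k_def flip: power_add mult_2)
    finally show "c + (2 * t + 1) * d < k" .
  qed simp
  finally show ?thesis by (intro exI[of _ k]) (simp add: k_def)
qed

section \<open>Surjective homomorphisms\<close>

lemma surj_homsD:
  assumes "h \<in> surj_homs X C"
  shows "x \<in> univ X \<Longrightarrow> h x \<in> univ C" "h \<in> extensional (univ X)" "h ` univ X = univ C"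
    "f \<in> syms X \<Longrightarrow> xs \<in> tuples (univ X) (arity X f) \<Longrightarrow> h (interp X f xs) = interp C f (map h xs)"
  using assms by (auto simp: surj_homs_def homs_def PiE_def)

lemma restrict_in_surj_homsI:
  assumes "is_ualg X" "h ` univ X = univ C"
    and hom: "\<And>f xs. f \<in> syms X \<Longrightarrow> xs \<in> tuples (univ X) (arity X f) \<Longrightarrow>
      h (interp X f xs) = interp C f (map h xs)"
  shows "restrict h (univ X) \<in> surj_homs X C"
proof -
  have "restrict h (univ X) (interp X f xs) = interp C f (map (restrict h (univ X)) xs)"
    if f: "f \<in> syms X" "xs \<in> tuples (univ X) (arity X f)" for f xs
  proof -
    have "interp X f xs \<in> univ X" using assms(1) f by (simp add: is_ualg_def)
    moreover have map_eq: "map (restrict h (univ X)) xs = map h xs" using f(2) by (auto simp: tuples_def)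
    ultimately show ?thesis using hom[OF f] unfolding map_eq by simp
  qed
  then show ?thesis using assms(2) by (auto simp: surj_homs_def homs_def)
qed

lemma surj_homs_eqI:
  assumes "h \<in> surj_homs X C" "h' \<in> surj_homs X C" "\<And>x. x \<in> univ X \<Longrightarrow> h x = h' x"
  shows "h = h'"
  using surj_homsD(2)[OF assms(1)] surj_homsD(2)[OF assms(2)] assms(3) by (rule extensionalityI)

lemma finite_surj_homs:
  assumes "finite (univ X)" "finite (univ C)"
  shows "finite (surj_homs X C)"
proof (rule finite_subset)
  show "surj_homs X C \<subseteq> univ X \<rightarrow>\<^sub>E univ C" unfolding surj_homs_def homs_def by blast
qed (use assms in \<open>auto intro: finite_PiE\<close>)

definition surj_bound :: "('f, 'a) ualg \<Rightarrow> (nat \<Rightarrow> nat) \<Rightarrow> bool" where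
  "surj_bound C b \<longleftrightarrow> (\<forall>X :: ('f, nat) ualg. is_ualg X \<and> finite (univ X) \<and> same_signature X C \<longrightarrow>
     card (surj_homs X C) \<le> b (card (univ X)))"

lemma surj_bound_mono: "surj_bound C b \<Longrightarrow> (\<And>n. b n \<le> b' n) \<Longrightarrow> surj_bound C b'"
  unfolding surj_bound_def by (meson order_trans)

lemma in_K_surj_iff:
  "in_K_surj C \<longleftrightarrow> is_ualg C \<and> finite (univ C) \<and> (\<exists>b. poly_bounded b \<and> surj_bound C b)"
proof
  assume "in_K_surj C"
  then obtain p :: "real poly" where "is_ualg C" "finite (univ C)"
    and p: "\<And>X :: ('a, nat) ualg. is_ualg X \<and> finite (univ X) \<and> same_signature X C \<Longrightarrow>
      real (card (surj_homs X C)) \<le> poly p (real (card (univ X)))"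
    unfolding in_K_surj_def by blast
  moreover have "surj_bound C (\<lambda>n. nat \<lceil>poly p (real n)\<rceil>)"
    unfolding surj_bound_def using p real_nat_ceiling_ge by (meson of_nat_le_iff order_trans)
  ultimately show "is_ualg C \<and> finite (univ C) \<and> (\<exists>b. poly_bounded b \<and> surj_bound C b)"
    using poly_bounded_poly by blast
next
  assume "is_ualg C \<and> finite (univ C) \<and> (\<exists>b. poly_bounded b \<and> surj_bound C b)"
  then obtain b where C: "is_ualg C" "finite (univ C)" and b: "poly_bounded b" "surj_bound C b" by blast
  obtain p :: "real poly" where p: "\<And>n. real (b n) \<le> poly p (real n)"
    by (rule poly_bounded_imp_poly[OF b(1)], rule that)
  have "real (card (surj_homs X C)) \<le> poly p (real (card (univ X)))"
    if "is_ualg X \<and> finite (univ X) \<and> same_signature X C" for X :: "('a, nat) ualg"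
    using b(2) that p[of "card (univ X)"] unfolding surj_bound_def by (meson of_nat_le_iff order_trans)
  then show "in_K_surj C" using C unfolding in_K_surj_def by blast
qed

definition relabel :: "('x \<Rightarrow> 'y) \<Rightarrow> ('y \<Rightarrow> 'x) \<Rightarrow> ('f, 'x) ualg \<Rightarrow> ('f, 'y) ualg" where
  "relabel \<phi> \<psi> X = \<lparr>syms = syms X, arity = arity X, univ = \<phi> ` univ X,
     interp = (\<lambda>f ys. \<phi> (interp X f (map \<psi> ys)))\<rparr>"

context
  fixes X :: "('f, 'x) ualg" and \<phi> :: "'x \<Rightarrow> 'y" and \<psi> :: "'y \<Rightarrow> 'x"
  assumes ualg_X: "is_ualg X" and \<psi>\<phi>: "\<And>x. x \<in> univ X \<Longrightarrow> \<psi> (\<phi> x) = x"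
begin

lemma relabel_interp_closed:
  assumes "f \<in> syms X" "ys \<in> tuples (\<phi> ` univ X) (arity X f)"
  shows "interp X f (map \<psi> ys) \<in> univ X"
proof -
  have "map \<psi> ys \<in> tuples (univ X) (arity X f)" using assms(2) by (rule tuples_map) (auto simp: \<psi>\<phi>)
  then show ?thesis using ualg_X assms(1) by (simp add: is_ualg_def)
qed

lemma is_ualg_relabel: "is_ualg (relabel \<phi> \<psi> X)"
  using ualg_X relabel_interp_closed by (auto simp: is_ualg_def relabel_def)

lemma surj_hom_relabel:
  assumes h: "h \<in> surj_homs X C"
  shows "restrict (h \<circ> \<psi>) (\<phi> ` univ X) \<in> surj_homs (relabel \<phi> \<psi> X) C"
proof -
  have "restrict (h \<circ> \<psi>) (univ (relabel \<phi> \<psi> X)) \<in> surj_homs (relabel \<phi> \<psi> X) C"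
  proof (rule restrict_in_surj_homsI[OF is_ualg_relabel])
    show "(h \<circ> \<psi>) ` univ (relabel \<phi> \<psi> X) = univ C"
      using surj_homsD(3)[OF h] by (force simp: relabel_def \<psi>\<phi>)
    fix f ys assume "f \<in> syms (relabel \<phi> \<psi> X)"
      "ys \<in> tuples (univ (relabel \<phi> \<psi> X)) (arity (relabel \<phi> \<psi> X) f)"
    then have f: "f \<in> syms X" "ys \<in> tuples (\<phi> ` univ X) (arity X f)" by (simp_all add: relabel_def)
    then have "map \<psi> ys \<in> tuples (univ X) (arity X f)" by (auto intro!: tuples_map simp: \<psi>\<phi>)
    then show "(h \<circ> \<psi>) (interp (relabel \<phi> \<psi> X) f ys) = interp C f (map (h \<circ> \<psi>) ys)"
      using surj_homsD(4)[OF h f(1)] relabel_interp_closed[OF f] by (simp add: relabel_def \<psi>\<phi>)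
  qed
  then show ?thesis by (simp add: relabel_def)
qed

lemma card_surj_homs_relabel:
  assumes "finite (univ X)" "finite (univ C)"
  shows "card (surj_homs X C) \<le> card (surj_homs (relabel \<phi> \<psi> X) C)"
proof (rule card_inj_on_le)
  let ?t = "\<lambda>h. restrict (h \<circ> \<psi>) (\<phi> ` univ X)"
  show "?t ` surj_homs X C \<subseteq> surj_homs (relabel \<phi> \<psi> X) C" using surj_hom_relabel by blast
  show "inj_on ?t (surj_homs X C)"
  proof (rule inj_onI)
    fix h h' assume h: "h \<in> surj_homs X C" "h' \<in> surj_homs X C" and eq: "?t h = ?t h'"
    show "h = h'"
    proof (rule surj_homs_eqI[OF h])
      fix x assume "x \<in> univ X"
      then show "h x = h' x" using fun_cong[OF eq, of "\<phi> x"] by (simp add: \<psi>\<phi>)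
    qed
  qed
  show "finite (surj_homs (relabel \<phi> \<psi> X) C)"
    using assms by (intro finite_surj_homs) (simp_all add: relabel_def)
qed

end

lemma surj_bound_any_universe:
  fixes X :: "('f, 'x) ualg"
  assumes "surj_bound C b" "finite (univ C)" and X: "is_ualg X" "finite (univ X)" "same_signature X C"
  shows "card (surj_homs X C) \<le> b (card (univ X))"
proof -
  obtain \<phi> :: "'x \<Rightarrow> nat" where inj: "inj_on \<phi> (univ X)"
    using finite_imp_inj_to_nat_seg[OF X(2)] by blast
  define \<psi> where "\<psi> = the_inv_into (univ X) \<phi>"
  have inverse: "\<psi> (\<phi> x) = x" if "x \<in> univ X" for x
    unfolding \<psi>_def by (rule the_inv_into_f_f[OF inj that])
  let ?Y = "relabel \<phi> \<psi> X"
  have "card (surj_homs X C) \<le> card (surj_homs ?Y C)"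
    by (rule card_surj_homs_relabel) (use X inverse assms(2) in auto)
  also have "\<dots> \<le> b (card (univ ?Y))"
  proof -
    have "is_ualg ?Y" by (rule is_ualg_relabel) (use X inverse in auto)
    moreover have "finite (univ ?Y)" "same_signature ?Y C"
      using X(2,3) by (simp_all add: relabel_def same_signature_def)
    ultimately show ?thesis using assms(1) unfolding surj_bound_def by blast
  qed
  also have "card (univ ?Y) = card (univ X)" using inj by (simp add: relabel_def card_image)
  finally show ?thesis .
qed

section \<open>Type 1 gives exponentially many homomorphisms\<close>

context three_minimal
begin

lemma separate_into_trace:
  assumes N: "trace A \<alpha> N" and cd: "(c, d) \<in> \<alpha>" "c \<noteq> d"
  obtains u where "pol1 A u" "\<And>w. (c, w) \<in> \<alpha> \<Longrightarrow> u w \<in> N" "u c \<noteq> u d"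
proof -
  obtain U a where U: "minimal_set A \<alpha> U" "N = \<alpha> `` {a} \<inter> U" "U \<subseteq> univ A"
    by (rule traceE[OF N], rule that)
  obtain e where e: "pol1 A e" "\<And>x. x \<in> univ A \<Longrightarrow> e x \<in> U" "\<And>x. x \<in> U \<Longrightarrow> e x = x"
    by (rule retraction[OF U(1)], rule that)
  obtain b b' where b: "b \<in> N" "b' \<in> N" "b \<noteq> b'"
    using trace_card[OF N] by (metis One_nat_def card_le_Suc0_iff_eq card.infinite not_less_eq_eq
        numeral_2_eq_2 zero_le)
  then have "e b \<noteq> e b'" using e(3) U(2) by auto
  then obtain r where r: "pol1 A r" "e (r c) \<noteq> e (r d)"
    using separate[OF trace_rel[OF N b(1,2)] _ cd] by blast
  let ?u = "\<lambda>z. e (r z)"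
  have u: "pol1 A ?u" by (rule pol1_comp[OF e(1) r(1)])
  have image: "?u w \<in> \<alpha> `` {?u c} \<inter> U" if "(c, w) \<in> \<alpha>" for w
    using congruence_pol1[OF cong u that] e(2) pol1_closed[OF r(1)] alpha_univ[OF that] by simp
  have "{?u c, ?u d} \<subseteq> \<alpha> `` {?u c} \<inter> U" using image cd(1) alpha_refl alpha_univ by blast
  moreover have "card {?u c, ?u d} = 2" using r(2) by simp
  moreover have "finite (\<alpha> `` {?u c} \<inter> U)" using U(3) finite_univ finite_subset by blast
  ultimately have "card (\<alpha> `` {?u c} \<inter> U) \<ge> 2" by (metis card_mono)
  then have "\<alpha> `` {?u c} = \<alpha> `` {a}"
    using large_class_unique[OF U(3)] trace_card[OF N] U(2) by blast
  then show ?thesis using that[OF u] image r(2) U(2) by blast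
qed

lemma separate_first_argument:
  assumes N: "trace A \<alpha> N" and ess: "ess_unary (induced A N)" and p: "pol2 A p"
    and xy: "x \<in> N" "x' \<in> N" "y \<in> N" "p x y \<noteq> p x' y"
  obtains u :: "'a \<Rightarrow> 'a" where "\<forall>s\<in>N. \<forall>t\<in>N. \<forall>t'\<in>N. u (p s t) = u (p s t')"
    "u (p x y) \<noteq> u (p x' y)"
proof -
  have sub: "N \<subseteq> univ A" "N \<noteq> {}" using traceE[OF N] by blast+
  have related: "(p x y, p s t) \<in> \<alpha>" if "s \<in> N" "t \<in> N" for s t
    by (rule congruence_pol2[OF cong p]) (use that xy trace_rel[OF N] in auto)
  obtain u where u: "pol1 A u" "\<And>w. (p x y, w) \<in> \<alpha> \<Longrightarrow> u w \<in> N" "u (p x y) \<noteq> u (p x' y)"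
    by (rule separate_into_trace[OF N related[OF xy(2,3)] xy(4)], rule that)
  have "pol (induced A N) 2 (\<lambda>xs. u (p (xs ! 0) (xs ! 1)))"
    by (rule pol_inducedI[OF sub pol_pol1[OF u(1) p]]) (use u(2) related in \<open>auto simp: tuples_two\<close>)
  then have "ess_unary_on N 2 (\<lambda>xs. u (p (xs ! 0) (xs ! 1)))" using ess by (simp add: ess_unary_def)
  then have "\<forall>s\<in>N. \<forall>t\<in>N. \<forall>t'\<in>N. u (p s t) = u (p s t')"
    using u(3) xy unfolding ess_unary_on_two by auto
  then show ?thesis using u(3) by (rule that)
qed

lemma pol2_ess_unary_on_trace:
  assumes N: "trace A \<alpha> N" and ess: "ess_unary (induced A N)" and p: "pol2 A p"
  shows "ess_unary_on N 2 (\<lambda>xs. p (xs ! 0) (xs ! 1))"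
proof (rule ccontr)
  assume not_unary: "\<not> ess_unary_on N 2 (\<lambda>xs. p (xs ! 0) (xs ! 1))"
  obtain x x' y where x: "x \<in> N" "x' \<in> N" "y \<in> N" "p x y \<noteq> p x' y"
    using not_unary unfolding ess_unary_on_two by auto
  obtain z w w' where w: "w \<in> N" "w' \<in> N" "z \<in> N" "p z w \<noteq> p z w'"
    using not_unary unfolding ess_unary_on_two by auto
  obtain u :: "'a \<Rightarrow> 'a" where u: "\<forall>s\<in>N. \<forall>t\<in>N. \<forall>t'\<in>N. u (p s t) = u (p s t')"
    "u (p x y) \<noteq> u (p x' y)"
    by (rule separate_first_argument[OF N ess p x])
  obtain v :: "'a \<Rightarrow> 'a" where v: "\<forall>t\<in>N. \<forall>s\<in>N. \<forall>s'\<in>N. v (p s t) = v (p s' t)"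
    "v (p z w) \<noteq> v (p z w')"
    by (rule separate_first_argument[OF N ess pol2_flip[OF p] w])
  have "u (p x t) \<noteq> u (p x' t')" if "t \<in> N" "t' \<in> N" for t t'
    using u x that by metis
  moreover have "v (p s w) \<noteq> v (p s' w')" if "s \<in> N" "s' \<in> N" for s s'
    using v w that by metis
  ultimately have "p x w \<noteq> p x' w" "p x w \<noteq> p x' w'" "p x w' \<noteq> p x' w" "p x w' \<noteq> p x' w'"
    "p x w \<noteq> p x w'" "p x' w \<noteq> p x' w'" using x w by metis+
  then have "card {p x w, p x' w, p x w', p x' w'} = 4" by auto
  moreover have "N \<subseteq> univ A" using traceE[OF N] by blast
  then have "{p x w, p x' w, p x w', p x' w'} \<subseteq> univ A" using x w pol2_closed[OF p] by auto
  ultimately show False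
    using card_mono[OF finite_univ, of "{p x w, p x' w, p x w', p x' w'}"] three by simp
qed

lemma pol_ess_unary_on_trace:
  assumes N: "trace A \<alpha> N" and "ess_unary (induced A N)" and F: "pol A k F"
  shows "ess_unary_on N k F"
proof (rule ess_unary_onI)
  have sub: "N \<subseteq> univ A" using traceE[OF N] by blast
  fix zs i j assume "zs \<in> tuples N k"
  then have "pol2 A (\<lambda>x y. F (zs[i := x, j := y]))"
    by (intro pol_update2[OF F tuples_mono[OF sub]] pol_proj) auto
  then show "ess_unary_on N 2 (\<lambda>xs. F (zs[i := xs ! 0, j := xs ! 1]))"
    by (rule pol2_ess_unary_on_trace[OF assms(1,2)])
qed

end

context finite_ualg
begin

definition restricted_pols :: "'a set \<Rightarrow> nat \<Rightarrow> ('f, 'a list \<Rightarrow> 'a) ualg" where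
  "restricted_pols N k = \<lparr>syms = syms A, arity = arity A,
     univ = {restrict F (tuples N k) | F. pol A k F},
     interp = (\<lambda>f Fs. restrict (\<lambda>xs. interp A f (map (\<lambda>F. F xs) Fs)) (tuples N k))\<rparr>"

lemma restrict_in_restricted_pols: "pol A k F \<Longrightarrow> restrict F (tuples N k) \<in> univ (restricted_pols N k)"
  by (auto simp: restricted_pols_def)

lemma is_ualg_restricted_pols: "is_ualg (restricted_pols N k)"
  unfolding is_ualg_def
proof (intro conjI ballI)
  obtain z where "z \<in> univ A" by (rule ex_element)
  then show "univ (restricted_pols N k) \<noteq> {}"
    using restrict_in_restricted_pols[OF pol_const] by blast
next
  fix f Fs assume f: "f \<in> syms (restricted_pols N k)"
    and Fs: "Fs \<in> tuples (univ (restricted_pols N k)) (arity (restricted_pols N k) f)"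
  have "\<exists>G. pol A k G \<and> Fs ! i = restrict G (tuples N k)" if "i < arity A f" for i
    using tuples_nth[OF Fs] that by (auto simp: restricted_pols_def)
  then obtain G where G: "\<And>i. i < arity A f \<Longrightarrow> pol A k (G i) \<and> Fs ! i = restrict (G i) (tuples N k)"
    by metis
  let ?H = "\<lambda>xs. interp A f (map (\<lambda>i. G i xs) [0..<arity A f])"
  have "map (\<lambda>F. F xs) Fs = map (\<lambda>i. G i xs) [0..<arity A f]" if "xs \<in> tuples N k" for xs
    by (rule nth_equalityI) (use tuples_length[OF Fs] G that in \<open>auto simp: restricted_pols_def\<close>)
  then have "interp (restricted_pols N k) f Fs = restrict ?H (tuples N k)"
    unfolding restricted_pols_def by (auto intro!: restrict_ext arg_cong[where f = "interp A f"])
  moreover have "pol A k ?H" using f G by (intro pol_app) (auto simp: restricted_pols_def)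
  ultimately show "interp (restricted_pols N k) f Fs \<in> univ (restricted_pols N k)"
    using restrict_in_restricted_pols by metis
qed

lemma finite_restricted_pols:
  assumes "N \<subseteq> univ A"
  shows "finite (univ (restricted_pols N k))"
proof (rule finite_subset)
  show "univ (restricted_pols N k) \<subseteq> tuples N k \<rightarrow>\<^sub>E univ A"
    using pol_closed tuples_mono[OF assms] by (auto simp: restricted_pols_def)
  have "finite (tuples N k)"
    using finite_lists_length_eq[OF finite_subset[OF assms finite_univ], of k]
    by (simp add: tuples_def conj_commute)
  then show "finite (tuples N k \<rightarrow>\<^sub>E univ A)" using finite_univ by (intro finite_PiE) auto
qed

lemma card_restricted_pols_ess_unary:
  assumes N: "N \<subseteq> univ A" and "k > 0" and ess: "\<And>F. pol A k F \<Longrightarrow> ess_unary_on N k F"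
  shows "card (univ (restricted_pols N k)) \<le> k * card (univ A) ^ card N"
proof -
  have finN: "finite N" using N finite_univ finite_subset by blast
  let ?unary = "\<lambda>(i, g). restrict (\<lambda>xs. g (xs ! i)) (tuples N k)"
  let ?codes = "{..<k} \<times> (N \<rightarrow>\<^sub>E univ A)"
  have "univ (restricted_pols N k) \<subseteq> ?unary ` ?codes"
  proof
    fix R assume "R \<in> univ (restricted_pols N k)"
    then obtain F where F: "pol A k F" "R = restrict F (tuples N k)" by (auto simp: restricted_pols_def)
    obtain i g where i: "i < k" and g: "\<And>xs. xs \<in> tuples N k \<Longrightarrow> F xs = g (xs ! i)"
      using ess_unary_on_unary[OF ess[OF F(1)] \<open>k > 0\<close>] by blast
    have "g x \<in> univ A" if "x \<in> N" for x
      using pol_closed[OF F(1) tuples_mono[OF N tuples_replicate[OF that]]]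
        g[OF tuples_replicate[OF that]] i by simp
    then have "restrict g N \<in> N \<rightarrow>\<^sub>E univ A" by auto
    moreover have "R = ?unary (i, restrict g N)"
      unfolding F(2) using g i by (auto intro!: restrict_ext simp: tuples_nth)
    ultimately show "R \<in> ?unary ` ?codes" using i by blast
  qed
  moreover have "finite ?codes" using finN finite_univ by (intro finite_cartesian_product finite_PiE) auto
  ultimately have "card (univ (restricted_pols N k)) \<le> card ?codes" by (rule surj_card_le[rotated])
  then show ?thesis using finN by (simp add: card_cartesian_product card_PiE)
qed

lemma evaluation_surj_hom:
  assumes N: "N \<subseteq> univ A" and z: "z \<in> tuples N k"
  shows "restrict (\<lambda>F. F z) (univ (restricted_pols N k)) \<in> surj_homs (restricted_pols N k) A"
proof (rule restrict_in_surj_homsI[OF is_ualg_restricted_pols])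
  show "(\<lambda>F. F z) ` univ (restricted_pols N k) = univ A"
  proof (intro equalityI subsetI)
    fix c assume "c \<in> univ A"
    then show "c \<in> (\<lambda>F. F z) ` univ (restricted_pols N k)"
      using z by (intro image_eqI[OF _ restrict_in_restricted_pols[OF pol_const]]) simp_all
  qed (use z pol_closed tuples_mono[OF N z] in \<open>auto simp: restricted_pols_def\<close>)
qed (use z in \<open>simp add: restricted_pols_def\<close>)

lemma card_surj_homs_restricted_pols:
  assumes N: "N \<subseteq> univ A"
  shows "card N ^ k \<le> card (surj_homs (restricted_pols N k) A)"
proof -
  let ?X = "restricted_pols N k"
  let ?ev = "\<lambda>z. restrict (\<lambda>F. F z) (univ ?X)"
  have "inj_on ?ev (tuples N k)"
  proof (rule inj_onI)
    fix z z' assume z: "z \<in> tuples N k" "z' \<in> tuples N k" and eq: "?ev z = ?ev z'"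
    show "z = z'"
    proof (rule nth_equalityI)
      fix i assume "i < length z"
      then have "pol A k (\<lambda>xs. xs ! i)" using z by (intro pol_proj) (simp add: tuples_length)
      from fun_cong[OF eq, of "restrict (\<lambda>xs. xs ! i) (tuples N k)"] restrict_in_restricted_pols[OF this]
      show "z ! i = z' ! i" using z by simp
    qed (use z in \<open>simp add: tuples_length\<close>)
  qed
  then have "card (tuples N k) \<le> card (surj_homs ?X A)"
    by (rule card_inj_on_le)
      (use evaluation_surj_hom[OF N] finite_surj_homs[OF finite_restricted_pols[OF N] finite_univ] in auto)
  then show ?thesis using card_tuples[OF finite_subset[OF N finite_univ]] by simp
qed

end

theorem (in three_minimal) type_1_not_in_K_surj:
  assumes "tct_type A \<alpha> = 1"
  shows "\<not> in_K_surj A"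
proof
  assume "in_K_surj A"
  then obtain b' where "poly_bounded b'" "surj_bound A b'" unfolding in_K_surj_iff by blast
  then obtain b where b: "poly_bounded b" "mono b" "surj_bound A b"
    using poly_bounded_monotone_bound surj_bound_mono by metis
  obtain N where N: "trace A \<alpha> N" by (rule ex_trace)
  have sub: "N \<subseteq> univ A" using traceE[OF N] by blast
  have "ess_unary (induced A N)" using assms tct_type_eq_1_iff[OF N] by blast
  note ess = pol_ess_unary_on_trace[OF N this]
  obtain k where k: "k > 0" "b (27 * k) < 2 ^ k"
    using poly_bounded_less_power[OF poly_bounded_scale[OF b(1)]] by blast
  have "card (univ A) ^ card N \<le> 3 ^ 3"
    unfolding three using card_mono[OF finite_univ sub] three by (intro power_increasing) auto
  then have "k * card (univ A) ^ card N \<le> 27 * k" by simp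
  then have card: "card (univ (restricted_pols N k)) \<le> 27 * k"
    using card_restricted_pols_ess_unary[OF sub k(1) ess] by linarith
  have "2 ^ k \<le> card N ^ k" using trace_card[OF N] by (rule power_mono) simp
  also have "\<dots> \<le> card (surj_homs (restricted_pols N k) A)" by (rule card_surj_homs_restricted_pols[OF sub])
  also have "\<dots> \<le> b (card (univ (restricted_pols N k)))"
    by (rule surj_bound_any_universe[OF b(3) finite_univ is_ualg_restricted_pols finite_restricted_pols[OF sub]])
      (simp add: same_signature_def restricted_pols_def)
  also have "\<dots> \<le> b (27 * k)" using b(2) card by (rule monoD)
  finally show False using k(2) by simp
qed

section \<open>Counting homomorphisms\<close>

lemma card_image_le_if_determined:
  assumes "\<And>h h'. h \<in> H \<Longrightarrow> h' \<in> H \<Longrightarrow> k h = k h' \<Longrightarrow> r h = r h'" "k ` H \<subseteq> S" "finite S"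
  shows "card (r ` H) \<le> card S"
proof -
  have "r h = r (inv_into H k (k h))" if "h \<in> H" for h
    using assms(1)[OF that, of "inv_into H k (k h)"] that by (simp add: f_inv_into_f inv_into_into)
  then have "r ` H = (\<lambda>s. r (inv_into H k s)) ` (k ` H)" by (force simp: image_image)
  then have "card (r ` H) \<le> card (k ` H)" using card_image_le assms(2,3) finite_subset by metis
  also have "\<dots> \<le> card S" using assms card_mono by blast
  finally show ?thesis .
qed

lemma card_le_fibers:
  assumes "finite H" "card (k ` H) \<le> a" "\<And>h. h \<in> H \<Longrightarrow> card {h' \<in> H. k h' = k h} \<le> b"
  shows "card H \<le> a * b"
proof -
  have "H = (\<Union>v\<in>k ` H. {h \<in> H. k h = v})" by auto
  then have "card H \<le> (\<Sum>v\<in>k ` H. card {h \<in> H. k h = v})"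
    using card_UN_le[of "k ` H" "\<lambda>v. {h \<in> H. k h = v}"] assms(1) by simp
  also have "\<dots> \<le> card (k ` H) * b"
    using sum_bounded_above[of "k ` H" "\<lambda>v. card {h \<in> H. k h = v}" b] assms(3) by auto
  also have "\<dots> \<le> a * b" using assms(2) by simp
  finally show ?thesis .
qed

lemma ex_meet_of_subset:
  assumes "finite F" "F \<noteq> {}" "F \<subseteq> Y"
    and closed: "\<And>x y. x \<in> Y \<Longrightarrow> y \<in> Y \<Longrightarrow> G x y \<in> Y"
    and hom: "\<And>h x y. h \<in> H \<Longrightarrow> x \<in> Y \<Longrightarrow> y \<in> Y \<Longrightarrow> h (G x y) = e \<longleftrightarrow> h x = e \<and> h y = e"
  shows "\<exists>m\<in>Y. \<forall>h\<in>H. h m = e \<longleftrightarrow> (\<forall>y\<in>F. h y = e)"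
  using assms(1-3)
proof (induction rule: finite_ne_induct)
  case (insert x F)
  then obtain m where "m \<in> Y" "\<forall>h\<in>H. h m = e \<longleftrightarrow> (\<forall>y\<in>F. h y = e)" by auto
  then show ?case using insert.prems closed hom by (intro bexI[of _ "G x m"]) auto
qed auto

text \<open>A homomorphism onto the two-element semilattice is determined by the meet of all points that
  it maps to the top.\<close>

lemma card_semilattice_homs_le:
  assumes "finite Y" and closed: "\<And>x y. x \<in> Y \<Longrightarrow> y \<in> Y \<Longrightarrow> G x y \<in> Y"
    and range: "\<And>h y. h \<in> H \<Longrightarrow> y \<in> Y \<Longrightarrow> h y \<in> {e, d}"
    and hom: "\<And>h x y. h \<in> H \<Longrightarrow> x \<in> Y \<Longrightarrow> y \<in> Y \<Longrightarrow> h (G x y) = e \<longleftrightarrow> h x = e \<and> h y = e"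
  shows "card ((\<lambda>h. restrict h Y) ` H) \<le> card Y + 1"
proof -
  define top where "top h = {y \<in> Y. h y = e}" for h
  have top_sub: "top h \<subseteq> Y" for h by (auto simp: top_def)
  have "\<exists>m\<in>Y. \<forall>h\<in>H. h m = e \<longleftrightarrow> (\<forall>y\<in>F. h y = e)" if "F \<subseteq> Y" "F \<noteq> {}" for F
    using ex_meet_of_subset[OF finite_subset[OF that(1) assms(1)] that(2,1) closed hom] by blast
  then obtain m where m: "\<And>F. F \<subseteq> Y \<Longrightarrow> F \<noteq> {} \<Longrightarrow> m F \<in> Y"
    "\<And>F h. F \<subseteq> Y \<Longrightarrow> F \<noteq> {} \<Longrightarrow> h \<in> H \<Longrightarrow> h (m F) = e \<longleftrightarrow> (\<forall>y\<in>F. h y = e)"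
    by metis
  let ?key = "\<lambda>h. if top h = {} then None else Some (m (top h))"
  have top_mono: "top h \<subseteq> top h'" if "h \<in> H" "h' \<in> H" "?key h = ?key h'" for h h'
  proof (cases "top h = {}")
    case False
    then have "top h' \<noteq> {}" "m (top h) = m (top h')" using that(3) by (auto split: if_splits)
    moreover have "h' (m (top h')) = e" using m(2)[OF top_sub \<open>top h' \<noteq> {}\<close> that(2)] by (auto simp: top_def)
    ultimately show ?thesis using m(2)[OF top_sub False that(2)] by (auto simp: top_def)
  qed simp
  have "card ((\<lambda>h. restrict h Y) ` H) \<le> card (insert None (Some ` Y))"
  proof (rule card_image_le_if_determined[where k = ?key])
    fix h h' assume h: "h \<in> H" "h' \<in> H" and key: "?key h = ?key h'"
    have "top h = top h'" using top_mono[OF h key] top_mono[OF h(2,1) key[symmetric]] by blast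
    then have "h y = e \<longleftrightarrow> h' y = e" if "y \<in> Y" for y using that by (auto simp: top_def)
    then have "h y = h' y" if "y \<in> Y" for y using range[OF h(1) that] range[OF h(2) that] that by auto
    then show "restrict h Y = restrict h' Y" by (intro restrict_ext) auto
  next
    show "?key ` H \<subseteq> insert None (Some ` Y)" using m(1)[OF top_sub] by auto
  qed (use assms in simp)
  also have "\<dots> \<le> card Y + 1"
    using card_insert_le_m1[of "card Y + 1" "Some ` Y" None] card_image[of Some Y] by simp
  finally show ?thesis .
qed

locale additive_homs =
  fixes Y :: "'x set" and G :: "'x \<Rightarrow> 'x \<Rightarrow> 'x" and z :: 'x
    and B :: "'b set" and \<phi> :: "'b \<Rightarrow> nat" and q :: nat and H :: "('x \<Rightarrow> 'b) set"
  assumes finite_Y: "finite Y" and finite_B: "finite B"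
    and zero: "z \<in> Y" "h \<in> H \<Longrightarrow> \<phi> (h z) = 0"
    and closed: "x \<in> Y \<Longrightarrow> y \<in> Y \<Longrightarrow> G x y \<in> Y"
    and range: "h \<in> H \<Longrightarrow> y \<in> Y \<Longrightarrow> h y \<in> B"
    and label: "inj_on \<phi> B" "b \<in> B \<Longrightarrow> \<phi> b < q"
    and hom: "h \<in> H \<Longrightarrow> x \<in> Y \<Longrightarrow> y \<in> Y \<Longrightarrow> \<phi> (h (G x y)) = (\<phi> (h x) + \<phi> (h y)) mod q"
begin

lemma ex_subset_sum:
  assumes "J \<subseteq> Y"
  shows "\<exists>m\<in>Y. \<forall>h\<in>H. \<phi> (h m) = (\<Sum>x\<in>J. \<phi> (h x)) mod q"
proof -
  have "finite J" using assms finite_Y finite_subset by blast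
  then show ?thesis using assms
  proof (induction rule: finite_induct)
    case empty
    then show ?case using zero by (intro bexI[of _ z]) auto
  next
    case (insert x J)
    then obtain m where m: "m \<in> Y" "\<forall>h\<in>H. \<phi> (h m) = (\<Sum>x\<in>J. \<phi> (h x)) mod q" by auto
    have x: "x \<in> Y" using insert.prems by simp
    have "\<phi> (h (G x m)) = (\<Sum>x\<in>insert x J. \<phi> (h x)) mod q" if "h \<in> H" for h
      using hom[OF that x m(1)] bspec[OF m(2) that] insert.hyps by (simp add: mod_add_right_eq)
    then show ?case using closed[OF x m(1)] by (intro bexI[of _ "G x m"]) auto
  qed
qed

definition determining :: "'x set \<Rightarrow> bool" where
  "determining I \<longleftrightarrow> I \<subseteq> Y \<and> (\<forall>h\<in>H. \<forall>h'\<in>H. (\<forall>x\<in>I. h x = h' x) \<longrightarrow> (\<forall>y\<in>Y. h y = h' y))"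

lemma determined_by_equal_sums:
  assumes J: "J \<subseteq> Y" "J' \<subseteq> Y" "y \<in> J" "y \<notin> J'"
    and sums: "\<And>h. h \<in> H \<Longrightarrow> (\<Sum>x\<in>J. \<phi> (h x)) mod q = (\<Sum>x\<in>J'. \<phi> (h x)) mod q"
    and h: "h \<in> H" "h' \<in> H" and agree: "\<And>x. x \<in> J \<union> J' - {y} \<Longrightarrow> h x = h' x"
  shows "h y = h' y"
proof -
  have "finite J" using J finite_Y finite_subset by blast
  then have split: "(\<phi> (g y) + (\<Sum>x\<in>J - {y}. \<phi> (g x))) mod q = (\<Sum>x\<in>J'. \<phi> (g x)) mod q" if "g \<in> H" for g
    using sums[OF that] J(3) by (simp add: sum.remove)
  have "h x = h' x" if "x \<in> J - {y} \<or> x \<in> J'" for x using agree that J(4) by blast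
  then have "(\<Sum>x\<in>J - {y}. \<phi> (h x)) = (\<Sum>x\<in>J - {y}. \<phi> (h' x))" "(\<Sum>x\<in>J'. \<phi> (h x)) = (\<Sum>x\<in>J'. \<phi> (h' x))"
    by simp_all
  then have "(\<phi> (h y) + (\<Sum>x\<in>J - {y}. \<phi> (h x))) mod q = (\<phi> (h' y) + (\<Sum>x\<in>J - {y}. \<phi> (h x))) mod q"
    using split[OF h(1)] split[OF h(2)] by simp
  then have "\<phi> (h y) mod q = \<phi> (h' y) mod q"
    using mod_sum_cancel[of "\<phi> (h y)" "\<Sum>x\<in>J - {y}. \<phi> (h x)" q "\<Sum>x\<in>J - {y}. \<phi> (h x)" "\<phi> (h' y)" 0]
    by (simp add: add.commute)
  moreover have "h y \<in> B" "h' y \<in> B" using range h J by blast+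
  ultimately show ?thesis using label by (simp add: inj_on_eq_iff)
qed

lemma subset_sums_of_minimal_determining:
  assumes I: "determining I" and minimal: "\<And>I'. determining I' \<Longrightarrow> I' \<subseteq> I \<Longrightarrow> I' = I"
    and J: "J \<subseteq> I" "J' \<subseteq> I"
    and sums: "\<And>h. h \<in> H \<Longrightarrow> (\<Sum>x\<in>J. \<phi> (h x)) mod q = (\<Sum>x\<in>J'. \<phi> (h x)) mod q"
  shows "J \<subseteq> J'"
proof (rule ccontr)
  assume "\<not> J \<subseteq> J'"
  then obtain y where y: "y \<in> J" "y \<notin> J'" by blast
  have IY: "I \<subseteq> Y" using I by (simp add: determining_def)
  have "\<forall>x\<in>I. h x = h' x" if h: "h \<in> H" "h' \<in> H" and agree: "\<forall>x\<in>I - {y}. h x = h' x" for h h'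
  proof -
    have "h y = h' y"
      by (rule determined_by_equal_sums[OF _ _ y sums h]) (use J IY agree in auto)
    then show ?thesis using agree by blast
  qed
  then have "determining (I - {y})" using I unfolding determining_def by blast
  then show False using minimal y(1) J(1) by blast
qed

lemma card_minimal_determining_le:
  assumes I: "determining I" and minimal: "\<And>I'. determining I' \<Longrightarrow> I' \<subseteq> I \<Longrightarrow> I' = I"
  shows "2 ^ card I \<le> card Y"
proof -
  have IY: "I \<subseteq> Y" using I by (simp add: determining_def)
  obtain m where m: "\<And>J. J \<subseteq> I \<Longrightarrow> m J \<in> Y"
    "\<And>J h. J \<subseteq> I \<Longrightarrow> h \<in> H \<Longrightarrow> \<phi> (h (m J)) = (\<Sum>x\<in>J. \<phi> (h x)) mod q"
    using ex_subset_sum IY by (metis order_trans)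
  have "J \<subseteq> J'" if J: "J \<subseteq> I" "J' \<subseteq> I" and eq: "m J = m J'" for J J'
    by (rule subset_sums_of_minimal_determining[OF I minimal J])
      (use m(2)[OF J(1)] m(2)[OF J(2)] eq in auto)
  then have "inj_on m (Pow I)" by (metis PowD inj_onI subset_antisym)
  then have "card (Pow I) \<le> card Y" by (rule card_inj_on_le) (use m finite_Y in auto)
  moreover have "finite I" using IY finite_Y finite_subset by blast
  ultimately show ?thesis by (simp add: card_Pow)
qed

lemma card_additive_homs_le:
  assumes "card B \<le> 2 ^ m"
  shows "card ((\<lambda>h. restrict h Y) ` H) \<le> card Y ^ m"
proof -
  have "finite {I. determining I}"
    by (rule finite_subset[of _ "Pow Y"]) (use finite_Y in \<open>auto simp: determining_def\<close>)
  moreover have "determining Y" by (auto simp: determining_def)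
  ultimately obtain I where I: "determining I" and minimal: "\<And>I'. determining I' \<Longrightarrow> I' \<subseteq> I \<Longrightarrow> I' = I"
    using finite_has_minimal[of "{I. determining I}"] by (metis empty_iff mem_Collect_eq)
  have IY: "I \<subseteq> Y" using I by (simp add: determining_def)
  then have "finite I" using finite_Y finite_subset by blast
  have "card ((\<lambda>h. restrict h Y) ` H) \<le> card (I \<rightarrow>\<^sub>E B)"
  proof (rule card_image_le_if_determined[where k = "\<lambda>h. restrict h I"])
    fix h h' assume h: "h \<in> H" "h' \<in> H" "restrict h I = restrict h' I"
    then have "\<forall>x\<in>I. h x = h' x" by (metis restrict_apply')
    then have "\<forall>y\<in>Y. h y = h' y" using I h(1,2) unfolding determining_def by blast
    then show "restrict h Y = restrict h' Y" by (intro restrict_ext) auto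
  qed (use range IY \<open>finite I\<close> finite_B in \<open>auto intro: finite_PiE\<close>)
  also have "\<dots> = card B ^ card I" using \<open>finite I\<close> by (simp add: card_PiE)
  also have "\<dots> \<le> (2 ^ m) ^ card I" using assms by (rule power_mono) simp
  also have "\<dots> = (2 ^ card I) ^ m" by (simp add: mult.commute flip: power_mult)
  also have "\<dots> \<le> card Y ^ m" by (intro power_mono card_minimal_determining_le[OF I minimal]) auto
  finally show ?thesis .
qed

end

lemma card_unital_homs_le:
  assumes fin: "finite Y" and z: "z \<in> Y" "\<And>h. h \<in> H \<Longrightarrow> h z = e"
    and closed: "\<And>x y. x \<in> Y \<Longrightarrow> y \<in> Y \<Longrightarrow> G x y \<in> Y"
    and range: "\<And>h y. h \<in> H \<Longrightarrow> y \<in> Y \<Longrightarrow> h y \<in> {e, d}"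
    and hom: "\<And>h x y. h \<in> H \<Longrightarrow> x \<in> Y \<Longrightarrow> y \<in> Y \<Longrightarrow> h (G x y) = g (h x) (h y)"
    and g: "e \<noteq> d" "g e e = e" "g e d = d" "g d e = d" "g d d \<in> {e, d}"
  shows "card ((\<lambda>h. restrict h Y) ` H) \<le> card Y + 1"
proof (cases "g d d = d")
  case True
  show ?thesis
  proof (rule card_semilattice_homs_le[where G = G and e = e and d = d])
    fix h x y assume h: "h \<in> H" "x \<in> Y" "y \<in> Y"
    show "h (G x y) = e \<longleftrightarrow> h x = e \<and> h y = e"
      using hom[OF h] range[OF h(1,2)] range[OF h(1,3)] g(1-4) True by auto
  qed (use fin closed range in auto)
next
  case False
  let ?label = "\<lambda>b. if b = e then 0 else (1::nat)"
  interpret additive_homs Y G z "{e, d}" ?label 2 H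
  proof unfold_locales
    fix h x y assume h: "h \<in> H" "x \<in> Y" "y \<in> Y"
    show "?label (h (G x y)) = (?label (h x) + ?label (h y)) mod 2"
      using hom[OF h] range[OF h(1,2)] range[OF h(1,3)] g False by auto
  qed (use fin z closed range in \<open>auto simp: inj_on_def\<close>)
  show ?thesis using card_additive_homs_le[of 1] g(1) by simp
qed

lemma (in two_element_ualg) ex_unital_pol2:
  assumes "\<not> ess_unary A"
  obtains e d g where "univ A = {e, d}" "e \<noteq> d" "pol2 A g" "g e e = e" "g e d = d" "g d e = d"
proof (cases "term_condition A")
  case False
  then obtain u v where uv: "univ A = {u, v}" "u \<noteq> v" "has_meet A u v"
    by (rule meet_of_not_term_condition)
  obtain F where F: "pol A 2 F" "F [u, u] = u" "F [u, v] = u" "F [v, u] = u" "F [v, v] = v"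
    using uv(3) unfolding has_meet_def by blast
  show ?thesis
  proof (rule that[of v u "\<lambda>x y. F [x, y]"])
    show "pol2 A (\<lambda>x y. F [x, y])" using F(1) by (subst (asm) pol2_iff)
  qed (use uv F in auto)
next
  case True
  then obtain \<phi> \<psi> where "affine_ualg A \<phi> \<psi>" using affine_of_term_condition assms by blast
  then interpret affine_ualg A \<phi> \<psi> .
  have "\<phi> (\<psi> 0) \<noteq> \<phi> (\<psi> 1)" using phi_psi two by simp
  then have "\<psi> 0 \<noteq> \<psi> 1" by auto
  then show ?thesis
    using that[of "\<psi> 0" "\<psi> 1" "\<lambda>x y. \<psi> ((\<phi> x + \<phi> y) mod p)"] univ_pair psi_closed pol_add phi_psi two
    by simp
qed

lemma (in finite_ualg) ex_unital_pol2_on_pair: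
  assumes N: "N \<subseteq> univ A" "card N = 2" and "\<not> ess_unary (induced A N)"
  obtains e d g where "N = {e, d}" "e \<noteq> d" "pol2 A g" "g e e = e" "g e d = d" "g d e = d" "g d d \<in> N"
proof -
  have sub: "N \<subseteq> univ A" "N \<noteq> {}" using N by auto
  interpret I: finite_ualg "induced A N" by (rule finite_ualg_induced[OF sub])
  interpret I: two_element_ualg "induced A N" by unfold_locales (use N in simp)
  obtain e d g where g: "N = {e, d}" "e \<noteq> d" "pol2 (induced A N) g" "g e e = e" "g e d = d" "g d e = d"
    using I.ex_unital_pol2[OF assms(3)] by auto
  obtain F where F: "pol A 2 F" "\<And>xs. xs \<in> tuples N 2 \<Longrightarrow> F xs \<in> N \<and> g (xs ! 0) (xs ! 1) = F xs"
    using g(3) by (auto elim: pol_inducedE[OF sub])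
  have "pol2 A (\<lambda>x y. F [x, y])" using F(1) by (subst (asm) pol2_iff)
  moreover have "F [x, y] \<in> N" "F [x, y] = g x y" if "x \<in> N" "y \<in> N" for x y
    using F(2)[of "[x, y]"] that by (simp_all add: tuples_two)
  ultimately show ?thesis using that[of e d "\<lambda>x y. F [x, y]"] g by simp
qed

section \<open>Few homomorphisms without type 1\<close>

definition homs_at :: "('f, 'x) ualg \<Rightarrow> ('f, 'a) ualg \<Rightarrow> ('a \<Rightarrow> 'x) \<Rightarrow> ('x \<Rightarrow> 'a) set" where
  "homs_at X A \<sigma> = {h \<in> homs X A. \<forall>a\<in>univ A. h (\<sigma> a) = a}"

lemma surj_homs_subset_homs_at: "surj_homs X A \<subseteq> (\<Union>\<sigma>\<in>univ A \<rightarrow>\<^sub>E univ X. homs_at X A \<sigma>)"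
proof
  fix h assume h: "h \<in> surj_homs X A"
  then have "\<forall>a\<in>univ A. \<exists>x\<in>univ X. h x = a" using surj_homsD(3) by (metis imageE)
  then obtain s where "\<forall>a\<in>univ A. s a \<in> univ X \<and> h (s a) = a" by metis
  then have "restrict s (univ A) \<in> univ A \<rightarrow>\<^sub>E univ X" "h \<in> homs_at X A (restrict s (univ A))"
    using h by (auto simp: homs_at_def surj_homs_def)
  then show "h \<in> (\<Union>\<sigma>\<in>univ A \<rightarrow>\<^sub>E univ X. homs_at X A \<sigma>)" by blast
qed

lemma finite_homs_at: "finite (univ X) \<Longrightarrow> finite (univ A) \<Longrightarrow> finite (homs_at X A \<sigma>)"
  by (rule finite_subset[of _ "univ X \<rightarrow>\<^sub>E univ A"]) (auto simp: homs_at_def homs_def intro: finite_PiE)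

lemma card_surj_homs_le:
  assumes fin: "finite (univ X)" "finite (univ A)"
    and bound: "\<And>\<sigma>. \<sigma> \<in> univ A \<rightarrow>\<^sub>E univ X \<Longrightarrow> card (homs_at X A \<sigma>) \<le> b"
  shows "card (surj_homs X A) \<le> card (univ X) ^ card (univ A) * b"
proof -
  let ?S = "univ A \<rightarrow>\<^sub>E univ X"
  have finite_S: "finite ?S" using fin by (intro finite_PiE) auto
  have "card (surj_homs X A) \<le> card (\<Union>\<sigma>\<in>?S. homs_at X A \<sigma>)"
    by (rule card_mono[OF _ surj_homs_subset_homs_at]) (use finite_S finite_homs_at[OF fin] in auto)
  also have "\<dots> \<le> (\<Sum>\<sigma>\<in>?S. card (homs_at X A \<sigma>))" by (rule card_UN_le[OF finite_S])
  also have "\<dots> \<le> card ?S * b" using sum_bounded_above[of ?S _ b] bound by simp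
  also have "card ?S = card (univ X) ^ card (univ A)" using fin by (simp add: card_PiE)
  finally show ?thesis .
qed

text \<open>A surjective homomorphism has a section \<open>\<sigma>\<close>. Once \<open>\<sigma>\<close> is fixed, the constants of a
  polynomial operation of \<open>A\<close> can be interpreted in \<open>X\<close>, so all polynomial operations lift.\<close>

locale pointed = finite_ualg A for A :: "('f, 'a) ualg" +
  fixes X :: "('f, 'x) ualg" and \<sigma> :: "'a \<Rightarrow> 'x"
  assumes X: "is_ualg X" "finite (univ X)" "same_signature X A"
    and section_closed: "\<And>a. a \<in> univ A \<Longrightarrow> \<sigma> a \<in> univ X"
begin

abbreviation H where "H \<equiv> homs_at X A \<sigma>"
abbreviation n where "n \<equiv> card (univ X)"

lemma finite_H: "finite H"
  using X(2) finite_univ by (rule finite_homs_at)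

lemma hom_closed: "h \<in> H \<Longrightarrow> x \<in> univ X \<Longrightarrow> h x \<in> univ A"
  by (auto simp: homs_at_def homs_def)

lemma hom_section: "h \<in> H \<Longrightarrow> a \<in> univ A \<Longrightarrow> h (\<sigma> a) = a"
  by (auto simp: homs_at_def)

lemma hom_eqI:
  assumes "h \<in> H" "h' \<in> H" "\<And>x. x \<in> univ X \<Longrightarrow> h x = h' x"
  shows "h = h'"
  by (rule PiE_ext[of _ "univ X" "\<lambda>_. univ A"]) (use assms in \<open>auto simp: homs_at_def homs_def\<close>)

lemma hom_interp:
  assumes "h \<in> H" "f \<in> syms A" "xs \<in> tuples (univ X) (arity A f)"
  shows "h (interp X f xs) = interp A f (map h xs)"
  using assms X(3) by (simp add: homs_at_def homs_def same_signature_def)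

lemma X_closed: "f \<in> syms A \<Longrightarrow> xs \<in> tuples (univ X) (arity A f) \<Longrightarrow> interp X f xs \<in> univ X"
  using X(1,3) by (simp add: is_ualg_def same_signature_def)

lemma pol_lift:
  assumes "pol A k F"
  shows "\<exists>F'. \<forall>xs\<in>tuples (univ X) k. F' xs \<in> univ X \<and> (\<forall>h\<in>H. h (F' xs) = F (map h xs))"
  using assms
proof (induction rule: pol_induct)
  case (proj i)
  then show ?case by (intro exI[of _ "\<lambda>xs. xs ! i"]) (auto simp: tuples_nth tuples_length)
next
  case (const c)
  then show ?case using section_closed hom_section by (intro exI[of _ "\<lambda>_. \<sigma> c"]) auto
next
  case (app f G)
  then obtain G' where G': "\<And>i xs. i < arity A f \<Longrightarrow> xs \<in> tuples (univ X) k \<Longrightarrow> G' i xs \<in> univ X"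
    "\<And>i xs h. i < arity A f \<Longrightarrow> xs \<in> tuples (univ X) k \<Longrightarrow> h \<in> H \<Longrightarrow> h (G' i xs) = G i (map h xs)"
    by metis
  let ?args = "\<lambda>xs. map (\<lambda>i. G' i xs) [0..<arity A f]"
  have args: "?args xs \<in> tuples (univ X) (arity A f)" if "xs \<in> tuples (univ X) k" for xs
    by (rule tuples_map_upt) (use G' that in blast)
  have "h (interp X f (?args xs)) = interp A f (map (\<lambda>i. G i (map h xs)) [0..<arity A f])"
    if h: "h \<in> H" and xs: "xs \<in> tuples (univ X) k" for h xs
  proof -
    have "map h (?args xs) = map (\<lambda>i. G i (map h xs)) [0..<arity A f]" using G'(2)[OF _ xs h] by simp
    then show ?thesis using hom_interp[OF h app(1) args[OF xs]] by (simp only:)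
  qed
  then show ?case using X_closed[OF app(1) args] by (intro exI[of _ "\<lambda>xs. interp X f (?args xs)"]) blast
next
  case (cong F G)
  then obtain F' where F': "\<And>xs. xs \<in> tuples (univ X) k \<Longrightarrow> F' xs \<in> univ X"
    "\<And>xs h. xs \<in> tuples (univ X) k \<Longrightarrow> h \<in> H \<Longrightarrow> h (F' xs) = F (map h xs)" by blast
  have "map h xs \<in> tuples (univ A) k" if "h \<in> H" "xs \<in> tuples (univ X) k" for h xs
    using that hom_closed by (auto simp: tuples_def)
  then show ?case using F' cong(2) by (intro exI[of _ F']) auto
qed

lemma pol1_lift:
  assumes "pol1 A f"
  obtains f' where "\<And>x. x \<in> univ X \<Longrightarrow> f' x \<in> univ X" "\<And>x h. x \<in> univ X \<Longrightarrow> h \<in> H \<Longrightarrow> h (f' x) = f (h x)"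
proof -
  obtain F' where F': "\<forall>xs\<in>tuples (univ X) 1. F' xs \<in> univ X \<and> (\<forall>h\<in>H. h (F' xs) = f (map h xs ! 0))"
    using pol_lift[OF assms] by blast
  have "F' [x] \<in> univ X \<and> (\<forall>h\<in>H. h (F' [x]) = f (h x))" if "x \<in> univ X" for x
    using bspec[OF F', of "[x]"] that by (simp add: tuples_one)
  then show ?thesis by (intro that[of "\<lambda>x. F' [x]"]) blast+
qed

lemma pol2_lift:
  assumes "pol2 A g"
  obtains g' where "\<And>x y. x \<in> univ X \<Longrightarrow> y \<in> univ X \<Longrightarrow> g' x y \<in> univ X"
    "\<And>x y h. x \<in> univ X \<Longrightarrow> y \<in> univ X \<Longrightarrow> h \<in> H \<Longrightarrow> h (g' x y) = g (h x) (h y)"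
proof -
  obtain F' where F': "\<forall>xs\<in>tuples (univ X) 2. F' xs \<in> univ X \<and>
      (\<forall>h\<in>H. h (F' xs) = g (map h xs ! 0) (map h xs ! 1))"
    using pol_lift[OF assms] by blast
  have "F' [x, y] \<in> univ X \<and> (\<forall>h\<in>H. h (F' [x, y]) = g (h x) (h y))" if "x \<in> univ X" "y \<in> univ X" for x y
    using bspec[OF F', of "[x, y]"] that by (simp add: tuples_two)
  then show ?thesis by (intro that[of "\<lambda>x y. F' [x, y]"]) blast+
qed

lemma card_homs_affine_le:
  assumes "affine_ualg A \<phi> \<psi>" "card (univ A) \<le> 2 ^ m"
  shows "card H \<le> n ^ m"
proof -
  interpret affine_ualg A \<phi> \<psi> by fact
  let ?z = "\<psi> 0"
  have z: "?z \<in> univ A" "\<phi> ?z = 0" using psi_closed phi_psi card_pos by auto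
  obtain g where g: "\<And>x y. x \<in> univ X \<Longrightarrow> y \<in> univ X \<Longrightarrow> g x y \<in> univ X"
    "\<And>x y h. x \<in> univ X \<Longrightarrow> y \<in> univ X \<Longrightarrow> h \<in> H \<Longrightarrow> h (g x y) = \<psi> ((\<phi> (h x) + \<phi> (h y)) mod p)"
    by (rule pol2_lift[OF pol_add], rule that)
  interpret additive_homs "univ X" g "\<sigma> ?z" "univ A" \<phi> p H
  proof
    show "inj_on \<phi> (univ A)" by (simp add: inj_on_def phi_eq_iff)
    fix h assume h: "h \<in> H"
    show "\<phi> (h (\<sigma> ?z)) = 0" using hom_section[OF h z(1)] z(2) by simp
    show "\<phi> (h (g x y)) = (\<phi> (h x) + \<phi> (h y)) mod p" if "x \<in> univ X" "y \<in> univ X" for x y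
      using g(2)[OF that h] phi_psi_mod by simp
  qed (use X g z section_closed hom_closed finite_univ phi_less in auto)
  have "inj_on (\<lambda>h. restrict h (univ X)) H" by (rule inj_onI) (metis hom_eqI restrict_apply')
  then show ?thesis using card_additive_homs_le[OF assms(2)] by (simp add: card_image)
qed

definition few_modulo :: "('a \<times> 'a) set \<Rightarrow> bool" where
  "few_modulo \<theta> \<longleftrightarrow> (\<exists>key :: ('x \<Rightarrow> 'a) \<Rightarrow> ('x \<Rightarrow> 'a). card (key ` H) \<le> (n + 1) ^ 2 \<and>
     (\<forall>h\<in>H. \<forall>h'\<in>H. key h = key h' \<longrightarrow> (\<forall>x\<in>univ X. (h x, h' x) \<in> \<theta>)))"

lemma few_modulo_Id_on: "card H \<le> (n + 1) ^ 2 \<Longrightarrow> few_modulo (Id_on (univ A))"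
  unfolding few_modulo_def using hom_closed by (intro exI[of _ "\<lambda>h. h"]) auto

lemma card_homs_le_if_few_modulo:
  assumes "few_modulo \<theta>" "few_modulo \<theta>'" "\<theta> \<inter> \<theta>' \<subseteq> Id"
  shows "card H \<le> (n + 1) ^ 4"
proof -
  obtain key :: "('x \<Rightarrow> 'a) \<Rightarrow> ('x \<Rightarrow> 'a)" where key: "card (key ` H) \<le> (n + 1) ^ 2"
    "\<forall>h\<in>H. \<forall>h'\<in>H. key h = key h' \<longrightarrow> (\<forall>x\<in>univ X. (h x, h' x) \<in> \<theta>)"
    using assms(1) unfolding few_modulo_def by blast
  obtain key' :: "('x \<Rightarrow> 'a) \<Rightarrow> ('x \<Rightarrow> 'a)" where key': "card (key' ` H) \<le> (n + 1) ^ 2"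
    "\<forall>h\<in>H. \<forall>h'\<in>H. key' h = key' h' \<longrightarrow> (\<forall>x\<in>univ X. (h x, h' x) \<in> \<theta>')"
    using assms(2) unfolding few_modulo_def by blast
  have "card ((\<lambda>h. h) ` H) \<le> card ((key ` H) \<times> (key' ` H))"
  proof (rule card_image_le_if_determined[where k = "\<lambda>h. (key h, key' h)"])
    fix h h' assume h: "h \<in> H" "h' \<in> H" and "(key h, key' h) = (key h', key' h')"
    then have "h x = h' x" if "x \<in> univ X" for x using key(2) key'(2) assms(3) that by blast
    then show "h = h'" using hom_eqI[OF h] by blast
  qed (use finite_H in auto)
  also have "\<dots> \<le> (n + 1) ^ 2 * (n + 1) ^ 2"
    unfolding card_cartesian_product using key key' by (intro mult_mono) auto
  finally show ?thesis by (simp flip: power_add)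
qed

lemma few_modulo_pol_kernel:
  assumes r: "pol1 A r" "\<And>x. x \<in> univ A \<Longrightarrow> r x \<in> {e, d}" "r e = e" "r d = d"
    and g: "pol2 A g" "e \<noteq> d" "g e e = e" "g e d = d" "g d e = d" "g d d \<in> {e, d}" and e: "e \<in> univ A"
  shows "few_modulo (pol_kernel (univ A \<times> univ A) r)"
proof -
  obtain s where s: "\<And>x. x \<in> univ X \<Longrightarrow> s x \<in> univ X" "\<And>x h. x \<in> univ X \<Longrightarrow> h \<in> H \<Longrightarrow> h (s x) = r (h x)"
    by (rule pol1_lift[OF r(1)], rule that)
  obtain g' where g': "\<And>x y. x \<in> univ X \<Longrightarrow> y \<in> univ X \<Longrightarrow> g' x y \<in> univ X"
    "\<And>x y h. x \<in> univ X \<Longrightarrow> y \<in> univ X \<Longrightarrow> h \<in> H \<Longrightarrow> h (g' x y) = g (h x) (h y)"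
    by (rule pol2_lift[OF g(1)], rule that)
  let ?Y = "s ` univ X"
  have range: "h y \<in> {e, d}" if "h \<in> H" "y \<in> ?Y" for h y
    using that s(2) r(2)[OF hom_closed] by auto
  have "card ((\<lambda>h. restrict h ?Y) ` H) \<le> card ?Y + 1"
  proof (rule card_unital_homs_le[where G = "\<lambda>x y. s (g' x y)" and e = e and d = d and g = g and z = "s (\<sigma> e)"])
    fix h x y assume h: "h \<in> H" and xy: "x \<in> ?Y" "y \<in> ?Y"
    then have "x \<in> univ X" "y \<in> univ X" using s(1) by auto
    then have "h (s (g' x y)) = r (g (h x) (h y))" using s(2) g' h by simp
    also have "\<dots> = g (h x) (h y)" using range[OF h xy(1)] range[OF h xy(2)] g r by auto
    finally show "h (s (g' x y)) = g (h x) (h y)" .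
  next
    fix h assume h: "h \<in> H"
    show "h (s (\<sigma> e)) = e" using s(2)[OF section_closed[OF e] h] hom_section[OF h e] r(3) by simp
  qed (use X(2) s(1) g g'(1) section_closed[OF e] range in auto)
  also have "\<dots> \<le> n + 1" using card_image_le[OF X(2), of s] by simp
  also have "\<dots> \<le> (n + 1) ^ 2" by (rule self_le_power) auto
  finally have "card ((\<lambda>h. restrict h ?Y) ` H) \<le> (n + 1) ^ 2" .
  moreover have "(h x, h' x) \<in> pol_kernel (univ A \<times> univ A) r"
    if h: "h \<in> H" "h' \<in> H" and eq: "restrict h ?Y = restrict h' ?Y" and x: "x \<in> univ X" for h h' x
  proof -
    have "r (f (h x)) = r (f (h' x))" if f: "pol1 A f" for f
    proof -
      obtain f' where f': "\<And>x. x \<in> univ X \<Longrightarrow> f' x \<in> univ X" "\<And>x h. x \<in> univ X \<Longrightarrow> h \<in> H \<Longrightarrow> h (f' x) = f (h x)"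
        by (rule pol1_lift[OF f], rule that)
      have "h (s (f' x)) = h' (s (f' x))" using fun_cong[OF eq, of "s (f' x)"] f'(1)[OF x] by simp
      then show ?thesis using s(2)[OF f'(1)[OF x]] f'(2)[OF x] h by simp
    qed
    then show ?thesis using hom_closed h x by (simp add: pol_kernel_def)
  qed
  ultimately show ?thesis unfolding few_modulo_def by (intro exI[of _ "\<lambda>h. restrict h ?Y"]) blast
qed

end

text \<open>The minimal set is the whole algebra, but the trace is not. The quotient modulo \<open>\<alpha>\<close> and the
  trace then carry unital operations, which bound the number of homomorphisms modulo \<open>\<alpha>\<close> and
  inside each class.\<close>

locale pointed_full_minimal_set = pointed A X \<sigma> + minimal_cong A \<alpha>
  for A :: "('f, 'a) ualg" and X :: "('f, 'x) ualg" and \<sigma> \<alpha> +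
  fixes e d c :: 'a and g :: "'a \<Rightarrow> 'a \<Rightarrow> 'a"
  assumes univ_eq: "univ A = {e, d, c}" and distinct: "e \<noteq> d" "c \<noteq> e" "c \<noteq> d"
    and full: "minimal_set A \<alpha> (univ A)" and classes: "(e, d) \<in> \<alpha>" "(e, c) \<notin> \<alpha>"
    and g: "pol2 A g" "g e e = e" "g e d = d" "g d e = d" "g d d \<in> {e, d}"
begin

lemma third_fixed:
  assumes f: "pol1 A f" "f e = e" "f d = d"
  shows "f c = c"
proof (rule ccontr)
  assume "f c \<noteq> c"
  then have "f c \<in> {e, d}" using pol1_closed[OF f(1), of c] univ_eq by auto
  moreover have "f ` univ A = univ A"
    by (rule minimal_setD[OF full f(1) _ classes(1)]) (use f distinct pol1_closed[OF f(1)] in auto)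
  ultimately show False using f distinct univ_eq by auto
qed

lemma third_absorbing:
  assumes "x \<in> {e, d}"
  shows "g c x = c" "g x c = c"
proof -
  have e: "e \<in> univ A" and c: "c \<in> univ A" using univ_eq by auto
  have unit: "g c e = c" "g e c = c"
    by (rule third_fixed[of "\<lambda>x. g x e"], rule pol1_pol2[OF g(1) pol1_id pol1_const[OF e]]; use g in simp)
      (rule third_fixed[of "\<lambda>x. g e x"], rule pol1_pol2[OF g(1) pol1_const[OF e] pol1_id]; use g in simp)
  have third_class: "y = c" if "(y, c) \<in> \<alpha>" for y
  proof (rule ccontr)
    assume "y \<noteq> c"
    then have "y = e \<or> y = d" using alpha_univ[OF that] univ_eq by auto
    then have "(e, y) \<in> \<alpha>" using classes(1) alpha_refl[OF e] by auto
    then show False using alpha_trans[OF _ that] classes(2) by blast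
  qed
  have "(x, e) \<in> \<alpha>" using assms classes(1) alpha_sym alpha_refl e by blast
  then have "(g c x, g c e) \<in> \<alpha>" "(g x c, g e c) \<in> \<alpha>"
    using congruence_pol2[OF cong g(1)] alpha_refl[OF c] by auto
  then show "g c x = c" "g x c = c" using third_class unit by auto
qed

definition collapse :: "'a \<Rightarrow> 'a" where "collapse x = (if x = c then c else e)"

lemma collapse_hom:
  assumes "s \<in> univ A" "t \<in> univ A"
  shows "collapse (g s t) = collapse (g (collapse s) (collapse t))"
proof -
  have "g s t \<noteq> c" if "s \<in> {e, d}" "t \<in> {e, d}" using that g distinct by auto
  then show ?thesis using assms third_absorbing g distinct unfolding univ_eq collapse_def by auto
qed

lemma card_collapsed_homs_le: "card ((\<lambda>h. restrict (\<lambda>x. collapse (h x)) (univ X)) ` H) \<le> n + 1"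
proof -
  obtain g' where g': "\<And>x y. x \<in> univ X \<Longrightarrow> y \<in> univ X \<Longrightarrow> g' x y \<in> univ X"
    "\<And>x y h. x \<in> univ X \<Longrightarrow> y \<in> univ X \<Longrightarrow> h \<in> H \<Longrightarrow> h (g' x y) = g (h x) (h y)"
    by (rule pol2_lift[OF g(1)], rule that)
  have e: "e \<in> univ A" using univ_eq by simp
  have "card ((\<lambda>h. restrict h (univ X)) ` ((\<lambda>h x. collapse (h x)) ` H)) \<le> n + 1"
  proof (rule card_unital_homs_le[where G = g' and z = "\<sigma> e" and e = e and d = c and
        g = "\<lambda>x y. collapse (g x y)"])
    fix h x y assume "h \<in> (\<lambda>h x. collapse (h x)) ` H" and xy: "x \<in> univ X" "y \<in> univ X"
    then obtain h' where h': "h = (\<lambda>x. collapse (h' x))" "h' \<in> H" by blast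
    show "h (g' x y) = collapse (g (h x) (h y))"
      using collapse_hom[OF hom_closed[OF h'(2) xy(1)] hom_closed[OF h'(2) xy(2)]] g'(2)[OF xy h'(2)] h'(1)
      by simp
  qed (use X(2) g'(1) section_closed[OF e] hom_section[OF _ e] third_absorbing g distinct
      in \<open>auto simp: collapse_def\<close>)
  then show ?thesis by (simp add: image_image)
qed

lemma card_homs_in_collapse_fiber_le:
  assumes h: "h \<in> H"
  shows "card {h' \<in> H. restrict (\<lambda>x. collapse (h' x)) (univ X) = restrict (\<lambda>x. collapse (h x)) (univ X)} \<le> n + 1"
    (is "card ?H \<le> _")
proof -
  let ?Y = "{x \<in> univ X. h x \<noteq> c}"
  have third_iff: "h' x = c \<longleftrightarrow> h x = c" if "h' \<in> ?H" "x \<in> univ X" for h' x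
  proof -
    have "restrict (\<lambda>x. collapse (h' x)) (univ X) = restrict (\<lambda>x. collapse (h x)) (univ X)" using that(1) by blast
    from fun_cong[OF this, of x] show ?thesis using that(2) distinct by (auto simp: collapse_def split: if_splits)
  qed
  have range: "h' x \<in> {e, d}" if "h' \<in> ?H" "x \<in> ?Y" for h' x
    using third_iff[OF that(1)] that hom_closed[of h' x] univ_eq by auto
  obtain g' where g': "\<And>x y. x \<in> univ X \<Longrightarrow> y \<in> univ X \<Longrightarrow> g' x y \<in> univ X"
    "\<And>x y h. x \<in> univ X \<Longrightarrow> y \<in> univ X \<Longrightarrow> h \<in> H \<Longrightarrow> h (g' x y) = g (h x) (h y)"
    by (rule pol2_lift[OF g(1)], rule that)
  have e: "e \<in> univ A" using univ_eq by simp
  have "card ((\<lambda>h. restrict h ?Y) ` ?H) \<le> card ?Y + 1"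
  proof (rule card_unital_homs_le[where G = g' and e = e and d = d and g = g and z = "\<sigma> e"])
    show "g' x y \<in> ?Y" if "x \<in> ?Y" "y \<in> ?Y" for x y
    proof -
      have "h x \<in> {e, d}" "h y \<in> {e, d}" using range[of h] h that by auto
      then have "g (h x) (h y) \<noteq> c" using g distinct by auto
      then show ?thesis using g' that h by simp
    qed
  qed (use X(2) g' g range section_closed[OF e] hom_section[OF _ e] h distinct in auto)
  also have "\<dots> \<le> n + 1" using card_mono[OF X(2), of ?Y] by auto
  finally have "card ((\<lambda>h. restrict h ?Y) ` ?H) \<le> n + 1" .
  moreover have "inj_on (\<lambda>h. restrict h ?Y) ?H"
  proof (rule inj_onI, rule hom_eqI)
    fix f f' x assume f: "f \<in> ?H" "f' \<in> ?H" and eq: "restrict f ?Y = restrict f' ?Y" and x: "x \<in> univ X"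
    show "f x = f' x"
      using fun_cong[OF eq, of x] x third_iff[OF f(1) x] third_iff[OF f(2) x] by (cases "h x = c") auto
  qed auto
  ultimately show ?thesis by (simp add: card_image)
qed

lemma card_homs_le: "card H \<le> (n + 1) ^ 2"
  using card_le_fibers[OF finite_H card_collapsed_homs_le card_homs_in_collapse_fiber_le]
  by (simp add: power2_eq_square)

end

lemma ex_third_element:
  assumes "card U = 3" "x \<in> U" "y \<in> U" "x \<noteq> y"
  obtains z where "U = {x, y, z}" "z \<noteq> x" "z \<noteq> y"
  using assms unfolding card_3_iff by (metis insert_commute insertE singletonD)

locale three_pointed = pointed A X \<sigma> + three_minimal A \<alpha>
  for A :: "('f, 'a) ualg" and X :: "('f, 'x) ualg" and \<sigma> \<alpha>
begin

lemma card_homs_full_trace_le: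
  assumes "trace A \<alpha> (univ A)" "\<not> ess_unary A"
  shows "card H \<le> (n + 1) ^ 2"
proof -
  obtain \<phi> \<psi> where "affine_ualg A \<phi> \<psi>"
    using affine_three[OF minimal_algebra_if_full_trace[OF assms(1)] three assms(2)] .
  then have "card H \<le> n ^ 2" using card_homs_affine_le[of \<phi> \<psi> 2] three by simp
  also have "\<dots> \<le> (n + 1) ^ 2" by (rule power_mono) auto
  finally show ?thesis .
qed

lemma card_homs_full_minimal_set_le:
  assumes N: "trace A \<alpha> N" "\<not> ess_unary (induced A N)" "card N = 2"
    and U: "minimal_set A \<alpha> (univ A)" "N = \<alpha> `` {a} \<inter> univ A"
  shows "card H \<le> (n + 1) ^ 2"
proof -
  have sub: "N \<subseteq> univ A" using U(2) by auto
  obtain e d g where g: "N = {e, d}" "e \<noteq> d" "pol2 A g" "g e e = e" "g e d = d" "g d e = d" "g d d \<in> N"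
    using ex_unital_pol2_on_pair[OF sub N(3,2)] .
  obtain c where c: "univ A = {e, d, c}" "c \<noteq> e" "c \<noteq> d"
    by (rule ex_third_element[OF three, of e d]) (use g(1,2) sub in auto)
  have "(a, e) \<in> \<alpha>" using U(2) g(1) by auto
  moreover have "(a, c) \<notin> \<alpha>" using U(2) g(1) c by auto
  ultimately have "(e, c) \<notin> \<alpha>" using alpha_trans by blast
  moreover have "(e, d) \<in> \<alpha>" using trace_rel[OF N(1)] g(1) by simp
  ultimately interpret pointed_full_minimal_set A X \<sigma> \<alpha> e d c g
    by unfold_locales (use U(1) g c in auto)
  show ?thesis by (rule card_homs_le)
qed

lemma ex_few_modulo_trace_minimal_set:
  assumes N: "trace A \<alpha> N" "\<not> ess_unary (induced A N)" "card N = 2" and U: "minimal_set A \<alpha> N"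
  shows "\<exists>\<theta>. congruence A \<theta> \<and> few_modulo \<theta> \<and> \<theta> \<inter> \<alpha> \<subseteq> Id"
proof -
  obtain e d g where g: "N = {e, d}" "e \<noteq> d" "pol2 A g" "g e e = e" "g e d = d" "g d e = d" "g d d \<in> N"
    using ex_unital_pol2_on_pair[OF minimal_set_sub[OF U] N(3,2)] .
  obtain r where r: "pol1 A r" "\<And>x. x \<in> univ A \<Longrightarrow> r x \<in> N" "\<And>x. x \<in> N \<Longrightarrow> r x = x"
    by (rule retraction[OF U], rule that)
  let ?\<theta> = "pol_kernel (univ A \<times> univ A) r"
  have "few_modulo ?\<theta>"
    by (rule few_modulo_pol_kernel[OF r(1) _ _ _ g(3)]) (use g r minimal_set_sub[OF U] in auto)
  moreover have "x = y" if xy: "(x, y) \<in> ?\<theta>" "(x, y) \<in> \<alpha>" for x y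
  proof (rule ccontr)
    assume "x \<noteq> y"
    moreover have "(e, d) \<in> \<alpha>" "r e \<noteq> r d" using trace_rel[OF N(1)] g(1,2) r(3) by auto
    ultimately obtain f where "pol1 A f" "r (f x) \<noteq> r (f y)" using separate xy(2) by metis
    then show False using xy(1) by (simp add: pol_kernel_def)
  qed
  ultimately show ?thesis using congruence_pol_kernel[OF congruence_full] by (intro exI[of _ ?\<theta>]) auto
qed

lemma ex_few_modulo:
  assumes "tct_type A \<alpha> \<noteq> 1"
  shows "\<exists>\<theta>. congruence A \<theta> \<and> few_modulo \<theta> \<and> \<theta> \<inter> \<alpha> \<subseteq> Id"
proof -
  obtain N where trace: "trace A \<alpha> N" by (rule ex_trace)
  then have ess: "\<not> ess_unary (induced A N)" using assms tct_type_eq_1_iff by blast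
  obtain U a where U: "minimal_set A \<alpha> U" "a \<in> U" "N = \<alpha> `` {a} \<inter> U" "U \<subseteq> univ A"
    "card N = 2 \<or> N = univ A \<and> U = univ A"
    by (rule traceE[OF trace])
  have few: ?thesis if "card H \<le> (n + 1) ^ 2"
    using few_modulo_Id_on[OF that] congruence_Id_on by (intro exI[of _ "Id_on (univ A)"]) auto
  consider (full_trace) "N = univ A" | (full_minimal_set) "card N = 2" "U = univ A" |
    (trace_minimal_set) "card N = 2" "U \<noteq> univ A" using U(5) by blast
  then show ?thesis
  proof cases
    case full_trace
    then have "\<not> ess_unary A" using ess pol_induced_univ by (simp add: ess_unary_def)
    then show ?thesis using few card_homs_full_trace_le trace full_trace by blast
  next
    case full_minimal_set
    then show ?thesis using few card_homs_full_minimal_set_le[OF trace ess] U by blast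
  next
    case trace_minimal_set
    have "card U < 3" using psubset_card_mono[OF finite_univ, of U] trace_minimal_set U(4) three by auto
    moreover have "N \<subseteq> U" "finite U" using U(3,4) finite_univ finite_subset by auto
    ultimately have "N = U" using trace_minimal_set card_seteq[of U N] by simp
    then show ?thesis using ex_few_modulo_trace_minimal_set[OF trace ess] trace_minimal_set U(1) by blast
  qed
qed

end

lemma (in finite_ualg) minimal_congruence_three:
  assumes three: "card (univ A) = 3" and \<theta>: "congruence A \<theta>" "\<theta> \<noteq> Id_on (univ A)" "\<theta> \<noteq> univ A \<times> univ A"
  shows "minimal_congruence A \<theta>"
proof -
  have "\<theta> \<subseteq> \<beta>" if \<beta>: "congruence A \<beta>" "\<beta> \<subseteq> \<theta>" "\<beta> \<noteq> Id_on (univ A)" for \<beta>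
  proof -
    obtain x y where xy: "(x, y) \<in> \<beta>" "x \<noteq> y" by (rule congruence_ne_Id_on[OF \<beta>(1,3)])
    have xyU: "x \<in> univ A" "y \<in> univ A" using congruence_univ[OF \<beta>(1) xy(1)] by auto
    obtain z where z: "univ A = {x, y, z}" by (rule ex_third_element[OF three xyU xy(2)])
    have xy\<theta>: "(x, y) \<in> \<theta>" using xy(1) \<beta>(2) by blast
    have not_xz: "(x, z) \<notin> \<theta>"
    proof
      assume "(x, z) \<in> \<theta>"
      then have "(x, w) \<in> \<theta>" if "w \<in> univ A" for w
        using that xy\<theta> congruence_refl[OF \<theta>(1) xyU(1)] z by auto
      then have "univ A \<times> univ A \<subseteq> \<theta>"
        using congruence_sym[OF \<theta>(1)] congruence_trans[OF \<theta>(1)] by (meson mem_Sigma_iff subrelI)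
      then show False using \<theta>(1,3) by (auto simp: congruence_def)
    qed
    then have not_yz: "(y, z) \<notin> \<theta>" using congruence_trans[OF \<theta>(1) xy\<theta>] by blast
    have "(u, v) \<in> \<beta>" if uv: "(u, v) \<in> \<theta>" for u v
    proof -
      have "u \<in> univ A" "v \<in> univ A" using congruence_univ[OF \<theta>(1) uv] by auto
      moreover have "(z, x) \<notin> \<theta>" "(z, y) \<notin> \<theta>" using not_xz not_yz congruence_sym[OF \<theta>(1)] by blast+
      ultimately have "u = v \<or> (u, v) = (x, y) \<or> (u, v) = (y, x)" using uv not_xz not_yz z by auto
      then show ?thesis
        using xy(1) congruence_sym[OF \<beta>(1) xy(1)] congruence_refl[OF \<beta>(1) \<open>u \<in> univ A\<close>] by auto
    qed
    then show ?thesis by auto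
  qed
  then show ?thesis using \<theta>(1,2) unfolding minimal_congruence_def by blast
qed

lemma (in pointed) card_homs_at_le:
  assumes three: "card (univ A) = 3" and types: "\<And>\<alpha>. minimal_congruence A \<alpha> \<Longrightarrow> tct_type A \<alpha> \<noteq> 1"
  shows "card H \<le> (n + 1) ^ 4"
proof -
  obtain \<alpha> where \<alpha>: "minimal_congruence A \<alpha>" using ex_minimal_congruence three by auto
  interpret \<alpha>: three_pointed A X \<sigma> \<alpha> by unfold_locales (use \<alpha> three in auto)
  obtain \<theta> where \<theta>: "congruence A \<theta>" "few_modulo \<theta>" "\<theta> \<inter> \<alpha> \<subseteq> Id" using \<alpha>.ex_few_modulo[OF types[OF \<alpha>]] by blast
  show ?thesis
  proof (cases "\<theta> = Id_on (univ A)")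
    case True
    then show ?thesis using card_homs_le_if_few_modulo[OF \<theta>(2,2)] by blast
  next
    case False
    obtain x y where xy: "(x, y) \<in> \<alpha>" "x \<noteq> y" by (rule \<alpha>.ex_alpha_pair)
    then have "(x, y) \<notin> \<theta>" using \<theta>(3) by auto
    then have "\<theta> \<noteq> univ A \<times> univ A" using \<alpha>.alpha_univ[OF xy(1)] by auto
    then have minimal: "minimal_congruence A \<theta>" by (rule minimal_congruence_three[OF three \<theta>(1) False])
    interpret \<theta>: three_pointed A X \<sigma> \<theta> by unfold_locales (use minimal three in auto)
    obtain \<theta>' where "few_modulo \<theta>'" "\<theta>' \<inter> \<theta> \<subseteq> Id" using \<theta>.ex_few_modulo[OF types[OF minimal]] by blast
    then show ?thesis using card_homs_le_if_few_modulo[OF \<theta>(2)] by (metis Int_commute)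
  qed
qed

theorem (in finite_ualg) not_type_1_in_K_surj:
  assumes "card (univ A) = 3" "\<And>\<alpha>. minimal_congruence A \<alpha> \<Longrightarrow> tct_type A \<alpha> \<noteq> 1"
  shows "in_K_surj A"
proof -
  have "card (surj_homs X A) \<le> (card (univ X) + 1) ^ 7"
    if X: "is_ualg X" "finite (univ X)" "same_signature X A" for X :: "('f, nat) ualg"
  proof -
    have "card (homs_at X A \<sigma>) \<le> (card (univ X) + 1) ^ 4" if "\<sigma> \<in> univ A \<rightarrow>\<^sub>E univ X" for \<sigma>
    proof -
      interpret pointed A X \<sigma> by unfold_locales (use X that in auto)
      show ?thesis by (rule card_homs_at_le[OF assms])
    qed
    then have "card (surj_homs X A) \<le> card (univ X) ^ 3 * (card (univ X) + 1) ^ 4"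
      using card_surj_homs_le[OF X(2) finite_univ] assms(1) by metis
    also have "\<dots> \<le> (card (univ X) + 1) ^ 3 * (card (univ X) + 1) ^ 4"
      by (intro mult_right_mono power_mono) auto
    finally show ?thesis by (simp flip: power_add)
  qed
  then have "surj_bound A (\<lambda>n. 1 * (n + 1) ^ 7)" by (simp add: surj_bound_def)
  then show ?thesis unfolding in_K_surj_iff using is_ualg finite_univ poly_bounded_power by blast
qed

section \<open>Enumeration by extending partial homomorphisms\<close>

text \<open>A partial map from \<open>{..<n}\<close> to the algebra is a list of \<open>n\<close> codes, where 0 means undefined. A
  search state is a partial map together with the number of conflicts met so far.\<close>

definition below :: "nat list \<Rightarrow> nat list \<Rightarrow> bool" where
  "below h g \<longleftrightarrow> length h = length g \<and> (\<forall>j<length h. h ! j \<noteq> 0 \<longrightarrow> g ! j = h ! j)"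

lemma below_refl: "below h h"
  by (simp add: below_def)

lemma below_trans: "below h g \<Longrightarrow> below g k \<Longrightarrow> below h k"
  by (auto simp: below_def)

lemma below_antisym: "below h g \<Longrightarrow> below g h \<Longrightarrow> h = g"
proof (rule nth_equalityI)
  fix i assume "below h g" "below g h" "i < length h"
  then show "h ! i = g ! i" unfolding below_def by metis
qed (simp add: below_def)

lemma below_nth: "below h g \<Longrightarrow> j < length h \<Longrightarrow> h ! j \<noteq> 0 \<Longrightarrow> g ! j = h ! j"
  by (simp add: below_def)

lemma below_length: "below h g \<Longrightarrow> length g = length h"
  by (simp add: below_def)

definition state_le :: "nat list \<times> nat \<Rightarrow> nat list \<times> nat \<Rightarrow> bool" where
  "state_le s t \<longleftrightarrow> below (fst s) (fst t) \<and> snd s \<le> snd t"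

lemma state_le_refl: "state_le s s"
  by (simp add: state_le_def below_refl)

lemma state_le_trans: "state_le s t \<Longrightarrow> state_le t u \<Longrightarrow> state_le s u"
  unfolding state_le_def using below_trans by fastforce

lemma state_le_antisym: "state_le s t \<Longrightarrow> state_le t s \<Longrightarrow> s = t"
  unfolding state_le_def using below_antisym by (metis le_antisym prod.expand)

lemma state_le_fold:
  assumes "\<And>x s. state_le s (F x s)"
  shows "state_le s (fold F xs s)"
proof (induction xs arbitrary: s)
  case (Cons x xs)
  show ?case using state_le_trans[OF assms[of s x] Cons[of "F x s"]] by simp
qed (simp add: state_le_refl)

lemma state_le_funpow:
  assumes "\<And>s. state_le s (F s)"
  shows "state_le s ((F ^^ m) s)"
proof (induction m)
  case (Suc m)
  show ?case using state_le_trans[OF Suc assms] by simp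
qed (simp add: state_le_refl)

lemma fold_fixed_imp_fixed:
  assumes "\<And>x s. state_le s (F x s)" "fold F xs s = s" "x \<in> set xs"
  shows "F x s = s"
  using assms(2,3)
proof (induction xs)
  case (Cons y ys)
  have "state_le (F y s) s" using state_le_fold[of F "F y s" ys] assms(1) Cons.prems(1) by simp
  then have "F y s = s" using state_le_antisym assms(1) by blast
  then show ?case using Cons by auto
qed simp

definition defined_count :: "nat list \<Rightarrow> nat" where
  "defined_count h = card {j. j < length h \<and> h ! j \<noteq> 0}"

lemma defined_count_le: "defined_count h \<le> length h"
  unfolding defined_count_def
  using card_mono[of "{..<length h}" "{j. j < length h \<and> h ! j \<noteq> 0}"] by auto

lemma defined_count_less:
  assumes "below h g" "h \<noteq> g"
  shows "defined_count h < defined_count g"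
proof -
  have len: "length h = length g" using assms by (simp add: below_def)
  have "{j. j < length h \<and> h ! j \<noteq> 0} \<subseteq> {j. j < length g \<and> g ! j \<noteq> 0}"
    using assms(1) by (auto simp: below_def)
  moreover have "\<exists>j<length h. h ! j \<noteq> g ! j" using assms(2) len nth_equalityI by blast
  then obtain j where "j < length h" "h ! j \<noteq> g ! j" by blast
  then have "h ! j = 0" "g ! j \<noteq> 0" "j < length g" using assms(1) len by (auto simp: below_def)
  ultimately have "{j. j < length h \<and> h ! j \<noteq> 0} \<subset> {j. j < length g \<and> g ! j \<noteq> 0}" by blast
  then show ?thesis unfolding defined_count_def by (rule psubset_card_mono[rotated]) simp
qed

text \<open>Without a conflict, every round that changes something defines a new value.\<close>

lemma funpow_fixed_if_no_conflict:
  assumes increasing: "\<And>s. state_le s (F s)" and no_conflict: "snd ((F ^^ Suc (length (fst s))) s) = 0"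
  shows "F ((F ^^ Suc (length (fst s))) s) = (F ^^ Suc (length (fst s))) s"
proof -
  let ?s = "\<lambda>m. (F ^^ m) s"
  have progress: "F (?s m) = ?s m \<or> m \<le> defined_count (fst (?s m))" if "snd (?s m) = 0" for m
    using that
  proof (induction m)
    case (Suc m)
    have grows: "state_le (?s m) (?s (Suc m))" using increasing by simp
    then have "snd (?s m) = 0" using Suc.prems by (simp add: state_le_def)
    then consider (fixed) "?s (Suc m) = ?s m" |
      (changed) "fst (?s m) \<noteq> fst (?s (Suc m))" "m \<le> defined_count (fst (?s m))"
      using Suc by (metis funpow.simps(2) o_apply prod.expand)
    then show ?case
    proof cases
      case changed
      then have "defined_count (fst (?s m)) < defined_count (fst (?s (Suc m)))"
        using grows by (intro defined_count_less) (simp_all add: state_le_def)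
      then show ?thesis using changed(2) by simp
    qed simp
  qed simp
  have "length (fst (?s m)) = length (fst s)" for m
    using state_le_funpow[OF increasing] below_length by (simp add: state_le_def)
  then have "defined_count (fst (?s m)) \<le> length (fst s)" for m using defined_count_le by metis
  then show ?thesis using progress[OF no_conflict] by (meson Suc_n_not_le_n order_trans)
qed

definition put :: "nat \<Rightarrow> nat \<Rightarrow> nat list \<times> nat \<Rightarrow> nat list \<times> nat" where
  "put y v s = (if fst s ! y = 0 then ((fst s)[y := v], snd s)
     else if fst s ! y = v then s else (fst s, Suc (snd s)))"

lemma state_le_put: "state_le s (put y v s)"
proof -
  have "below h (h[y := v])" if "h ! y = 0" for h
    using that by (cases "y < length h") (auto simp: below_def nth_list_update)
  then show ?thesis by (auto simp: state_le_def put_def below_refl)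
qed

lemma put_nth:
  assumes "snd (put y v s) \<le> snd s" "y < length (fst s)"
  shows "fst (put y v s) ! y = v"
  using assms by (auto simp: put_def split: if_splits)

definition compatible :: "nat list \<Rightarrow> nat list \<times> nat \<Rightarrow> bool" where
  "compatible g s \<longleftrightarrow> below (fst s) g \<and> snd s = 0"

lemma compatible_put:
  assumes "compatible g s" "y < length g" "g ! y = v" "v \<noteq> 0"
  shows "compatible g (put y v s)"
proof -
  have "below ((fst s)[y := v]) g"
    using assms by (auto simp: compatible_def below_def nth_list_update)
  moreover have "fst s ! y = 0 \<or> fst s ! y = v"
    using assms by (auto simp: compatible_def below_def)
  ultimately show ?thesis using assms(1) by (auto simp: compatible_def put_def)
qed

lemma compatible_fold:
  assumes "\<And>x s. x \<in> set xs \<Longrightarrow> compatible g s \<Longrightarrow> compatible g (F x s)" "compatible g s"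
  shows "compatible g (fold F xs s)"
  using assms by (induction xs arbitrary: s) auto

lemma n_lists_upt_eq_tuples: "set (List.n_lists k [0..<n]) = tuples {..<n} k"
  by (auto simp: set_n_lists tuples_def)

lemma distinct_concat_map:
  assumes "distinct xs" "\<And>x. x \<in> set xs \<Longrightarrow> distinct (F x)"
    and "\<And>x y z. x \<in> set xs \<Longrightarrow> y \<in> set xs \<Longrightarrow> z \<in> set (F x) \<Longrightarrow> z \<in> set (F y) \<Longrightarrow> x = y"
  shows "distinct (concat (map F xs))"
  using assms
proof (induction xs)
  case (Cons x xs)
  have "set (F x) \<inter> set (F y) = {}" if "y \<in> set xs" for y
    using Cons.prems(1) Cons.prems(3)[of x y] that by auto
  then show ?case using Cons by auto
qed simp

locale coded_algebra = labelled_ualg A \<phi> \<psi> for A :: "('f, 'a) ualg" and \<phi> \<psi> +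
  fixes fs :: "'f list"
  assumes set_fs: "set fs = syms A"
begin

definition code :: "'a \<Rightarrow> nat" where "code a = Suc (\<phi> a)"

definition dec :: "nat \<Rightarrow> 'a" where "dec v = \<psi> (v - 1)"

lemma code_range: "a \<in> univ A \<Longrightarrow> code a \<in> {1..p}"
  using phi_less by (simp add: code_def Suc_leI)

lemma dec_code: "a \<in> univ A \<Longrightarrow> dec (code a) = a"
  using psi_phi by (simp add: code_def dec_def)

lemma dec_closed: "v \<in> {1..p} \<Longrightarrow> dec v \<in> univ A"
  using psi_closed by (auto simp: dec_def)

lemma code_dec: "v \<in> {1..p} \<Longrightarrow> code (dec v) = v"
  using phi_psi by (auto simp: code_def dec_def)

definition tab :: "'f \<Rightarrow> nat list \<Rightarrow> nat" where
  "tab f vs = (if vs \<in> tuples {1..p} (arity A f) then code (interp A f (map dec vs)) else 0)"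

lemma tab_defined:
  assumes "f \<in> syms A" "vs \<in> tuples {1..p} (arity A f)"
  shows "tab f vs \<in> {1..p}" "dec (tab f vs) = interp A f (map dec vs)"
proof -
  have "map dec vs \<in> tuples (univ A) (arity A f)" using assms(2) dec_closed by (auto simp: tuples_def)
  then have "interp A f (map dec vs) \<in> univ A" by (rule interp_closed[OF assms(1)])
  then show "tab f vs \<in> {1..p}" "dec (tab f vs) = interp A f (map dec vs)"
    using assms(2) code_range dec_code by (simp_all add: tab_def)
qed

lemma tab_le: "f \<in> syms A \<Longrightarrow> tab f vs \<le> p"
  using tab_defined(1)[of f vs] by (cases "vs \<in> tuples {1..p} (arity A f)") (auto simp: tab_def)

lemma tab_nonzero: "tab f vs \<noteq> 0 \<Longrightarrow> vs \<in> tuples {1..p} (arity A f)"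
  by (simp add: tab_def split: if_splits)

end

locale enumeration = coded_algebra A \<phi> \<psi> fs for A :: "('f, 'a) ualg" and \<phi> \<psi> fs +
  fixes X :: "('f, nat) ualg" and n :: nat
  assumes X: "is_ualg X" "univ X = {..<n}" "same_signature X A"
begin

abbreviation T where "T \<equiv> op_table X"

lemma same_syms: "syms X = syms A" "f \<in> syms A \<Longrightarrow> arity X f = arity A f"
  using X(3) by (auto simp: same_signature_def)

lemma T_eq: "f \<in> syms A \<Longrightarrow> xs \<in> tuples {..<n} (arity A f) \<Longrightarrow> T f xs = interp X f xs"
  using X same_syms by (simp add: op_table_def)

lemma T_less: "f \<in> syms A \<Longrightarrow> xs \<in> tuples {..<n} (arity A f) \<Longrightarrow> T f xs < n"
  using T_eq[of f xs] X same_syms unfolding is_ualg_def by force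

subsection \<open>Closing a partial map under the operations\<close>

definition step :: "'f \<Rightarrow> nat list \<Rightarrow> nat list \<times> nat \<Rightarrow> nat list \<times> nat" where
  "step f xs s = (let v = tab f (map ((!) (fst s)) xs) in if v = 0 then s else put (T f xs) v s)"

definition pass :: "nat list \<times> nat \<Rightarrow> nat list \<times> nat" where
  "pass = fold (\<lambda>f. fold (step f) (List.n_lists (arity A f) [0..<n])) fs"

definition close :: "nat list \<times> nat \<Rightarrow> nat list \<times> nat" where
  "close s = (pass ^^ Suc n) s"

definition partial_hom :: "nat list \<Rightarrow> bool" where
  "partial_hom h \<longleftrightarrow> (\<forall>f\<in>syms A. \<forall>xs\<in>tuples {..<n} (arity A f). tab f (map ((!) h) xs) \<noteq> 0 \<longrightarrow>
     h ! T f xs = tab f (map ((!) h) xs))"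

definition valued :: "nat list \<Rightarrow> bool" where
  "valued h \<longleftrightarrow> length h = n \<and> set h \<subseteq> {0..p}"

lemma valued_nth:
  assumes "valued h" "j < n" "h ! j \<noteq> 0"
  shows "h ! j \<in> {1..p}"
proof -
  have "h ! j \<in> {0..p}" using assms(1,2) nth_mem[of j h] unfolding valued_def by blast
  then show ?thesis using assms(3) by simp
qed

lemma valued_put:
  assumes "valued (fst s)" "v \<le> p"
  shows "valued (fst (put y v s))"
proof -
  have "set ((fst s)[y := v]) \<subseteq> insert v (set (fst s))" by (rule set_update_subset_insert)
  then have "valued ((fst s)[y := v])" using assms by (auto simp: valued_def)
  then show ?thesis using assms(1) by (simp add: put_def)
qed

lemma state_le_step: "state_le s (step f xs s)"
  by (simp add: step_def Let_def state_le_refl state_le_put)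

lemma state_le_pass: "state_le s (pass s)"
  unfolding pass_def by (intro state_le_fold state_le_step)

lemma state_le_close: "state_le s (close s)"
  unfolding close_def by (rule state_le_funpow[OF state_le_pass])

lemma tab_below:
  assumes "below h g" "length h = n" "xs \<in> tuples {..<n} k" "tab f (map ((!) h) xs) \<noteq> 0"
  shows "tab f (map ((!) g) xs) = tab f (map ((!) h) xs)"
proof -
  have "map ((!) h) xs \<in> tuples {1..p} (arity A f)" by (rule tab_nonzero[OF assms(4)])
  then have "h ! x \<noteq> 0" if "x \<in> set xs" for x using that by (auto simp: tuples_def)
  then have "map ((!) g) xs = map ((!) h) xs"
    using assms(1-3) by (auto simp: below_def tuples_def)
  then show ?thesis by (rule arg_cong)
qed

lemma compatible_step:
  assumes g: "partial_hom g" "length g = n" and f: "f \<in> syms A" "xs \<in> tuples {..<n} (arity A f)"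
    and s: "compatible g s"
  shows "compatible g (step f xs s)"
proof -
  let ?v = "tab f (map ((!) (fst s)) xs)"
  have "below (fst s) g" "length (fst s) = n" using s g(2) below_length by (auto simp: compatible_def)
  then have "g ! T f xs = ?v" if "?v \<noteq> 0"
    using g(1) f tab_below[OF _ _ f(2) that] that unfolding partial_hom_def by metis
  then show ?thesis
    using s g(2) T_less[OF f] by (auto simp: step_def Let_def intro: compatible_put)
qed

lemma compatible_close:
  assumes g: "partial_hom g" "length g = n" and s: "compatible g s"
  shows "compatible g (close s)"
proof -
  have "compatible g (pass t)" if "compatible g t" for t
    unfolding pass_def
    by (intro compatible_fold that compatible_step[OF g]) (auto simp: n_lists_upt_eq_tuples set_fs)
  then have "compatible g ((pass ^^ m) s)" for m by (induction m) (use s in auto)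
  then show ?thesis unfolding close_def .
qed

lemma partial_hom_close:
  assumes s: "length (fst s) = n" and no_conflict: "snd (close s) = 0"
  shows "partial_hom (fst (close s))"
  unfolding partial_hom_def
proof (intro ballI impI)
  let ?t = "close s"
  fix f xs assume f: "f \<in> syms A" "xs \<in> tuples {..<n} (arity A f)"
    and nonzero: "tab f (map ((!) (fst ?t)) xs) \<noteq> 0"
  have "pass ?t = ?t"
    using funpow_fixed_if_no_conflict[of pass s, OF state_le_pass] s no_conflict by (simp add: close_def)
  then have "fold (step f) (List.n_lists (arity A f) [0..<n]) ?t = ?t"
    unfolding pass_def by (rule fold_fixed_imp_fixed[rotated]) (auto simp: f set_fs intro: state_le_fold state_le_step)
  then have "step f xs ?t = ?t"
    by (rule fold_fixed_imp_fixed[rotated]) (auto simp: f n_lists_upt_eq_tuples intro: state_le_step)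
  then have "put (T f xs) (tab f (map ((!) (fst ?t)) xs)) ?t = ?t"
    using nonzero by (simp add: step_def)
  moreover have "T f xs < length (fst ?t)"
    using T_less[OF f] s state_le_close[of s] below_length[of "fst s" "fst ?t"] by (simp add: state_le_def)
  ultimately show "fst ?t ! T f xs = tab f (map ((!) (fst ?t)) xs)"
    using put_nth[of "T f xs" "tab f (map ((!) (fst ?t)) xs)" ?t] by simp
qed

lemma valued_close:
  assumes "valued (fst s)"
  shows "valued (fst (close s))"
proof -
  have step: "valued (fst (step f xs t))" if "f \<in> syms A" "valued (fst t)" for f xs t
    using that tab_le valued_put by (simp add: step_def Let_def)
  have "valued (fst (fold (step f) xss t))" if "f \<in> syms A" "valued (fst t)" for f xss t
    using that(2) by (induction xss arbitrary: t) (use that(1) step in auto)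
  then have "valued (fst (fold (\<lambda>f. fold (step f) (xss f)) gs t))"
    if "set gs \<subseteq> syms A" "valued (fst t)" for gs xss t
    using that by (induction gs arbitrary: t) auto
  then have "valued (fst (pass t))" if "valued (fst t)" for t using that set_fs by (simp add: pass_def)
  then have "valued (fst ((pass ^^ m) s))" for m by (induction m) (use assms in auto)
  then show ?thesis unfolding close_def .
qed

definition admit :: "nat list \<times> nat \<Rightarrow> nat list list" where
  "admit s = (if snd (close s) = 0 then [fst (close s)] else [])"

lemma admitD:
  assumes "h \<in> set (admit s)" "valued (fst s)"
  shows "partial_hom h" "valued h" "below (fst s) h" "snd s = 0"
proof -
  have h: "h = fst (close s)" "snd (close s) = 0" using assms(1) by (auto simp: admit_def split: if_splits)
  show "partial_hom h" unfolding h(1) using assms(2) h(2) by (intro partial_hom_close) (simp_all add: valued_def)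
  show "valued h" unfolding h(1) by (rule valued_close[OF assms(2)])
  show "below (fst s) h" "snd s = 0" using state_le_close[of s] h by (auto simp: state_le_def)
qed

lemma ex_admit_below:
  assumes "partial_hom g" "length g = n" "compatible g s"
  shows "\<exists>h\<in>set (admit s). below h g"
  using compatible_close[OF assms] by (auto simp: admit_def compatible_def)

lemma distinct_map_admit: "distinct (map k (admit s))"
  by (simp add: admit_def)

subsection \<open>The levels of the search\<close>

text \<open>The search starts from a tuple \<open>x\<close> of preimages of all elements of \<open>A\<close>. The maps on level \<open>i\<close>
  are defined on \<open>{..<i}\<close> and determined by their values there.\<close>

definition based :: "nat list \<Rightarrow> nat list \<Rightarrow> bool" where
  "based x h \<longleftrightarrow> (\<forall>a<p. h ! (x ! a) = Suc a)"

definition start :: "nat list \<Rightarrow> nat list \<times> nat" where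
  "start x = fold (\<lambda>a. put (x ! a) (Suc a)) [0..<p] (replicate n 0, 0)"

definition next_level :: "nat \<Rightarrow> nat list list \<Rightarrow> nat list list" where
  "next_level i L = concat (map (\<lambda>h. concat (map (\<lambda>v. admit (put i (Suc v) (h, 0))) [0..<p])) L)"

lemma in_next_level_iff:
  "h' \<in> set (next_level i L) \<longleftrightarrow> (\<exists>h\<in>set L. \<exists>v<p. h' \<in> set (admit (put i (Suc v) (h, 0))))"
  by (simp add: next_level_def atLeast0LessThan Bex_def)

primrec level :: "nat list \<Rightarrow> nat \<Rightarrow> nat list list" where
  "level x 0 = admit (start x)"
| "level x (Suc i) = next_level i (level x i)"

definition total :: "nat list \<Rightarrow> bool" where
  "total g \<longleftrightarrow> length g = n \<and> set g \<subseteq> {1..p}"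

lemma total_nth: "total g \<Longrightarrow> j < n \<Longrightarrow> g ! j \<in> {1..p}"
  unfolding total_def using nth_mem[of j g] by blast

lemma total_iff: "total g \<longleftrightarrow> valued g \<and> (\<forall>j<n. g ! j \<noteq> 0)"
proof
  assume g: "valued g \<and> (\<forall>j<n. g ! j \<noteq> 0)"
  then have "g ! j \<in> {1..p}" if "j < n" for j using valued_nth that by blast
  then show "total g" using g by (fastforce simp: total_def valued_def in_set_conv_nth)
qed (use total_nth in \<open>force simp: total_def valued_def\<close>)

lemma based_below:
  assumes "based x h" "below h g" "x \<in> tuples {..<n} p" "length h = n"
  shows "based x g"
  using assms tuples_nth[OF assms(3)] by (fastforce simp: based_def below_def)

lemma valued_start: "valued (fst (start x))"
proof -
  have "valued (fst (fold (\<lambda>a. put (x ! a) (Suc a)) [0..<m] (replicate n 0, 0)))" if "m \<le> p" for m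
    using that
  proof (induction m)
    case 0
    then show ?case by (auto simp: valued_def)
  qed (simp add: valued_put)
  then show ?thesis by (simp add: start_def)
qed

lemma based_start:
  assumes x: "x \<in> tuples {..<n} p" and no_conflict: "snd (start x) = 0"
  shows "based x (fst (start x))"
proof -
  let ?s = "\<lambda>m. fold (\<lambda>a. put (x ! a) (Suc a)) [0..<m] (replicate n 0, 0)"
  have len: "length (fst (?s m)) = n" for m
    using state_le_fold[of "\<lambda>a. put (x ! a) (Suc a)" "(replicate n 0, 0)"] state_le_put below_length
    by (fastforce simp: state_le_def)
  have "\<forall>a<m. fst (?s m) ! (x ! a) = Suc a" if "snd (?s m) = 0" "m \<le> p" for m
    using that
  proof (induction m)
    case (Suc m)
    have grows: "state_le (?s m) (?s (Suc m))" by (simp add: state_le_put)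
    then have zero: "snd (?s m) = 0" using Suc.prems by (simp add: state_le_def)
    have bound: "x ! a < n" if "a \<le> m" for a using tuples_nth[OF x, of a] that Suc.prems by simp
    have "fst (?s (Suc m)) ! (x ! m) = Suc m"
      using put_nth[of "x ! m" "Suc m" "?s m"] Suc.prems zero len bound by simp
    moreover have "fst (?s (Suc m)) ! (x ! a) = Suc a" if "a < m" for a
      using below_nth[of "fst (?s m)" "fst (?s (Suc m))" "x ! a"] grows Suc zero len bound[of a] that
      by (simp add: state_le_def)
    ultimately show ?case using less_Suc_eq by blast
  qed simp
  then show ?thesis using no_conflict by (simp add: start_def based_def)
qed

lemma compatible_start:
  assumes "based x g" "x \<in> tuples {..<n} p" "length g = n"
  shows "compatible g (start x)"
  unfolding start_def
  by (intro compatible_fold compatible_put)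
    (use assms tuples_nth[OF assms(2)] in \<open>auto simp: based_def compatible_def below_def\<close>)

lemma extension_props:
  assumes h: "valued h" "based x h" "\<And>j. j < i \<Longrightarrow> h ! j \<noteq> 0" and i: "i < n" and x: "x \<in> tuples {..<n} p"
    and h': "h' \<in> set (admit (put i (Suc v) (h, 0)))" and v: "v < p"
  shows "partial_hom h'" "valued h'" "based x h'" "\<And>j. j < Suc i \<Longrightarrow> h' ! j \<noteq> 0"
    "take (Suc i) h' = take i h @ [Suc v]"
proof -
  let ?s = "put i (Suc v) (h, 0)"
  have "valued (fst ?s)" by (rule valued_put) (use h(1) v in auto)
  note admitted = admitD[OF h' this]
  show "partial_hom h'" "valued h'" using admitted by auto
  have "below h (fst ?s)" using state_le_put[of "(h, 0)"] by (simp add: state_le_def)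
  then have below: "below h h'" using admitted(3) by (rule below_trans)
  have len: "length h = n" "length h' = n" using h(1) below_length[OF below] by (auto simp: valued_def)
  show "based x h'" by (rule based_below[OF h(2) below x len(1)])
  have "fst ?s ! i = Suc v" using put_nth[of i "Suc v" "(h, 0)"] admitted(4) i len by simp
  then have at_i: "h' ! i = Suc v" using below_nth[OF admitted(3), of i] below_length[OF admitted(3)] i len by simp
  have before_i: "h' ! j = h ! j" if "j < i" for j using below_nth[OF below, of j] h(3)[OF that] that i len by simp
  show "h' ! j \<noteq> 0" if "j < Suc i" for j using that at_i before_i h(3) by (cases "j = i") auto
  show "take (Suc i) h' = take i h @ [Suc v]"
    by (rule nth_equalityI) (use i len at_i before_i in \<open>auto simp: nth_append less_Suc_eq\<close>)
qed

definition level_inv :: "nat list \<Rightarrow> nat \<Rightarrow> nat list list \<Rightarrow> bool" where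
  "level_inv x i L \<longleftrightarrow> distinct (map (take i) L) \<and>
     (\<forall>h\<in>set L. partial_hom h \<and> valued h \<and> based x h \<and> (\<forall>j<i. h ! j \<noteq> 0)) \<and>
     (\<forall>g. partial_hom g \<and> total g \<and> based x g \<longrightarrow> (\<exists>h\<in>set L. below h g))"

lemma level_inv_start:
  assumes x: "x \<in> tuples {..<n} p"
  shows "level_inv x 0 (admit (start x))"
  unfolding level_inv_def
proof (intro conjI ballI allI impI)
  fix h assume "h \<in> set (admit (start x))"
  note admitted = admitD[OF this valued_start]
  then show "partial_hom h" "valued h" by auto
  show "based x h"
    using based_below[OF based_start[OF x admitted(4)] admitted(3) x] valued_start[of x] by (simp add: valued_def)
next
  fix g assume "partial_hom g \<and> total g \<and> based x g"
  then show "\<exists>h\<in>set (admit (start x)). below h g"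
    using compatible_start[OF _ x] by (intro ex_admit_below) (auto simp: total_def)
qed (simp_all add: distinct_map_admit)

lemma distinct_next_level:
  assumes distinct: "distinct (map (take i) L)"
    and determined: "\<And>h h' v. h \<in> set L \<Longrightarrow> v < p \<Longrightarrow> h' \<in> set (admit (put i (Suc v) (h, 0))) \<Longrightarrow>
      take (Suc i) h' = take i h @ [Suc v]"
  shows "distinct (map (take (Suc i)) (next_level i L))"
proof -
  let ?E = "\<lambda>h v. map (take (Suc i)) (admit (put i (Suc v) (h, 0)))"
  have prefix: "z = take i h @ [Suc v]" if "h \<in> set L" "v < p" "z \<in> set (?E h v)" for h v z
    using that determined by auto
  have "distinct (concat (map (\<lambda>h. concat (map (?E h) [0..<p])) L))"
  proof (rule distinct_concat_map)
    show "distinct L" using distinct by (simp add: distinct_map)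
    show "distinct (concat (map (?E h) [0..<p]))" if "h \<in> set L" for h
    proof (rule distinct_concat_map)
      fix v w z assume "v \<in> set [0..<p]" "w \<in> set [0..<p]" "z \<in> set (?E h v)" "z \<in> set (?E h w)"
      then show "v = w" using prefix[OF that, of v z] prefix[OF that, of w z] by simp
    qed (simp_all only: distinct_map_admit distinct_upt)
    have candidate: "\<exists>v<p. z \<in> set (?E h v)" if "z \<in> set (concat (map (?E h) [0..<p]))" for h z
      using that by fastforce
    fix h h' z assume h: "h \<in> set L" "h' \<in> set L"
      and "z \<in> set (concat (map (?E h) [0..<p]))" "z \<in> set (concat (map (?E h') [0..<p]))"
    then obtain v v' where "v < p" "z \<in> set (?E h v)" "v' < p" "z \<in> set (?E h' v')" using candidate by blast
    then have "take i h = take i h'" using prefix h by (metis append1_eq_conv)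
    then show "h = h'" using distinct h by (auto simp: distinct_map dest: inj_onD)
  qed
  then show ?thesis by (simp add: next_level_def map_concat comp_def)
qed

lemma level_inv_next_level:
  assumes x: "x \<in> tuples {..<n} p" and i: "i < n" and inv: "level_inv x i L"
  shows "level_inv x (Suc i) (next_level i L)"
proof -
  have props: "partial_hom h'" "valued h'" "based x h'" "\<And>j. j < Suc i \<Longrightarrow> h' ! j \<noteq> 0"
    "take (Suc i) h' = take i h @ [Suc v]"
    if "h \<in> set L" "v < p" "h' \<in> set (admit (put i (Suc v) (h, 0)))" for h v h'
    using extension_props[OF _ _ _ i x that(3,2)] inv that(1) by (auto simp: level_inv_def)
  show ?thesis unfolding level_inv_def
  proof (intro conjI ballI allI impI)
    show "distinct (map (take (Suc i)) (next_level i L))"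
      by (rule distinct_next_level) (use inv props(5) in \<open>auto simp: level_inv_def\<close>)
  next
    fix h' assume "h' \<in> set (next_level i L)"
    then obtain h v where h: "h \<in> set L" "v < p" "h' \<in> set (admit (put i (Suc v) (h, 0)))"
      unfolding in_next_level_iff by blast
    show "partial_hom h'" "valued h'" "based x h'" using props[OF h] by auto
    show "h' ! j \<noteq> 0" if "j < Suc i" for j by (rule props(4)[OF h that])
  next
    fix g assume g: "partial_hom g \<and> total g \<and> based x g"
    then obtain h where h: "h \<in> set L" "below h g" using inv by (auto simp: level_inv_def)
    obtain v where v: "g ! i = Suc v" "v < p" using total_nth[of g i] g i by (cases "g ! i") auto
    have "length g = n" using g by (simp add: total_def)
    then have "compatible g (put i (Suc v) (h, 0))"
      using h(2) v i by (intro compatible_put) (auto simp: compatible_def)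
    then obtain h' where "h' \<in> set (admit (put i (Suc v) (h, 0)))" "below h' g"
      using ex_admit_below[OF _ \<open>length g = n\<close>] g by blast
    then show "\<exists>h\<in>set (next_level i L). below h g" using h(1) v(2) in_next_level_iff by blast
  qed
qed

lemma level_inv_level: "x \<in> tuples {..<n} p \<Longrightarrow> i \<le> n \<Longrightarrow> level_inv x i (level x i)"
  by (induction i) (auto intro: level_inv_start level_inv_next_level)

lemma level_top:
  assumes x: "x \<in> tuples {..<n} p"
  shows "distinct (level x n)" "set (level x n) = {g. partial_hom g \<and> total g \<and> based x g}"
proof -
  have inv: "level_inv x n (level x n)" by (rule level_inv_level[OF x]) simp
  then show "distinct (level x n)" by (simp add: level_inv_def distinct_map)
  have total: "total h" if "h \<in> set (level x n)" for h
    using that inv by (simp add: level_inv_def total_iff)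
  have "h = g" if "h \<in> set (level x n)" "total g" "below h g" for h g
    by (rule nth_equalityI) (use that inv in \<open>auto simp: below_def total_def level_inv_def\<close>)
  then show "set (level x n) = {g. partial_hom g \<and> total g \<and> based x g}"
    using inv total by (auto simp: level_inv_def) metis
qed

subsection \<open>The size of the levels\<close>

text \<open>Restricting to the common domain, a subalgebra, turns the members of a level into distinct
  surjective homomorphisms.\<close>

definition subalg :: "nat set \<Rightarrow> ('f, nat) ualg" where
  "subalg S = \<lparr>syms = syms X, arity = arity X, univ = S, interp = interp X\<rparr>"

lemma subalg_simps [simp]: "syms (subalg S) = syms A" "univ (subalg S) = S" "interp (subalg S) = interp X"
    "f \<in> syms A \<Longrightarrow> arity (subalg S) f = arity A f"
  by (simp_all add: subalg_def same_syms)

lemma subalg_full: "subalg {..<n} = X"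
  by (rule ualg.equality) (simp_all add: subalg_def X)

lemma partial_hom_on_domain:
  assumes h: "partial_hom h" "valued h" and S: "\<And>j. j \<in> S \<Longrightarrow> j < n \<and> h ! j \<noteq> 0"
    and f: "f \<in> syms A" "xs \<in> tuples S (arity A f)"
  shows "h ! interp X f xs \<noteq> 0" "dec (h ! interp X f xs) = interp A f (map (\<lambda>j. dec (h ! j)) xs)"
proof -
  have xs: "xs \<in> tuples {..<n} (arity A f)" using S f(2) by (auto simp: tuples_def)
  have "h ! j \<in> {1..p}" if "j \<in> S" for j using valued_nth[OF h(2)] S[OF that] by blast
  then have "map ((!) h) xs \<in> tuples {1..p} (arity A f)" using f(2) by (auto simp: tuples_def)
  note tab = tab_defined[OF f(1) this]
  then have "h ! T f xs = tab f (map ((!) h) xs)" using h(1) f(1) xs unfolding partial_hom_def by force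
  then show "h ! interp X f xs \<noteq> 0" "dec (h ! interp X f xs) = interp A f (map (\<lambda>j. dec (h ! j)) xs)"
    using tab T_eq[OF f(1) xs] by (auto simp: comp_def)
qed

lemma restrict_partial_hom_surj_hom:
  assumes h: "partial_hom h" "valued h" "based x h" and x: "x \<in> tuples {..<n} p"
    and S: "\<And>j. j \<in> S \<Longrightarrow> j < n \<and> h ! j \<noteq> 0" "set x \<subseteq> S" "is_ualg (subalg S)"
  shows "restrict (\<lambda>j. dec (h ! j)) S \<in> surj_homs (subalg S) A"
proof -
  have "dec (h ! j) \<in> univ A" if "j \<in> S" for j using S(1)[OF that] valued_nth[OF h(2)] dec_closed by blast
  moreover have "\<exists>j\<in>S. dec (h ! j) = a" if a: "a \<in> univ A" for a
  proof (intro bexI)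
    show "x ! \<phi> a \<in> S" using S(2) x phi_less[OF a] by (auto simp: tuples_def)
    show "dec (h ! (x ! \<phi> a)) = a" using h(3) phi_less[OF a] dec_code[OF a] by (simp add: based_def code_def)
  qed
  ultimately have "(\<lambda>j. dec (h ! j)) ` S = univ A" by force
  then have "restrict (\<lambda>j. dec (h ! j)) (univ (subalg S)) \<in> surj_homs (subalg S) A"
    by (intro restrict_in_surj_homsI) (use S partial_hom_on_domain(2)[OF h(1,2) S(1)] in auto)
  then show ?thesis by simp
qed

definition common_domain :: "nat list list \<Rightarrow> nat set" where
  "common_domain L = {j. j < n \<and> (\<forall>h\<in>set L. h ! j \<noteq> 0)}"

lemma is_ualg_common_domain:
  assumes inv: "level_inv x i L" and ne: "common_domain L \<noteq> {}"
  shows "is_ualg (subalg (common_domain L))"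
  unfolding is_ualg_def
proof (intro conjI ballI)
  fix f xs assume "f \<in> syms (subalg (common_domain L))"
    and "xs \<in> tuples (univ (subalg (common_domain L))) (arity (subalg (common_domain L)) f)"
  then have f: "f \<in> syms A" "xs \<in> tuples (common_domain L) (arity A f)" by simp_all
  then have "xs \<in> tuples {..<n} (arity A f)" by (auto simp: tuples_def common_domain_def)
  then have "interp X f xs < n" using T_less[OF f(1)] T_eq[OF f(1)] by metis
  moreover have "h ! interp X f xs \<noteq> 0" if "h \<in> set L" for h
    by (rule partial_hom_on_domain(1)[OF _ _ _ f])
      (use that inv in \<open>auto simp: level_inv_def common_domain_def\<close>)
  ultimately show "interp (subalg (common_domain L)) f xs \<in> univ (subalg (common_domain L))"
    by (simp add: common_domain_def)
qed (use ne in simp)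

lemma base_in_common_domain:
  assumes x: "x \<in> tuples {..<n} p" and inv: "level_inv x i L"
  shows "set x \<subseteq> common_domain L"
proof
  fix j assume "j \<in> set x"
  then obtain a where "a < p" "j = x ! a" using x by (auto simp: tuples_def in_set_conv_nth)
  moreover have "j < n" using \<open>j \<in> set x\<close> x by (auto simp: tuples_def)
  ultimately show "j \<in> common_domain L" using inv by (auto simp: level_inv_def based_def common_domain_def)
qed

lemma inj_on_restrict_common_domain:
  assumes inv: "level_inv x i L" and i: "i \<le> n"
  shows "inj_on (\<lambda>h. restrict (\<lambda>j. dec (h ! j)) (common_domain L)) (set L)"
proof (rule inj_onI)
  fix h g assume hg: "h \<in> set L" "g \<in> set L"
    and eq: "restrict (\<lambda>j. dec (h ! j)) (common_domain L) = restrict (\<lambda>j. dec (g ! j)) (common_domain L)"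
  have valued: "valued h" "valued g" using inv hg by (auto simp: level_inv_def)
  have "h ! j = g ! j" if "j < i" for j
  proof -
    have j: "j < n" "h ! j \<noteq> 0" "g ! j \<noteq> 0" "j \<in> common_domain L"
      using inv i hg that by (auto simp: level_inv_def common_domain_def)
    then have "dec (h ! j) = dec (g ! j)" using fun_cong[OF eq, of j] by simp
    then show ?thesis using valued_nth[OF valued(1) j(1,2)] valued_nth[OF valued(2) j(1,3)] code_dec by metis
  qed
  then have "take i h = take i g" using valued i by (intro nth_equalityI) (auto simp: valued_def)
  then show "h = g" using inv hg by (auto simp: level_inv_def distinct_map dest: inj_onD)
qed

lemma length_level_le:
  assumes x: "x \<in> tuples {..<n} p" and i: "i \<le> n" and b: "surj_bound A b" "mono b"
  shows "length (level x i) \<le> b n"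
proof -
  let ?L = "level x i" and ?S = "common_domain (level x i)"
  let ?restrict = "\<lambda>h. restrict (\<lambda>j. dec (h ! j)) ?S"
  have inv: "level_inv x i ?L" by (rule level_inv_level[OF x i])
  have base: "set x \<subseteq> ?S" by (rule base_in_common_domain[OF x inv])
  then have "?S \<noteq> {}" using x card_pos by (auto simp: tuples_def)
  then have sub: "is_ualg (subalg ?S)" by (rule is_ualg_common_domain[OF inv])
  have "?restrict h \<in> surj_homs (subalg ?S) A" if "h \<in> set ?L" for h
    by (rule restrict_partial_hom_surj_hom[OF _ _ _ x _ base sub])
      (use inv that in \<open>auto simp: level_inv_def common_domain_def\<close>)
  then have image: "?restrict ` set ?L \<subseteq> surj_homs (subalg ?S) A" by blast
  have finite: "finite ?S" by (simp add: common_domain_def)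
  have "length ?L = card (set ?L)"
    using inv distinct_card by (metis distinct_map level_inv_def)
  also have "\<dots> \<le> card (surj_homs (subalg ?S) A)"
    using inj_on_restrict_common_domain[OF inv i] image
    by (rule card_inj_on_le) (simp add: finite_surj_homs finite finite_univ)
  also have "\<dots> \<le> b (card ?S)"
    using b(1) sub finite X(3) unfolding surj_bound_def same_signature_def
    by (auto dest!: spec[of _ "subalg ?S"])
  also have "\<dots> \<le> b n"
    using b(2) card_mono[of "{..<n}" ?S] by (auto simp: monoD common_domain_def subset_iff)
  finally show ?thesis .
qed

subsection \<open>Every surjective homomorphism is found exactly once\<close>

definition canonical :: "nat list \<Rightarrow> nat list \<Rightarrow> bool" where
  "canonical x g \<longleftrightarrow> (\<forall>j<n. x ! (g ! j - 1) \<le> j)"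

definition result :: "nat list list" where
  "result = concat (map (\<lambda>x. filter (canonical x) (level x n)) (List.n_lists p [0..<n]))"

definition decode :: "nat list \<Rightarrow> nat \<Rightarrow> 'a" where
  "decode g = restrict (\<lambda>j. dec (g ! j)) {..<n}"

definition encode :: "(nat \<Rightarrow> 'a) \<Rightarrow> nat list" where
  "encode h = map (\<lambda>j. code (h j)) [0..<n]"

lemma canonical_unique:
  assumes "x \<in> tuples {..<n} p" "y \<in> tuples {..<n} p" "based x g" "based y g" "canonical x g" "canonical y g"
  shows "x = y"
proof (rule nth_equalityI)
  have "x ! a \<le> y ! a" if "a < p" "y \<in> tuples {..<n} p" "based y g" "canonical x g" for x y a
  proof -
    have "g ! (y ! a) = Suc a" "y ! a < n" using that tuples_nth[OF that(2,1)] by (auto simp: based_def)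
    then show ?thesis using that(4) unfolding canonical_def by fastforce
  qed
  then show "x ! a = y ! a" if "a < length x" for a
    using assms that by (metis le_antisym tuples_length)
qed (use assms in \<open>simp add: tuples_length\<close>)

lemma decode_surj_hom:
  assumes g: "partial_hom g" "total g" "based x g" and x: "x \<in> tuples {..<n} p"
  shows "decode g \<in> surj_homs X A"
proof -
  have "restrict (\<lambda>j. dec (g ! j)) {..<n} \<in> surj_homs (subalg {..<n}) A"
    by (rule restrict_partial_hom_surj_hom[OF g(1) _ g(3) x])
      (use g(2) x X(1) in \<open>auto simp: total_iff subalg_full tuples_def\<close>)
  then show ?thesis by (simp add: decode_def subalg_full)
qed

lemma encode_decode: "total g \<Longrightarrow> encode (decode g) = g"
  by (rule nth_equalityI) (simp_all add: encode_def decode_def code_dec[OF total_nth], simp add: total_def)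

lemma
  assumes h: "h \<in> surj_homs X A"
  shows total_encode: "total (encode h)" and partial_hom_encode: "partial_hom (encode h)"
    and decode_encode: "decode (encode h) = h"
proof -
  have closed: "h j \<in> univ A" if "j < n" for j using surj_homsD(1)[OF h] that X(2) by simp
  have nth: "encode h ! j = code (h j)" if "j < n" for j using that by (simp add: encode_def)
  show "total (encode h)" using code_range[OF closed] by (auto simp: encode_def total_def)
  show "partial_hom (encode h)" unfolding partial_hom_def
  proof (intro ballI impI)
    fix f xs assume f: "f \<in> syms A" "xs \<in> tuples {..<n} (arity A f)"
    have codes: "map ((!) (encode h)) xs = map (\<lambda>j. code (h j)) xs" using f(2) nth by (auto simp: tuples_def)
    have "map (\<lambda>j. code (h j)) xs \<in> tuples {1..p} (arity A f)"
      using f(2) code_range[OF closed] by (fastforce simp: tuples_def)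
    moreover have "map dec (map (\<lambda>j. code (h j)) xs) = map h xs"
      using f(2) dec_code[OF closed] by (auto simp: tuples_def)
    ultimately have "tab f (map ((!) (encode h)) xs) = code (interp A f (map h xs))"
      unfolding codes by (simp add: tab_def del: map_map)
    also have "interp A f (map h xs) = h (T f xs)"
      using surj_homsD(4)[OF h, of f xs] f X(2) same_syms T_eq[OF f] by simp
    finally show "encode h ! T f xs = tab f (map ((!) (encode h)) xs)" using nth[OF T_less[OF f]] by simp
  qed
  show "decode (encode h) = h"
  proof (rule extensionalityI[of _ "{..<n}"])
    show "h \<in> extensional {..<n}" using surj_homsD(2)[OF h] X(2) by simp
    show "decode (encode h) j = h j" if "j \<in> {..<n}" for j
      using that nth dec_code[OF closed] by (simp add: decode_def)
  qed (simp add: decode_def)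
qed

lemma ex_canonical_base:
  assumes h: "h \<in> surj_homs X A"
  obtains x where "x \<in> tuples {..<n} p" "based x (encode h)" "canonical x (encode h)"
proof -
  let ?g = "encode h"
  define first where "first a = (LEAST j. j < n \<and> ?g ! j = Suc a)" for a
  have first: "first a < n \<and> ?g ! first a = Suc a" if "a < p" for a
  proof -
    have "\<psi> a \<in> h ` {..<n}" using surj_homsD(3)[OF h] psi_closed[OF that] X(2) by simp
    then obtain j where "j < n" "h j = \<psi> a" by auto
    then have "j < n \<and> ?g ! j = Suc a" using phi_psi[OF that] by (simp add: encode_def code_def)
    then show ?thesis unfolding first_def by (rule LeastI)
  qed
  let ?x = "map first [0..<p]"
  have "?x ! (?g ! j - 1) \<le> j" if j: "j < n" for j
  proof -
    obtain a where "?g ! j = Suc a" "a < p"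
      using total_nth[OF total_encode[OF h] j] by (cases "?g ! j") auto
    then show ?thesis using j by (auto simp: first_def intro: Least_le)
  qed
  then have "canonical ?x ?g" by (simp add: canonical_def)
  moreover have "?x \<in> tuples {..<n} p" "based ?x ?g" using first by (auto simp: tuples_def based_def)
  ultimately show ?thesis by (rule that[rotated 2])
qed

lemma in_result_iff:
  "g \<in> set result \<longleftrightarrow> (\<exists>x\<in>tuples {..<n} p. partial_hom g \<and> total g \<and> based x g \<and> canonical x g)"
  unfolding result_def using level_top(2) by (auto simp: n_lists_upt_eq_tuples)

lemma encode_decode_result: "map encode (map decode result) = result"
  using in_result_iff encode_decode by (auto simp: comp_def intro!: map_idI)

lemma distinct_decode_result: "distinct (map decode result)"
proof -
  have "distinct result" unfolding result_def
  proof (rule distinct_concat_map)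
    show "distinct (List.n_lists p [0..<n])" by (simp add: distinct_n_lists)
    show "distinct (filter (canonical x) (level x n))" if "x \<in> set (List.n_lists p [0..<n])" for x
      using that level_top(1) by (simp add: n_lists_upt_eq_tuples)
  qed (use level_top(2) canonical_unique in \<open>auto simp: n_lists_upt_eq_tuples\<close>)
  then have "distinct (map encode (map decode result))" unfolding encode_decode_result .
  then show ?thesis by (simp only: distinct_map[of encode])
qed

lemma set_decode_result: "set (map decode result) = surj_homs X A"
proof
  show "set (map decode result) \<subseteq> surj_homs X A" using in_result_iff decode_surj_hom by auto
  show "surj_homs X A \<subseteq> set (map decode result)"
  proof
    fix h assume h: "h \<in> surj_homs X A"
    obtain x where "x \<in> tuples {..<n} p" "based x (encode h)" "canonical x (encode h)"
      using ex_canonical_base[OF h] .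
    then have "encode h \<in> set result"
      using in_result_iff total_encode[OF h] partial_hom_encode[OF h] by blast
    then show "h \<in> set (map decode result)" using decode_encode[OF h] by (metis image_eqI list.set_map)
  qed
qed

end

section \<open>A program logic with running times\<close>

definition run :: "('f \<Rightarrow> nat list \<Rightarrow> nat) \<Rightarrow> 'f com \<Rightarrow> (nat \<Rightarrow> state \<Rightarrow> bool) \<Rightarrow> state \<Rightarrow> bool" where
  "run T c Q s \<longleftrightarrow> (\<exists>t s'. exec T c s t s' \<and> Q t s')"

abbreviation set_reg :: "nat \<Rightarrow> nat \<Rightarrow> state \<Rightarrow> state" where
  "set_reg r v s \<equiv> s\<lparr>regs := (regs s)(r := v)\<rparr>"

abbreviation set_array :: "nat \<Rightarrow> nat list \<Rightarrow> nat \<Rightarrow> state \<Rightarrow> state" where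
  "set_array a ix v s \<equiv> s\<lparr>arrays := (arrays s)(a := (arrays s a)(ix := v))\<rparr>"

lemma run_Skip [simp]: "run T Skip Q s \<longleftrightarrow> Q 1 s"
  unfolding run_def by (auto elim: exec.cases intro!: exI exec.Skip[unfolded One_nat_def])

lemma run_Assign [simp]: "run T (Assign r e) Q s \<longleftrightarrow> Q (1 + exp_cost e) (set_reg r (eval_exp T s e) s)"
  unfolding run_def by (auto elim: exec.cases intro!: exI exec.Assign)

lemma run_Store [simp]:
  "run T (Store a es e) Q s \<longleftrightarrow>
     Q (1 + sum_list (map exp_cost es) + exp_cost e) (set_array a (map (eval_exp T s) es) (eval_exp T s e) s)"
  unfolding run_def by (auto elim: exec.cases intro!: exI exec.Store)

lemma run_Output [simp]:
  "run T (Output e) Q s \<longleftrightarrow> Q (1 + exp_cost e) (s\<lparr>outp := outp s @ [eval_exp T s e]\<rparr>)"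
  unfolding run_def by (auto elim: exec.cases intro!: exI exec.Output)

lemma run_Seq [simp]: "run T (Seq c1 c2) Q s \<longleftrightarrow> run T c1 (\<lambda>t1. run T c2 (\<lambda>t2. Q (t1 + t2))) s"
proof
  assume "run T (Seq c1 c2) Q s"
  then obtain t s' where "exec T (Seq c1 c2) s t s'" "Q t s'" unfolding run_def by blast
  then show "run T c1 (\<lambda>t1. run T c2 (\<lambda>t2. Q (t1 + t2))) s"
    unfolding run_def by cases blast
qed (auto simp: run_def intro: exec.Seq)

lemma run_Cond [simp]:
  "run T (Cond b c1 c2) Q s \<longleftrightarrow>
     run T (if eval_exp T s b \<noteq> 0 then c1 else c2) (\<lambda>t. Q (1 + exp_cost b + t)) s"
proof
  assume "run T (Cond b c1 c2) Q s"
  then obtain t s' where "exec T (Cond b c1 c2) s t s'" "Q t s'" unfolding run_def by blast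
  then show "run T (if eval_exp T s b \<noteq> 0 then c1 else c2) (\<lambda>t. Q (1 + exp_cost b + t)) s"
    unfolding run_def by cases auto
next
  assume "run T (if eval_exp T s b \<noteq> 0 then c1 else c2) (\<lambda>t. Q (1 + exp_cost b + t)) s"
  then show "run T (Cond b c1 c2) Q s"
    unfolding run_def by (cases "eval_exp T s b = 0") (metis exec.CondFalse, metis exec.CondTrue)
qed

lemma run_While_True:
  assumes "eval_exp T s b \<noteq> 0" "run T c (\<lambda>t1. run T (While b c) (\<lambda>t2. Q (1 + exp_cost b + t1 + t2))) s"
  shows "run T (While b c) Q s"
  using assms unfolding run_def by (blast intro: exec.WhileTrue)

lemma run_While_False: "eval_exp T s b = 0 \<Longrightarrow> Q (1 + exp_cost b) s \<Longrightarrow> run T (While b c) Q s"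
  unfolding run_def by (blast intro: exec.WhileFalse)

lemma run_mono: "run T c P s \<Longrightarrow> (\<And>t s'. P t s' \<Longrightarrow> Q t s') \<Longrightarrow> run T c Q s"
  unfolding run_def by blast

definition run_within :: "('f \<Rightarrow> nat list \<Rightarrow> nat) \<Rightarrow> 'f com \<Rightarrow> nat \<Rightarrow> (state \<Rightarrow> bool) \<Rightarrow> state \<Rightarrow> bool" where
  "run_within T c b Q s \<longleftrightarrow> run T c (\<lambda>t s'. t \<le> b \<and> Q s') s"

lemma run_if_run_within:
  assumes "run_within T c b P s" "\<And>t s'. t \<le> b \<Longrightarrow> P s' \<Longrightarrow> Q t s'"
  shows "run T c Q s"
  using assms unfolding run_within_def by (elim run_mono) blast

lemma run_within_mono:
  assumes "run_within T c b P s" "\<And>s'. P s' \<Longrightarrow> Q s'" "b \<le> b'"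
  shows "run_within T c b' Q s"
  unfolding run_within_def using assms by (auto elim: run_if_run_within)

lemma run_within_Seq:
  assumes "run_within T c1 t1 P s" "\<And>s1. P s1 \<Longrightarrow> run_within T c2 t2 Q s1"
  shows "run_within T (Seq c1 c2) (t1 + t2) Q s"
  unfolding run_within_def run_Seq
proof (rule run_if_run_within[OF assms(1)])
  fix t s1 assume "t \<le> t1" "P s1"
  then show "run T c2 (\<lambda>t'. \<lambda>s'. t + t' \<le> t1 + t2 \<and> Q s') s1"
    by (intro run_if_run_within[OF assms(2)]) auto
qed

lemma run_within_Skip: "Q s \<Longrightarrow> 1 \<le> t \<Longrightarrow> run_within T Skip t Q s"
  by (simp add: run_within_def)

lemma run_within_Assign:
  "Q (set_reg r (eval_exp T s e) s) \<Longrightarrow> 1 + exp_cost e \<le> t \<Longrightarrow> run_within T (Assign r e) t Q s"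
  by (simp add: run_within_def)

lemma run_within_Assign_Seq:
  assumes "run_within T c t Q (set_reg r (eval_exp T s e) s)" "1 + exp_cost e \<le> k"
  shows "run_within T (Seq (Assign r e) c) (k + t) Q s"
  by (rule run_within_Seq[where P = "\<lambda>s'. s' = set_reg r (eval_exp T s e) s"])
    (use assms in \<open>auto intro: run_within_Assign\<close>)

lemma run_within_Cond:
  assumes "eval_exp T s b \<noteq> 0 \<Longrightarrow> run_within T c1 t Q s" "eval_exp T s b = 0 \<Longrightarrow> run_within T c2 t Q s"
    and "1 + exp_cost b \<le> k"
  shows "run_within T (Cond b c1 c2) (k + t) Q s"
  unfolding run_within_def run_Cond
  by (rule run_if_run_within[where b = t and P = Q]) (use assms in auto)

subsection \<open>Loops\<close>

definition For :: "nat \<Rightarrow> 'f exp \<Rightarrow> 'f com \<Rightarrow> 'f com" where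
  "For r e c = Seq (Assign r (Num 0)) (While (Monus e (Reg r)) (Seq c (Assign r (Plus (Reg r) (Num 1)))))"

definition for_cost :: "nat \<Rightarrow> nat \<Rightarrow> nat \<Rightarrow> nat" where
  "for_cost m b t = m * (t + b + 7) + b + 5"

lemma for_cost_mono: "m \<le> m' \<Longrightarrow> t \<le> t' \<Longrightarrow> for_cost m b t \<le> for_cost m' b t'"
  unfolding for_cost_def by (intro add_mono mult_le_mono) auto

lemma run_within_For:
  fixes T :: "'f \<Rightarrow> nat list \<Rightarrow> nat" and e :: "'f exp"
  assumes init: "I 0 (set_reg r 0 s)"
    and bound: "\<And>i s. I i s \<Longrightarrow> eval_exp T s e = N"
    and body: "\<And>i s. i < N \<Longrightarrow> I i s \<Longrightarrow> regs s r = i \<Longrightarrow>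
      run_within T c t (\<lambda>s'. regs s' r = i \<and> I (Suc i) (set_reg r (Suc i) s')) s"
  shows "run_within T (For r e c) (for_cost N (exp_cost e) t) (I N) s"
proof -
  let ?W = "While (Monus e (Reg r)) (Seq c (Assign r (Plus (Reg r) (Num 1))))"
  let ?cost = "\<lambda>m. m * (t + exp_cost e + 7) + exp_cost e + 3"
  have loop: "run T ?W (\<lambda>t' s''. t' \<le> ?cost m \<and> I N s'') s'"
    if "i + m = N" "I i s'" "regs s' r = i" for m i s'
    using that
  proof (induction m arbitrary: i s')
    case 0
    then show ?case using bound[OF 0(2)] by (intro run_While_False) auto
  next
    case (Suc m)
    show ?case
    proof (rule run_While_True, unfold run_Seq run_Assign)
      show "eval_exp T s' (Monus e (Reg r)) \<noteq> 0" using bound[OF Suc.prems(2)] Suc.prems by simp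
      have "run_within T c t (\<lambda>s''. regs s'' r = i \<and> I (Suc i) (set_reg r (Suc i) s'')) s'"
        using body Suc.prems by simp
      then show "run T c (\<lambda>t1 s1. run T ?W (\<lambda>t2 s''. 1 + exp_cost (Monus e (Reg r)) +
          (t1 + (1 + exp_cost (Plus (Reg r) (Num 1) :: 'f exp))) + t2 \<le> ?cost (Suc m) \<and> I N s'')
          (set_reg r (eval_exp T s1 (Plus (Reg r) (Num 1))) s1)) s'"
      proof (rule run_if_run_within)
        fix t1 s1 assume "t1 \<le> t" and s1: "regs s1 r = i \<and> I (Suc i) (set_reg r (Suc i) s1)"
        have "run T ?W (\<lambda>t' s''. t' \<le> ?cost m \<and> I N s'') (set_reg r (Suc i) s1)"
          by (rule Suc.IH) (use Suc.prems s1 in auto)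
        then show "run T ?W (\<lambda>t2 s''. 1 + exp_cost (Monus e (Reg r)) +
            (t1 + (1 + exp_cost (Plus (Reg r) (Num 1) :: 'f exp))) + t2 \<le> ?cost (Suc m) \<and> I N s'')
            (set_reg r (eval_exp T s1 (Plus (Reg r) (Num 1))) s1)"
          using s1 \<open>t1 \<le> t\<close> by (auto elim: run_mono)
      qed
    qed
  qed
  have "run T ?W (\<lambda>t' s''. t' \<le> ?cost N \<and> I N s'') (set_reg r 0 s)"
    by (rule loop[of 0]) (use init in auto)
  then show ?thesis unfolding For_def run_within_def by (auto elim: run_mono simp: for_cost_def)
qed

lemma run_within_For_fold:
  fixes T :: "'f \<Rightarrow> nat list \<Rightarrow> nat" and e :: "'f exp"
  assumes bound: "\<And>s. Inv s \<Longrightarrow> eval_exp T s e = N"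
    and counter: "\<And>s v. Inv s \<Longrightarrow> Inv (set_reg r v s) \<and> st (set_reg r v s) = st s"
    and body: "\<And>i s. i < N \<Longrightarrow> Inv s \<Longrightarrow> regs s r = i \<Longrightarrow>
      run_within T c t (\<lambda>s'. Inv s' \<and> st s' = f i (st s) \<and> regs s' r = i) s"
    and "Inv s"
  shows "run_within T (For r e c) (for_cost N (exp_cost e) t) (\<lambda>s'. Inv s' \<and> st s' = fold f [0..<N] (st s)) s"
proof (rule run_within_For[where I = "\<lambda>i s'. Inv s' \<and> st s' = fold f [0..<i] (st s)"])
  fix i s' assume i: "i < N" and s': "Inv s' \<and> st s' = fold f [0..<i] (st s)" "regs s' r = i"
  then show "run_within T c t (\<lambda>s''. regs s'' r = i \<and>
      Inv (set_reg r (Suc i) s'') \<and> st (set_reg r (Suc i) s'') = fold f [0..<Suc i] (st s)) s'"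
    using counter by (intro run_within_mono[OF body[OF i]]) (auto simp del: fun_upd_apply)
qed (use bound counter[OF \<open>Inv s\<close>] in \<open>auto simp del: fun_upd_apply\<close>)

primrec nest :: "nat \<Rightarrow> nat \<Rightarrow> 'f com \<Rightarrow> 'f com" where
  "nest r 0 c = c"
| "nest r (Suc k) c = nest (Suc r) k (For r (Reg 0) c)"

primrec nest_cost :: "nat \<Rightarrow> nat \<Rightarrow> nat \<Rightarrow> nat" where
  "nest_cost n 0 t = t"
| "nest_cost n (Suc k) t = nest_cost n k (for_cost n 1 t)"

lemma fold_n_lists_Suc:
  "fold f (List.n_lists (Suc k) xs) s = fold (\<lambda>ys. fold (\<lambda>y. f (y # ys)) xs) (List.n_lists k xs) s"
proof -
  have "fold f (concat (map (\<lambda>ys. map (\<lambda>y. y # ys) xs) yss)) s =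
      fold (\<lambda>ys. fold (\<lambda>y. f (y # ys)) xs) yss s" for yss
    by (induction yss arbitrary: s) (simp_all add: fold_map comp_def)
  then show ?thesis by simp
qed

lemma run_within_nest:
  fixes T :: "'f \<Rightarrow> nat list \<Rightarrow> nat"
  assumes size: "\<And>s. Inv s \<Longrightarrow> regs s 0 = n"
    and counters: "\<And>s r' v. r \<le> r' \<Longrightarrow> r' < r + k \<Longrightarrow> Inv s \<Longrightarrow>
      Inv (set_reg r' v s) \<and> st (set_reg r' v s) = st s"
    and body: "\<And>s xs. Inv s \<Longrightarrow> xs \<in> tuples {..<n} k \<Longrightarrow> (\<And>j. j < k \<Longrightarrow> regs s (r + j) = xs ! j) \<Longrightarrow>
      run_within T c t (\<lambda>s'. Inv s' \<and> st s' = f xs (st s) \<and> (\<forall>j<k. regs s' (r + j) = xs ! j)) s"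
    and "Inv s"
  shows "run_within T (nest r k c) (nest_cost n k t)
    (\<lambda>s'. Inv s' \<and> st s' = fold f (List.n_lists k [0..<n]) (st s)) s"
  using counters body
proof (induction k arbitrary: r c t f)
  case 0
  show ?case using 0(2)[of s "[]"] \<open>Inv s\<close> by (auto simp: tuples_Nil elim: run_within_mono)
next
  case (Suc k)
  have "run_within T (nest (Suc r) k (For r (Reg 0) c)) (nest_cost n k (for_cost n 1 t))
    (\<lambda>s'. Inv s' \<and> st s' = fold (\<lambda>ys. fold (\<lambda>y. f (y # ys)) [0..<n]) (List.n_lists k [0..<n]) (st s)) s"
  proof (rule Suc.IH)
    fix s ys assume s: "Inv s" "\<And>j. j < k \<Longrightarrow> regs s (Suc r + j) = ys ! j" and ys: "ys \<in> tuples {..<n} k"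
    let ?Inv = "\<lambda>s'. Inv s' \<and> (\<forall>j<k. regs s' (Suc r + j) = ys ! j)"
    have "run_within T (For r (Reg 0) c) (for_cost n (exp_cost (Reg 0 :: 'f exp)) t)
      (\<lambda>s'. ?Inv s' \<and> st s' = fold (\<lambda>y. f (y # ys)) [0..<n] (st s)) s"
    proof (rule run_within_For_fold[where Inv = ?Inv])
      fix y s' assume y: "y < n" and s': "?Inv s'" "regs s' r = y"
      have "regs s' (r + j) = (y # ys) ! j" if "j < Suc k" for j
        using s' that by (cases j) auto
      then have "run_within T c t (\<lambda>s''. Inv s'' \<and> st s'' = f (y # ys) (st s') \<and>
          (\<forall>j<Suc k. regs s'' (r + j) = (y # ys) ! j)) s'"
        using s' ys y by (intro Suc.prems(2)) (auto simp: tuples_Cons)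
      then show "run_within T c t (\<lambda>s''. ?Inv s'' \<and> st s'' = f (y # ys) (st s') \<and> regs s'' r = y) s'"
        by (rule run_within_mono) (auto simp: All_less_Suc2)
    next
      fix s' v assume "?Inv s'"
      then show "?Inv (set_reg r v s') \<and> st (set_reg r v s') = st s'" using Suc.prems(1)[of r s' v]
        by (auto simp: fun_upd_other simp del: fun_upd_apply)
    qed (use s size in auto)
    then show "run_within T (For r (Reg 0) c) (for_cost n 1 t)
      (\<lambda>s'. Inv s' \<and> st s' = fold (\<lambda>y. f (y # ys)) [0..<n] (st s) \<and> (\<forall>j<k. regs s' (Suc r + j) = ys ! j)) s"
      by (rule run_within_mono) auto
  qed (use Suc.prems(1) in auto)
  then show ?case unfolding fold_n_lists_Suc by simp
qed

definition seqs :: "'f com list \<Rightarrow> 'f com" where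
  "seqs cs = foldr Seq cs Skip"

lemma run_within_seqs:
  assumes body: "\<And>x s. x \<in> set xs \<Longrightarrow> Inv s \<Longrightarrow> run_within T (c x) (t x) (\<lambda>s'. Inv s' \<and> st s' = f x (st s)) s"
    and "Inv s"
  shows "run_within T (seqs (map c xs)) ((\<Sum>x\<leftarrow>xs. t x) + 1) (\<lambda>s'. Inv s' \<and> st s' = fold f xs (st s)) s"
  using assms
proof (induction xs arbitrary: s)
  case Nil
  then show ?case by (simp add: seqs_def run_within_def)
next
  case (Cons x xs)
  have "run_within T (Seq (c x) (seqs (map c xs))) (t x + ((\<Sum>x\<leftarrow>xs. t x) + 1))
    (\<lambda>s'. Inv s' \<and> st s' = fold f (x # xs) (st s)) s"
  proof (rule run_within_Seq)
    show "run_within T (c x) (t x) (\<lambda>s'. Inv s' \<and> st s' = f x (st s)) s" using Cons.prems by simp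
    show "run_within T (seqs (map c xs)) ((\<Sum>x\<leftarrow>xs. t x) + 1) (\<lambda>s'. Inv s' \<and> st s' = fold f (x # xs) (st s)) s1"
      if "Inv s1 \<and> st s1 = f x (st s)" for s1
      using Cons.IH[of s1] Cons.prems(1) that by simp
  qed
  then show ?case by (simp add: seqs_def add.assoc)
qed

subsection \<open>Frames\<close>

definition frame :: "nat set \<Rightarrow> nat set \<Rightarrow> state \<Rightarrow> state \<Rightarrow> bool" where
  "frame R B s s' \<longleftrightarrow> (\<forall>r. r \<notin> R \<longrightarrow> regs s' r = regs s r) \<and>
     (\<forall>a. a \<notin> B \<longrightarrow> arrays s' a = arrays s a) \<and> outp s' = outp s"

lemma frame_refl: "frame R B s s"
  by (simp add: frame_def)

lemma frame_trans:
  assumes "frame R B s s'" "frame R' B' s' s''" "R' \<subseteq> R" "B' \<subseteq> B"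
  shows "frame R B s s''"
  using assms unfolding frame_def by (metis in_mono)

lemma frame_mono: "frame R B s s' \<Longrightarrow> R \<subseteq> R' \<Longrightarrow> B \<subseteq> B' \<Longrightarrow> frame R' B' s s'"
  unfolding frame_def by blast

lemma frame_set_reg: "frame R B s s' \<Longrightarrow> r \<in> R \<Longrightarrow> frame R B s (set_reg r v s')"
  by (auto simp: frame_def)

lemma frame_set_array: "frame R B s s' \<Longrightarrow> a \<in> B \<Longrightarrow> frame R B s (set_array a ix v s')"
  by (auto simp: frame_def)

lemma frameD:
  assumes "frame R B s s'"
  shows "r \<notin> R \<Longrightarrow> regs s' r = regs s r" "a \<notin> B \<Longrightarrow> arrays s' a = arrays s a" "outp s' = outp s"
  using assms by (auto simp: frame_def)

lemma run_within_fill: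
  fixes T :: "'f \<Rightarrow> nat list \<Rightarrow> nat"
  assumes n: "regs s 0 = n" and r: "r \<noteq> 0"
    and prefix: "\<And>s'. frame {r} {a} s s' \<Longrightarrow> map (eval_exp T s') es = ix"
    and element: "\<And>s'. frame {r} {a} s s' \<Longrightarrow> regs s' r < n \<Longrightarrow> eval_exp T s' e = v (regs s' r)"
    and t: "sum_list (map exp_cost es) + exp_cost e + 2 \<le> t"
  shows "run_within T (For r (Reg 0) (Store a (es @ [Reg r]) e)) (for_cost n 1 t)
    (\<lambda>s'. (\<forall>j<n. arrays s' a (ix @ [j]) = v j) \<and>
      (\<forall>iy. butlast iy \<noteq> ix \<longrightarrow> arrays s' a iy = arrays s a iy) \<and> frame {r} {a} s s') s"
proof -
  let ?I = "\<lambda>i s'. (\<forall>j<i. arrays s' a (ix @ [j]) = v j) \<and>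
    (\<forall>iy. butlast iy \<noteq> ix \<longrightarrow> arrays s' a iy = arrays s a iy) \<and> frame {r} {a} s s'"
  have "run_within T (For r (Reg 0) (Store a (es @ [Reg r]) e)) (for_cost n (exp_cost (Reg 0 :: 'f exp)) t) (?I n) s"
  proof (rule run_within_For[where I = ?I])
    show "?I 0 (set_reg r 0 s)" by (auto intro: frame_set_reg frame_refl)
    show "eval_exp T s' (Reg 0) = n" if "?I i s'" for i s'
      using that n r frameD(1)[of "{r}" "{a}" s s' 0] by auto
    fix i s' assume "i < n" and I: "?I i s'" and i: "regs s' r = i"
    then have frame: "frame {r} {a} s s'" by blast
    let ?s = "set_array a (ix @ [i]) (v i) s'"
    have "frame {r} {a} s (set_reg r (Suc i) ?s)"
      using frame by (intro frame_set_reg frame_set_array) auto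
    moreover have "map (eval_exp T s') es = ix" "eval_exp T s' e = v i"
      using prefix[OF frame] element[OF frame] i \<open>i < n\<close> by simp_all
    ultimately show "run_within T (Store a (es @ [Reg r]) e) t
        (\<lambda>s''. regs s'' r = i \<and> ?I (Suc i) (set_reg r (Suc i) s'')) s'"
      using I i t by (auto simp: run_within_def less_Suc_eq)
  qed
  then show ?thesis by simp
qed

section \<open>The enumeration program\<close>

definition neq :: "'f exp \<Rightarrow> 'f exp \<Rightarrow> 'f exp" where
  "neq e e' = Plus (Monus e e') (Monus e' e)"

lemma eval_neq: "eval_exp T s (neq e e') = 0 \<longleftrightarrow> eval_exp T s e = eval_exp T s e'"
  by (auto simp: neq_def)

lemma exp_cost_neq [simp]: "exp_cost (neq e e') = 3 + 2 * exp_cost e + 2 * exp_cost e'"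
  by (simp add: neq_def)

primrec mismatch :: "'f exp list \<Rightarrow> nat list \<Rightarrow> 'f exp" where
  "mismatch es [] = Num 0"
| "mismatch es (v # vs) = Plus (neq (hd es) (Num v)) (mismatch (tl es) vs)"

lemma eval_mismatch:
  "length es = length vs \<Longrightarrow> eval_exp T s (mismatch es vs) = 0 \<longleftrightarrow> map (eval_exp T s) es = vs"
  by (induction es vs rule: list_induct2) (auto simp: eval_neq)

definition scale :: "nat \<Rightarrow> 'f exp \<Rightarrow> 'f exp" where
  "scale k e = ((Plus e) ^^ k) (Num 0)"

lemma eval_scale: "eval_exp T s (scale k e) = k * eval_exp T s e"
  unfolding scale_def by (induction k) auto

text \<open>Truncated subtraction turns \<open>c\<close> into 0 unless the arguments are \<open>vs\<close>.\<close>

definition select :: "nat \<Rightarrow> 'f exp list \<Rightarrow> nat list \<Rightarrow> 'f exp" where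
  "select c es vs = Monus (Num c) (scale c (mismatch es vs))"

lemma eval_select:
  assumes "length es = length vs"
  shows "eval_exp T s (select c es vs) = (if map (eval_exp T s) es = vs then c else 0)"
proof (cases "map (eval_exp T s) es = vs")
  case True
  then show ?thesis using eval_mismatch[OF assms, of T s] by (simp add: select_def eval_scale)
next
  case False
  then have "c \<le> c * eval_exp T s (mismatch es vs)" using eval_mismatch[OF assms, of T s] by simp
  then show ?thesis using False by (simp add: select_def eval_scale)
qed

abbreviation (input) "size_reg \<equiv> 0 :: nat"
abbreviation (input) "index_reg \<equiv> 2 :: nat"
abbreviation (input) "count_reg \<equiv> 3 :: nat"
abbreviation (input) "next_reg \<equiv> 4 :: nat"
abbreviation (input) "candidate_reg \<equiv> 5 :: nat"
abbreviation (input) "position_reg \<equiv> 6 :: nat"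
abbreviation (input) "round_reg \<equiv> 7 :: nat"
abbreviation (input) "value_reg \<equiv> 8 :: nat"
abbreviation (input) "conflict_reg \<equiv> 9 :: nat"
abbreviation (input) "reject_reg \<equiv> 10 :: nat"
abbreviation (input) "level_reg \<equiv> 11 :: nat"
abbreviation (input) "base_reg \<equiv> 12 :: nat"
abbreviation (input) "map_array \<equiv> 2 :: nat"
abbreviation (input) "level_array \<equiv> 3 :: nat"
abbreviation (input) "base_array \<equiv> 4 :: nat"

definition put_com :: "'f exp \<Rightarrow> 'f exp \<Rightarrow> 'f com" where
  "put_com y v = Cond (Read map_array [y])
     (Cond (neq (Read map_array [y]) v) (Assign conflict_reg (Plus (Reg conflict_reg) (Num 1))) Skip)
     (Store map_array [y] v)"

definition put_cost :: "'f exp \<Rightarrow> 'f exp \<Rightarrow> nat" where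
  "put_cost y v = 3 * exp_cost y + 2 * exp_cost v + 20"

definition load_com :: "'f exp \<Rightarrow> 'f com" where
  "load_com e = Seq (Assign conflict_reg (Num 0))
     (For position_reg (Reg size_reg) (Store map_array [Reg position_reg] e))"

definition load_cost :: "nat \<Rightarrow> nat" where
  "load_cost n = 2 + for_cost n 1 6"

context coded_algebra
begin

abbreviation (input) "arg_reg \<equiv> base_reg + p"

definition arg_regs :: "'f \<Rightarrow> nat list" where
  "arg_regs f = [arg_reg..<arg_reg + arity A f]"

definition tab_exp :: "'f \<Rightarrow> 'f exp list \<Rightarrow> 'f exp" where
  "tab_exp f es = foldr (\<lambda>vs. Plus (select (tab f vs) es vs)) (List.n_lists (arity A f) [1..<Suc p]) (Num 0)"

lemma eval_tab_exp:
  assumes "length es = arity A f"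
  shows "eval_exp T s (tab_exp f es) = tab f (map (eval_exp T s) es)"
proof -
  let ?ws = "map (eval_exp T s) es"
  let ?tuples = "List.n_lists (arity A f) [1..<Suc p]"
  have sum: "eval_exp T s (foldr (\<lambda>vs. Plus (select (tab f vs) es vs)) vss (Num 0)) =
      (if ?ws \<in> set vss then tab f ?ws else 0)"
    if "distinct vss" "\<And>vs. vs \<in> set vss \<Longrightarrow> length vs = arity A f" for vss
    using that by (induction vss) (auto simp: eval_select assms)
  have "set ?tuples = tuples {1..p} (arity A f)"
    by (auto simp: set_n_lists tuples_def atLeastLessThanSuc_atLeastAtMost simp del: upt_Suc)
  moreover have "distinct ?tuples" by (intro distinct_n_lists distinct_upt)
  ultimately have "eval_exp T s (tab_exp f es) = (if ?ws \<in> tuples {1..p} (arity A f) then tab f ?ws else 0)"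
    unfolding tab_exp_def by (subst sum) (auto simp: tuples_length)
  then show ?thesis by (auto simp: tab_def)
qed

definition step_com :: "'f \<Rightarrow> 'f com" where
  "step_com f = Seq (Assign value_reg (tab_exp f (map (\<lambda>r. Read map_array [Reg r]) (arg_regs f))))
     (Cond (Reg value_reg) (put_com (Lookup f (map Reg (arg_regs f))) (Reg value_reg)) Skip)"

definition step_cost :: "'f \<Rightarrow> nat" where
  "step_cost f = exp_cost (tab_exp f (map (\<lambda>r. Read map_array [Reg r]) (arg_regs f))) +
     put_cost (Lookup f (map Reg (arg_regs f))) (Reg value_reg) + 4"

definition pass_com :: "'f com" where
  "pass_com = seqs (map (\<lambda>f. nest arg_reg (arity A f) (step_com f)) fs)"

definition pass_cost :: "nat \<Rightarrow> nat" where
  "pass_cost n = (\<Sum>f\<leftarrow>fs. nest_cost n (arity A f) (step_cost f)) + 1"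

definition close_com :: "'f com" where
  "close_com = For round_reg (Plus (Reg size_reg) (Num 1)) pass_com"

definition close_cost :: "nat \<Rightarrow> nat" where
  "close_cost n = for_cost (Suc n) 3 (pass_cost n)"

definition admit_com :: "'f exp \<Rightarrow> 'f com" where
  "admit_com l = Seq close_com (Cond (Reg conflict_reg) Skip
     (Seq (For position_reg (Reg size_reg)
         (Store level_array [l, Reg next_reg, Reg position_reg] (Read map_array [Reg position_reg])))
       (Assign next_reg (Plus (Reg next_reg) (Num 1)))))"

definition admit_cost :: "nat \<Rightarrow> nat" where
  "admit_cost n = close_cost n + for_cost n 1 10 + 10"

definition start_com :: "'f com" where
  "start_com = Seq (load_com (Num 0))
     (Seq (seqs (map (\<lambda>a. put_com (Reg (base_reg + a)) (Num (Suc a))) [0..<p])) (admit_com (Num 0)))"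

definition start_cost :: "nat \<Rightarrow> nat" where
  "start_cost n = load_cost n + (p * 25 + 1 + admit_cost n)"

definition extend_com :: "'f com" where
  "extend_com = Seq (load_com (Read level_array [Reg level_reg, Reg index_reg, Reg position_reg]))
     (Seq (put_com (Reg level_reg) (Plus (Reg candidate_reg) (Num 1)))
       (admit_com (Plus (Reg level_reg) (Num 1))))"

definition extend_cost :: "nat \<Rightarrow> nat" where
  "extend_cost n = load_cost n + (29 + admit_cost n)"

definition level_com :: "'f com" where
  "level_com = Seq (Assign next_reg (Num 0))
     (Seq (For index_reg (Reg count_reg) (For candidate_reg (Num p) extend_com))
       (Assign count_reg (Reg next_reg)))"

definition level_cost :: "nat \<Rightarrow> nat \<Rightarrow> nat" where
  "level_cost P n = 2 + (for_cost P 1 (for_cost p 1 (extend_cost n)) + 2)"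

abbreviation (input) "entry_exp \<equiv> Read level_array [Reg size_reg, Reg index_reg, Reg position_reg]"

definition check_com :: "'f com" where
  "check_com = For position_reg (Reg size_reg) (Assign reject_reg (Plus (Reg reject_reg)
     (Monus (Read base_array [entry_exp]) (Reg position_reg))))"

definition print_com :: "'f com" where
  "print_com = For position_reg (Reg size_reg) (Output entry_exp)"

definition final_com :: "'f com" where
  "final_com = Seq (Assign reject_reg (Num 0)) (Seq check_com (Cond (Reg reject_reg) Skip print_com))"

definition final_cost :: "nat \<Rightarrow> nat" where
  "final_cost n = 2 + (for_cost n 1 10 + (2 + for_cost n 1 5))"

definition base_com :: "'f com" where
  "base_com = Seq (seqs (map (\<lambda>a. Store base_array [Num (Suc a)] (Reg (base_reg + a))) [0..<p]))
     (Seq (Assign next_reg (Num 0)) (Seq start_com (Seq (Assign count_reg (Reg next_reg))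
       (Seq (For level_reg (Reg size_reg) level_com) (For index_reg (Reg count_reg) final_com)))))"

definition base_cost :: "nat \<Rightarrow> nat \<Rightarrow> nat" where
  "base_cost P n = p * 3 + 1 + (2 + (start_cost n + (2 +
     (for_cost n 1 (level_cost P n) + for_cost P 1 (final_cost n)))))"

definition enum_com :: "'f com" where
  "enum_com = nest base_reg p base_com"

definition enum_cost :: "nat \<Rightarrow> nat \<Rightarrow> nat" where
  "enum_cost P n = nest_cost n p (base_cost P n)"

end

lemma fold_append_conv_concat: "fold (\<lambda>x acc. acc @ g x) xs acc = acc @ concat (map g xs)"
  by (induction xs arbitrary: acc) simp_all

subsection \<open>The maps and levels held in memory\<close>

definition current :: "nat \<Rightarrow> state \<Rightarrow> nat list \<times> nat" where
  "current n s = (map (\<lambda>j. arrays s map_array [j]) [0..<n], regs s conflict_reg)"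

definition stored_map :: "nat \<Rightarrow> state \<Rightarrow> nat \<Rightarrow> nat \<Rightarrow> nat list" where
  "stored_map n s i k = map (\<lambda>j. arrays s level_array [i, k, j]) [0..<n]"

definition stored_level :: "nat \<Rightarrow> state \<Rightarrow> nat \<Rightarrow> nat \<Rightarrow> nat list list" where
  "stored_level n s i c = map (stored_map n s i) [0..<c]"

lemma stored_level_Suc: "stored_level n s i (Suc c) = stored_level n s i c @ [stored_map n s i c]"
  by (simp add: stored_level_def)

lemma stored_map_set_reg [simp]: "stored_map n (set_reg r v s) = stored_map n s"
  by (intro ext) (simp add: stored_map_def)

lemma stored_level_set_reg [simp]: "stored_level n (set_reg r v s) = stored_level n s"
  by (intro ext) (simp add: stored_level_def)

lemma stored_level_nth: "stored_level n s i c = L \<Longrightarrow> k < c \<Longrightarrow> stored_map n s i k = L ! k"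
  by (auto simp: stored_level_def)

lemma stored_level_frame:
  assumes "frame R B s s'" "level_array \<notin> B"
  shows "stored_map n s' = stored_map n s" "stored_level n s' = stored_level n s"
  using frameD(2)[OF assms] by (auto simp: stored_map_def stored_level_def fun_eq_iff)

lemma current_set_reg: "r \<noteq> conflict_reg \<Longrightarrow> current n (set_reg r v s) = current n s"
  by (simp add: current_def)

lemma fst_current_nth: "j < n \<Longrightarrow> fst (current n s) ! j = arrays s map_array [j]"
  by (simp add: current_def)

lemma current_store:
  "j < n \<Longrightarrow> current n (set_array map_array [j] v s) = ((fst (current n s))[j := v], snd (current n s))"
  by (auto simp: current_def nth_list_update intro!: nth_equalityI)

lemma current_conflict:
  "current n (set_reg conflict_reg v s) = (fst (current n s), v)" "snd (current n s) = regs s conflict_reg"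
  by (simp_all add: current_def)

lemma run_within_put:
  assumes y: "eval_exp T s y = j" "j < n" and v: "eval_exp T s v = w"
  shows "run_within T (put_com y v) (put_cost y v)
    (\<lambda>s'. current n s' = put j w (current n s) \<and> frame {conflict_reg} {map_array} s s') s"
proof -
  have conflict: "current n (set_reg conflict_reg (Suc (regs s conflict_reg)) s) = put j w (current n s)"
    if "arrays s map_array [j] \<noteq> 0" "arrays s map_array [j] \<noteq> w"
    using that y(2) unfolding current_conflict by (simp add: put_def fst_current_nth current_conflict)
  have keep: "current n s = put j w (current n s)"
    if "arrays s map_array [j] \<noteq> 0" "arrays s map_array [j] = w"
    using that y(2) by (simp add: put_def fst_current_nth)
  have define_value: "current n (set_array map_array [j] w s) = put j w (current n s)"
    if "arrays s map_array [j] = 0"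
    using that y(2) by (simp add: put_def fst_current_nth current_store)
  have "frame {conflict_reg} {map_array} s s" "frame {conflict_reg} {map_array} s (set_reg conflict_reg k s)"
    "frame {conflict_reg} {map_array} s (set_array map_array [j] w s)" for k
    by (simp_all add: frame_refl frame_set_reg frame_set_array)
  then show ?thesis
    using conflict keep define_value y v
    by (simp add: run_within_def put_com_def put_cost_def eval_neq del: fun_upd_apply)
qed

lemma run_within_load:
  assumes n: "regs s size_reg = n" and h: "length h = n" and cost: "exp_cost e \<le> 4"
    and e: "\<And>s'. frame {position_reg, conflict_reg} {map_array} s s' \<Longrightarrow> regs s' position_reg < n \<Longrightarrow>
      eval_exp T s' e = h ! regs s' position_reg"
  shows "run_within T (load_com e) (load_cost n)
    (\<lambda>s'. current n s' = (h, 0) \<and> frame {position_reg, conflict_reg} {map_array} s s') s"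
  unfolding load_com_def load_cost_def
proof (rule run_within_Assign_Seq)
  let ?s = "set_reg conflict_reg (eval_exp T s (Num 0)) s"
  let ?loop = "\<lambda>es. For position_reg (Reg size_reg) (Store map_array es e)"
  have frame: "frame {position_reg, conflict_reg} {map_array} s ?s" by (intro frame_set_reg frame_refl) simp
  have "run_within T (?loop ([] @ [Reg position_reg])) (for_cost n 1 6)
    (\<lambda>s'. (\<forall>j<n. arrays s' map_array ([] @ [j]) = h ! j) \<and>
      (\<forall>iy. butlast iy \<noteq> [] \<longrightarrow> arrays s' map_array iy = arrays ?s map_array iy) \<and>
      frame {position_reg} {map_array} ?s s') ?s"
    by (rule run_within_fill) (use n e cost frame_trans[OF frame] in auto)
  then have "run_within T (?loop [Reg position_reg]) (for_cost n 1 6)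
    (\<lambda>s'. (\<forall>j<n. arrays s' map_array [j] = h ! j) \<and> frame {position_reg} {map_array} ?s s') ?s"
    by (auto elim: run_within_mono)
  then show "run_within T (?loop [Reg position_reg]) (for_cost n 1 6)
    (\<lambda>s'. current n s' = (h, 0) \<and> frame {position_reg, conflict_reg} {map_array} s s') ?s"
  proof (rule run_within_mono)
    fix s' assume s': "(\<forall>j<n. arrays s' map_array [j] = h ! j) \<and> frame {position_reg} {map_array} ?s s'"
    then have "map (\<lambda>j. arrays s' map_array [j]) [0..<n] = h" using h by (auto intro: nth_equalityI)
    moreover have "regs s' conflict_reg = 0" using s' frameD(1)[of "{position_reg}" "{map_array}" ?s s'] by simp
    ultimately show "current n s' = (h, 0) \<and> frame {position_reg, conflict_reg} {map_array} s s'"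
      using s' frame_trans[OF frame] by (auto simp: current_def)
  qed simp
qed simp

context enumeration
begin

subsection \<open>Closing and admitting the current map\<close>

lemma run_within_step:
  assumes f: "f \<in> syms A" and xs: "xs \<in> tuples {..<n} (arity A f)"
    and args: "\<And>j. j < arity A f \<Longrightarrow> regs s (arg_reg + j) = xs ! j"
  shows "run_within T (step_com f) (step_cost f)
    (\<lambda>s'. current n s' = step f xs (current n s) \<and> frame {value_reg, conflict_reg} {map_array} s s') s"
proof -
  let ?v = "tab f (map ((!) (fst (current n s))) xs)" and ?s1 = "\<lambda>v. set_reg value_reg v s"
  let ?Q = "\<lambda>s'. current n s' = step f xs (current n s) \<and> frame {value_reg, conflict_reg} {map_array} s s'"
  let ?put = "put_com (Lookup f (map Reg (arg_regs f))) (Reg value_reg)"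
    and ?put_cost = "put_cost (Lookup f (map Reg (arg_regs f))) (Reg value_reg)"
  have regs_args: "map (regs s) (arg_regs f) = xs"
    by (rule nth_equalityI) (use args xs in \<open>auto simp: arg_regs_def tuples_length\<close>)
  then have regs_args1: "map (regs (?s1 v)) (arg_regs f) = xs" for v
    by (auto simp: arg_regs_def)
  have "map (\<lambda>r. arrays s map_array [regs s r]) (arg_regs f) = map (\<lambda>x. arrays s map_array [x]) xs"
    using regs_args by auto
  also have "\<dots> = map ((!) (fst (current n s))) xs"
    using xs by (auto simp: tuples_def fst_current_nth)
  finally have table_value: "eval_exp T s (tab_exp f (map (\<lambda>r. Read map_array [Reg r]) (arg_regs f))) = ?v"
    by (subst eval_tab_exp) (simp_all add: arg_regs_def comp_def)
  have frame: "frame {value_reg, conflict_reg} {map_array} s (?s1 v)" for v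
    by (intro frame_set_reg frame_refl) simp
  have put: "run_within T ?put ?put_cost ?Q (?s1 ?v)" if "?v \<noteq> 0"
  proof (rule run_within_mono[OF run_within_put])
    show "eval_exp T (?s1 ?v) (Lookup f (map Reg (arg_regs f))) = T f xs"
      using regs_args1[of ?v] by (simp add: comp_def del: fun_upd_apply)
    show "T f xs < n" by (rule T_less[OF f xs])
    fix s' assume "current n s' = put (T f xs) ?v (current n (?s1 ?v)) \<and> frame {conflict_reg} {map_array} (?s1 ?v) s'"
    then show "?Q s'" using that frame_trans[OF frame] by (auto simp: step_def current_set_reg)
  qed simp_all
  have skip: "?Q (?s1 ?v)" if "?v = 0" using that frame by (simp add: step_def current_set_reg)
  have "run_within T (step_com f) ((1 + exp_cost (tab_exp f (map (\<lambda>r. Read map_array [Reg r]) (arg_regs f)))) +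
      (2 + ?put_cost)) ?Q s"
    unfolding step_com_def
    by (intro run_within_Assign_Seq run_within_Cond, unfold table_value)
      (use put skip in \<open>auto intro!: run_within_Skip simp: put_cost_def\<close>)
  then show ?thesis by (rule run_within_mono) (auto simp: step_cost_def)
qed

lemma run_within_pass:
  assumes n: "regs s size_reg = n"
  shows "run_within T pass_com (pass_cost n)
    (\<lambda>s'. current n s' = pass (current n s) \<and> frame ({value_reg, conflict_reg} \<union> {arg_reg..}) {map_array} s s') s"
proof -
  let ?Inv = "frame ({value_reg, conflict_reg} \<union> {arg_reg..}) {map_array} s"
  have nest: "run_within T (nest arg_reg (arity A f) (step_com f)) (nest_cost n (arity A f) (step_cost f))
      (\<lambda>s''. ?Inv s'' \<and> current n s'' = fold (step f) (List.n_lists (arity A f) [0..<n]) (current n s')) s'"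
    if f: "f \<in> syms A" and s': "?Inv s'" for f s'
  proof (rule run_within_nest[where Inv = ?Inv and st = "current n"])
    fix s' xs assume s': "?Inv s'" and xs: "xs \<in> tuples {..<n} (arity A f)"
      and args: "\<And>j. j < arity A f \<Longrightarrow> regs s' (arg_reg + j) = xs ! j"
    show "run_within T (step_com f) (step_cost f) (\<lambda>s''. ?Inv s'' \<and>
        current n s'' = step f xs (current n s') \<and> (\<forall>j<arity A f. regs s'' (arg_reg + j) = xs ! j)) s'"
    proof (rule run_within_mono[OF run_within_step[OF f xs args]])
      fix s'' assume s'': "current n s'' = step f xs (current n s') \<and> frame {value_reg, conflict_reg} {map_array} s' s''"
      then have "?Inv s''" using frame_trans[OF s'] by auto
      moreover have "regs s'' (arg_reg + j) = regs s' (arg_reg + j)" for j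
        using s'' frameD(1)[of "{value_reg, conflict_reg}" "{map_array}" s' s''] by simp
      ultimately show "?Inv s'' \<and> current n s'' = step f xs (current n s') \<and>
          (\<forall>j<arity A f. regs s'' (arg_reg + j) = xs ! j)" using s'' args by simp
    qed simp_all
  next
    show "regs s' size_reg = n" if "?Inv s'" for s' using frameD(1)[OF that, of size_reg] n by simp
  qed (use s' in \<open>auto intro: frame_set_reg current_set_reg\<close>)
  have "run_within T pass_com (pass_cost n) (\<lambda>s'. ?Inv s' \<and>
      current n s' = fold (\<lambda>f. fold (step f) (List.n_lists (arity A f) [0..<n])) fs (current n s)) s"
    unfolding pass_com_def pass_cost_def
    by (rule run_within_seqs[where Inv = ?Inv and st = "current n"]) (use nest set_fs frame_refl in auto)
  then show ?thesis by (rule run_within_mono) (auto simp: pass_def)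
qed

lemma run_within_close:
  assumes n: "regs s size_reg = n"
  shows "run_within T close_com (close_cost n)
    (\<lambda>s'. current n s' = close (current n s) \<and>
      frame ({round_reg, value_reg, conflict_reg} \<union> {arg_reg..}) {map_array} s s') s"
proof -
  let ?Inv = "frame ({round_reg, value_reg, conflict_reg} \<union> {arg_reg..}) {map_array} s"
  have size: "regs s' size_reg = n" if "?Inv s'" for s' using frameD(1)[OF that, of size_reg] n by simp
  have "run_within T close_com (for_cost (Suc n) (exp_cost (Plus (Reg size_reg) (Num 1) :: 'f exp)) (pass_cost n))
      (\<lambda>s'. ?Inv s' \<and> current n s' = fold (\<lambda>_. pass) [0..<Suc n] (current n s)) s"
    unfolding close_com_def
  proof (rule run_within_For_fold[where Inv = ?Inv and st = "current n"])
    fix i s' assume s': "?Inv s'" and i: "regs s' round_reg = i"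
    show "run_within T pass_com (pass_cost n)
        (\<lambda>s''. ?Inv s'' \<and> current n s'' = pass (current n s') \<and> regs s'' round_reg = i) s'"
    proof (rule run_within_mono[OF run_within_pass[OF size[OF s']]])
      fix s'' assume s'': "current n s'' = pass (current n s') \<and>
        frame ({value_reg, conflict_reg} \<union> {arg_reg..}) {map_array} s' s''"
      then have "regs s'' round_reg = i"
        using i frameD(1)[of "{value_reg, conflict_reg} \<union> {arg_reg..}" "{map_array}" s' s''] by simp
      moreover have "?Inv s''" by (rule frame_trans[OF s' conjunct2[OF s'']]) auto
      ultimately show "?Inv s'' \<and> current n s'' = pass (current n s') \<and> regs s'' round_reg = i" using s'' by simp
    qed simp
  qed (auto simp: size frame_refl current_set_reg intro: frame_set_reg)
  moreover have "fold (\<lambda>_. pass) [0..<m] t = (pass ^^ m) t" for m t by (induction m) auto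
  then have "fold (\<lambda>_. pass) [0..<Suc n] t = close t" for t unfolding close_def .
  ultimately show ?thesis by (simp add: close_cost_def numeral_3_eq_3 conj_commute del: upt_Suc)
qed

lemma run_within_save:
  assumes n: "regs s size_reg = n" and l: "\<And>s'. frame {position_reg} {level_array} s s' \<Longrightarrow> eval_exp T s' l = i"
    and cost: "exp_cost l \<le> 3"
  shows "run_within T (For position_reg (Reg size_reg)
      (Store level_array [l, Reg next_reg, Reg position_reg] (Read map_array [Reg position_reg]))) (for_cost n 1 10)
    (\<lambda>s'. stored_map n s' i (regs s next_reg) = fst (current n s) \<and>
      (\<forall>i' k. i' \<noteq> i \<or> k \<noteq> regs s next_reg \<longrightarrow> stored_map n s' i' k = stored_map n s i' k) \<and>
      frame {position_reg} {level_array} s s') s"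
proof -
  let ?loop = "\<lambda>es. For position_reg (Reg size_reg) (Store level_array es (Read map_array [Reg position_reg]))"
  let ?ix = "[i, regs s next_reg]"
  have "run_within T (?loop ([l, Reg next_reg] @ [Reg position_reg])) (for_cost n 1 10)
    (\<lambda>s'. (\<forall>j<n. arrays s' level_array (?ix @ [j]) = arrays s map_array [j]) \<and>
      (\<forall>iy. butlast iy \<noteq> ?ix \<longrightarrow> arrays s' level_array iy = arrays s level_array iy) \<and>
      frame {position_reg} {level_array} s s') s"
  proof (rule run_within_fill)
    fix s' assume frame: "frame {position_reg} {level_array} s s'"
    show "map (eval_exp T s') [l, Reg next_reg] = ?ix" using l[OF frame] frameD(1)[OF frame] by simp
    show "eval_exp T s' (Read map_array [Reg position_reg]) = arrays s map_array [regs s' position_reg]"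
      using frameD(2)[OF frame] by simp
  qed (use n cost in auto)
  then show ?thesis by (auto elim!: run_within_mono simp: stored_map_def current_def)
qed

abbreviation (input) "admit_regs \<equiv>
  {next_reg, position_reg, round_reg, value_reg, conflict_reg} \<union> {arg_reg..}"

lemma run_within_admit:
  assumes n: "regs s size_reg = n" and cost: "exp_cost l \<le> 3"
    and l: "\<And>s'. frame admit_regs {map_array, level_array} s s' \<Longrightarrow> eval_exp T s' l = i"
  shows "run_within T (admit_com l) (admit_cost n)
    (\<lambda>s'. stored_level n s' i (regs s' next_reg) = stored_level n s i (regs s next_reg) @ admit (current n s) \<and>
      (\<forall>i'. i' \<noteq> i \<longrightarrow> stored_map n s' i' = stored_map n s i') \<and>
      frame admit_regs {map_array, level_array} s s') s" (is "run_within _ _ _ ?Q _")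
proof -
  let ?save = "For position_reg (Reg size_reg)
      (Store level_array [l, Reg next_reg, Reg position_reg] (Read map_array [Reg position_reg]))"
  have "run_within T (admit_com l) (close_cost n + (2 + (for_cost n 1 10 + 4))) ?Q s"
    unfolding admit_com_def
  proof (intro run_within_Seq[OF run_within_close[OF n]] run_within_Cond)
    fix s1 assume s1: "current n s1 = close (current n s) \<and>
      frame ({round_reg, value_reg, conflict_reg} \<union> {arg_reg..}) {map_array} s s1"
    then have frame1: "frame admit_regs {map_array, level_array} s s1" by (auto elim: frame_mono)
    have stored1: "stored_map n s1 = stored_map n s" "stored_level n s1 = stored_level n s"
      using stored_level_frame[OF conjunct2[OF s1]] by simp_all
    have regs1: "regs s1 size_reg = n" "regs s1 next_reg = regs s next_reg"
      using frameD(1)[OF conjunct2[OF s1]] n by simp_all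
    have admit: "admit (current n s) = (if regs s1 conflict_reg = 0 then [fst (current n s1)] else [])"
      using s1 current_conflict(2)[of n s1] by (simp add: admit_def)
    show "run_within T Skip (for_cost n 1 10 + 4) ?Q s1" if "eval_exp T s1 (Reg conflict_reg) \<noteq> 0"
      by (rule run_within_Skip) (use that admit frame1 stored1 regs1 in auto)
    show "run_within T (Seq ?save (Assign next_reg (Plus (Reg next_reg) (Num 1)))) (for_cost n 1 10 + 4) ?Q s1"
      if conflict: "eval_exp T s1 (Reg conflict_reg) = 0"
    proof (rule run_within_Seq[OF run_within_save[OF regs1(1) _ cost]])
      show "eval_exp T s' l = i" if "frame {position_reg} {level_array} s1 s'" for s'
        by (rule l[OF frame_trans[OF frame1 that]]) auto
      fix s2 assume s2: "stored_map n s2 i (regs s1 next_reg) = fst (current n s1) \<and>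
        (\<forall>i' k. i' \<noteq> i \<or> k \<noteq> regs s1 next_reg \<longrightarrow> stored_map n s2 i' k = stored_map n s1 i' k) \<and>
        frame {position_reg} {level_array} s1 s2"
      then have "frame admit_regs {map_array, level_array} s s2" using frame_trans[OF frame1] by auto
      moreover have "regs s2 next_reg = regs s next_reg"
        using s2 regs1 frameD(1)[of "{position_reg}" "{level_array}" s1 s2] by simp
      moreover have "stored_level n s2 i (Suc (regs s next_reg)) =
          stored_level n s i (regs s next_reg) @ admit (current n s)"
        using s2 regs1 stored1 admit conflict by (simp add: stored_level_Suc) (simp add: stored_level_def)
      ultimately show "run_within T (Assign next_reg (Plus (Reg next_reg) (Num 1))) 4 ?Q s2"
        using s2 stored1 by (intro run_within_Assign) (auto simp: fun_eq_iff intro: frame_set_reg)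
    qed
  qed simp
  then show ?thesis by (rule run_within_mono) (auto simp: admit_cost_def)
qed

subsection \<open>Building the levels\<close>

lemma run_within_puts:
  assumes base: "\<And>a. a < p \<Longrightarrow> regs s (base_reg + a) = x ! a" and x: "x \<in> tuples {..<n} p"
  shows "run_within T (seqs (map (\<lambda>a. put_com (Reg (base_reg + a)) (Num (Suc a))) [0..<p])) (p * 25 + 1)
    (\<lambda>s'. current n s' = fold (\<lambda>a. put (x ! a) (Suc a)) [0..<p] (current n s) \<and>
      frame {conflict_reg} {map_array} s s') s"
proof -
  let ?Inv = "frame {conflict_reg} {map_array} s"
  have "run_within T (seqs (map (\<lambda>a. put_com (Reg (base_reg + a)) (Num (Suc a))) [0..<p])) ((\<Sum>a\<leftarrow>[0..<p]. 25) + 1)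
    (\<lambda>s'. ?Inv s' \<and> current n s' = fold (\<lambda>a. put (x ! a) (Suc a)) [0..<p] (current n s)) s"
  proof (rule run_within_seqs[where Inv = ?Inv and st = "current n"])
    fix a s' assume a: "a \<in> set [0..<p]" and s': "?Inv s'"
    have "regs s' (base_reg + a) = x ! a" "x ! a < n"
      using frameD(1)[OF s'] base tuples_nth[OF x] a by auto
    then have "run_within T (put_com (Reg (base_reg + a)) (Num (Suc a))) (put_cost (Reg (base_reg + a) :: 'f exp) (Num (Suc a)))
        (\<lambda>s''. current n s'' = put (x ! a) (Suc a) (current n s') \<and> frame {conflict_reg} {map_array} s' s'') s'"
      by (intro run_within_put) auto
    then show "run_within T (put_com (Reg (base_reg + a)) (Num (Suc a))) 25
        (\<lambda>s''. ?Inv s'' \<and> current n s'' = put (x ! a) (Suc a) (current n s')) s'"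
      by (rule run_within_mono) (use frame_trans[OF s'] in \<open>auto simp: put_cost_def\<close>)
  qed (rule frame_refl)
  then show ?thesis by (rule run_within_mono) (auto simp: sum_list_triv)
qed

lemma run_within_start:
  assumes n: "regs s size_reg = n" and base: "\<And>a. a < p \<Longrightarrow> regs s (base_reg + a) = x ! a"
    and x: "x \<in> tuples {..<n} p"
  shows "run_within T start_com (start_cost n)
    (\<lambda>s'. stored_level n s' 0 (regs s' next_reg) = stored_level n s 0 (regs s next_reg) @ level x 0 \<and>
      frame admit_regs {map_array, level_array} s s') s"
  unfolding start_com_def start_cost_def
proof (rule run_within_Seq, rule run_within_load[OF n, of "replicate n 0"])
  show "eval_exp T s' (Num 0) = replicate n 0 ! regs s' position_reg" if "regs s' position_reg < n" for s'
    using that by simp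
  fix s1 assume s1: "current n s1 = (replicate n 0, 0) \<and> frame {position_reg, conflict_reg} {map_array} s s1"
  note frame1 = conjunct2[OF s1]
  show "run_within T (Seq (seqs (map (\<lambda>a. put_com (Reg (base_reg + a)) (Num (Suc a))) [0..<p])) (admit_com (Num 0)))
    (p * 25 + 1 + admit_cost n) (\<lambda>s'. stored_level n s' 0 (regs s' next_reg) =
      stored_level n s 0 (regs s next_reg) @ level x 0 \<and> frame admit_regs {map_array, level_array} s s') s1"
  proof (rule run_within_Seq, rule run_within_puts[OF _ x])
    show "regs s1 (base_reg + a) = x ! a" if "a < p" for a using frameD(1)[OF frame1] base[OF that] by simp
    fix s2 assume s2: "current n s2 = fold (\<lambda>a. put (x ! a) (Suc a)) [0..<p] (current n s1) \<and>
      frame {conflict_reg} {map_array} s1 s2"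
    have frame2: "frame {position_reg, conflict_reg} {map_array} s s2"
      using s2 by (auto intro: frame_trans[OF frame1])
    have "current n s2 = start x" using s1 s2 by (simp add: start_def)
    moreover have "regs s2 size_reg = n" "regs s2 next_reg = regs s next_reg" "stored_level n s2 = stored_level n s"
      using frameD(1)[OF frame2] n stored_level_frame(2)[OF frame2] by simp_all
    moreover have "frame admit_regs {map_array, level_array} s s2" using frame2 by (rule frame_mono) auto
    ultimately show "run_within T (admit_com (Num 0)) (admit_cost n) (\<lambda>s'. stored_level n s' 0 (regs s' next_reg) =
        stored_level n s 0 (regs s next_reg) @ level x 0 \<and> frame admit_regs {map_array, level_array} s s') s2"
      by (intro run_within_mono[OF run_within_admit[where i = 0]]) (auto elim: frame_trans)
  qed
qed simp_all

lemma run_within_extend: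
  assumes n: "regs s size_reg = n" and i: "regs s level_reg = i" "i < n"
    and h: "stored_map n s i (regs s index_reg) = h"
  shows "run_within T extend_com (extend_cost n)
    (\<lambda>s'. stored_level n s' (Suc i) (regs s' next_reg) = stored_level n s (Suc i) (regs s next_reg) @
        admit (put i (Suc (regs s candidate_reg)) (h, 0)) \<and>
      stored_map n s' i = stored_map n s i \<and> frame admit_regs {map_array, level_array} s s') s"
    (is "run_within _ _ _ ?Q _")
  unfolding extend_com_def extend_cost_def
proof (rule run_within_Seq, rule run_within_load[OF n, of h])
  show "eval_exp T s' (Read level_array [Reg level_reg, Reg index_reg, Reg position_reg]) = h ! regs s' position_reg"
    if "frame {position_reg, conflict_reg} {map_array} s s'" "regs s' position_reg < n" for s'
    using frameD[OF that(1)] that(2) i h by (auto simp: stored_map_def)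
  show "length h = n" using h by (auto simp: stored_map_def)
  fix s1 assume s1: "current n s1 = (h, 0) \<and> frame {position_reg, conflict_reg} {map_array} s s1"
  note frame1 = conjunct2[OF s1]
  show "run_within T (Seq (put_com (Reg level_reg) (Plus (Reg candidate_reg) (Num 1)))
      (admit_com (Plus (Reg level_reg) (Num 1)))) (29 + admit_cost n) ?Q s1"
  proof (rule run_within_Seq)
    have "run_within T (put_com (Reg level_reg) (Plus (Reg candidate_reg) (Num 1)))
        (put_cost (Reg level_reg :: 'f exp) (Plus (Reg candidate_reg) (Num 1)))
        (\<lambda>s'. current n s' = put i (Suc (regs s candidate_reg)) (current n s1) \<and>
          frame {conflict_reg} {map_array} s1 s') s1"
      by (rule run_within_put) (use frameD(1)[OF frame1] i in auto)
    then show "run_within T (put_com (Reg level_reg) (Plus (Reg candidate_reg) (Num 1))) 29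
        (\<lambda>s'. current n s' = put i (Suc (regs s candidate_reg)) (h, 0) \<and> frame {conflict_reg} {map_array} s1 s') s1"
      by (rule run_within_mono) (use s1 in \<open>auto simp: put_cost_def\<close>)
    fix s2 assume s2: "current n s2 = put i (Suc (regs s candidate_reg)) (h, 0) \<and> frame {conflict_reg} {map_array} s1 s2"
    have frame2: "frame {position_reg, conflict_reg} {map_array} s s2"
      using s2 by (auto intro: frame_trans[OF frame1])
    have regs2: "regs s2 size_reg = n" "regs s2 next_reg = regs s next_reg" "regs s2 level_reg = i"
      using frameD(1)[OF frame2] n i by simp_all
    have "frame admit_regs {map_array, level_array} s s2" using frame2 by (rule frame_mono) auto
    then show "run_within T (admit_com (Plus (Reg level_reg) (Num 1))) (admit_cost n) ?Q s2"
      using s2 regs2 stored_level_frame[OF frame2]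
      by (intro run_within_mono[OF run_within_admit[where i = "Suc i"]]) (auto simp: frame_def)
  qed
qed simp_all

abbreviation (input) "level_regs \<equiv> {index_reg, count_reg, candidate_reg} \<union> admit_regs"

lemma run_within_candidates:
  assumes n: "regs s size_reg = n" and i: "regs s level_reg = i" "i < n"
    and h: "stored_map n s i (regs s index_reg) = h"
  shows "run_within T (For candidate_reg (Num p) extend_com) (for_cost p 1 (extend_cost n))
    (\<lambda>s'. stored_level n s' (Suc i) (regs s' next_reg) = stored_level n s (Suc i) (regs s next_reg) @
        concat (map (\<lambda>v. admit (put i (Suc v) (h, 0))) [0..<p]) \<and>
      stored_map n s' i = stored_map n s i \<and>
      frame (insert candidate_reg admit_regs) {map_array, level_array} s s') s"
proof -
  let ?R = "insert candidate_reg admit_regs"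
  let ?Inv = "\<lambda>s'. stored_map n s' i = stored_map n s i \<and> frame ?R {map_array, level_array} s s'"
  let ?st = "\<lambda>s'. stored_level n s' (Suc i) (regs s' next_reg)"
  let ?f = "\<lambda>v L. L @ admit (put i (Suc v) (h, 0))"
  have "run_within T (For candidate_reg (Num p) extend_com) (for_cost p (exp_cost (Num p :: 'f exp)) (extend_cost n))
      (\<lambda>s'. ?Inv s' \<and> ?st s' = fold ?f [0..<p] (?st s)) s"
  proof (rule run_within_For_fold[where Inv = ?Inv and st = ?st])
    fix v s' assume s': "?Inv s'" and v: "regs s' candidate_reg = v"
    note frame = conjunct2[OF s']
    have "regs s' size_reg = n" "regs s' level_reg = i" "stored_map n s' i (regs s' index_reg) = h"
      using frameD(1)[OF frame] n i h s' by simp_all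
    then show "run_within T extend_com (extend_cost n)
        (\<lambda>s''. ?Inv s'' \<and> ?st s'' = ?f v (?st s') \<and> regs s'' candidate_reg = v) s'"
      using s' v i(2)
      by (intro run_within_mono[OF run_within_extend]) (auto simp: frame_def)
  next
    show "?Inv (set_reg candidate_reg v s') \<and> ?st (set_reg candidate_reg v s') = ?st s'" if "?Inv s'" for s' v
      using that by (auto intro: frame_set_reg)
  qed (simp_all add: frame_refl)
  then show ?thesis by (rule run_within_mono) (auto simp: fold_append_conv_concat)
qed

lemma run_within_level:
  assumes n: "regs s size_reg = n" and i: "regs s level_reg = i" "i < n"
    and L: "stored_level n s i (regs s count_reg) = L" and P: "length L \<le> P"
  shows "run_within T level_com (level_cost P n)
    (\<lambda>s'. stored_level n s' (Suc i) (regs s' count_reg) = next_level i L \<and>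
      frame level_regs {map_array, level_array} s s') s" (is "run_within _ _ _ ?Q _")
  unfolding level_com_def level_cost_def
proof (rule run_within_Assign_Seq)
  let ?s = "set_reg next_reg (eval_exp T s (Num 0)) s"
  let ?R = "{index_reg, candidate_reg} \<union> admit_regs"
  let ?Inv = "\<lambda>s'. stored_map n s' i = stored_map n s i \<and> frame ?R {map_array, level_array} s s'"
  let ?st = "\<lambda>s'. stored_level n s' (Suc i) (regs s' next_reg)"
  let ?g = "\<lambda>h. concat (map (\<lambda>v. admit (put i (Suc v) (h, 0))) [0..<p])"
  have count: "regs s count_reg = length L" using L by (auto simp: stored_level_def)
  have "run_within T (For index_reg (Reg count_reg) (For candidate_reg (Num p) extend_com))
      (for_cost (length L) (exp_cost (Reg count_reg :: 'f exp)) (for_cost p 1 (extend_cost n)))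
      (\<lambda>s'. ?Inv s' \<and> ?st s' = fold (\<lambda>k acc. acc @ ?g (L ! k)) [0..<length L] (?st ?s)) ?s"
  proof (rule run_within_For_fold[where Inv = ?Inv and st = ?st])
    fix k s' assume k: "k < length L" and s': "?Inv s'" and index: "regs s' index_reg = k"
    note frame = conjunct2[OF s']
    have "regs s' size_reg = n" "regs s' level_reg = i" "stored_map n s' i (regs s' index_reg) = L ! k"
      using frameD(1)[OF frame] n i s' index stored_level_nth[OF L] k count by simp_all
    then show "run_within T (For candidate_reg (Num p) extend_com) (for_cost p 1 (extend_cost n))
        (\<lambda>s''. ?Inv s'' \<and> ?st s'' = ?st s' @ ?g (L ! k) \<and> regs s'' index_reg = k) s'"
      using s' index i(2)
      by (intro run_within_mono[OF run_within_candidates]) (auto simp: frame_def)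
  next
    show "eval_exp T s' (Reg count_reg) = length L" if "?Inv s'" for s'
      using frameD(1)[OF conjunct2[OF that]] count by simp
    show "?Inv (set_reg index_reg v s') \<and> ?st (set_reg index_reg v s') = ?st s'" if "?Inv s'" for s' v
      using that by (auto intro: frame_set_reg)
  qed (simp add: frame_refl frame_set_reg)
  moreover have "map (\<lambda>k. ?g (L ! k)) [0..<length L] = map ?g L"
    by (rule nth_equalityI) simp_all
  ultimately have "run_within T (For index_reg (Reg count_reg) (For candidate_reg (Num p) extend_com))
      (for_cost P 1 (for_cost p 1 (extend_cost n))) (\<lambda>s'. ?Inv s' \<and> ?st s' = next_level i L) ?s"
    using P by (elim run_within_mono)
      (auto simp: fold_append_conv_concat next_level_def stored_level_def intro: for_cost_mono)
  then show "run_within T (Seq (For index_reg (Reg count_reg) (For candidate_reg (Num p) extend_com))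
      (Assign count_reg (Reg next_reg))) (for_cost P 1 (for_cost p 1 (extend_cost n)) + 2) ?Q ?s"
    by (rule run_within_Seq) (auto intro!: run_within_Assign frame_set_reg elim: frame_mono)
qed simp

lemma run_within_levels:
  assumes n: "regs s size_reg = n" and L: "stored_level n s 0 (regs s count_reg) = level x 0"
    and P: "\<And>i. i \<le> n \<Longrightarrow> length (level x i) \<le> P"
  shows "run_within T (For level_reg (Reg size_reg) level_com) (for_cost n 1 (level_cost P n))
    (\<lambda>s'. stored_level n s' n (regs s' count_reg) = level x n \<and>
      frame (insert level_reg level_regs) {map_array, level_array} s s') s"
proof -
  let ?R = "insert level_reg level_regs"
  let ?I = "\<lambda>i s'. stored_level n s' i (regs s' count_reg) = level x i \<and> frame ?R {map_array, level_array} s s'"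
  have size: "regs s' size_reg = n" if "?I i s'" for i s'
    using frameD(1)[OF conjunct2[OF that]] n by simp
  have "run_within T (For level_reg (Reg size_reg) level_com)
      (for_cost n (exp_cost (Reg size_reg :: 'f exp)) (level_cost P n)) (?I n) s"
  proof (rule run_within_For[where I = ?I])
    fix i s' assume i: "i < n" and s': "?I i s'" and level: "regs s' level_reg = i"
    show "run_within T level_com (level_cost P n) (\<lambda>s''. regs s'' level_reg = i \<and>
        ?I (Suc i) (set_reg level_reg (Suc i) s'')) s'"
      using s' i level
      by (intro run_within_mono[OF run_within_level[OF size[OF s'] level i conjunct1[OF s'] P]])
        (auto simp: frame_def)
  qed (use L size in \<open>auto simp: frame_refl frame_set_reg\<close>)
  then show ?thesis by simp
qed

subsection \<open>Printing the canonical maps\<close>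

lemma run_within_check:
  assumes n: "regs s size_reg = n" and g: "stored_map n s n (regs s index_reg) = g" "total g"
    and base: "\<And>a. a < p \<Longrightarrow> arrays s base_array [Suc a] = x ! a" and reject: "regs s reject_reg = 0"
  shows "run_within T check_com (for_cost n 1 10)
    (\<lambda>s'. (regs s' reject_reg = 0 \<longleftrightarrow> canonical x g) \<and> frame {position_reg, reject_reg} {} s s') s"
proof -
  let ?frame = "frame {position_reg, reject_reg} {} s"
  let ?I = "\<lambda>i s'. (regs s' reject_reg = 0 \<longleftrightarrow> (\<forall>j<i. x ! (g ! j - 1) \<le> j)) \<and> ?frame s'"
  have "run_within T check_com (for_cost n (exp_cost (Reg size_reg :: 'f exp)) 10) (?I n) s"
    unfolding check_com_def
  proof (rule run_within_For[where I = ?I])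
    fix j s' assume j: "j < n" and s': "?I j s'" "regs s' position_reg = j"
    have "arrays s base_array [g ! j] = x ! (g ! j - 1)"
      using base[of "g ! j - 1"] total_nth[OF g(2) j] by auto
    moreover have "eval_exp T s' entry_exp = g ! j"
      using s' j n g(1) by (auto simp: frame_def stored_map_def)
    ultimately have "eval_exp T s' (Read base_array [entry_exp]) = x ! (g ! j - 1)"
      using s' by (simp add: frame_def)
    then show "run_within T (Assign reject_reg (Plus (Reg reject_reg)
          (Monus (Read base_array [entry_exp]) (Reg position_reg)))) 10
        (\<lambda>s''. regs s'' position_reg = j \<and> ?I (Suc j) (set_reg position_reg (Suc j) s'')) s'"
      using s' by (intro run_within_Assign) (auto simp: frame_def less_Suc_eq)
  qed (use n reject in \<open>auto simp: frame_def\<close>)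
  then show ?thesis by (simp add: canonical_def)
qed

lemma run_within_print:
  assumes n: "regs s size_reg = n" and g: "stored_map n s n (regs s index_reg) = g"
  shows "run_within T print_com (for_cost n 1 5)
    (\<lambda>s'. outp s' = outp s @ g \<and> frame {position_reg} {} (s\<lparr>outp := outp s'\<rparr>) s') s"
proof -
  let ?I = "\<lambda>i s'. outp s' = outp s @ take i g \<and> frame {position_reg} {} (s\<lparr>outp := outp s'\<rparr>) s'"
  have length: "length g = n" using g by (auto simp: stored_map_def)
  have "run_within T print_com (for_cost n (exp_cost (Reg size_reg :: 'f exp)) 5) (?I n) s"
    unfolding print_com_def
  proof (rule run_within_For[where I = ?I])
    fix j s' assume j: "j < n" and s': "?I j s'" "regs s' position_reg = j"
    have "eval_exp T s' entry_exp = g ! j" using s' j n g by (auto simp: frame_def stored_map_def)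
    then show "run_within T (Output entry_exp) 5
        (\<lambda>s''. regs s'' position_reg = j \<and> ?I (Suc j) (set_reg position_reg (Suc j) s'')) s'"
      using s' j length by (auto simp: run_within_def frame_def take_Suc_conv_app_nth)
  qed (use n in \<open>auto simp: frame_def\<close>)
  then show ?thesis using length by simp
qed

lemma run_within_final:
  assumes n: "regs s size_reg = n" and g: "stored_map n s n (regs s index_reg) = g" "total g"
    and base: "\<And>a. a < p \<Longrightarrow> arrays s base_array [Suc a] = x ! a"
  shows "run_within T final_com (final_cost n)
    (\<lambda>s'. outp s' = outp s @ (if canonical x g then g else []) \<and>
      frame {position_reg, reject_reg} {} (s\<lparr>outp := outp s'\<rparr>) s') s" (is "run_within _ _ _ ?Q _")
  unfolding final_com_def final_cost_def
proof (rule run_within_Assign_Seq, rule run_within_Seq[OF run_within_check])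
  fix s1 assume s1: "(regs s1 reject_reg = 0 \<longleftrightarrow> canonical x g) \<and>
    frame {position_reg, reject_reg} {} (set_reg reject_reg (eval_exp T s (Num 0)) s) s1"
  show "run_within T (Cond (Reg reject_reg) Skip print_com) (2 + for_cost n 1 5) ?Q s1"
  proof (rule run_within_Cond)
    show "run_within T Skip (for_cost n 1 5) ?Q s1" if "eval_exp T s1 (Reg reject_reg) \<noteq> 0"
      by (rule run_within_Skip) (use s1 that in \<open>auto simp: frame_def for_cost_def\<close>)
    show "run_within T print_com (for_cost n 1 5) ?Q s1" if "eval_exp T s1 (Reg reject_reg) = 0"
    proof (rule run_within_mono[OF run_within_print])
      show "regs s1 size_reg = n" "stored_map n s1 n (regs s1 index_reg) = g"
        using s1 n g(1) by (auto simp: frame_def stored_map_def)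
    qed (use s1 that in \<open>auto simp: frame_def\<close>)
  qed simp
qed (use n g base in auto)

lemma run_within_finals:
  assumes n: "regs s size_reg = n" and L: "stored_level n s n (regs s count_reg) = L" "\<And>g. g \<in> set L \<Longrightarrow> total g"
    and base: "\<And>a. a < p \<Longrightarrow> arrays s base_array [Suc a] = x ! a" and P: "length L \<le> P"
  shows "run_within T (For index_reg (Reg count_reg) final_com) (for_cost P 1 (final_cost n))
    (\<lambda>s'. outp s' = outp s @ concat (filter (canonical x) L) \<and>
      frame {index_reg, position_reg, reject_reg} {} (s\<lparr>outp := outp s'\<rparr>) s') s"
proof -
  let ?Inv = "\<lambda>s'. frame {index_reg, position_reg, reject_reg} {} (s\<lparr>outp := outp s'\<rparr>) s'"
  let ?print = "\<lambda>g. if canonical x g then g else []"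
  have count: "regs s count_reg = length L" using L(1) by (auto simp: stored_level_def)
  have "run_within T (For index_reg (Reg count_reg) final_com)
      (for_cost (length L) (exp_cost (Reg count_reg :: 'f exp)) (final_cost n))
      (\<lambda>s'. ?Inv s' \<and> outp s' = fold (\<lambda>k out. out @ ?print (L ! k)) [0..<length L] (outp s)) s"
  proof (rule run_within_For_fold[where Inv = ?Inv and st = outp])
    fix k s' assume k: "k < length L" and s': "?Inv s'" "regs s' index_reg = k"
    have "stored_map n s' n k = L ! k"
      using s'(1) stored_level_nth[OF L(1), of k] k count by (simp add: frame_def stored_map_def)
    then have "run_within T final_com (final_cost n) (\<lambda>s''. outp s'' = outp s' @ ?print (L ! k) \<and>
        frame {position_reg, reject_reg} {} (s'\<lparr>outp := outp s''\<rparr>) s'') s'"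
      using s' n L(2) k base by (intro run_within_final) (auto simp: frame_def)
    then show "run_within T final_com (final_cost n)
        (\<lambda>s''. ?Inv s'' \<and> outp s'' = outp s' @ ?print (L ! k) \<and> regs s'' index_reg = k) s'"
      by (rule run_within_mono) (use s' in \<open>auto simp: frame_def\<close>)
  qed (use count in \<open>auto simp: frame_def\<close>)
  moreover have "map (\<lambda>k. ?print (L ! k)) [0..<length L] = map ?print L"
    by (rule nth_equalityI) simp_all
  moreover have "concat (map ?print L) = concat (filter (canonical x) L)" by (induction L) auto
  ultimately show ?thesis
    using P by (elim run_within_mono) (auto simp: fold_append_conv_concat intro: for_cost_mono)
qed

subsection \<open>The whole program\<close>

lemma run_within_base_array:
  assumes base: "\<And>a. a < p \<Longrightarrow> regs s (base_reg + a) = x ! a"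
  shows "run_within T (seqs (map (\<lambda>a. Store base_array [Num (Suc a)] (Reg (base_reg + a))) [0..<p])) (p * 3 + 1)
    (\<lambda>s'. (\<forall>a<p. arrays s' base_array [Suc a] = x ! a) \<and> frame {} {base_array} s s') s"
proof -
  let ?st = "\<lambda>s' a. arrays s' base_array [Suc a]"
  let ?f = "\<lambda>a. (\<lambda>t. t(a := x ! a))"
  have "run_within T (seqs (map (\<lambda>a. Store base_array [Num (Suc a)] (Reg (base_reg + a))) [0..<p]))
    ((\<Sum>a\<leftarrow>[0..<p]. 3) + 1) (\<lambda>s'. frame {} {base_array} s s' \<and> ?st s' = fold ?f [0..<p] (?st s)) s"
    by (rule run_within_seqs[where Inv = "frame {} {base_array} s" and st = ?st])
      (use base in \<open>auto simp: run_within_def frame_def fun_eq_iff\<close>)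
  moreover have "fold ?f [0..<m] t a = x ! a" if "a < m" for m t a
    using that by (induction m) (auto simp: less_Suc_eq)
  ultimately show ?thesis by (elim run_within_mono) (auto simp: sum_list_triv fun_eq_iff)
qed

lemma run_within_base:
  assumes n: "regs s size_reg = n" and x: "x \<in> tuples {..<n} p" "\<And>a. a < p \<Longrightarrow> regs s (base_reg + a) = x ! a"
    and P: "\<And>i. i \<le> n \<Longrightarrow> length (level x i) \<le> P"
  shows "run_within T base_com (base_cost P n)
    (\<lambda>s'. regs s' size_reg = n \<and> outp s' = outp s @ concat (filter (canonical x) (level x n)) \<and>
      (\<forall>a<p. regs s' (base_reg + a) = x ! a)) s" (is "run_within _ _ _ ?Q _")
  unfolding base_com_def base_cost_def
proof (rule run_within_Seq[OF run_within_base_array[OF x(2)]], assumption, rule run_within_Assign_Seq,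
    rule run_within_Seq[OF run_within_start[OF _ _ x(1)]])
  fix s1 assume s1: "(\<forall>a<p. arrays s1 base_array [Suc a] = x ! a) \<and> frame {} {base_array} s s1"
  let ?s2 = "set_reg next_reg (eval_exp T s1 (Num 0)) s1"
  show "regs ?s2 size_reg = n" "\<And>a. a < p \<Longrightarrow> regs ?s2 (base_reg + a) = x ! a"
    using s1 n x(2) by (simp_all add: frame_def)
  fix s3 assume s3: "stored_level n s3 0 (regs s3 next_reg) = stored_level n ?s2 0 (regs ?s2 next_reg) @ level x 0 \<and>
    frame admit_regs {map_array, level_array} ?s2 s3"
  then have level0: "stored_level n s3 0 (regs s3 next_reg) = level x 0" by (simp add: stored_level_def)
  show "run_within T (Seq (Assign count_reg (Reg next_reg))
      (Seq (For level_reg (Reg size_reg) level_com) (For index_reg (Reg count_reg) final_com)))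
    (2 + (for_cost n 1 (level_cost P n) + for_cost P 1 (final_cost n))) ?Q s3"
  proof (rule run_within_Assign_Seq, rule run_within_Seq[OF run_within_levels[OF _ _ P]])
    let ?s4 = "set_reg count_reg (eval_exp T s3 (Reg next_reg)) s3"
    show "regs ?s4 size_reg = n" "stored_level n ?s4 0 (regs ?s4 count_reg) = level x 0"
      using s1 s3 n level0 by (simp_all add: frame_def)
    fix s5 assume s5: "stored_level n s5 n (regs s5 count_reg) = level x n \<and>
      frame (insert level_reg level_regs) {map_array, level_array} ?s4 s5"
    have "run_within T (For index_reg (Reg count_reg) final_com) (for_cost P 1 (final_cost n))
      (\<lambda>s'. outp s' = outp s5 @ concat (filter (canonical x) (level x n)) \<and>
        frame {index_reg, position_reg, reject_reg} {} (s5\<lparr>outp := outp s'\<rparr>) s') s5"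
      using s1 s3 s5 n P[of n] level_top(2)[OF x(1)] by (intro run_within_finals) (auto simp: frame_def)
    then show "run_within T (For index_reg (Reg count_reg) final_com) (for_cost P 1 (final_cost n)) ?Q s5"
      by (rule run_within_mono) (use s1 s3 s5 n x(2) in \<open>auto simp: frame_def\<close>)
  qed simp_all
qed simp_all

lemma run_within_enum:
  assumes P: "\<And>x i. x \<in> tuples {..<n} p \<Longrightarrow> i \<le> n \<Longrightarrow> length (level x i) \<le> P"
  shows "run_within T enum_com (enum_cost P n) (\<lambda>s'. outp s' = concat result) (init_state n)"
proof -
  let ?print = "\<lambda>x. concat (filter (canonical x) (level x n))"
  have "run_within T enum_com (enum_cost P n) (\<lambda>s'. regs s' size_reg = n \<and>
      outp s' = fold (\<lambda>x out. out @ ?print x) (List.n_lists p [0..<n]) (outp (init_state n))) (init_state n)"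
    unfolding enum_com_def enum_cost_def
  proof (rule run_within_nest[where st = outp])
    fix s :: state and x assume "regs s size_reg = n" and x: "x \<in> tuples {..<n} p"
      and "\<And>a. a < p \<Longrightarrow> regs s (base_reg + a) = x ! a"
    then show "run_within T base_com (base_cost P n) (\<lambda>s'. regs s' size_reg = n \<and>
        outp s' = outp s @ ?print x \<and> (\<forall>a<p. regs s' (base_reg + a) = x ! a)) s"
      using P[OF x] by (rule run_within_base)
  qed (auto simp: init_state_def)
  moreover have "concat (map ?print xs) = concat (concat (map (\<lambda>x. filter (canonical x) (level x n)) xs))" for xs
    by (induction xs) simp_all
  ultimately show ?thesis
    by (auto elim!: run_within_mono simp: fold_append_conv_concat result_def init_state_def)
qed

end

section \<open>Polynomial running time\<close>

lemma poly_bounded_for: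
  "poly_bounded f \<Longrightarrow> poly_bounded g \<Longrightarrow> poly_bounded (\<lambda>n. for_cost (f n) c (g n))"
  unfolding for_cost_def by (intro poly_bounded_add poly_bounded_mult poly_bounded_const)

lemma poly_bounded_nest: "poly_bounded f \<Longrightarrow> poly_bounded (\<lambda>n. nest_cost n k (f n))"
  by (induction k arbitrary: f) (auto intro: poly_bounded_for poly_bounded_id)

context coded_algebra
begin

lemma poly_bounded_enum_cost:
  assumes "poly_bounded P"
  shows "poly_bounded (\<lambda>n. enum_cost (P n) n)"
proof -
  note closure = poly_bounded_add poly_bounded_const poly_bounded_id poly_bounded_for poly_bounded_nest
    poly_bounded_sum_list
  have "poly_bounded (\<lambda>n. Suc n)" using poly_bounded_add[OF poly_bounded_id poly_bounded_const[of 1]] by simp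
  then have "poly_bounded close_cost" unfolding close_cost_def pass_cost_def by (intro closure)
  then have admit: "poly_bounded admit_cost" unfolding admit_cost_def by (intro closure)
  then have "poly_bounded start_cost" unfolding start_cost_def load_cost_def by (intro closure)
  moreover have "poly_bounded (\<lambda>n. level_cost (P n) n)"
    unfolding level_cost_def extend_cost_def load_cost_def by (intro closure admit assms)
  moreover have "poly_bounded final_cost" unfolding final_cost_def by (intro closure)
  ultimately show ?thesis unfolding enum_cost_def base_cost_def by (intro closure assms)
qed

theorem poly_time_enumerable:
  assumes "in_K_surj A"
  shows "surj_homs_poly_time_enumerable A"
proof -
  obtain b where "poly_bounded b" "surj_bound A b" using assms unfolding in_K_surj_iff by blast
  then obtain b where b: "poly_bounded b" "mono b" "surj_bound A b"
    using poly_bounded_monotone_bound surj_bound_mono by metis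
  then obtain time :: "real poly" where time: "\<And>n. real (enum_cost (b n) n) \<le> poly time (real n)"
    using poly_bounded_imp_poly[OF poly_bounded_enum_cost] by blast
  show ?thesis unfolding surj_homs_poly_time_enumerable_def
  proof (intro exI[of _ enum_com] exI[of _ code] exI[of _ time] conjI allI impI)
    show "inj_on code (univ A)" using dec_code by (metis inj_onI)
    fix X :: "('f, nat) ualg" and n assume X: "is_ualg X \<and> univ X = {..<n} \<and> same_signature X A"
    interpret enumeration A \<phi> \<psi> fs X n by unfold_locales (use X in auto)
    have "run_within T enum_com (enum_cost (b n) n) (\<lambda>s'. outp s' = concat result) (init_state n)"
      by (intro run_within_enum length_level_le b)
    then obtain t s where ts: "exec T enum_com (init_state n) t s" "t \<le> enum_cost (b n) n" "outp s = concat result"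
      unfolding run_within_def run_def by blast
    moreover have "real t \<le> poly time (real n)" using ts(2) time[of n] by linarith
    moreover have "map (\<lambda>h. map (\<lambda>x. code (h x)) [0..<n]) (map decode result) = result"
      using encode_decode_result unfolding encode_def .
    ultimately show "\<exists>t s hs. exec T enum_com (init_state n) t s \<and> real t \<le> poly time (real n) \<and>
        distinct hs \<and> set hs = surj_homs X A \<and>
        outp s = concat (map (\<lambda>h. map (\<lambda>x. code (h x)) [0..<n]) hs)"
      using distinct_decode_result set_decode_result
      by (intro exI[of _ t] exI[of _ s] exI[of _ "map decode result"]) (simp del: map_map set_map)
  qed
qed

end

theorem in_K_surj_imp_in_K_surj_eff:
  fixes A :: "('f, 'a) ualg"
  assumes "finite (syms A)" "in_K_surj A"
  shows "in_K_surj_eff A"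
proof -
  interpret finite_ualg A using assms(2) by unfold_locales (auto simp: in_K_surj_def)
  obtain fs where "set fs = syms A" using finite_list[OF assms(1)] by blast
  moreover obtain e where "e \<in> univ A" by (rule ex_element)
  then obtain \<phi> :: "'a \<Rightarrow> nat" and \<psi> where "\<And>x. x \<in> univ A \<Longrightarrow> \<phi> x < card (univ A)"
    "\<And>x. x \<in> univ A \<Longrightarrow> \<psi> (\<phi> x) = x" "\<And>i. i < card (univ A) \<Longrightarrow> \<psi> i \<in> univ A"
    "\<And>i. i < card (univ A) \<Longrightarrow> \<phi> (\<psi> i) = i"
    using ex_labelling[OF finite_univ] by metis
  ultimately interpret coded_algebra A \<phi> \<psi> fs by unfold_locales auto
  show ?thesis using assms(2) poly_time_enumerable by (simp add: in_K_surj_eff_def)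
qed

theorem theorem29:
  fixes A :: "('f, 'a) ualg"
  assumes "is_ualg A" and "card (univ A) = 3"
  shows "(in_K_surj A \<longleftrightarrow> (\<forall>\<alpha>. minimal_congruence A \<alpha> \<longrightarrow> tct_type A \<alpha> \<noteq> 1)) \<and>
         (finite (syms A) \<longrightarrow> in_K_surj A \<longrightarrow> in_K_surj_eff A)"
proof -
  have "finite (univ A)" using assms(2) by (metis card.infinite zero_neq_numeral)
  then interpret finite_ualg A by unfold_locales (use assms in auto)
  have "tct_type A \<alpha> \<noteq> 1" if "in_K_surj A" "minimal_congruence A \<alpha>" for \<alpha>
  proof -
    interpret three_minimal A \<alpha> by unfold_locales (use that assms in auto)
    show ?thesis using type_1_not_in_K_surj that by blast
  qed
  moreover have "in_K_surj A" if "\<forall>\<alpha>. minimal_congruence A \<alpha> \<longrightarrow> tct_type A \<alpha> \<noteq> 1"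
    using not_type_1_in_K_surj[OF assms(2)] that by blast
  ultimately show ?thesis using in_K_surj_imp_in_K_surj_eff by blast
qed

end
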